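(* Let $f_1(\mathbf{x})\in\mathbb{C}\{\mathbf{x}\}=\mathbb{C}\{x_0,\dots,x_n\}$ and $f_2(\mathbf{y})\in\mathbb{C}\{\mathbf{y}\}=\mathbb{C}\{y_0,\dots,y_m\}$ be germs of isolated hypersurface singularities in different (separated) variables, and consider $f_1+f_2\in\mathbb{C}\{\mathbf{x};\mathbf{y}\}$. Then $$\tau_{f_1+f_2}=\tau_{f_1}\tau_{f_2}+(\mu_{f_1}-\tau_{f_1})(\mu_{f_2}-\tau_{f_2})-\nu_1^{(f_2)}\bigl(\mu_{f_1}-\tau_{f_1}-\nu_1^{(f_1)}\bigr)-\nu_1^{(f_1)}\bigl(\mu_{f_2}-\tau_{f_2}-\nu_1^{(f_2)}\bigr)-b_{f_1+f_2}+u_{f_1+f_2}.$$ In particular, $$\tau_{f_1}\tau_{f_2}\leq \tau_{f_1+f_2}\leq \tau_{f_1}\tau_{f_2} +(\mu_{f_1}-\tau_{f_1})(\mu_{f_2}-\tau_{f_2}).$$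
   Context: A germ of isolated hypersurface singularity is a germ $f$ of holomorphic function at the origin with $f(0)=0$ that has an isolated critical point at the origin. For such $f$ in variables $z_0,\dots,z_k$, let $J_f=(\partial f/\partial z_0,\dots,\partial f/\partial z_k)$ and $M_f=\mathbb{C}\{z_0,\dots,z_k\}/J_f$ (Milnor algebra). The Milnor number is $\mu_f=\dim_{\mathbb{C}}M_f$ and the Tjurina number is $\tau_f=\dim_{\mathbb{C}}\mathbb{C}\{z_0,\dots,z_k\}/((f)+J_f)$. All dimensions are over $\mathbb{C}$. For $i=1,2$ let $\operatorname{Ker}(f_i)$ and $\operatorname{Im}(f_i)$ denote the kernel and image of the $\mathbb{C}$-linear map $M_{f_i}\to M_{f_i}$ given by multiplication by $f_i$, and set $$\nu_1^{(f_i)}:=\dim\bigl(\operatorname{Ker}(f_i)\cap\operatorname{Im}(f_i)\bigr).$$ Let $B_i$ be a vector space complement of $\operatorname{Im}(f_i)\cap\operatorname{Ker}(f_i)$ in $\operatorname{Im}(f_i)$. The Milnor algebra of the join is $M_{f_1+f_2}\cong M_{f_1}\otimes_{\mathbb{C}} M_{f_2}$, and multiplication by $f_1+f_2$ on it is the map $F:=f_1\otimes 1+1\otimes f_2$ on $M_{f_1}\otimes M_{f_2}$. Set $$U:=\operatorname{Ker}(f_1)\otimes\operatorname{Im}(f_2)+\operatorname{Im}(f_1)\otimes\operatorname{Ker}(f_2)\subset M_{f_1}\otimes M_{f_2},$$ $$b_{f_1+f_2}:=\dim F(B_1\otimes B_2),\qquad u_{f_1+f_2}:=\dim\bigl(U\cap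 F(B_1\otimes B_2)\bigr).$$ *)

theory Defs
  imports "HOL-Analysis.Analysis" "HOL-Algebra.Embedded_Algebras" "HOL-Algebra.QuotRing"
begin

section \<open>Convergent power series in finitely many variables\<close>

text \<open>
  The variables are indexed by a finite type \<open>'n\<close>, so \<open>CARD('n)\<close> is their number (at least one),
  and the disjoint union of two sets of variables is indexed by \<open>'n + 'm\<close>. A germ of holomorphic
  function at the origin is represented by its convergent Taylor series, i.e. by the
  coefficients \<open>a \<alpha>\<close> of \<open>z\<^sup>\<alpha>\<close> for \<open>\<alpha> :: 'n \<Rightarrow> nat\<close>.
\<close>

type_synonym 'n mseries = "('n \<Rightarrow> nat) \<Rightarrow> complex"

definition convergent_mseries :: "'n::finite mseries \<Rightarrow> bool" where
  "convergent_mseries a \<longleftrightarrow>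
     (\<exists>r::real. r > 0 \<and> (\<lambda>\<alpha>. norm (a \<alpha>) * r ^ (\<Sum>i\<in>UNIV. \<alpha> i)) summable_on UNIV)"

definition mseries_const :: "complex \<Rightarrow> 'n mseries" where
  "mseries_const c = (\<lambda>\<alpha>. if \<alpha> = (\<lambda>_. 0) then c else 0)"

definition conv_series :: "'n::finite mseries ring" where
  "conv_series =
     \<lparr>carrier = {a. convergent_mseries a},
      mult = (\<lambda>a b \<alpha>. \<Sum>\<beta> | \<beta> \<le> \<alpha>. a \<beta> * b (\<lambda>i. \<alpha> i - \<beta> i)),
      one = mseries_const 1,
      zero = (\<lambda>_. 0),
      add = (\<lambda>a b \<alpha>. a \<alpha> + b \<alpha>)\<rparr>"

definition mseries_eval :: "'n::finite mseries \<Rightarrow> complex ^ 'n \<Rightarrow> complex" where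
  "mseries_eval a z = (\<Sum>\<^sub>\<infinity>\<alpha>. a \<alpha> * (\<Prod>i\<in>UNIV. (z $ i) ^ \<alpha> i))"

definition mseries_partial :: "'n \<Rightarrow> 'n mseries \<Rightarrow> 'n mseries" where
  "mseries_partial i a = (\<lambda>\<alpha>. of_nat (Suc (\<alpha> i)) * a (\<alpha>(i := Suc (\<alpha> i))))"

definition isolated_hypersurface_singularity :: "'n::finite mseries \<Rightarrow> bool" where
  "isolated_hypersurface_singularity f \<longleftrightarrow>
     f \<in> carrier conv_series \<and>
     mseries_eval f 0 = 0 \<and>
     (\<forall>i. mseries_eval (mseries_partial i f) 0 = 0) \<and>
     (\<forall>\<^sub>F z in at 0. \<exists>i. mseries_eval (mseries_partial i f) z \<noteq> 0)"

text \<open>The sum of two series in separate sets of variables.\<close>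

definition mseries_Inl :: "'n mseries \<Rightarrow> ('n + 'm) mseries" where
  "mseries_Inl f = (\<lambda>\<alpha>. if \<forall>j. \<alpha> (Inr j) = 0 then f (\<lambda>i. \<alpha> (Inl i)) else 0)"

definition mseries_Inr :: "'m mseries \<Rightarrow> ('n + 'm) mseries" where
  "mseries_Inr g = (\<lambda>\<alpha>. if \<forall>i. \<alpha> (Inl i) = 0 then g (\<lambda>j. \<alpha> (Inr j)) else 0)"

definition join_series :: "'n::finite mseries \<Rightarrow> 'm::finite mseries \<Rightarrow> ('n + 'm) mseries" where
  "join_series f g = mseries_Inl f \<oplus>\<^bsub>conv_series\<^esub> mseries_Inr g"


section \<open>Milnor and Tjurina algebras\<close>

text \<open>
  Complex dimensions are the library's dimensions over a subfield of a ring, the subfield being the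
  image of the constants in the quotient.
\<close>

definition jacobian_ideal :: "'n::finite mseries \<Rightarrow> 'n mseries set" where
  "jacobian_ideal f = Idl\<^bsub>conv_series\<^esub> (range (\<lambda>i. mseries_partial i f))"

definition quot_scalar :: "'n::finite mseries set \<Rightarrow> complex \<Rightarrow> 'n mseries set" where
  "quot_scalar I c = I +>\<^bsub>conv_series\<^esub> mseries_const c"

definition quot_dim :: "'n::finite mseries set \<Rightarrow> 'n mseries set set \<Rightarrow> nat" where
  "quot_dim I V = ring.dim (conv_series Quot I) (range (quot_scalar I)) V"

definition milnor_algebra :: "'n::finite mseries \<Rightarrow> 'n mseries set ring" where
  "milnor_algebra f = conv_series Quot (jacobian_ideal f)"

definition milnor_scalar :: "'n::finite mseries \<Rightarrow> complex \<Rightarrow> 'n mseries set" where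
  "milnor_scalar f = quot_scalar (jacobian_ideal f)"

definition milnor_number :: "'n::finite mseries \<Rightarrow> nat" where
  "milnor_number f = quot_dim (jacobian_ideal f) (carrier (milnor_algebra f))"

definition tjurina_ideal :: "'n::finite mseries \<Rightarrow> 'n mseries set" where
  "tjurina_ideal f = (PIdl\<^bsub>conv_series\<^esub> f) <+>\<^bsub>conv_series\<^esub> jacobian_ideal f"

definition tjurina_number :: "'n::finite mseries \<Rightarrow> nat" where
  "tjurina_number f = quot_dim (tjurina_ideal f) (carrier (conv_series Quot (tjurina_ideal f)))"

definition milnor_class :: "'n::finite mseries \<Rightarrow> 'n mseries set" where
  "milnor_class f = jacobian_ideal f +>\<^bsub>conv_series\<^esub> f"

definition milnor_Ker :: "'n::finite mseries \<Rightarrow> 'n mseries set set" where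
  "milnor_Ker f =
     a_kernel (milnor_algebra f) (milnor_algebra f) (\<lambda>x. milnor_class f \<otimes>\<^bsub>milnor_algebra f\<^esub> x)"

definition milnor_Im :: "'n::finite mseries \<Rightarrow> 'n mseries set set" where
  "milnor_Im f = (\<lambda>x. milnor_class f \<otimes>\<^bsub>milnor_algebra f\<^esub> x) ` carrier (milnor_algebra f)"

definition nu1 :: "'n::finite mseries \<Rightarrow> nat" where
  "nu1 f = quot_dim (jacobian_ideal f) (milnor_Ker f \<inter> milnor_Im f)"

text \<open>In the library, \<open>subalgebra K V R\<close> only says that \<open>V\<close> is a \<open>K\<close>-linear subspace of \<open>R\<close>.\<close>

definition vs_complement :: "'a set \<Rightarrow> ('a, 'r) ring_scheme \<Rightarrow> 'a set \<Rightarrow> 'a set \<Rightarrow> 'a set \<Rightarrow> bool" where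
  "vs_complement K A W V B \<longleftrightarrow>
     subalgebra K B A \<and> B \<subseteq> V \<and> B \<inter> W = {\<zero>\<^bsub>A\<^esub>} \<and> B <+>\<^bsub>A\<^esub> W = V"

definition Im_complement :: "'n::finite mseries \<Rightarrow> 'n mseries set set \<Rightarrow> bool" where
  "Im_complement f B \<longleftrightarrow>
     vs_complement (range (milnor_scalar f)) (milnor_algebra f)
       (milnor_Im f \<inter> milnor_Ker f) (milnor_Im f) B"


section \<open>Tensor product of two commutative complex algebras\<close>

text \<open>
  The algebra of finitely supported functions on a commutative monoid \<open>G\<close>, with convolution.
\<close>

definition monoid_algebra :: "('g, 'r) monoid_scheme \<Rightarrow> ('g \<Rightarrow> complex) ring" where
  "monoid_algebra G =
     \<lparr>carrier = {p. finite {g. p g \<noteq> 0} \<and> {g. p g \<noteq> 0} \<subseteq> carrier G},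
      mult = (\<lambda>p q g. \<Sum>x | p x \<noteq> 0. \<Sum>y | q y \<noteq> 0. if x \<otimes>\<^bsub>G\<^esub> y = g then p x * q y else 0),
      one = (\<lambda>g. if g = \<one>\<^bsub>G\<^esub> then 1 else 0),
      zero = (\<lambda>_. 0),
      add = (\<lambda>p q g. p g + q g)\<rparr>"

definition point_mass :: "complex \<Rightarrow> 'g \<Rightarrow> 'g \<Rightarrow> complex" where
  "point_mass c g = (\<lambda>h. if h = g then c else 0)"

text \<open>
  The complex algebras are given by rings \<open>A\<close>, \<open>B\<close> with structure maps \<open>s\<close>, \<open>t\<close> from the complex
  numbers. As a vector space the monoid algebra of the multiplicative monoid of \<open>A \<times> B\<close> is free on
  \<open>A \<times> B\<close>. The linear span of the bilinearity relations below is stable under multiplication by point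
  masses, hence it equals the ideal they generate, and the quotient is the usual
  tensor product over the complex numbers.
\<close>

definition tensor_relations ::
  "(complex \<Rightarrow> 'a) \<Rightarrow> ('a, 'r) ring_scheme \<Rightarrow> (complex \<Rightarrow> 'b) \<Rightarrow> ('b, 'q) ring_scheme \<Rightarrow>
   ('a \<times> 'b \<Rightarrow> complex) set" where
  "tensor_relations s A t B =
     {point_mass 1 (a \<oplus>\<^bsub>A\<^esub> a', b) \<ominus>\<^bsub>P\<^esub> (point_mass 1 (a, b) \<oplus>\<^bsub>P\<^esub> point_mass 1 (a', b)) |
        P a a' b. P = monoid_algebra (A \<times>\<times> B) \<and> a \<in> carrier A \<and> a' \<in> carrier A \<and> b \<in> carrier B} \<union>
     {point_mass 1 (a, b \<oplus>\<^bsub>B\<^esub> b') \<ominus>\<^bsub>P\<^esub> (point_mass 1 (a, b) \<oplus>\<^bsub>P\<^esub> point_mass 1 (a, b')) |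
        P a b b'. P = monoid_algebra (A \<times>\<times> B) \<and> a \<in> carrier A \<and> b \<in> carrier B \<and> b' \<in> carrier B} \<union>
     {point_mass 1 (s c \<otimes>\<^bsub>A\<^esub> a, b) \<ominus>\<^bsub>P\<^esub> point_mass c (a, b) |
        P c a b. P = monoid_algebra (A \<times>\<times> B) \<and> a \<in> carrier A \<and> b \<in> carrier B} \<union>
     {point_mass 1 (a, t c \<otimes>\<^bsub>B\<^esub> b) \<ominus>\<^bsub>P\<^esub> point_mass c (a, b) |
        P c a b. P = monoid_algebra (A \<times>\<times> B) \<and> a \<in> carrier A \<and> b \<in> carrier B}"

definition tensor_ideal ::
  "(complex \<Rightarrow> 'a) \<Rightarrow> ('a, 'r) ring_scheme \<Rightarrow> (complex \<Rightarrow> 'b) \<Rightarrow> ('b, 'q) ring_scheme \<Rightarrow>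
   ('a \<times> 'b \<Rightarrow> complex) set" where
  "tensor_ideal s A t B = Idl\<^bsub>monoid_algebra (A \<times>\<times> B)\<^esub> (tensor_relations s A t B)"

definition algebra_tensor ::
  "(complex \<Rightarrow> 'a) \<Rightarrow> ('a, 'r) ring_scheme \<Rightarrow> (complex \<Rightarrow> 'b) \<Rightarrow> ('b, 'q) ring_scheme \<Rightarrow>
   ('a \<times> 'b \<Rightarrow> complex) set ring" where
  "algebra_tensor s A t B = monoid_algebra (A \<times>\<times> B) Quot tensor_ideal s A t B"

definition pure_tensor ::
  "(complex \<Rightarrow> 'a) \<Rightarrow> ('a, 'r) ring_scheme \<Rightarrow> (complex \<Rightarrow> 'b) \<Rightarrow> ('b, 'q) ring_scheme \<Rightarrow>
   'a \<Rightarrow> 'b \<Rightarrow> ('a \<times> 'b \<Rightarrow> complex) set" where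
  "pure_tensor s A t B a b = tensor_ideal s A t B +>\<^bsub>monoid_algebra (A \<times>\<times> B)\<^esub> point_mass 1 (a, b)"

definition tensor_scalar ::
  "(complex \<Rightarrow> 'a) \<Rightarrow> ('a, 'r) ring_scheme \<Rightarrow> (complex \<Rightarrow> 'b) \<Rightarrow> ('b, 'q) ring_scheme \<Rightarrow>
   complex \<Rightarrow> ('a \<times> 'b \<Rightarrow> complex) set" where
  "tensor_scalar s A t B c =
     tensor_ideal s A t B +>\<^bsub>monoid_algebra (A \<times>\<times> B)\<^esub> point_mass c (\<one>\<^bsub>A\<^esub>, \<one>\<^bsub>B\<^esub>)"

text \<open>The tensor product of two subspaces, as a subspace: the linear span of the pure tensors.\<close>

definition subspace_tensor ::
  "(complex \<Rightarrow> 'a) \<Rightarrow> ('a, 'r) ring_scheme \<Rightarrow> (complex \<Rightarrow> 'b) \<Rightarrow> ('b, 'q) ring_scheme \<Rightarrow>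
   'a set \<Rightarrow> 'b set \<Rightarrow> ('a \<times> 'b \<Rightarrow> complex) set set" where
  "subspace_tensor s A t B V W =
     \<Inter>{X. subalgebra (range (tensor_scalar s A t B)) X (algebra_tensor s A t B) \<and>
         (\<forall>v\<in>V. \<forall>w\<in>W. pure_tensor s A t B v w \<in> X)}"


section \<open>The tensor product of two Milnor algebras\<close>

type_synonym ('n, 'm) milnor_tensor_elt = "('n mseries set \<times> 'm mseries set \<Rightarrow> complex) set"

definition milnor_tensor ::
  "'n::finite mseries \<Rightarrow> 'm::finite mseries \<Rightarrow> ('n, 'm) milnor_tensor_elt ring" where
  "milnor_tensor f g =
     algebra_tensor (milnor_scalar f) (milnor_algebra f) (milnor_scalar g) (milnor_algebra g)"

definition milnor_pure ::
  "'n::finite mseries \<Rightarrow> 'm::finite mseries \<Rightarrow> 'n mseries set \<Rightarrow> 'm mseries set \<Rightarrow>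
   ('n, 'm) milnor_tensor_elt" where
  "milnor_pure f g =
     pure_tensor (milnor_scalar f) (milnor_algebra f) (milnor_scalar g) (milnor_algebra g)"

definition milnor_subspace_tensor ::
  "'n::finite mseries \<Rightarrow> 'm::finite mseries \<Rightarrow> 'n mseries set set \<Rightarrow> 'm mseries set set \<Rightarrow>
   ('n, 'm) milnor_tensor_elt set" where
  "milnor_subspace_tensor f g =
     subspace_tensor (milnor_scalar f) (milnor_algebra f) (milnor_scalar g) (milnor_algebra g)"

definition milnor_tensor_dim ::
  "'n::finite mseries \<Rightarrow> 'm::finite mseries \<Rightarrow> ('n, 'm) milnor_tensor_elt set \<Rightarrow> nat" where
  "milnor_tensor_dim f g V =
     ring.dim (milnor_tensor f g)
       (range (tensor_scalar (milnor_scalar f) (milnor_algebra f)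
                 (milnor_scalar g) (milnor_algebra g))) V"

text \<open>The map \<open>f \<otimes> 1 + 1 \<otimes> g\<close>, as multiplication by this element of the tensor product.\<close>

definition join_map ::
  "'n::finite mseries \<Rightarrow> 'm::finite mseries \<Rightarrow>
   ('n, 'm) milnor_tensor_elt \<Rightarrow> ('n, 'm) milnor_tensor_elt" where
  "join_map f g x =
     (milnor_pure f g (milnor_class f) \<one>\<^bsub>milnor_algebra g\<^esub> \<oplus>\<^bsub>milnor_tensor f g\<^esub>
      milnor_pure f g \<one>\<^bsub>milnor_algebra f\<^esub> (milnor_class g)) \<otimes>\<^bsub>milnor_tensor f g\<^esub> x"

definition join_U ::
  "'n::finite mseries \<Rightarrow> 'm::finite mseries \<Rightarrow> ('n, 'm) milnor_tensor_elt set" where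
  "join_U f g =
     milnor_subspace_tensor f g (milnor_Ker f) (milnor_Im g) <+>\<^bsub>milnor_tensor f g\<^esub>
     milnor_subspace_tensor f g (milnor_Im f) (milnor_Ker g)"

definition join_b ::
  "'n::finite mseries \<Rightarrow> 'm::finite mseries \<Rightarrow> 'n mseries set set \<Rightarrow> 'm mseries set set \<Rightarrow> nat" where
  "join_b f g B1 B2 =
     milnor_tensor_dim f g (join_map f g ` milnor_subspace_tensor f g B1 B2)"

definition join_u ::
  "'n::finite mseries \<Rightarrow> 'm::finite mseries \<Rightarrow> 'n mseries set set \<Rightarrow> 'm mseries set set \<Rightarrow> nat" where
  "join_u f g B1 B2 =
     milnor_tensor_dim f g (join_U f g \<inter> join_map f g ` milnor_subspace_tensor f g B1 B2)"

end

theory Submission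
  imports Defs "HOL-Library.Function_Algebras"
begin

text \<open>
  On a small polydisc the origin is the only common zero of the partial derivatives of \<open>f\<close>. The series
  that are absolutely summable there form a Banach algebra whose characters are the evaluations at points,
  so every variable \<open>z\<^sub>i\<close> has spectral radius zero modulo the ideal of the partial derivatives: the
  quotient seminorms of its powers tend to zero. This is enough to divide: every series is congruent to
  a polynomial of bounded degree, and a linear relation between the powers of \<open>z\<^sub>i\<close> puts one of them
  into the Jacobian ideal. This replaces the Nullstellensatz for convergent series.

  In a basis of the Milnor algebra of \<open>f\<^sub>i\<close> adapted to \<open>Ker\<close>, \<open>Im\<close> and \<open>B\<^sub>i\<close>, all the subspaces in the
  statement are spanned by sets of basis vectors. Since the Milnor algebra of the join is the tensor
  product, \<open>\<mu> - \<tau>\<close> of the join is the rank of \<open>F\<close>. The image of \<open>F\<close> contains \<open>U\<close>, and modulo \<open>U\<close> only the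
  tensor product of complements of the kernels contributes; there \<open>F\<close> can vanish modulo \<open>U\<close> only on
  \<open>B\<^sub>1 \<otimes> B\<^sub>2\<close>, whose image modulo \<open>U\<close> has dimension \<open>b - u\<close>.
\<close>

section \<open>Quotient norms and eigenvalues in Banach algebras\<close>

text \<open>The ideal generated by the partial derivatives in the Banach algebra is not known to be
  closed, so a small quotient seminorm does not yet give membership. What it gives is that
  \<open>z_i^M\<close> is congruent to some \<open>E_i\<close> of small norm. Replacing
  \<open>z_i^M\<close> by \<open>E_i\<close> in the tail of a series is a contraction, and its fixed
  point turns the approximation into exact membership. The decay of the seminorms comes from
  resolvents averaged over roots of unity, which stand in for Cauchy's integral formula.

  Three kinds of structure have to meet: Banach algebras as types, rings given by records, and
  vector spaces of complex functions. One device joins them, a linear map from a ring to a function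
  space whose kernel on the ring is exactly the ideal. Such a map is produced for the Milnor
  algebras, the Tjurina algebras and the tensor product, and all dimensions are read off in the
  function space.

  The inequalities do not mention \<open>B_1\<close> and \<open>B_2\<close>, yet the coordinates
  that prove them are adapted to such complements; hence their existence is shown as well.\<close>

definition ideal_set :: "'a::comm_ring_1 set \<Rightarrow> bool" where
  "ideal_set I \<longleftrightarrow> 0 \<in> I \<and> (\<forall>x\<in>I. \<forall>y\<in>I. x + y \<in> I) \<and> (\<forall>x\<in>I. \<forall>a. a * x \<in> I)"

lemma ideal_setD:
  assumes "ideal_set I"
  shows "0 \<in> I" "x \<in> I \<Longrightarrow> y \<in> I \<Longrightarrow> x + y \<in> I" "x \<in> I \<Longrightarrow> a * x \<in> I" "x \<in> I \<Longrightarrow> x * a \<in> I"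
    "x \<in> I \<Longrightarrow> - x \<in> I" "x \<in> I \<Longrightarrow> y \<in> I \<Longrightarrow> x - y \<in> I"
proof -
  show *: "0 \<in> I" "x \<in> I \<Longrightarrow> y \<in> I \<Longrightarrow> x + y \<in> I" "x \<in> I \<Longrightarrow> a * x \<in> I" for x y a
    using assms unfolding ideal_set_def by auto
  show "x \<in> I \<Longrightarrow> x * a \<in> I" using *(3)[of x a] by (simp add: mult.commute)
  show **: "x \<in> I \<Longrightarrow> - x \<in> I" for x using *(3)[of x "-1"] by simp
  show "x \<in> I \<Longrightarrow> y \<in> I \<Longrightarrow> x - y \<in> I" using *(2)[of x "-y"] ** by simp
qed

lemma ideal_set_sum:
  assumes "ideal_set I" "\<And>i. i \<in> A \<Longrightarrow> f i \<in> I"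
  shows "sum f A \<in> I"
  using assms(2) by (induction A rule: infinite_finite_induct) (auto intro: ideal_setD[OF assms(1)])

lemma ideal_set_adjoin:
  assumes "ideal_set I"
  shows "ideal_set {b + a * x |a b. b \<in> I}"
  unfolding ideal_set_def
proof (intro conjI ballI allI)
  show "0 \<in> {b + a * x |a b. b \<in> I}"
    using ideal_setD(1)[OF assms] by (auto intro!: exI[of _ 0])
next
  fix y z assume "y \<in> {b + a * x |a b. b \<in> I}" "z \<in> {b + a * x |a b. b \<in> I}"
  then obtain a b a' b' where "y = b + a * x" "z = b' + a' * x" "b \<in> I" "b' \<in> I" by auto
  then have "y + z = (b + b') + (a + a') * x" "b + b' \<in> I"
    using ideal_setD(2)[OF assms] by (auto simp: algebra_simps)
  then show "y + z \<in> {b + a * x |a b. b \<in> I}" by blast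
next
  fix y c assume "y \<in> {b + a * x |a b. b \<in> I}"
  then obtain a b where "y = b + a * x" "b \<in> I" by auto
  then have "c * y = c * b + (c * a) * x" "c * b \<in> I"
    using ideal_setD(3)[OF assms] by (auto simp: algebra_simps)
  then show "c * y \<in> {b + a * x |a b. b \<in> I}" by blast
qed

text \<open>The type class provides real scalars only; complex scalars enter through the isometric
  ring homomorphism \<open>K\<close>.\<close>

locale complex_banach_algebra =
  fixes K :: "complex \<Rightarrow> 'a::{comm_ring_1, real_normed_algebra_1, banach}"
  assumes K_add: "K (c + d) = K c + K d"
    and K_mult: "K (c * d) = K c * K d"
    and K_1: "K 1 = 1"
    and norm_K: "norm (K c) = norm c"
begin

lemma K_0: "K 0 = 0" using norm_K[of 0] by simp
lemma K_minus: "K (- c) = - K c" using K_add[of c "-c"] K_0 by (simp add: eq_neg_iff_add_eq_0 add.commute)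
lemma K_diff: "K (c - d) = K c - K d" using K_add[of c "-d"] K_minus by simp
lemma K_power: "K (c ^ n) = K c ^ n" by (induction n) (auto simp: K_1 K_mult)
lemma K_sum: "K (sum f A) = (\<Sum>i\<in>A. K (f i))"
  by (induction A rule: infinite_finite_induct) (auto simp: K_0 K_add)

text \<open>The inverse is the fixed point of the contraction \<open>y \<mapsto> 1 + b * y\<close>,
  that is, the sum of the Neumann series.\<close>

lemma one_minus_invertible:
  fixes b :: 'a
  assumes "norm b < 1" obtains y where "(1 - b) * y = 1"
proof -
  have "\<exists>!y. 1 + b * y = y"
  proof (rule banach_fix_type)
    show "0 \<le> norm b" "norm b < 1" using assms by auto
    show "\<forall>x y. dist (1 + b * x) (1 + b * y) \<le> norm b * dist x y"
      by (metis add_diff_cancel_left dist_norm norm_mult_ineq right_diff_distrib)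
  qed
  then obtain y where "1 + b * y = y" by blast
  then have "(1 - b) * y = 1" by (simp add: algebra_simps)
  then show ?thesis by (rule that)
qed

end

locale complex_banach_ideal = complex_banach_algebra K
  for K :: "complex \<Rightarrow> 'a::{comm_ring_1, real_normed_algebra_1, banach}" +
  fixes I :: "'a set"
  assumes ideal: "ideal_set I"
begin

lemmas idl = ideal_setD[OF ideal]

text \<open>The quotient seminorm modulo \<open>I\<close>. Since \<open>I\<close> need not be
  closed, \<open>qn a = 0\<close> only says that \<open>a\<close> lies in the closure of
  \<open>I\<close>.\<close>

definition qn :: "'a \<Rightarrow> real" where "qn a = infdist a I"

lemma qn_nonneg [simp]: "0 \<le> qn a" unfolding qn_def by (rule infdist_nonneg)

lemma qn_le: "b \<in> I \<Longrightarrow> qn a \<le> norm (a - b)"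
  unfolding qn_def using infdist_le[of b I a] by (simp add: dist_norm)

lemma qn_le_norm: "qn a \<le> norm a" using qn_le[OF idl(1), of a] by simp

lemma qn_approx:
  assumes "qn a < e" obtains b where "b \<in> I" "norm (a - b) < e"
proof -
  have "I \<noteq> {}" using idl(1) by blast
  then have "(INF b\<in>I. dist a b) < e" using assms unfolding qn_def by (simp add: infdist_notempty)
  then obtain b where "b \<in> I" "dist a b < e"
    using cINF_less_iff[of I "dist a" e] \<open>I \<noteq> {}\<close> by (auto intro: bdd_belowI[of _ 0])
  then show ?thesis using that by (auto simp: dist_norm)
qed

lemma qn_add: "qn (a + b) \<le> qn a + qn b"
proof (rule field_le_epsilon)
  fix e :: real assume "e > 0"
  obtain c where c: "c \<in> I" "norm (a - c) < qn a + e/2" using qn_approx[of a "qn a + e/2"] \<open>e > 0\<close> by auto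
  obtain d where d: "d \<in> I" "norm (b - d) < qn b + e/2" using qn_approx[of b "qn b + e/2"] \<open>e > 0\<close> by auto
  have "qn (a + b) \<le> norm ((a + b) - (c + d))" by (intro qn_le idl c d)
  also have "\<dots> \<le> norm (a - c) + norm (b - d)" by (rule norm_diff_triangle_ineq)
  finally show "qn (a + b) \<le> qn a + qn b + e" using c d by simp
qed

text \<open>Nearly optimal representatives of \<open>a\<close> and \<open>b\<close> multiply to a
  representative of \<open>a * b\<close>, because the product differs from \<open>a * b\<close> by
  an element of the ideal. The error \<open>e\<close> then tends to \<open>0\<close>.\<close>

lemma qn_mult: "qn (a * b) \<le> qn a * qn b"
proof (rule dense_ge)
  fix z assume "qn a * qn b < z"
  have "((\<lambda>e. (qn a + e) * (qn b + e)) \<longlongrightarrow> (qn a + 0) * (qn b + 0)) (at_right 0)"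
    by (intro tendsto_intros)
  then have "\<forall>\<^sub>F e in at_right 0. (qn a + e) * (qn b + e) < z"
    using \<open>qn a * qn b < z\<close> by (intro order_tendstoD) auto
  moreover have "\<forall>\<^sub>F e in at_right (0::real). e > 0" by (simp add: eventually_at_right_less)
  ultimately have "\<forall>\<^sub>F e in at_right 0. (qn a + e) * (qn b + e) < z \<and> e > 0" by eventually_elim auto
  then obtain e where e: "(qn a + e) * (qn b + e) < z" "e > 0"
    using eventually_happens'[OF trivial_limit_at_right_real] by blast
  obtain c where c: "c \<in> I" "norm (a - c) < qn a + e" using qn_approx[of a "qn a + e"] \<open>e > 0\<close> by auto
  obtain d where d: "d \<in> I" "norm (b - d) < qn b + e" using qn_approx[of b "qn b + e"] \<open>e > 0\<close> by auto
  have "a * b - (c * b + a * d - c * d) = (a - c) * (b - d)" by (simp add: algebra_simps)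
  moreover have "c * b + a * d - c * d \<in> I" by (intro idl c d)
  ultimately have "qn (a * b) \<le> norm ((a - c) * (b - d))" using qn_le by metis
  also have "\<dots> \<le> norm (a - c) * norm (b - d)" by (rule norm_mult_ineq)
  also have "\<dots> \<le> (qn a + e) * (qn b + e)" using c d by (intro mult_mono) (auto intro: order_trans[OF norm_ge_zero] less_imp_le)
  finally show "qn (a * b) \<le> z" using e by simp
qed

lemma qn_I: "a \<in> I \<Longrightarrow> qn a = 0" using qn_le[of a a] qn_nonneg[of a] by simp

lemma qn_cong:
  assumes "a - b \<in> I" shows "qn a = qn b"
proof -
  have "qn a \<le> qn b" if "a - b \<in> I" for a b
    using qn_add[of "a - b" b] qn_I[OF that] by simp
  moreover have "b - a \<in> I" using idl(5)[OF assms] by simp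
  ultimately show ?thesis using assms by (meson antisym)
qed

lemma qn_minus: "qn (- a) = qn a"
proof -
  have "qn (- a) \<le> qn a" for a
    using qn_mult[of "K (-1)" a] mult_right_mono[OF qn_le_norm[of "K (-1)"] qn_nonneg[of a]]
    by (simp add: K_minus K_1 norm_K)
  from this[of a] this[of "- a"] show ?thesis by simp
qed

lemma qn_diff: "qn (a - b) \<le> qn a + qn b"
  using qn_add[of a "- b"] qn_minus[of b] by simp

lemma qn_K: "qn (K c * a) = norm c * qn a"
proof -
  have le: "qn (K c * a) \<le> norm c * qn a" for c a
    using qn_mult[of "K c" a] mult_right_mono[OF qn_le_norm[of "K c"] qn_nonneg[of a]]
    by (simp add: norm_K)
  show ?thesis
  proof (cases "c = 0")
    case True then show ?thesis using qn_I[OF idl(1)] by (simp add: K_0)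
  next
    case False
    have "K (inverse c) * (K c * a) = a"
      using K_mult[of "inverse c" c] False K_1 by (simp add: mult.assoc[symmetric])
    then have "qn a \<le> norm (inverse c) * qn (K c * a)" using le[of "inverse c" "K c * a"] by simp
    then have "norm c * qn a \<le> qn (K c * a)" using False
      by (simp add: norm_divide field_simps)
    then show ?thesis using le[of c a] by simp
  qed
qed

lemma qn_sum: "finite A \<Longrightarrow> qn (sum f A) \<le> (\<Sum>i\<in>A. qn (f i))"
proof (induction A rule: finite_induct)
  case empty then show ?case using qn_I[OF idl(1)] by simp
next
  case (insert x F) then show ?case using qn_add[of "f x" "sum f F"] by simp
qed

lemma qn_power: "qn (a ^ n) \<le> qn a ^ n" if "qn 1 \<le> 1"
proof (induction n)
  case 0 then show ?case using that by simp
next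
  case (Suc n) then show ?case
    using qn_mult[of a "a ^ n"] mult_left_mono[OF Suc qn_nonneg[of a]] by simp
qed

text \<open>An element of \<open>I\<close> at distance less than \<open>1\<close> from
  \<open>1\<close> would be a unit. Hence the closure of a proper ideal is again proper.\<close>

lemma qn_1_ge: assumes "1 \<notin> I" shows "qn 1 \<ge> 1"
proof (rule ccontr)
  assume "\<not> ?thesis"
  then obtain b where b: "b \<in> I" "norm (1 - b) < 1" using qn_approx[of 1 1] by auto
  obtain y where "(1 - (1 - b)) * y = 1" using one_minus_invertible[OF b(2)] by blast
  then have "b * y = 1" by simp
  then show False using idl(4)[OF b(1), of y] assms by simp
qed

end

section \<open>Decay of powers in the quotient, from resolvents averaged over roots of unity\<close>

lemma sum_roots_of_unity:
  fixes M i :: nat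
  assumes "0 < i" "i < M"
  shows "(\<Sum>k<M. (exp (2 * of_real pi * \<i> / of_nat M) :: complex) ^ (k * i)) = 0"
proof -
  let ?w = "exp (2 * of_real pi * \<i> / of_nat M) :: complex"
  have eq: "?w ^ i = exp (2 * of_real pi * \<i> * of_nat i / of_nat M)"
    by (simp add: exp_of_nat_mult[symmetric] mult_ac)
  have "?w ^ i \<noteq> 1"
    unfolding eq using complex_root_unity_eq_1[of M i] assms by (auto dest: dvd_imp_le)
  moreover have "?w ^ M = 1"
    using assms by (simp add: exp_of_nat_mult[symmetric] mult_ac)
  then have "(?w ^ i) ^ M = 1" by (metis mult.commute power_mult power_one)
  ultimately have "(\<Sum>k<M. (?w ^ i) ^ k) = 0" by (simp add: geometric_sum)
  then show ?thesis by (simp add: power_mult[symmetric] mult.commute)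
qed

context complex_banach_ideal begin

context
  fixes x :: 'a
  assumes inv: "\<And>u. \<exists>y. y * (1 - K u * x) - 1 \<in> I"
begin

text \<open>The resolvent: an inverse of \<open>1 - K u * x\<close> modulo \<open>I\<close>. The
  choice is unique only modulo \<open>I\<close>, a difference that \<open>qn\<close> does not
  see.\<close>

definition G :: "complex \<Rightarrow> 'a" where "G u = (SOME y. y * (1 - K u * x) - 1 \<in> I)"

lemma G: "G u * (1 - K u * x) - 1 \<in> I"
  unfolding G_def using inv by (rule someI_ex)

lemma G_resolvent: "(G u - G v) - K (u - v) * (x * G v) * G u \<in> I"
proof -
  have "(G u - G v) - K (u - v) * (x * G v) * G u =
    G v * (G u * (1 - K u * x) - 1) - G u * (G v * (1 - K v * x) - 1)"
    by (simp add: K_diff algebra_simps)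
  then show ?thesis using idl(3)[OF G] idl(6) by presburger
qed

lemma qn_G_diff: "qn (G u - G v) \<le> norm (u - v) * qn (x * G v) * qn (G u)"
proof -
  have "qn (G u - G v) = qn (K (u - v) * ((x * G v) * G u))"
    using qn_cong[OF G_resolvent] by (simp add: mult.assoc)
  also have "\<dots> \<le> norm (u - v) * (qn (x * G v) * qn (G u))"
    unfolding qn_K by (intro mult_left_mono qn_mult) auto
  finally show ?thesis by (simp add: mult.assoc)
qed

text \<open>By the resolvent identity, \<open>qn (G u)\<close> is at most twice
  \<open>qn (G v)\<close> for \<open>u\<close> in some disc around \<open>v\<close>; finitely many
  such discs cover a compact disc.\<close>

lemma qn_G_bounded: obtains C where "C > 0" "\<And>u. norm u \<le> U \<Longrightarrow> qn (G u) \<le> C"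
proof -
  \<comment> \<open>The radius makes \<open>norm (u - v) * qn (x * G v)\<close> at most
    \<open>1/2\<close>; the summand \<open>1\<close> keeps the denominator positive.\<close>
  define T where "T v = ball v (1 / (2 * qn (x * G v) + 1))" for v
  have loc: "qn (G u) \<le> 2 * qn (G v)" if "u \<in> T v" for u v
  proof -
    let ?c = "qn (x * G v)"
    have "norm (u - v) * (2 * ?c + 1) \<le> 1"
      using that qn_nonneg[of "x * G v"] unfolding T_def
      by (auto simp: dist_norm norm_minus_commute field_simps add_nonneg_pos less_imp_le)
    then have "norm (u - v) * ?c \<le> 1/2" by (simp add: algebra_simps) (smt (verit) norm_ge_zero)
    then have "norm (u - v) * ?c * qn (G u) \<le> 1/2 * qn (G u)" by (intro mult_right_mono) auto
    moreover have "qn (G u) \<le> qn (G v) + qn (G u - G v)" using qn_add[of "G v" "G u - G v"] by simp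
    ultimately show ?thesis using qn_G_diff[of u v] by linarith
  qed
  have "cball 0 U \<subseteq> (\<Union>v\<in>cball 0 U. T v)"
  proof
    fix v :: complex assume "v \<in> cball 0 U"
    moreover have "v \<in> T v" unfolding T_def by (simp add: add_nonneg_pos)
    ultimately show "v \<in> (\<Union>v\<in>cball 0 U. T v)" by blast
  qed
  then obtain F where F: "F \<subseteq> cball 0 U" "finite F" "cball 0 U \<subseteq> (\<Union>v\<in>F. T v)"
    using compactE_image[of "cball 0 U" "cball 0 U" T] compact_cball unfolding T_def by blast
  show ?thesis
  proof (rule that)
    show "0 < (\<Sum>v\<in>F. 2 * qn (G v)) + 1" by (intro add_nonneg_pos sum_nonneg) auto
    fix u :: complex assume "norm u \<le> U"
    then obtain v where v: "v \<in> F" "u \<in> T v" using F(3) by auto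
    have "2 * qn (G v) \<le> (\<Sum>v\<in>F. 2 * qn (G v))" using v F(2) by (intro member_le_sum) auto
    then show "qn (G u) \<le> (\<Sum>v\<in>F. 2 * qn (G v)) + 1" using loc[OF v(2)] by linarith
  qed
qed

definition root1 :: "nat \<Rightarrow> complex" where "root1 M = exp (2 * of_real pi * \<i> / of_nat M)"

lemma norm_root1 [simp]: "norm (root1 M) = 1" unfolding root1_def by (simp add: norm_exp_eq_Re)

lemma root1_power: "M > 0 \<Longrightarrow> root1 M ^ M = 1"
  unfolding root1_def by (simp add: exp_of_nat_mult[symmetric] mult_ac)

text \<open>The average over the \<open>M\<close>-th roots of unity takes the place of a Cauchy
  integral: averaging \<open>1 / (1 - w^k y)\<close> over \<open>k\<close> leaves
  \<open>1 / (1 - y^M)\<close>. So it gives access to \<open>x ^ M\<close> while inheriting the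
  bounds on \<open>G\<close>, uniformly in \<open>M\<close>.\<close>

definition S :: "nat \<Rightarrow> complex \<Rightarrow> 'a" where
  "S M u = K (1 / of_nat M) * (\<Sum>k<M. G (root1 M ^ k * u))"

lemma S_inverse:
  assumes "M > 0" shows "S M u * (1 - K (u ^ M) * x ^ M) - 1 \<in> I"
proof -
  let ?y = "K u * x"
  define a where "a k = K (root1 M ^ k) * ?y" for k
  have aM: "a k ^ M = ?y ^ M" for k
    using root1_power[OF assms]
    by (simp add: a_def power_mult_distrib K_power[symmetric] power_mult[symmetric] mult.commute[of k])
       (simp add: power_mult K_1)
  have "G (root1 M ^ k * u) * (1 - ?y ^ M) - (\<Sum>i<M. a k ^ i) \<in> I" for k
  proof -
    have "1 - ?y ^ M = (1 - a k) * (\<Sum>i<M. a k ^ i)" by (metis aM one_diff_power_eq)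
    then have "G (root1 M ^ k * u) * (1 - ?y ^ M) - (\<Sum>i<M. a k ^ i)
        = G (root1 M ^ k * u) * ((1 - a k) * (\<Sum>i<M. a k ^ i)) - (\<Sum>i<M. a k ^ i)"
      by (simp only:)
    also have "\<dots> = (\<Sum>i<M. a k ^ i) * (G (root1 M ^ k * u) * (1 - a k) - 1)"
      by (simp add: algebra_simps)
    finally have "G (root1 M ^ k * u) * (1 - ?y ^ M) - (\<Sum>i<M. a k ^ i)
        = (\<Sum>i<M. a k ^ i) * (G (root1 M ^ k * u) * (1 - a k) - 1)" .
    moreover have "G (root1 M ^ k * u) * (1 - a k) - 1 \<in> I"
      using G[of "root1 M ^ k * u"] unfolding a_def by (simp add: K_mult mult.assoc)
    ultimately show ?thesis using idl(3) by presburger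
  qed
  then have "(\<Sum>k<M. G (root1 M ^ k * u) * (1 - ?y ^ M) - (\<Sum>i<M. a k ^ i)) \<in> I"
    by (intro ideal_set_sum[OF ideal])
  then have "K (1 / of_nat M) * (\<Sum>k<M. G (root1 M ^ k * u) * (1 - ?y ^ M) - (\<Sum>i<M. a k ^ i)) \<in> I"
    by (rule idl(3))
  moreover have "(\<Sum>k<M. \<Sum>i<M. a k ^ i) = K (of_nat M)"
  proof -
    have "(\<Sum>k<M. \<Sum>i<M. a k ^ i) = (\<Sum>i<M. \<Sum>k<M. a k ^ i)" by (rule sum.swap)
    also have "\<dots> = (\<Sum>i<M. K (\<Sum>k<M. root1 M ^ (k * i)) * ?y ^ i)"
      unfolding a_def K_sum by (simp add: power_mult_distrib K_power[symmetric] power_mult[symmetric] sum_distrib_right)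
    \<comment> \<open>Only the exponent \<open>0\<close> survives the summation over the roots of
      unity.\<close>
    also have "\<dots> = (\<Sum>i<M. if i = 0 then K (of_nat M) else 0)"
      using sum_roots_of_unity[of _ M] by (intro sum.cong) (auto simp: root1_def K_0)
    also have "\<dots> = K (of_nat M)" using assms by simp
    finally show ?thesis .
  qed
  ultimately have "S M u * (1 - ?y ^ M) - K (1 / of_nat M) * K (of_nat M) \<in> I"
    unfolding S_def by (simp add: sum_subtractf sum_distrib_right right_diff_distrib mult.assoc)
  then show ?thesis using assms by (simp add: K_mult[symmetric] K_1 power_mult_distrib K_power)
qed

text \<open>Extends the decay to a slightly larger radius. \<open>S M u\<close> inverts
  \<open>1 - u^M x^M\<close>. At radius \<open>v\<close> it is near \<open>1\<close>, because the
  powers are small there, and the Lipschitz bound on \<open>G\<close> carries this over to radius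
  \<open>u\<close> for all \<open>M\<close> at once. So the scaled powers are eventually bounded at
  radius \<open>u\<close>, and they tend to \<open>0\<close> at any smaller radius
  \<open>w\<close>.\<close>

lemma qn_power_tendsto_step:
  assumes C: "C > 0" "\<And>u. norm u \<le> U \<Longrightarrow> qn (G u) \<le> C"
    and lim: "(\<lambda>M. qn (x ^ M) * v ^ M) \<longlonglongrightarrow> 0"
    and "0 \<le> v" "v \<le> u" "u \<le> U" and small: "(u - v) * (qn x * C * C) \<le> 1/6"
    and w: "0 \<le> w" "w < u"
  shows "(\<lambda>M. qn (x ^ M) * w ^ M) \<longlonglongrightarrow> 0"
proof -
  have "u > 0" using w by simp
  have qnS: "qn (K (1 / of_nat M) * (\<Sum>k<M. f k)) \<le> c" if "M > 0" "\<And>k. k < M \<Longrightarrow> qn (f k) \<le> c" for M f c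
  proof -
    have "qn (K (1 / of_nat M) * (\<Sum>k<M. f k)) \<le> (1 / of_nat M) * (\<Sum>k<M. c)"
      unfolding qn_K using that(2)
      by (intro mult_mono order_trans[OF qn_sum sum_mono]) (auto simp: norm_divide sum_nonneg)
    also have "\<dots> = c" using that(1) by simp
    finally show ?thesis .
  qed
  have S_le: "qn (S M (of_real s)) \<le> C" if "M > 0" "0 \<le> s" "s \<le> U" for M s
    unfolding S_def by (rule qnS) (use that in \<open>auto intro!: C simp: norm_mult norm_power\<close>)
  have S_diff: "qn (S M (of_real u) - S M (of_real v)) \<le> 1/6" if "M > 0" for M
  proof -
    have "S M (of_real u) - S M (of_real v) =
       K (1 / of_nat M) * (\<Sum>k<M. G (root1 M ^ k * of_real u) - G (root1 M ^ k * of_real v))"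
      unfolding S_def by (simp add: sum_subtractf right_diff_distrib)
    moreover have "qn (G (root1 M ^ k * of_real u) - G (root1 M ^ k * of_real v)) \<le> 1/6" for k
    proof -
      let ?u = "root1 M ^ k * of_real u" and ?v = "root1 M ^ k * of_real v"
      have n: "norm ?u \<le> U" "norm ?v \<le> U" "norm (?u - ?v) = u - v"
        using assms by (auto simp: norm_mult norm_power right_diff_distrib[symmetric] of_real_diff[symmetric] simp del: of_real_diff)
      have "qn (G ?u - G ?v) \<le> norm (?u - ?v) * (qn x * C) * C"
        using assms n
        by (intro order_trans[OF qn_G_diff] mult_mono order_trans[OF qn_mult] C mult_nonneg_nonneg) auto
      then show ?thesis using small n by (simp add: mult.assoc)
    qed
    ultimately show ?thesis using qnS[OF that] by presburger
  qed
  have "\<forall>\<^sub>F M in sequentially. C * (qn (x ^ M) * v ^ M) < 1/6"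
    using tendsto_mult_left[OF lim, of C] by (intro order_tendstoD) auto
  moreover have "\<forall>\<^sub>F M in sequentially. M > 0" by (rule eventually_gt_at_top)
  \<comment> \<open>The distance of \<open>S M v\<close> from \<open>1\<close> and that of
    \<open>S M u\<close> from \<open>S M v\<close> are each at most \<open>1/6\<close>, which gives
    the \<open>1/3\<close> below.\<close>
  ultimately have half: "\<forall>\<^sub>F M in sequentially. qn (x ^ M) * u ^ M \<le> 1/2"
  proof eventually_elim
    case (elim M)
    let ?yv = "K (of_real v ^ M) * x ^ M" and ?yu = "K (of_real u ^ M) * x ^ M"
    let ?Sv = "S M (of_real v)" and ?Su = "S M (of_real u)"
    have qv: "qn ?yv = qn (x ^ M) * v ^ M" using assms by (simp add: qn_K norm_power)
    have qu: "qn ?yu = qn (x ^ M) * u ^ M" using assms by (simp add: qn_K norm_power)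
    have "(?Sv - 1) - ?Sv * ?yv \<in> I" using S_inverse[OF elim(2), of "of_real v"]
      by (simp add: algebra_simps)
    then have "qn (?Sv - 1) = qn (?Sv * ?yv)" by (rule qn_cong)
    also have "\<dots> \<le> C * (qn (x ^ M) * v ^ M)"
      using S_le[of M v] elim assms C unfolding qv[symmetric] by (intro order_trans[OF qn_mult] mult_right_mono) auto
    finally have "qn (?Sv - 1) \<le> 1/6" using elim by simp
    then have Su: "qn (?Su - 1) \<le> 1/3" using qn_add[of "?Su - ?Sv" "?Sv - 1"] S_diff[OF elim(2)] by simp
    \<comment> \<open>Solving the congruence of \<open>?Su * (1 - ?yu)\<close> to \<open>1\<close>
      for \<open>?yu\<close> puts the small factor \<open>?Su - 1\<close> in front. The seminorm
      \<open>q\<close> of \<open>?yu\<close> then satisfies \<open>q \<le> 1/3 + q/3\<close>, so it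
      is at most \<open>1/2\<close>.\<close>
    have "?yu - ((?Su - 1) - (?Su - 1) * ?yu) = - (?Su * (1 - ?yu) - 1)" by (simp add: algebra_simps)
    then have "?yu - ((?Su - 1) - (?Su - 1) * ?yu) \<in> I"
      using idl(5)[OF S_inverse[OF elim(2), of "of_real u"]] by presburger
    then have "qn ?yu = qn ((?Su - 1) - (?Su - 1) * ?yu)" by (rule qn_cong)
    also have "\<dots> \<le> qn (?Su - 1) + qn (?Su - 1) * qn ?yu"
      by (intro order_trans[OF qn_diff] add_left_mono qn_mult)
    also have "\<dots> \<le> 1/3 + 1/3 * qn ?yu" using Su by (intro add_mono mult_right_mono) auto
    finally show ?case using qu by simp
  qed
  have "(\<lambda>M. 1/2 * (w / u) ^ M) \<longlonglongrightarrow> 1/2 * 0"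
    using w \<open>u > 0\<close> by (intro tendsto_mult_left LIMSEQ_realpow_zero) auto
  then have lim2: "(\<lambda>M. 1/2 * (w / u) ^ M) \<longlonglongrightarrow> 0" by simp
  show ?thesis
  proof (rule tendsto_sandwich[OF _ _ tendsto_const lim2])
    show "\<forall>\<^sub>F M in sequentially. 0 \<le> qn (x ^ M) * w ^ M" using w by simp
    show "\<forall>\<^sub>F M in sequentially. qn (x ^ M) * w ^ M \<le> 1/2 * (w / u) ^ M"
      using half
    proof eventually_elim
      case (elim M)
      have "qn (x ^ M) * w ^ M = (qn (x ^ M) * u ^ M) * (w / u) ^ M"
        using \<open>u > 0\<close> by (simp add: power_divide)
      also have "\<dots> \<le> 1/2 * (w / u) ^ M" using elim w \<open>u > 0\<close> by (intro mult_right_mono) auto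
      finally show ?case .
    qed
  qed
qed

text \<open>The admissible step size depends only on the bound \<open>C\<close>, which holds on a
  disc of twice the radius, so finitely many equal steps reach \<open>t\<close>.\<close>

lemma qn_power_tendsto:
  assumes "t \<ge> 0" shows "(\<lambda>M. qn (x ^ M) * t ^ M) \<longlonglongrightarrow> 0"
proof -
  obtain C where C: "C > 0" "\<And>u. norm u \<le> 2 * t \<Longrightarrow> qn (G u) \<le> C"
    using qn_G_bounded[of "2 * t"] by blast
  define L where "L = qn x * C * C"
  have "L \<ge> 0" using C by (simp add: L_def)
  \<comment> \<open>A step starts at \<open>v = k * h\<close> and looks ahead to
    \<open>u = (k + 2) * h\<close>, in order to secure \<open>w = (k + 1) * h < u\<close>. With
    \<open>h = t / n\<close>, the product of \<open>u - v\<close> and \<open>L\<close> is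
    \<open>2 * t * L / n\<close>, which the factor \<open>12\<close> brings below
    \<open>1/6\<close>.\<close>
  obtain n :: nat where n: "12 * t * L < n" using reals_Archimedean2 by blast
  then have "n > 0" using \<open>L \<ge> 0\<close> assms by (metis gr0I leD mult_nonneg_nonneg of_nat_0 zero_le_numeral)
  define h where "h = t / n"
  have "h \<ge> 0" using assms by (simp add: h_def)
  have nh: "n * h = t" using \<open>n > 0\<close> by (simp add: h_def)
  have "(\<lambda>M. qn (x ^ M) * (k * h) ^ M) \<longlonglongrightarrow> 0" if "k \<le> n" for k :: nat
    using that
  proof (induction k)
    case 0
    show ?case by (rule tendsto_eventually) (auto simp: eventually_sequentially intro!: exI[of _ 1])
  next
    case (Suc k)
    show ?case
    proof (cases "h = 0")
      case True then show ?thesis using Suc by simp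
    next
      case False
      have "real k + 2 \<le> 2 * n" using Suc.prems \<open>n > 0\<close> by simp
      then have "(real k + 2) * h \<le> 2 * n * h" using \<open>h \<ge> 0\<close> by (intro mult_right_mono) auto
      then have le: "(real k + 2) * h \<le> 2 * t" using nh by simp
      show ?thesis
      proof (rule qn_power_tendsto_step[OF C, where v = "k * h" and u = "(real k + 2) * h"])
        show "(\<lambda>M. qn (x ^ M) * (k * h) ^ M) \<longlonglongrightarrow> 0" using Suc by simp
        show "((real k + 2) * h - k * h) * (qn x * C * C) \<le> 1 / 6"
          unfolding L_def[symmetric] using n \<open>n > 0\<close> by (simp add: h_def field_simps)
        show "real (Suc k) * h < (real k + 2) * h" using \<open>h \<ge> 0\<close> False by simp
      qed (use \<open>h \<ge> 0\<close> le in \<open>auto simp: algebra_simps\<close>)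
    qed
  qed
  from this[of n] show ?thesis using nh by simp
qed

end

text \<open>Gelfand-Mazur modulo \<open>I\<close>. If adjoining \<open>x - K l\<close> always
  produced \<open>1\<close>, then every \<open>1 - K u * x\<close> would be invertible modulo
  \<open>I\<close>, and the powers of \<open>x\<close> would decay faster than any geometric
  sequence. But the case \<open>l = 0\<close> makes \<open>x\<close> itself invertible, with inverse
  \<open>a\<close>, and then \<open>1 \<le> qn (x ^ M) * qn a ^ M\<close>.\<close>

theorem exists_eigenvalue:
  assumes "1 \<notin> I"
  obtains l where "1 \<notin> {b + a * (x - K l) |a b. b \<in> I}"
proof (rule ccontr)
  assume "\<not> thesis"
  then have all: "\<exists>a b. 1 = b + a * (x - K l) \<and> b \<in> I" for l using that by blast
  have inv: "\<exists>y. y * (1 - K u * x) - 1 \<in> I" for u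
  proof (cases "u = 0")
    case True then show ?thesis using idl(1) by (auto simp: K_0 intro!: exI[of _ 1])
  next
    case False
    obtain a b where ab: "1 = b + a * (x - K (1/u))" "b \<in> I" using all by blast
    have "K u * K (1/u) = 1" using False by (simp add: K_mult[symmetric] K_1)
    then have "(- a * K (1/u)) * (1 - K u * x) = a * (x - K (1/u))"
      by (simp add: algebra_simps)
    then have "(- a * K (1/u)) * (1 - K u * x) - 1 = - b" using ab(1) by (simp add: algebra_simps)
    then show ?thesis using idl(5)[OF ab(2)] by metis
  qed
  obtain a b where ab: "1 = b + a * (x - K 0)" "b \<in> I" using all by blast
  have ax: "1 - (a * x) \<in> I" using ab by (metis K_0 add_diff_cancel_right' diff_zero)
  have "1 - (a * x) ^ M \<in> I" for M
    using idl(4)[OF ax, of "\<Sum>i<M. (a * x) ^ i"] by (metis one_diff_power_eq)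
  then have eq: "qn 1 = qn ((a * x) ^ M)" for M by (rule qn_cong)
  have le1: "qn 1 \<le> 1" using qn_le_norm[of 1] by simp
  have le: "1 \<le> qn (x ^ M) * qn a ^ M" for M
  proof -
    have "1 \<le> qn ((a * x) ^ M)" using qn_1_ge[OF assms] eq[of M] by simp
    also have "\<dots> \<le> qn (a ^ M) * qn (x ^ M)" unfolding power_mult_distrib by (rule qn_mult)
    also have "\<dots> \<le> qn a ^ M * qn (x ^ M)" by (intro mult_right_mono qn_power le1) auto
    finally show ?thesis by (simp add: mult.commute)
  qed
  have "(\<lambda>M. qn (x ^ M) * qn a ^ M) \<longlonglongrightarrow> 0" by (rule qn_power_tendsto[OF inv]) auto
  then have "1 \<le> (0::real)" by (rule LIMSEQ_le_const) (use le in auto)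
  then show False by simp
qed

end

section \<open>The algebra of absolutely summable power series\<close>

text \<open>Convolution is summed over pairs of exponents rather than over lower exponents, so that
  commutativity and associativity become bijections between sets of pairs.\<close>

definition splittings :: "('n \<Rightarrow> nat) \<Rightarrow> (('n \<Rightarrow> nat) \<times> ('n \<Rightarrow> nat)) set" where
  "splittings \<alpha> = {p. fst p + snd p = \<alpha>}"

lemma mem_splittings: "p \<in> splittings \<alpha> \<longleftrightarrow> fst p \<le> \<alpha> \<and> snd p = \<alpha> - fst p"
proof
  assume "p \<in> splittings \<alpha>"
  then have "fst p i + snd p i = \<alpha> i" for i by (auto simp: splittings_def)
  then show "fst p \<le> \<alpha> \<and> snd p = \<alpha> - fst p"
    by (metis (no_types, lifting) diff_add_inverse ext le_add1 le_funI fun_diff_def)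
qed (auto simp: splittings_def le_fun_def fun_eq_iff)

lemma finite_fun_le: "finite {\<beta>. \<beta> \<le> (\<alpha> :: 'n::finite \<Rightarrow> nat)}"
proof -
  have "{\<beta>. \<beta> \<le> \<alpha>} \<subseteq> PiE UNIV (\<lambda>i. {..\<alpha> i})" by (auto simp: le_fun_def)
  then show ?thesis by (rule finite_subset) (auto intro: finite_PiE)
qed

lemma finite_splittings [simp]: "finite (splittings (\<alpha> :: 'n::finite \<Rightarrow> nat))"
proof -
  have "splittings \<alpha> \<subseteq> {\<beta>. \<beta> \<le> \<alpha>} \<times> {\<beta>. \<beta> \<le> \<alpha>}"
    unfolding splittings_def by (auto simp: le_fun_def)
  then show ?thesis by (rule finite_subset) (simp add: finite_fun_le)
qed

definition mmul :: "'n::finite mseries \<Rightarrow> 'n mseries \<Rightarrow> 'n mseries" where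
  "mmul a b \<alpha> = (\<Sum>p\<in>splittings \<alpha>. a (fst p) * b (snd p))"

lemma mmul_eq: "mmul a b = (\<lambda>\<alpha>. \<Sum>\<beta> | \<beta> \<le> \<alpha>. a \<beta> * b (\<lambda>i. \<alpha> i - \<beta> i))"
proof
  fix \<alpha>
  show "mmul a b \<alpha> = (\<Sum>\<beta> | \<beta> \<le> \<alpha>. a \<beta> * b (\<lambda>i. \<alpha> i - \<beta> i))"
    unfolding mmul_def
    by (rule sum.reindex_bij_witness[of _ "\<lambda>\<beta>. (\<beta>, \<lambda>i. \<alpha> i - \<beta> i)" fst])
       (auto simp: mem_splittings fun_diff_def)
qed

lemma mmul_commute: "mmul a b = mmul b a"
proof
  fix \<alpha>
  show "mmul a b \<alpha> = mmul b a \<alpha>"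
    unfolding mmul_def splittings_def
    by (rule sum.reindex_bij_witness[of _ prod.swap prod.swap]) (auto simp: add.commute)
qed

lemma mmul_assoc: "mmul (mmul a b) c = mmul a (mmul b c)"
proof
  fix \<alpha>
  have "mmul (mmul a b) c \<alpha> =
     (\<Sum>(p, q)\<in>(SIGMA p:splittings \<alpha>. splittings (fst p)). a (fst q) * b (snd q) * c (snd p))"
    unfolding mmul_def by (simp add: sum.Sigma sum_distrib_right)
  also have "\<dots> = (\<Sum>(p, q)\<in>(SIGMA p:splittings \<alpha>. splittings (snd p)). a (fst p) * (b (fst q) * c (snd q)))"
    by (rule sum.reindex_bij_witness
        [of _ "\<lambda>(p, q). ((fst p + fst q, snd q), (fst p, fst q))"
              "\<lambda>(p, q). ((fst q, snd q + snd p), (snd q, snd p))"])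
       (auto simp: splittings_def add.assoc)
  also have "\<dots> = mmul a (mmul b c) \<alpha>"
    unfolding mmul_def by (simp add: sum.Sigma sum_distrib_left)
  finally show "mmul (mmul a b) c \<alpha> = mmul a (mmul b c) \<alpha>" .
qed

lemma mmul_add_left: "mmul (a + b) c = mmul a c + mmul b c"
  by (rule ext) (simp add: mmul_def sum.distrib algebra_simps)

lemma mmul_const: "mmul (mseries_const c) a = (\<lambda>\<alpha>. c * a \<alpha>)"
proof
  fix \<alpha>
  have "mmul (mseries_const c) a \<alpha> = (\<Sum>p\<in>splittings \<alpha>. if p = (0, \<alpha>) then c * a \<alpha> else 0)"
    unfolding mmul_def mseries_const_def
    by (rule sum.cong) (auto simp: mem_splittings zero_fun_def)
  moreover have "(0, \<alpha>) \<in> splittings \<alpha>" by (simp add: splittings_def)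
  ultimately show "mmul (mseries_const c) a \<alpha> = c * a \<alpha>" by simp
qed

definition mmonom :: "('n \<Rightarrow> nat) \<Rightarrow> 'n mseries" where
  "mmonom \<alpha> = (\<lambda>\<beta>. if \<beta> = \<alpha> then 1 else 0)"

lemma mmul_monom: "mmul (mmonom \<alpha>) a \<beta> = (if \<alpha> \<le> \<beta> then a (\<beta> - \<alpha>) else 0)"
proof -
  have "mmul (mmonom \<alpha>) a \<beta> = (\<Sum>p\<in>splittings \<beta>. if p = (\<alpha>, \<beta> - \<alpha>) then a (\<beta> - \<alpha>) else 0)"
    unfolding mmul_def mmonom_def by (rule sum.cong) (auto simp: mem_splittings)
  moreover have "(\<alpha>, \<beta> - \<alpha>) \<in> splittings \<beta> \<longleftrightarrow> \<alpha> \<le> \<beta>"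
    by (simp add: mem_splittings)
  ultimately show ?thesis by simp
qed

lemma mmul_monom_monom: "mmul (mmonom \<alpha>) (mmonom \<beta>) = mmonom (\<alpha> + \<beta>)"
proof
  fix \<gamma>
  have "\<alpha> \<le> \<gamma> \<and> \<beta> = \<gamma> - \<alpha> \<longleftrightarrow> \<alpha> + \<beta> = \<gamma>"
    using mem_splittings[of "(\<alpha>, \<beta>)" \<gamma>] by (simp add: splittings_def)
  then show "mmul (mmonom \<alpha>) (mmonom \<beta>) \<gamma> = mmonom (\<alpha> + \<beta>) \<gamma>"
    unfolding mmul_monom by (auto simp: mmonom_def)
qed

section \<open>Absolutely summable families and their convolution\<close>

abbreviation abs_summ :: "('a \<Rightarrow> 'b::real_normed_vector) \<Rightarrow> bool" where
  "abs_summ f \<equiv> (\<lambda>x. norm (f x)) summable_on UNIV"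

lemma abs_summableI:
  fixes f :: "'a \<Rightarrow> 'b::real_normed_vector"
  assumes "\<And>F. finite F \<Longrightarrow> (\<Sum>x\<in>F. norm (f x)) \<le> C"
  shows "abs_summ f" "(\<Sum>\<^sub>\<infinity>x. norm (f x)) \<le> C"
proof -
  show *: "abs_summ f"
    by (rule nonneg_bdd_above_summable_on) (use assms in \<open>auto intro!: bdd_aboveI\<close>)
  show "(\<Sum>\<^sub>\<infinity>x. norm (f x)) \<le> C" by (rule infsum_le_finite_sums[OF *]) (use assms in auto)
qed

lemma abs_summable_finite_sum_le:
  fixes f :: "'a \<Rightarrow> 'b::real_normed_vector"
  assumes "abs_summ f" "finite F"
  shows "(\<Sum>x\<in>F. norm (f x)) \<le> (\<Sum>\<^sub>\<infinity>x. norm (f x))"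
  by (rule finite_sum_le_infsum) (use assms in auto)

lemma abs_summ_add:
  fixes f g :: "'a \<Rightarrow> 'b::real_normed_vector"
  assumes "abs_summ f" "abs_summ g"
  shows "abs_summ (\<lambda>x. f x + g x)"
proof (rule abs_summableI(1)[where C = "(\<Sum>\<^sub>\<infinity>x. norm (f x)) + (\<Sum>\<^sub>\<infinity>x. norm (g x))"])
  fix F :: "'a set" assume "finite F"
  have "(\<Sum>x\<in>F. norm (f x + g x)) \<le> (\<Sum>x\<in>F. norm (f x) + norm (g x))"
    by (intro sum_mono norm_triangle_ineq)
  also have "\<dots> \<le> (\<Sum>\<^sub>\<infinity>x. norm (f x)) + (\<Sum>\<^sub>\<infinity>x. norm (g x))"
    unfolding sum.distrib using \<open>finite F\<close> by (intro add_mono abs_summable_finite_sum_le assms)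
  finally show "(\<Sum>x\<in>F. norm (f x + g x)) \<le> (\<Sum>\<^sub>\<infinity>x. norm (f x)) + (\<Sum>\<^sub>\<infinity>x. norm (g x))" .
qed

text \<open>Finitely many exponents have finitely many splittings, and these lie in a finite
  rectangle of pairs, over which the sum factors.\<close>

lemma abs_summable_mmul:
  assumes "abs_summ a" "abs_summ b"
  shows "abs_summ (mmul a b)"
    "(\<Sum>\<^sub>\<infinity>\<alpha>. norm (mmul a b \<alpha>)) \<le> (\<Sum>\<^sub>\<infinity>\<alpha>. norm (a \<alpha>)) * (\<Sum>\<^sub>\<infinity>\<alpha>. norm (b \<alpha>))"
proof -
  have *: "(\<Sum>\<alpha>\<in>F. norm (mmul a b \<alpha>)) \<le> (\<Sum>\<^sub>\<infinity>\<alpha>. norm (a \<alpha>)) * (\<Sum>\<^sub>\<infinity>\<alpha>. norm (b \<alpha>))"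
    if "finite F" for F
  proof -
    let ?P = "SIGMA \<alpha>:F. splittings \<alpha>"
    let ?G = "(fst \<circ> snd) ` ?P" and ?H = "(snd \<circ> snd) ` ?P"
    have fin: "finite ?P" using that by auto
    have sub: "snd ` ?P \<subseteq> ?G \<times> ?H"
    proof
      fix p assume "p \<in> snd ` ?P"
      then obtain \<alpha> where "(\<alpha>, p) \<in> ?P" by auto
      then have "fst p \<in> ?G" "snd p \<in> ?H"
        by (auto intro: image_eqI[of _ _ "(\<alpha>, p)"])
      then show "p \<in> ?G \<times> ?H" by (simp add: mem_Times_iff)
    qed
    have "(\<Sum>\<alpha>\<in>F. norm (mmul a b \<alpha>)) \<le> (\<Sum>\<alpha>\<in>F. \<Sum>p\<in>splittings \<alpha>. norm (a (fst p)) * norm (b (snd p)))"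
      unfolding mmul_def norm_mult[symmetric] by (intro sum_mono norm_sum)
    also have "\<dots> = (\<Sum>(\<alpha>, p)\<in>?P. norm (a (fst p)) * norm (b (snd p)))"
      using that by (simp add: sum.Sigma)
    also have "\<dots> = (\<Sum>p\<in>snd ` ?P. norm (a (fst p)) * norm (b (snd p)))"
      by (subst sum.reindex) (auto simp: inj_on_def splittings_def case_prod_beta)
    also have "\<dots> \<le> (\<Sum>p\<in>?G \<times> ?H. norm (a (fst p)) * norm (b (snd p)))"
      using fin sub by (intro sum_mono2 finite_cartesian_product finite_imageI) auto
    also have "\<dots> = (\<Sum>\<alpha>\<in>?G. norm (a \<alpha>)) * (\<Sum>\<alpha>\<in>?H. norm (b \<alpha>))"
      by (simp add: sum_product sum.cartesian_product case_prod_beta)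
    also have "\<dots> \<le> (\<Sum>\<^sub>\<infinity>\<alpha>. norm (a \<alpha>)) * (\<Sum>\<^sub>\<infinity>\<alpha>. norm (b \<alpha>))"
      using fin assms by (intro mult_mono abs_summable_finite_sum_le sum_nonneg infsum_nonneg) auto
    finally show ?thesis .
  qed
  show "abs_summ (mmul a b)" by (rule abs_summableI(1)[OF *])
  show "(\<Sum>\<^sub>\<infinity>\<alpha>. norm (mmul a b \<alpha>)) \<le> (\<Sum>\<^sub>\<infinity>\<alpha>. norm (a \<alpha>)) * (\<Sum>\<^sub>\<infinity>\<alpha>. norm (b \<alpha>))"
    by (rule abs_summableI(2)[OF *])
qed

text \<open>Absolute summability of the coefficients is absolute convergence on the closed unit
  polydisc. All other radii are brought to this one by \<open>rescale\<close>, so a single type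
  suffices.\<close>

typedef (overloaded) 'n l1 = "{a :: 'n::finite mseries. abs_summ a}"
  morphisms l1coeff Abs_l1
  by (rule exI[of _ "\<lambda>_. 0"]) simp

lemma l1_eqI: "(\<And>\<alpha>. l1coeff a \<alpha> = l1coeff b \<alpha>) \<Longrightarrow> a = b"
  by (rule iffD1[OF l1coeff_inject], rule ext)

lemma coeff_summable: "abs_summ (l1coeff a)"
  using l1coeff[of a] unfolding mem_Collect_eq .

lemma abs_summable_monom: "abs_summ (mmonom \<alpha>)"
proof (rule abs_summableI(1)[where C = 1])
  fix F :: "('a \<Rightarrow> nat) set" assume "finite F"
  have "(\<Sum>\<beta>\<in>F. norm (mmonom \<alpha> \<beta>)) = (\<Sum>\<beta>\<in>F. if \<beta> = \<alpha> then 1 else 0)"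
    unfolding mmonom_def by (intro sum.cong) auto
  then show "(\<Sum>\<beta>\<in>F. norm (mmonom \<alpha> \<beta>)) \<le> 1" using \<open>finite F\<close> by simp
qed

lemma abs_summable_scale: "abs_summ a \<Longrightarrow> abs_summ (\<lambda>\<alpha>. c * a \<alpha>)" for c :: complex
  unfolding norm_mult by (rule summable_on_cmult_right)

lemma mseries_const_eq: "mseries_const c = (\<lambda>\<alpha>. c * mmonom 0 \<alpha>)"
  unfolding mseries_const_def mmonom_def zero_fun_def by auto

instantiation l1 :: (finite) comm_ring_1
begin

definition "0 = Abs_l1 (\<lambda>_. 0)"
definition "1 = Abs_l1 (mmonom 0)"
definition "a + b = Abs_l1 (\<lambda>\<alpha>. l1coeff a \<alpha> + l1coeff b \<alpha>)"
definition "a - b = Abs_l1 (\<lambda>\<alpha>. l1coeff a \<alpha> - l1coeff b \<alpha>)"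
definition "- a = Abs_l1 (\<lambda>\<alpha>. - l1coeff a \<alpha>)"
definition "a * b = Abs_l1 (mmul (l1coeff a) (l1coeff b))"

lemma coeff_ops:
  "l1coeff 0 = (\<lambda>_. 0)" "l1coeff 1 = mmonom 0" "l1coeff (a + b) = (\<lambda>\<alpha>. l1coeff a \<alpha> + l1coeff b \<alpha>)"
  "l1coeff (a - b) = (\<lambda>\<alpha>. l1coeff a \<alpha> - l1coeff b \<alpha>)" "l1coeff (- a) = (\<lambda>\<alpha>. - l1coeff a \<alpha>)"
  "l1coeff (a * b) = mmul (l1coeff a) (l1coeff b)"
proof -
  have minus: "abs_summ (\<lambda>\<alpha>. - l1coeff b \<alpha>)" for b
    using coeff_summable[of b] by simp
  show "l1coeff 0 = (\<lambda>_. 0)" unfolding zero_l1_def by (simp add: Abs_l1_inverse)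
  show "l1coeff 1 = mmonom 0" unfolding one_l1_def by (simp add: Abs_l1_inverse abs_summable_monom)
  show "l1coeff (a + b) = (\<lambda>\<alpha>. l1coeff a \<alpha> + l1coeff b \<alpha>)"
    unfolding plus_l1_def using abs_summ_add[OF coeff_summable[of a] coeff_summable[of b]]
    by (intro Abs_l1_inverse) simp
  show "l1coeff (- a) = (\<lambda>\<alpha>. - l1coeff a \<alpha>)" unfolding uminus_l1_def using minus by (intro Abs_l1_inverse) auto
  show "l1coeff (a - b) = (\<lambda>\<alpha>. l1coeff a \<alpha> - l1coeff b \<alpha>)"
    unfolding minus_l1_def using abs_summ_add[OF coeff_summable[of a] minus[of b]]
    by (intro Abs_l1_inverse) auto
  show "l1coeff (a * b) = mmul (l1coeff a) (l1coeff b)"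
    unfolding times_l1_def by (intro Abs_l1_inverse) (auto intro: abs_summable_mmul coeff_summable)
qed

instance
proof
  fix a b c :: "'a l1"
  show "a * b * c = a * (b * c)" by (rule l1_eqI) (simp add: coeff_ops mmul_assoc)
  show "a * b = b * a" by (rule l1_eqI) (simp add: coeff_ops mmul_commute)
  show "1 * a = a" using mmul_const[of 1 "l1coeff a"]
    by (intro l1_eqI) (simp add: coeff_ops mseries_const_eq)
  show "(a + b) * c = a * c + b * c" using mmul_add_left[of "l1coeff a" "l1coeff b" "l1coeff c"]
    by (intro l1_eqI) (simp add: coeff_ops plus_fun_def)
  show "(0::'a l1) \<noteq> 1"
  proof
    assume "(0::'a l1) = 1"
    then have "l1coeff (0::'a l1) 0 = l1coeff 1 0" by simp
    then show False by (simp add: coeff_ops mmonom_def)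
  qed
next
  fix a b c :: "'a l1"
  show "a + b + c = a + (b + c)" by (rule l1_eqI) (simp add: coeff_ops add.assoc)
  show "a + b = b + a" by (rule l1_eqI) (simp add: coeff_ops add.commute)
  show "0 + a = a" by (rule l1_eqI) (simp add: coeff_ops)
  show "- a + a = 0" by (rule l1_eqI) (simp add: coeff_ops)
  show "a - b = a + - b" by (rule l1_eqI) (simp add: coeff_ops)
qed

end

instantiation l1 :: (finite) real_vector
begin

definition scaleR_l1 :: "real \<Rightarrow> 'a l1 \<Rightarrow> 'a l1" where "scaleR_l1 r a = Abs_l1 (\<lambda>\<alpha>. r *\<^sub>R l1coeff a \<alpha>)"

lemma coeff_scaleR: "l1coeff (r *\<^sub>R a) = (\<lambda>\<alpha>. r *\<^sub>R l1coeff a \<alpha>)"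
  unfolding scaleR_l1_def using summable_on_cmult_right[OF coeff_summable[of a], of "\<bar>r\<bar>"]
  by (intro Abs_l1_inverse) simp

instance
proof
  fix a b :: "'a l1" and r s :: real
  show "r *\<^sub>R (a + b) = r *\<^sub>R a + r *\<^sub>R b"
    by (rule l1_eqI) (simp add: coeff_ops coeff_scaleR scaleR_add_right)
  show "(r + s) *\<^sub>R a = r *\<^sub>R a + s *\<^sub>R a"
    by (rule l1_eqI) (simp add: coeff_ops coeff_scaleR scaleR_add_left)
  show "r *\<^sub>R s *\<^sub>R a = (r * s) *\<^sub>R a"
    by (rule l1_eqI) (simp add: coeff_scaleR)
  show "1 *\<^sub>R a = a"
    by (rule l1_eqI) (simp add: coeff_scaleR)
qed

end

instantiation l1 :: (finite) real_normed_algebra_1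
begin

definition norm_l1 :: "'a l1 \<Rightarrow> real" where "norm_l1 a = (\<Sum>\<^sub>\<infinity>\<alpha>. norm (l1coeff a \<alpha>))"
definition dist_l1 :: "'a l1 \<Rightarrow> 'a l1 \<Rightarrow> real" where "dist_l1 a b = norm (a - b)"
definition sgn_l1 :: "'a l1 \<Rightarrow> 'a l1" where "sgn_l1 a = a /\<^sub>R norm a"
definition uniformity_l1 :: "('a l1 \<times> 'a l1) filter" where
  "uniformity_l1 = (INF e\<in>{0<..}. principal {(a, b). dist a b < e})"
definition open_l1 :: "'a l1 set \<Rightarrow> bool" where
  "open_l1 U \<longleftrightarrow> (\<forall>a\<in>U. eventually (\<lambda>(a', b). a' = a \<longrightarrow> b \<in> U) uniformity)"

lemma norm_l1_le: "(\<And>F. finite F \<Longrightarrow> (\<Sum>\<alpha>\<in>F. norm (l1coeff a \<alpha>)) \<le> C) \<Longrightarrow> norm a \<le> C"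
  unfolding norm_l1_def by (rule abs_summableI(2))

lemma norm_l1_ge: "finite F \<Longrightarrow> (\<Sum>\<alpha>\<in>F. norm (l1coeff a \<alpha>)) \<le> norm a"
  unfolding norm_l1_def by (rule abs_summable_finite_sum_le[OF coeff_summable])

lemma norm_coeff_le: "norm (l1coeff a \<alpha>) \<le> norm a"
  using norm_l1_ge[of "{\<alpha>}" a] by simp

instance
proof
  fix a b :: "'a l1" and r :: real
  show "r *\<^sub>R a * b = r *\<^sub>R (a * b)" for a b :: "'a l1"
    by (rule l1_eqI) (simp add: coeff_ops coeff_scaleR mmul_def scaleR_sum_right)
  then show "a * r *\<^sub>R b = r *\<^sub>R (a * b)" by (metis mult.commute)
  show "norm a = 0 \<longleftrightarrow> a = 0"
  proof
    assume "norm a = 0"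
    then have "l1coeff a \<alpha> = 0" for \<alpha> using norm_coeff_le[of a \<alpha>] by simp
    then show "a = 0" by (intro l1_eqI) (simp add: coeff_ops)
  qed (simp add: norm_l1_def coeff_ops)
  show "norm (a + b) \<le> norm a + norm b"
  proof (rule norm_l1_le)
    fix F :: "('a \<Rightarrow> nat) set" assume F: "finite F"
    have "(\<Sum>\<alpha>\<in>F. norm (l1coeff (a + b) \<alpha>)) \<le> (\<Sum>\<alpha>\<in>F. norm (l1coeff a \<alpha>) + norm (l1coeff b \<alpha>))"
      by (intro sum_mono) (simp add: coeff_ops norm_triangle_ineq)
    also have "\<dots> \<le> norm a + norm b"
      unfolding sum.distrib by (intro add_mono norm_l1_ge F)
    finally show "(\<Sum>\<alpha>\<in>F. norm (l1coeff (a + b) \<alpha>)) \<le> norm a + norm b" .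
  qed
  show "norm (r *\<^sub>R a) = \<bar>r\<bar> * norm a"
    unfolding norm_l1_def by (simp add: coeff_scaleR infsum_cmult_right')
  show "norm (a * b) \<le> norm a * norm b"
    unfolding norm_l1_def coeff_ops by (intro abs_summable_mmul coeff_summable)
  show "norm (1::'a l1) = 1"
  proof (rule antisym)
    show "norm (1::'a l1) \<le> 1"
    proof (rule norm_l1_le)
      fix F :: "('a \<Rightarrow> nat) set" assume "finite F"
      have "(\<Sum>\<beta>\<in>F. norm (l1coeff 1 \<beta>)) = (\<Sum>\<beta>\<in>F. if \<beta> = 0 then 1 else 0)"
        unfolding coeff_ops mmonom_def by (intro sum.cong) auto
      then show "(\<Sum>\<beta>\<in>F. norm (l1coeff 1 \<beta>)) \<le> 1" using \<open>finite F\<close> by simp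
    qed
    show "1 \<le> norm (1::'a l1)" using norm_coeff_le[of "1::'a l1" 0] by (simp add: coeff_ops mmonom_def)
  qed
qed (simp_all add: dist_l1_def sgn_l1_def uniformity_l1_def open_l1_def)

end

instance l1 :: (finite) banach
proof
  fix X :: "nat \<Rightarrow> 'a l1" assume X: "Cauchy X"
  have "Cauchy (\<lambda>n. l1coeff (X n) \<alpha>)" for \<alpha>
  proof (rule CauchyI)
    fix e :: real assume "e > 0"
    then obtain N where "\<forall>m\<ge>N. \<forall>n\<ge>N. norm (X m - X n) < e" using CauchyD[OF X] by blast
    moreover have "norm (l1coeff (X m) \<alpha> - l1coeff (X n) \<alpha>) \<le> norm (X m - X n)" for m n
      using norm_coeff_le[of "X m - X n" \<alpha>] by (simp add: coeff_ops)
    ultimately show "\<exists>N. \<forall>m\<ge>N. \<forall>n\<ge>N. norm (l1coeff (X m) \<alpha> - l1coeff (X n) \<alpha>) < e"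
      by (meson le_less_trans)
  qed
  then have "\<exists>l. (\<lambda>n. l1coeff (X n) \<alpha>) \<longlonglongrightarrow> l" for \<alpha> by (simp add: Cauchy_convergent_iff convergent_def)
  then obtain l where l: "\<And>\<alpha>. (\<lambda>n. l1coeff (X n) \<alpha>) \<longlonglongrightarrow> l \<alpha>" by metis
  have close: "\<exists>N. \<forall>n\<ge>N. \<forall>F. finite F \<longrightarrow> (\<Sum>\<alpha>\<in>F. norm (l1coeff (X n) \<alpha> - l \<alpha>)) \<le> e" if e: "e > 0" for e
  proof -
    obtain N where N: "\<forall>m\<ge>N. \<forall>n\<ge>N. norm (X m - X n) < e" using CauchyD[OF X e] by blast
    have "(\<Sum>\<alpha>\<in>F. norm (l1coeff (X n) \<alpha> - l \<alpha>)) \<le> e" if "n \<ge> N" "finite F" for n F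
    proof (rule LIMSEQ_le_const2)
      show "(\<lambda>m. \<Sum>\<alpha>\<in>F. norm (l1coeff (X n) \<alpha> - l1coeff (X m) \<alpha>)) \<longlonglongrightarrow> (\<Sum>\<alpha>\<in>F. norm (l1coeff (X n) \<alpha> - l \<alpha>))"
        by (intro tendsto_intros l)
      have "(\<Sum>\<alpha>\<in>F. norm (l1coeff (X n) \<alpha> - l1coeff (X m) \<alpha>)) \<le> e" if "m \<ge> N" for m
      proof -
        have "norm (X n - X m) < e" using N that \<open>n \<ge> N\<close> by blast
        then show ?thesis using norm_l1_ge[OF \<open>finite F\<close>, of "X n - X m"] by (simp add: coeff_ops)
      qed
      then show "\<exists>N. \<forall>m\<ge>N. (\<Sum>\<alpha>\<in>F. norm (l1coeff (X n) \<alpha> - l1coeff (X m) \<alpha>)) \<le> e" by blast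
    qed
    then show ?thesis by blast
  qed
  obtain N where N: "\<And>F. finite F \<Longrightarrow> (\<Sum>\<alpha>\<in>F. norm (l1coeff (X N) \<alpha> - l \<alpha>)) \<le> 1" using close[of 1] by auto
  \<comment> \<open>One index \<open>N\<close> at bounded distance shows that the coefficientwise
    limit is summable: it is \<open>X N\<close> minus the summable \<open>D\<close>.\<close>
  define D where "D = Abs_l1 (\<lambda>\<alpha>. l1coeff (X N) \<alpha> - l \<alpha>)"
  have D: "l1coeff D = (\<lambda>\<alpha>. l1coeff (X N) \<alpha> - l \<alpha>)"
    unfolding D_def using abs_summableI(1)[of "\<lambda>\<alpha>. l1coeff (X N) \<alpha> - l \<alpha>", OF N] by (intro Abs_l1_inverse) auto
  define Y where "Y = X N - D"
  have Y: "l1coeff Y \<alpha> = l \<alpha>" for \<alpha> by (simp add: Y_def coeff_ops D)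
  have "X \<longlonglongrightarrow> Y"
  proof (rule LIMSEQ_I)
    fix e :: real assume "e > 0"
    then obtain N where "\<And>n F. n \<ge> N \<Longrightarrow> finite F \<Longrightarrow> (\<Sum>\<alpha>\<in>F. norm (l1coeff (X n) \<alpha> - l \<alpha>)) \<le> e/2"
      using close[of "e/2"] by auto
    then have "norm (X n - Y) \<le> e/2" if "n \<ge> N" for n
      using that by (intro norm_l1_le) (simp add: coeff_ops Y)
    moreover have "e / 2 < e" using \<open>e > 0\<close> by simp
    ultimately show "\<exists>N. \<forall>n\<ge>N. norm (X n - Y) < e" by (meson le_less_trans)
  qed
  then show "convergent X" by (auto simp: convergent_def)
qed

section \<open>Constants, monomials and truncations\<close>

definition unitv :: "'n \<Rightarrow> nat \<Rightarrow> 'n \<Rightarrow> nat" where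
  "unitv i k = (\<lambda>j. if j = i then k else 0)"

lemma unitv_le_iff [simp]: "unitv i k \<le> \<alpha> \<longleftrightarrow> k \<le> \<alpha> i"
  by (auto simp: unitv_def le_fun_def)

lemma unitv_add: "unitv i k + unitv i l = unitv i (k + l)"
  by (auto simp: unitv_def)

lemma unitv_0 [simp]: "unitv i 0 = 0"
  by (auto simp: unitv_def)

definition l1_const :: "complex \<Rightarrow> 'n::finite l1" where "l1_const c = Abs_l1 (mseries_const c)"

definition l1_monom :: "('n::finite \<Rightarrow> nat) \<Rightarrow> 'n l1" where "l1_monom \<alpha> = Abs_l1 (mmonom \<alpha>)"

lemma coeff_l1_monom [simp]: "l1coeff (l1_monom \<alpha>) = mmonom \<alpha>"
  unfolding l1_monom_def by (rule Abs_l1_inverse) (simp add: abs_summable_monom)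

lemma coeff_l1_const: "l1coeff (l1_const c) = mseries_const c"
  unfolding l1_const_def using abs_summable_scale[OF abs_summable_monom, of c 0]
  by (intro Abs_l1_inverse) (simp add: mseries_const_eq)

lemma coeff_l1_const_mult [simp]: "l1coeff (l1_const c * a) = (\<lambda>\<alpha>. c * l1coeff a \<alpha>)"
  by (simp add: coeff_ops coeff_l1_const mmul_const)

lemma l1_monom_0: "l1_monom 0 = 1" by (rule l1_eqI) (simp add: coeff_ops)

lemma l1_monom_0': "l1_monom (\<lambda>_. 0) = 1" using l1_monom_0 by (simp add: zero_fun_def)

definition l1_var :: "'n \<Rightarrow> 'n::finite l1" where "l1_var i = l1_monom (unitv i 1)"

lemma l1_monom_mult: "l1_monom \<alpha> * l1_monom \<beta> = l1_monom (\<alpha> + \<beta>)"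
  by (rule l1_eqI) (simp add: coeff_ops mmul_monom_monom)

lemma l1_monom_power: "l1_var i ^ k = l1_monom (unitv i k)"
  by (induction k) (simp_all add: l1_monom_0 l1_monom_0' l1_var_def l1_monom_mult unitv_add)

lemma norm_l1_const: "norm (l1_const c :: 'n::finite l1) = norm c"
proof -
  have "norm (l1_const c * 1 :: 'n l1) = norm c * norm (1 :: 'n l1)"
    unfolding norm_l1_def coeff_l1_const_mult norm_mult by (rule infsum_cmult_right')
  then show ?thesis by simp
qed

interpretation l1: complex_banach_algebra "l1_const :: complex \<Rightarrow> 'n::finite l1"
proof
  fix c d :: complex
  show "l1_const (c + d) = (l1_const c + l1_const d :: 'n l1)"
    by (rule l1_eqI) (simp add: coeff_ops coeff_l1_const mseries_const_def)
  show "l1_const (c * d) = (l1_const c * l1_const d :: 'n l1)"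
    by (rule l1_eqI) (simp add: coeff_l1_const mseries_const_def)
  show "l1_const 1 = (1 :: 'n l1)"
    by (rule l1_eqI) (simp add: coeff_ops coeff_l1_const mseries_const_eq)
  show "norm (l1_const c :: 'n l1) = norm c" by (rule norm_l1_const)
qed

lemma l1_monom_prod:
  "l1_monom \<alpha> = (\<Prod>i\<in>UNIV. l1_var i ^ \<alpha> i)"
proof -
  have "(\<Prod>i\<in>S. l1_var i ^ \<alpha> i) = l1_monom (\<lambda>i. if i \<in> S then \<alpha> i else 0)" if "finite S" for S
    using that
  proof (induction S rule: finite_induct)
    case empty then show ?case by (simp add: l1_monom_0')
  next
    case (insert i S)
    have "unitv i (\<alpha> i) + (\<lambda>i. if i \<in> S then \<alpha> i else 0) = (\<lambda>j. if j \<in> insert i S then \<alpha> j else 0)"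
      using insert by (auto simp: unitv_def fun_eq_iff)
    then have "l1_monom (\<lambda>j. if j \<in> insert i S then \<alpha> j else 0)
        = l1_var i ^ \<alpha> i * l1_monom (\<lambda>i. if i \<in> S then \<alpha> i else 0)"
      by (simp only: l1_monom_power l1_monom_mult)
    then show ?case using insert by simp
  qed
  from this[of UNIV] show ?thesis by simp
qed

definition l1_trunc :: "('n::finite \<Rightarrow> nat) set \<Rightarrow> 'n l1 \<Rightarrow> 'n l1" where
  "l1_trunc F a = (\<Sum>\<alpha>\<in>F. l1_const (l1coeff a \<alpha>) * l1_monom \<alpha>)"

lemma coeff_sum: "l1coeff (sum f A) \<alpha> = (\<Sum>i\<in>A. l1coeff (f i) \<alpha>)"
  by (induction A rule: infinite_finite_induct) (auto simp: coeff_ops)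

lemma coeff_l1_trunc:
  assumes "finite F" shows "l1coeff (l1_trunc F a) \<alpha> = (if \<alpha> \<in> F then l1coeff a \<alpha> else 0)"
proof -
  have "l1coeff (l1_trunc F a) \<alpha> = (\<Sum>\<beta>\<in>F. if \<beta> = \<alpha> then l1coeff a \<alpha> else 0)"
    unfolding l1_trunc_def coeff_sum by (intro sum.cong) (auto simp: mmonom_def)
  then show ?thesis using assms by simp
qed

lemma l1_trunc_approx:
  assumes "e > 0" obtains F where "finite F" "norm (a - l1_trunc F a) \<le> e"
proof -
  have "((\<lambda>\<alpha>. norm (l1coeff a \<alpha>)) has_sum norm a) UNIV"
    unfolding norm_l1_def by (rule has_sum_infsum[OF coeff_summable])
  then have "\<forall>\<^sub>F F in finite_subsets_at_top UNIV. norm a - e < (\<Sum>\<alpha>\<in>F. norm (l1coeff a \<alpha>))"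
    unfolding has_sum_def using assms by (intro order_tendstoD) auto
  moreover have "\<forall>\<^sub>F F in finite_subsets_at_top UNIV. finite (F :: ('a \<Rightarrow> nat) set)"
    by (rule eventually_finite_subsets_at_top_weakI)
  ultimately have "\<forall>\<^sub>F F in finite_subsets_at_top UNIV. norm a - e < (\<Sum>\<alpha>\<in>F. norm (l1coeff a \<alpha>)) \<and> finite F"
    by eventually_elim auto
  then obtain F where F: "norm a - e < (\<Sum>\<alpha>\<in>F. norm (l1coeff a \<alpha>))" "finite F"
    using eventually_happens'[OF finite_subsets_at_top_neq_bot] by blast
  have "norm (a - l1_trunc F a) \<le> e"
  proof (rule norm_l1_le)
    fix G :: "('a \<Rightarrow> nat) set" assume "finite G"
    have "(\<Sum>\<alpha>\<in>G. norm (l1coeff (a - l1_trunc F a) \<alpha>)) = (\<Sum>\<alpha>\<in>G - F. norm (l1coeff a \<alpha>))"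
      using \<open>finite G\<close> F(2) by (intro sum.mono_neutral_cong_right) (auto simp: coeff_ops coeff_l1_trunc)
    moreover have "(\<Sum>\<alpha>\<in>G - F. norm (l1coeff a \<alpha>)) + (\<Sum>\<alpha>\<in>F. norm (l1coeff a \<alpha>)) = (\<Sum>\<alpha>\<in>G \<union> F. norm (l1coeff a \<alpha>))"
      using \<open>finite G\<close> F(2) by (subst sum.union_disjoint[symmetric]) (auto intro!: sum.cong)
    moreover have "\<dots> \<le> norm a" using \<open>finite G\<close> F(2) by (intro norm_l1_ge) auto
    ultimately show "(\<Sum>\<alpha>\<in>G. norm (l1coeff (a - l1_trunc F a) \<alpha>)) \<le> e" using F(1) by linarith
  qed
  then show ?thesis using that F(2) by blast
qed

section \<open>Point evaluations and proper ideals\<close>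

definition monom_eval :: "('n::finite \<Rightarrow> complex) \<Rightarrow> ('n \<Rightarrow> nat) \<Rightarrow> complex" where
  "monom_eval z \<alpha> = (\<Prod>i\<in>UNIV. z i ^ \<alpha> i)"

definition l1_eval :: "('n::finite \<Rightarrow> complex) \<Rightarrow> 'n l1 \<Rightarrow> complex" where
  "l1_eval z a = (\<Sum>\<^sub>\<infinity>\<alpha>. l1coeff a \<alpha> * monom_eval z \<alpha>)"

context
  fixes z :: "'n::finite \<Rightarrow> complex"
  assumes z: "\<And>i. norm (z i) \<le> 1"
begin

lemma norm_monom_eval_le: "norm (monom_eval z \<alpha>) \<le> 1"
  unfolding monom_eval_def prod_norm[symmetric] norm_power
  by (intro prod_le_1) (auto intro: power_le_one z)

lemma l1_eval_abs_summable: "abs_summ (\<lambda>\<alpha>. l1coeff a \<alpha> * monom_eval z \<alpha>)"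
  "norm (l1_eval z a) \<le> norm a"
proof -
  have *: "(\<Sum>\<alpha>\<in>F. norm (l1coeff a \<alpha> * monom_eval z \<alpha>)) \<le> norm a" if "finite F" for F
  proof -
    have "(\<Sum>\<alpha>\<in>F. norm (l1coeff a \<alpha> * monom_eval z \<alpha>)) \<le> (\<Sum>\<alpha>\<in>F. norm (l1coeff a \<alpha>) * 1)"
      unfolding norm_mult by (intro sum_mono mult_left_mono norm_monom_eval_le) auto
    also have "\<dots> \<le> norm a" using norm_l1_ge[OF that, of a] by simp
    finally show ?thesis .
  qed
  show s: "abs_summ (\<lambda>\<alpha>. l1coeff a \<alpha> * monom_eval z \<alpha>)" by (rule abs_summableI(1)[OF *])
  have "norm (l1_eval z a) \<le> (\<Sum>\<^sub>\<infinity>\<alpha>. norm (l1coeff a \<alpha> * monom_eval z \<alpha>))"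
    unfolding l1_eval_def by (rule norm_infsum_bound[OF s])
  also have "\<dots> \<le> norm a" by (rule abs_summableI(2)[OF *])
  finally show "norm (l1_eval z a) \<le> norm a" .
qed

lemma l1_eval_diff: "l1_eval z (a - b) = l1_eval z a - l1_eval z b"
proof -
  have "l1_eval z (a - b) + l1_eval z b
      = (\<Sum>\<^sub>\<infinity>\<alpha>. l1coeff (a - b) \<alpha> * monom_eval z \<alpha> + l1coeff b \<alpha> * monom_eval z \<alpha>)"
    unfolding l1_eval_def
    by (rule infsum_add[symmetric, OF abs_summable_summable[OF l1_eval_abs_summable(1)]
          abs_summable_summable[OF l1_eval_abs_summable(1)]])
  also have "\<dots> = l1_eval z a"
    unfolding l1_eval_def by (simp add: coeff_ops algebra_simps)
  finally show ?thesis by (simp add: algebra_simps)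
qed

lemma l1_eval_trunc:
  assumes "finite F"
  shows "l1_eval z (l1_trunc F a) = (\<Sum>\<alpha>\<in>F. l1coeff a \<alpha> * monom_eval z \<alpha>)"
proof -
  have "l1_eval z (l1_trunc F a) = (\<Sum>\<^sub>\<infinity>\<alpha>\<in>F. l1coeff a \<alpha> * monom_eval z \<alpha>)"
    unfolding l1_eval_def using assms
    by (intro infsum_cong_neutral) (auto simp: coeff_l1_trunc)
  then show ?thesis using assms by simp
qed

text \<open>Modulo \<open>I\<close> each polynomial is congruent to its value at \<open>z\<close>.
  Polynomials are dense and evaluation is bounded by the norm, so in the seminorm \<open>qn\<close>
  each \<open>a\<close> is indistinguishable from its value. For \<open>a \<in> I\<close> the
  seminorm is \<open>0\<close>, and \<open>qn 1 \<ge> 1\<close> forces the value to vanish.\<close>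

lemma l1_eval_ideal:
  assumes I: "ideal_set I" "1 \<notin> I" and X: "\<And>i. l1_var i - l1_const (z i) \<in> I"
    and a: "a \<in> I"
  shows "l1_eval z a = 0"
proof -
  interpret I: complex_banach_ideal l1_const I by unfold_locales (rule I)
  have mult: "a * b - a' * b' \<in> I" if "a - a' \<in> I" "b - b' \<in> I" for a a' b b' :: "'n l1"
  proof -
    have "a * b - a' * b' = (a - a') * b + a' * (b - b')" by (simp add: algebra_simps)
    then show ?thesis using I.idl(2)[OF I.idl(4)[OF that(1)] I.idl(3)[OF that(2)]] by simp
  qed
  have pow: "l1_var i ^ k - l1_const (z i ^ k) \<in> I" for i k
    by (induction k) (auto simp: l1.K_1 l1.K_mult I.idl(1) intro!: mult X)
  have "(\<Prod>i\<in>S. l1_var i ^ \<alpha> i) - l1_const (\<Prod>i\<in>S. z i ^ \<alpha> i) \<in> I" if "finite S" for S \<alpha>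
    using that by (induction S rule: finite_induct) (auto simp: l1.K_1 l1.K_mult I.idl(1) intro!: mult pow)
  then have mon: "l1_monom \<alpha> - l1_const (monom_eval z \<alpha>) \<in> I" for \<alpha>
    unfolding monom_eval_def l1_monom_prod[of \<alpha>] by simp
  have tr: "l1_trunc F a - l1_const (l1_eval z (l1_trunc F a)) \<in> I" if "finite F" for F
  proof -
    have "l1_trunc F a - l1_const (l1_eval z (l1_trunc F a)) =
       (\<Sum>\<alpha>\<in>F. l1_const (l1coeff a \<alpha>) * (l1_monom \<alpha> - l1_const (monom_eval z \<alpha>)))"
      unfolding l1_eval_trunc[OF that] l1.K_sum
      by (simp add: l1_trunc_def sum_subtractf right_diff_distrib l1.K_mult)
    then show ?thesis by (auto intro!: ideal_set_sum[OF I(1)] I.idl(3) mon)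
  qed
  have "norm (l1_eval z a) * I.qn 1 \<le> 0"
  proof (rule field_le_epsilon)
    fix e :: real assume "e > 0"
    then obtain F where F: "finite F" "norm (a - l1_trunc F a) \<le> e/2"
      using l1_trunc_approx[of "e/2" a] by auto
    have "norm (l1_eval z a) * I.qn 1 = I.qn (l1_const (l1_eval z a))"
      using I.qn_K[of "l1_eval z a" 1] by simp
    also have "\<dots> \<le> I.qn (l1_const (l1_eval z a - l1_eval z (l1_trunc F a))) + I.qn (l1_const (l1_eval z (l1_trunc F a)))"
      using I.qn_add[of "l1_const (l1_eval z a - l1_eval z (l1_trunc F a))" "l1_const (l1_eval z (l1_trunc F a))"]
      by (simp add: l1.K_diff)
    also have "I.qn (l1_const (l1_eval z a - l1_eval z (l1_trunc F a))) \<le> norm (l1_eval z (a - l1_trunc F a))"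
      using I.qn_le_norm[of "l1_const (l1_eval z (a - l1_trunc F a))"] by (simp add: l1_eval_diff norm_l1_const)
    also have "\<dots> \<le> e/2" using l1_eval_abs_summable(2)[of "a - l1_trunc F a"] F(2) by linarith
    also have "I.qn (l1_const (l1_eval z (l1_trunc F a))) = I.qn (l1_trunc F a)"
      using I.qn_cong[OF tr[OF F(1)]] by simp
    also have "\<dots> \<le> I.qn a + I.qn (a - l1_trunc F a)"
      using I.qn_diff[of a "a - l1_trunc F a"] by simp
    also have "\<dots> \<le> 0 + e/2" using I.qn_I[OF a] I.qn_le_norm[of "a - l1_trunc F a"] F(2) by linarith
    finally show "norm (l1_eval z a) * I.qn 1 \<le> 0 + e" by simp
  qed
  moreover have "norm (l1_eval z a) * 1 \<le> norm (l1_eval z a) * I.qn 1"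
    by (intro mult_left_mono I.qn_1_ge I) auto
  ultimately have "norm (l1_eval z a) \<le> 0" by linarith
  then show ?thesis by simp
qed

end

lemma subset_adjoin: "b \<in> I \<Longrightarrow> b \<in> {b + a * x |a b. b \<in> (I :: 'a::comm_ring_1 set)}"
proof -
  assume "b \<in> I"
  moreover have "b = b + 0 * x" by simp
  ultimately show ?thesis by blast
qed

lemma mem_adjoin: "0 \<in> I \<Longrightarrow> x \<in> {b + a * x |a b. b \<in> (I :: 'a::comm_ring_1 set)}"
proof -
  assume "0 \<in> I"
  moreover have "x = 0 + 1 * x" by simp
  ultimately show ?thesis by blast
qed

text \<open>The elements \<open>l1_var i - l1_const c\<close> are adjoined one at a time; induction
  over the finitely many variables takes the place of a maximal ideal. A value with
  \<open>norm (z i) > 1\<close> is excluded because \<open>l1_var i\<close> has norm at most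
  \<open>1\<close>, so that \<open>l1_var i - l1_const (z i)\<close> would be a unit.\<close>

lemma exists_common_eigenvalue:
  fixes I :: "'n::finite l1 set"
  assumes "ideal_set I" "1 \<notin> I"
  obtains I' z where "ideal_set I'" "1 \<notin> I'" "I \<subseteq> I'" "\<And>i. l1_var i - l1_const (z i) \<in> I'"
    "\<And>i. norm (z i) \<le> 1"
proof -
  have "\<exists>I'. ideal_set I' \<and> 1 \<notin> I' \<and> I \<subseteq> I' \<and> (\<forall>i\<in>S. \<exists>c. l1_var i - l1_const c \<in> I')"
    if "finite S" for S :: "'n set"
    using that
  proof (induction S rule: finite_induct)
    case empty then show ?case using assms by blast
  next
    case (insert i S)
    then obtain I' where I': "ideal_set I'" "1 \<notin> I'" "I \<subseteq> I'"
      "\<forall>i\<in>S. \<exists>c. l1_var i - l1_const c \<in> I'" by blast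
    interpret I': complex_banach_ideal l1_const I' by unfold_locales (rule I')
    obtain c where c: "1 \<notin> {b + a * (l1_var i - l1_const c) |a b. b \<in> I'}"
      by (rule I'.exists_eigenvalue[OF I'(2), of "l1_var i"]) (use that in blast)
    define J where "J = {b + a * (l1_var i - l1_const c) |a b. b \<in> I'}"
    have J: "ideal_set J" "1 \<notin> J" unfolding J_def by (rule ideal_set_adjoin[OF I'(1)], rule c)
    have sub: "I' \<subseteq> J" unfolding J_def using subset_adjoin by blast
    have "l1_var i - l1_const c \<in> J" unfolding J_def by (rule mem_adjoin[OF I'.idl(1)])
    moreover have "\<forall>j\<in>S. \<exists>c. l1_var j - l1_const c \<in> J" using I'(4) sub by blast
    ultimately have "\<forall>j\<in>insert i S. \<exists>c. l1_var j - l1_const c \<in> J" by blast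
    then show ?case using J sub I'(3) by blast
  qed
  from this[of UNIV] obtain I' z where I': "ideal_set I'" "1 \<notin> I'" "I \<subseteq> I'"
    and z: "\<And>i. l1_var i - l1_const (z i) \<in> I'" by (metis UNIV_I finite_code)
  have "norm (z i) \<le> 1" for i
  proof (rule ccontr)
    assume gt: "\<not> norm (z i) \<le> 1"
    then have nz: "z i \<noteq> 0" by auto
    let ?x = "l1_var i :: 'n l1"
    have "norm ?x \<le> 1"
    proof (rule norm_l1_le)
      fix F :: "('n \<Rightarrow> nat) set" assume "finite F"
      have "(\<Sum>\<beta>\<in>F. norm (l1coeff ?x \<beta>)) = (\<Sum>\<beta>\<in>F. if \<beta> = unitv i 1 then 1 else 0)"
        by (intro sum.cong) (auto simp: mmonom_def l1_var_def)
      then show "(\<Sum>\<beta>\<in>F. norm (l1coeff ?x \<beta>)) \<le> 1" using \<open>finite F\<close> by simp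
    qed
    then have "norm (l1_const (1 / z i) * ?x) \<le> (1 / norm (z i)) * 1"
      by (intro order_trans[OF norm_mult_ineq] mult_mono) (auto simp: norm_l1_const norm_divide)
    also have "\<dots> < 1" using gt nz by (simp add: divide_less_eq)
    finally obtain y where y: "(1 - l1_const (1 / z i) * ?x) * y = 1" by (rule l1.one_minus_invertible)
    have "l1_const (1 / z i) * l1_const (z i) = (1 :: 'n l1)"
      using nz by (simp add: l1.K_mult[symmetric] l1.K_1)
    then have "(- l1_const (1 / z i) * y) * (?x - l1_const (z i)) = (1 - l1_const (1 / z i) * ?x) * y"
      by (simp add: algebra_simps)
    then have "(- l1_const (1 / z i) * y) * (?x - l1_const (z i)) = 1" using y by simp
    then show False using ideal_setD(3)[OF I'(1) z[of i]] I'(2) by metis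
  qed
  then show ?thesis using that I' z by blast
qed

text \<open>If \<open>1 - u z_i\<close> were not invertible modulo \<open>I\<close>, then
  \<open>I\<close> together with it would generate a proper ideal, with a common zero
  \<open>z\<close>. By \<open>zeros\<close> this is the origin, so \<open>z_i\<close> lies in a
  proper ideal that also contains \<open>1 - u z_i\<close>, which is absurd.\<close>

theorem qn_var_power_tendsto_0:
  fixes I :: "'n::finite l1 set"
  assumes I: "ideal_set I"
    and zeros: "\<And>z. (\<And>i. norm (z i) \<le> 1) \<Longrightarrow> (\<And>a. a \<in> I \<Longrightarrow> l1_eval z a = 0) \<Longrightarrow> z = (\<lambda>_. 0)"
  shows "(\<lambda>M. infdist (l1_var i ^ M) I) \<longlonglongrightarrow> 0"
proof -
  interpret I: complex_banach_ideal l1_const I by unfold_locales (rule I)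
  have inv: "\<exists>y. y * (1 - l1_const u * l1_var i) - 1 \<in> I" for u
  proof (rule ccontr)
    assume no: "\<nexists>y. y * (1 - l1_const u * l1_var i) - 1 \<in> I"
    let ?w = "1 - l1_const u * l1_var i"
    let ?J = "{b + a * ?w |a b. b \<in> I}"
    have "1 \<notin> ?J"
    proof
      assume "1 \<in> ?J"
      then obtain a b where "1 = b + a * ?w" "b \<in> I" by auto
      then have "a * ?w - 1 = - b" by (simp add: algebra_simps)
      then show False using no I.idl(5)[OF \<open>b \<in> I\<close>] by metis
    qed
    then obtain I' z where I': "ideal_set I'" "1 \<notin> I'" "?J \<subseteq> I'"
      and z: "\<And>i. l1_var i - l1_const (z i) \<in> I'" "\<And>i. norm (z i) \<le> 1"
      using exists_common_eigenvalue[OF ideal_set_adjoin[OF I, of ?w]] by blast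
    note I'D = ideal_setD[OF I'(1)]
    have sub: "I \<subseteq> I'"
    proof
      fix b assume "b \<in> I"
      then have "b \<in> ?J" by (rule subset_adjoin)
      then show "b \<in> I'" using I'(3) by blast
    qed
    have "l1_eval z a = 0" if "a \<in> I" for a
      using l1_eval_ideal[OF z(2) I'(1,2) z(1) subsetD[OF sub that]] .
    then have "z = (\<lambda>_. 0)" by (rule zeros[OF z(2)])
    then have "z i = 0" by simp
    then have "l1_var i \<in> I'" using z(1)[of i] by (simp add: l1.K_0)
    then have "l1_const u * l1_var i \<in> I'" by (rule I'D(3))
    moreover have "?w \<in> ?J" by (rule mem_adjoin[OF I.idl(1)])
    then have "?w \<in> I'" using I'(3) by blast
    ultimately have "?w + l1_const u * l1_var i \<in> I'" by (intro I'D(2))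
    then show False using I'(2) by simp
  qed
  show ?thesis using I.qn_power_tendsto[OF inv, of 1] by (simp add: I.qn_def)
qed

subsection \<open>Division\<close>

definition ebox :: "nat \<Rightarrow> ('n \<Rightarrow> nat) set" where "ebox M = {\<alpha>. \<forall>i. \<alpha> i < M}"

definition box_part :: "nat \<Rightarrow> 'n mseries \<Rightarrow> 'n mseries" where
  "box_part M h = (\<lambda>\<alpha>. if \<alpha> \<in> ebox M then h \<alpha> else 0)"

text \<open>Every exponent outside the box is charged to one of the variables whose exponent is too big.\<close>

definition quot_part :: "nat \<Rightarrow> 'n \<Rightarrow> 'n mseries \<Rightarrow> 'n mseries" where
  "quot_part M i h = (\<lambda>\<beta>. if (SOME j. M \<le> (\<beta> + unitv i M) j) = i then h (\<beta> + unitv i M) else 0)"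

lemma finite_ebox: "finite (ebox M :: ('n::finite \<Rightarrow> nat) set)"
proof -
  have "ebox M \<subseteq> {\<beta>. \<beta> \<le> (\<lambda>_::'n. M)}" by (auto simp: ebox_def le_fun_def less_imp_le)
  then show ?thesis by (rule finite_subset) (rule finite_fun_le)
qed

lemma box_decomposition:
  "h = (\<lambda>\<alpha>. box_part M h \<alpha> + (\<Sum>i\<in>UNIV. mmul (mmonom (unitv i M)) (quot_part M i h) \<alpha>))"
  for h :: "'n::finite mseries"
proof
  fix \<alpha> :: "'n \<Rightarrow> nat"
  have eq: "mmul (mmonom (unitv i M)) (quot_part M i h) \<alpha> =
      (if M \<le> \<alpha> i \<and> (SOME j. M \<le> \<alpha> j) = i then h \<alpha> else 0)" for i
  proof -
    have "\<alpha> - unitv i M + unitv i M = \<alpha>" if "M \<le> \<alpha> i"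
      using that by (auto simp: fun_eq_iff unitv_def)
    then have "quot_part M i h (\<alpha> - unitv i M) = (if (SOME j. M \<le> \<alpha> j) = i then h \<alpha> else 0)"
      if "M \<le> \<alpha> i"
      unfolding quot_part_def using that by (simp only:)
    then show ?thesis by (simp add: mmul_monom)
  qed
  show "h \<alpha> = box_part M h \<alpha> + (\<Sum>i\<in>UNIV. mmul (mmonom (unitv i M)) (quot_part M i h) \<alpha>)"
  proof (cases "\<alpha> \<in> ebox M")
    case True
    then have "\<not> M \<le> \<alpha> i" for i by (simp add: ebox_def not_le)
    then show ?thesis unfolding eq using True by (simp add: box_part_def)
  next
    case False
    define j where "j = (SOME j. M \<le> \<alpha> j)"
    have "\<exists>j. M \<le> \<alpha> j" using False by (auto simp: ebox_def not_less)
    then have "M \<le> \<alpha> j" unfolding j_def by (rule someI_ex)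
    have "(\<Sum>i\<in>UNIV. if M \<le> \<alpha> i \<and> j = i then h \<alpha> else 0) = (\<Sum>i\<in>UNIV. if j = i then h \<alpha> else 0)"
      using \<open>M \<le> \<alpha> j\<close> by (intro sum.cong) auto
    then show ?thesis unfolding eq j_def[symmetric] using False by (simp add: box_part_def)
  qed
qed

lemma quot_part_abs_sum_le:
  assumes "finite F"
  obtains G where "finite G" "\<And>h. (\<Sum>\<beta>\<in>F. norm (quot_part M i h \<beta>)) \<le> (\<Sum>\<beta>\<in>G. norm (h \<beta>))"
proof
  show "finite ((\<lambda>\<beta>. \<beta> + unitv i M) ` F)" using assms by simp
  fix h :: "'a mseries"
  have "(\<Sum>\<beta>\<in>F. norm (quot_part M i h \<beta>)) \<le> (\<Sum>\<beta>\<in>F. norm (h (\<beta> + unitv i M)))"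
    by (intro sum_mono) (auto simp: quot_part_def)
  also have "\<dots> = (\<Sum>\<beta>\<in>(\<lambda>\<beta>. \<beta> + unitv i M) ` F. norm (h \<beta>))"
    by (subst sum.reindex) (auto simp: inj_on_def)
  finally show "(\<Sum>\<beta>\<in>F. norm (quot_part M i h \<beta>)) \<le> (\<Sum>\<beta>\<in>(\<lambda>\<beta>. \<beta> + unitv i M) ` F. norm (h \<beta>))" .
qed

definition l1_quot_part :: "nat \<Rightarrow> 'n::finite \<Rightarrow> 'n l1 \<Rightarrow> 'n l1" where
  "l1_quot_part M i h = Abs_l1 (quot_part M i (l1coeff h))"

lemma l1_quot_part:
  fixes h :: "'n::finite l1"
  shows "l1coeff (l1_quot_part M i h) = quot_part M i (l1coeff h)" "norm (l1_quot_part M i h) \<le> norm h"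
proof -
  have *: "(\<Sum>\<beta>\<in>F. norm (quot_part M i (l1coeff h) \<beta>)) \<le> norm h" if F: "finite F" for F
  proof -
    obtain G where "finite G" "(\<Sum>\<beta>\<in>F. norm (quot_part M i (l1coeff h) \<beta>)) \<le> (\<Sum>\<beta>\<in>G. norm (l1coeff h \<beta>))"
      using quot_part_abs_sum_le[OF F, of M i] by metis
    then show ?thesis using norm_l1_ge[of G h] by linarith
  qed
  show c: "l1coeff (l1_quot_part M i h) = quot_part M i (l1coeff h)"
    unfolding l1_quot_part_def using abs_summableI(1)[OF *] by (intro Abs_l1_inverse) simp
  show "norm (l1_quot_part M i h) \<le> norm h" by (rule norm_l1_le) (simp add: c *)
qed

lemma l1_quot_part_diff: "l1_quot_part M i (a - b) = l1_quot_part M i a - l1_quot_part M i b"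
  by (rule l1_eqI) (simp add: l1_quot_part coeff_ops quot_part_def)

text \<open>Division in which small elements \<open>E i\<close> stand for the powers
  \<open>z_i^M\<close>. Let \<open>g_i\<close> be the quotient parts of \<open>g\<close>. If
  \<open>g = h + \<Sum> E i * g_i\<close>, then \<open>h\<close> minus the box part of
  \<open>g\<close> equals \<open>\<Sum> (z_i^M - E i) * g_i\<close>, an element of
  \<open>I\<close>.\<close>

theorem l1_division:
  fixes I :: "'n::finite l1 set"
  assumes I: "ideal_set I" and lim: "\<And>i. (\<lambda>M. infdist (l1_var i ^ M) I) \<longlonglongrightarrow> 0"
  obtains M where "\<And>h. \<exists>p. l1coeff p = box_part M (l1coeff p) \<and> h - p \<in> I"
proof -
  interpret I: complex_banach_ideal l1_const I by unfold_locales (rule I)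
  \<comment> \<open>With \<open>CARD('n)\<close> summands, this bound on the norms of the
    \<open>E i\<close> gives the contraction factor \<open>1/2\<close>.\<close>
  define d where "d = 1 / (2 * real CARD('n))"
  have "d > 0" by (simp add: d_def)
  have "\<forall>\<^sub>F M in sequentially. \<forall>i. infdist (l1_var i ^ M) I < d"
    using order_tendstoD(2)[OF lim \<open>d > 0\<close>] by (simp add: eventually_all_finite)
  then obtain M where "\<And>i. I.qn (l1_var i ^ M) < d"
    unfolding I.qn_def using eventually_happens'[OF sequentially_bot] by blast
  then have "\<exists>E. l1_var i ^ M - E \<in> I \<and> norm E < d" for i
    using I.qn_approx[of "l1_var i ^ M" d] by (metis cancel_comm_monoid_add_class.diff_cancel diff_diff_eq2 add_diff_cancel_left')
  then obtain E where E: "\<And>i. l1_var i ^ M - E i \<in> I" "\<And>i. norm (E i) < d" by metis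
  have "\<exists>p. l1coeff p = box_part M (l1coeff p) \<and> h - p \<in> I" for h
  proof -
    let ?f = "\<lambda>g. h + (\<Sum>i\<in>UNIV. E i * l1_quot_part M i g)"
    have "\<exists>!g. ?f g = g"
    proof (rule banach_fix_type)
      show "\<forall>a b. dist (?f a) (?f b) \<le> 1/2 * dist a b"
      proof (intro allI)
        fix a b
        have "dist (?f a) (?f b) = norm (\<Sum>i\<in>UNIV. E i * l1_quot_part M i (a - b))"
          by (simp add: dist_norm l1_quot_part_diff right_diff_distrib sum_subtractf)
        also have "\<dots> \<le> (\<Sum>i\<in>(UNIV::'n set). d * norm (a - b))"
          using E(2) l1_quot_part(2) \<open>d > 0\<close>
          by (intro sum_norm_le order_trans[OF norm_mult_ineq] mult_mono) (auto intro: less_imp_le)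
        also have "\<dots> = 1/2 * dist a b" by (simp add: d_def dist_norm)
        finally show "dist (?f a) (?f b) \<le> 1/2 * dist a b" .
      qed
    qed auto
    then obtain g where g: "?f g = g" by blast
    define p where "p = g - (\<Sum>i\<in>UNIV. l1_var i ^ M * l1_quot_part M i g)"
    have p: "l1coeff p = box_part M (l1coeff g)"
    proof
      fix \<alpha>
      show "l1coeff p \<alpha> = box_part M (l1coeff g) \<alpha>"
        using fun_cong[OF box_decomposition[of "l1coeff g" M], of \<alpha>]
        by (simp add: p_def coeff_ops coeff_sum l1_monom_power l1_quot_part)
    qed
    have "h - p = (\<Sum>i\<in>UNIV. (l1_var i ^ M - E i) * l1_quot_part M i g)"
    proof -
      have "h = g - (\<Sum>i\<in>UNIV. E i * l1_quot_part M i g)" using g by (simp add: algebra_simps)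
      then show ?thesis by (simp add: p_def left_diff_distrib sum_subtractf)
    qed
    then have "h - p \<in> I" using E(1) by (auto intro!: ideal_set_sum[OF I] I.idl(4))
    moreover have "l1coeff p = box_part M (l1coeff p)" unfolding p by (rule ext) (simp add: box_part_def)
    ultimately show ?thesis by blast
  qed
  then show ?thesis by (rule that)
qed

section \<open>The ring of convergent power series\<close>

definition mdeg :: "('n::finite \<Rightarrow> nat) \<Rightarrow> nat" where "mdeg \<alpha> = (\<Sum>i\<in>UNIV. \<alpha> i)"

lemma mdeg_add: "mdeg (\<alpha> + \<beta>) = mdeg \<alpha> + mdeg \<beta>"
  by (simp add: mdeg_def sum.distrib)

lemma mdeg_unitv: "mdeg (unitv i k) = k" for i :: "'n::finite"
  by (simp add: mdeg_def unitv_def)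

lemma mdeg_0_iff: "mdeg \<alpha> = 0 \<longleftrightarrow> \<alpha> = 0"
  by (auto simp: mdeg_def fun_eq_iff)

text \<open>The substitution of \<open>r * z\<close> for \<open>z\<close>: a series summable on the
  polydisc of radius \<open>r\<close> becomes summable on the unit polydisc, where \<open>l1\<close>
  is available.\<close>

definition rescale :: "real \<Rightarrow> 'n::finite mseries \<Rightarrow> 'n mseries" where
  "rescale r a = (\<lambda>\<alpha>. of_real (r ^ mdeg \<alpha>) * a \<alpha>)"

lemma norm_rescale: "r \<ge> 0 \<Longrightarrow> norm (rescale r a \<alpha>) = norm (a \<alpha>) * r ^ mdeg \<alpha>"
  by (simp add: rescale_def norm_mult norm_power mult.commute)

lemma convergent_iff: "convergent_mseries a \<longleftrightarrow> (\<exists>r>0. abs_summ (rescale r a))"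
  unfolding convergent_mseries_def mdeg_def[symmetric]
  by (intro ex_cong conj_cong refl) (simp add: norm_rescale less_imp_le)

lemma rescale_rescale: "rescale r (rescale s a) = rescale (r * s) a"
  by (simp add: rescale_def power_mult_distrib mult_ac)

lemma rescale_1: "rescale 1 a = a"
  by (simp add: rescale_def)

lemma rescale_mmul: "rescale r (mmul a b) = mmul (rescale r a) (rescale r b)"
proof
  fix \<alpha>
  show "rescale r (mmul a b) \<alpha> = mmul (rescale r a) (rescale r b) \<alpha>"
    unfolding rescale_def mmul_def sum_distrib_left
    by (intro sum.cong refl) (auto simp: splittings_def mdeg_add power_add)
qed

lemma rescale_add: "rescale r (a + b) = rescale r a + rescale r b"
  by (rule ext) (simp add: rescale_def algebra_simps)

lemma rescale_sum: "rescale r (\<lambda>\<alpha>. \<Sum>i\<in>A. f i \<alpha>) = (\<lambda>\<alpha>. \<Sum>i\<in>A. rescale r (f i) \<alpha>)"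
  by (rule ext) (simp add: rescale_def sum_distrib_left)

lemma abs_summ_comparison:
  fixes f :: "'a \<Rightarrow> 'b::real_normed_vector" and g :: "'a \<Rightarrow> 'c::real_normed_vector"
  assumes "abs_summ f" "\<And>x. norm (g x) \<le> norm (f x)"
  shows "abs_summ g"
proof (rule abs_summableI(1)[where C = "\<Sum>\<^sub>\<infinity>x. norm (f x)"])
  fix F :: "'a set" assume "finite F"
  then show "(\<Sum>x\<in>F. norm (g x)) \<le> (\<Sum>\<^sub>\<infinity>x. norm (f x))"
    by (intro order_trans[OF sum_mono abs_summable_finite_sum_le] assms)
qed

lemma rescale_smaller:
  assumes "abs_summ (rescale r a)" "0 \<le> s" "s \<le> r"
  shows "abs_summ (rescale s a)"
  by (rule abs_summ_comparison[OF assms(1)])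
     (use assms in \<open>auto simp: norm_rescale intro!: mult_left_mono power_mono\<close>)

lemma convergent_common_radius:
  assumes "finite A" "\<And>a. a \<in> A \<Longrightarrow> convergent_mseries a" "R > 0"
  obtains r where "r > 0" "r \<le> R" "\<And>a. a \<in> A \<Longrightarrow> abs_summ (rescale r a)"
proof -
  have "\<exists>r>0. r \<le> R \<and> (\<forall>a\<in>A. abs_summ (rescale r a))"
    using assms(1,2)
  proof (induction A rule: finite_induct)
    case empty then show ?case using assms(3) by auto
  next
    case (insert a A)
    from insert.IH insert.prems obtain r where "r > 0" "r \<le> R" "\<forall>a\<in>A. abs_summ (rescale r a)" by auto
    moreover from insert.prems[of a] obtain s where "s > 0" "abs_summ (rescale s a)"
      by (auto simp: convergent_iff)
    ultimately show ?case
      by (intro exI[of _ "min r s"]) (auto intro: rescale_smaller)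
  qed
  then show ?thesis using that by blast
qed

lemma convergent_add:
  assumes "convergent_mseries a" "convergent_mseries b"
  shows "convergent_mseries (a + b)"
proof -
  obtain r where "r > 0" "\<And>c. c \<in> {a, b} \<Longrightarrow> abs_summ (rescale r c)"
    using convergent_common_radius[of "{a, b}" 1] assms by auto
  then show ?thesis unfolding convergent_iff rescale_add
    using abs_summ_add[of "rescale r a" "rescale r b"] by (auto simp: plus_fun_def)
qed

lemma convergent_mmul:
  assumes "convergent_mseries a" "convergent_mseries b"
  shows "convergent_mseries (mmul a b)"
proof -
  obtain r where "r > 0" "\<And>c. c \<in> {a, b} \<Longrightarrow> abs_summ (rescale r c)"
    using convergent_common_radius[of "{a, b}" 1] assms by auto
  then show ?thesis unfolding convergent_iff
    using abs_summable_mmul(1)[of "rescale r a" "rescale r b"] by (auto simp: rescale_mmul)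
qed

lemma convergent_finite_support:
  assumes "finite {\<alpha>. a \<alpha> \<noteq> 0}" shows "convergent_mseries a"
  unfolding convergent_iff
proof (intro exI conjI)
  show "abs_summ (rescale 1 a)"
    unfolding rescale_1 by (rule finite_nonzero_values_imp_summable_on) (use assms in simp)
qed simp

lemma convergent_monom [simp]: "convergent_mseries (mmonom \<alpha>)"
  by (rule convergent_finite_support) (simp add: mmonom_def)

lemma convergent_const [simp]: "convergent_mseries (mseries_const c)"
  by (rule convergent_finite_support, rule finite_subset[of _ "{\<lambda>_. 0}"]) (auto simp: mseries_const_def)

lemma convergent_scale: "convergent_mseries a \<Longrightarrow> convergent_mseries (\<lambda>\<alpha>. c * a \<alpha>)"
  using convergent_mmul[OF convergent_const, of a c] by (simp add: mmul_const)

lemma convergent_uminus: "convergent_mseries a \<Longrightarrow> convergent_mseries (- a)"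
  using convergent_scale[of a "-1"] by (simp add: fun_Compl_def)

lemma convergent_quot_part:
  assumes "convergent_mseries h" shows "convergent_mseries (quot_part M i h)"
proof -
  obtain r where r: "r > 0" "abs_summ (rescale r h)" using assms by (auto simp: convergent_iff)
  have eq: "norm (rescale r (quot_part M i h) \<beta>) = norm (quot_part M i (rescale r h) \<beta>) / r ^ M" for \<beta>
    using r(1) by (auto simp: quot_part_def rescale_def norm_mult norm_power mdeg_add mdeg_unitv power_add)
  have "abs_summ (rescale r (quot_part M i h))"
  proof (rule abs_summableI(1)[where C = "(\<Sum>\<^sub>\<infinity>x. norm (rescale r h x)) / r ^ M"])
    fix F :: "('a \<Rightarrow> nat) set" assume F: "finite F"
    obtain G where G: "finite G"
      "(\<Sum>\<beta>\<in>F. norm (quot_part M i (rescale r h) \<beta>)) \<le> (\<Sum>\<beta>\<in>G. norm (rescale r h \<beta>))"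
      using quot_part_abs_sum_le[OF F, of M i] by metis
    have "(\<Sum>\<beta>\<in>G. norm (rescale r h \<beta>)) \<le> (\<Sum>\<^sub>\<infinity>x. norm (rescale r h x))"
      by (rule abs_summable_finite_sum_le[OF r(2) G(1)])
    then show "(\<Sum>\<beta>\<in>F. norm (rescale r (quot_part M i h) \<beta>)) \<le> (\<Sum>\<^sub>\<infinity>x. norm (rescale r h x)) / r ^ M"
      unfolding eq sum_divide_distrib[symmetric] using G(2) r(1) by (intro divide_right_mono) auto
  qed
  then show ?thesis using r(1) by (auto simp: convergent_iff)
qed

text \<open>Halving the radius absorbs the factor \<open>\<alpha> i + 1\<close>, which is at most
  \<open>2 ^ mdeg \<alpha>\<close>.\<close>

lemma convergent_partial:
  assumes "convergent_mseries a" shows "convergent_mseries (mseries_partial i a)"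
proof -
  obtain r where r: "r > 0" "abs_summ (rescale r a)" using assms by (auto simp: convergent_iff)
  have upd: "\<alpha>(i := Suc (\<alpha> i)) = \<alpha> + unitv i 1" for \<alpha> by (auto simp: unitv_def)
  have le: "norm (rescale (r/2) (mseries_partial i a) \<alpha>) \<le> norm (rescale r a (\<alpha> + unitv i 1)) / r" for \<alpha>
  proof -
    have "\<alpha> i \<le> mdeg \<alpha>" unfolding mdeg_def by (rule member_le_sum) auto
    moreover have "Suc (mdeg \<alpha>) \<le> 2 ^ mdeg \<alpha>" by (rule Suc_leI) simp
    ultimately have "real (Suc (\<alpha> i)) \<le> real (2 ^ mdeg \<alpha>)" by (intro of_nat_mono) linarith
    then have "real (Suc (\<alpha> i)) * norm (a (\<alpha> + unitv i 1)) * (r / 2) ^ mdeg \<alpha>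
        \<le> 2 ^ mdeg \<alpha> * norm (a (\<alpha> + unitv i 1)) * (r / 2) ^ mdeg \<alpha>"
      using r(1) by (intro mult_right_mono) auto
    also have "\<dots> = norm (a (\<alpha> + unitv i 1)) * r ^ mdeg \<alpha>"
      by (simp add: power_divide)
    finally show ?thesis
      using r(1) unfolding mseries_partial_def upd
      by (simp add: norm_rescale norm_mult mdeg_add mdeg_unitv del: of_nat_Suc)
  qed
  have "abs_summ (rescale (r/2) (mseries_partial i a))"
  proof (rule abs_summableI(1)[where C = "(\<Sum>\<^sub>\<infinity>x. norm (rescale r a x)) / r"])
    fix F :: "('a \<Rightarrow> nat) set" assume F: "finite F"
    have "(\<Sum>\<alpha>\<in>F. norm (rescale (r/2) (mseries_partial i a) \<alpha>)) \<le> (\<Sum>\<alpha>\<in>F. norm (rescale r a (\<alpha> + unitv i 1)) / r)"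
      by (intro sum_mono le)
    also have "\<dots> = (\<Sum>\<alpha>\<in>(\<lambda>\<alpha>. \<alpha> + unitv i 1) ` F. norm (rescale r a \<alpha>)) / r"
      unfolding sum_divide_distrib by (subst sum.reindex) (auto simp: inj_on_def)
    also have "\<dots> \<le> (\<Sum>\<^sub>\<infinity>x. norm (rescale r a x)) / r"
      using r F by (intro divide_right_mono abs_summable_finite_sum_le) auto
    finally show "(\<Sum>\<alpha>\<in>F. norm (rescale (r/2) (mseries_partial i a) \<alpha>)) \<le> (\<Sum>\<^sub>\<infinity>x. norm (rescale r a x)) / r" .
  qed
  then show ?thesis using r(1) by (auto simp: convergent_iff intro: exI[of _ "r/2"])
qed

lemma conv_series_simps:
  "carrier conv_series = {a. convergent_mseries a}"
  "a \<otimes>\<^bsub>conv_series\<^esub> b = mmul a b"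
  "\<one>\<^bsub>conv_series\<^esub> = mseries_const 1"
  "\<zero>\<^bsub>conv_series\<^esub> = 0"
  "a \<oplus>\<^bsub>conv_series\<^esub> b = a + b"
  by (simp_all add: conv_series_def mmul_eq zero_fun_def plus_fun_def)

lemma convergent_0 [simp]: "convergent_mseries 0"
  by (rule convergent_finite_support) simp

lemma cring_conv_series: "cring (conv_series :: 'n::finite mseries ring)"
proof (rule cringI)
  show "abelian_group (conv_series :: 'n mseries ring)"
    by (rule abelian_groupI)
       (auto simp: conv_series_simps convergent_add add.assoc add.commute
             intro!: bexI[where x = "- x" for x] convergent_uminus)
  show "comm_monoid (conv_series :: 'n mseries ring)"
    by (rule comm_monoidI)
       (auto simp: conv_series_simps convergent_mmul mmul_assoc mmul_const intro: mmul_commute)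
  show "(x \<oplus>\<^bsub>conv_series\<^esub> y) \<otimes>\<^bsub>conv_series\<^esub> z =
      x \<otimes>\<^bsub>conv_series\<^esub> z \<oplus>\<^bsub>conv_series\<^esub> y \<otimes>\<^bsub>conv_series\<^esub> z" for x y z :: "'n mseries"
    by (simp add: conv_series_simps mmul_add_left)
qed

interpretation conv: cring "conv_series :: 'n::finite mseries ring"
  by (rule cring_conv_series)

lemma conv_a_inv: "convergent_mseries a \<Longrightarrow> \<ominus>\<^bsub>conv_series\<^esub> a = - a"
  by (rule sym, rule conv.sum_zero_eq_neg) (auto simp: conv_series_simps convergent_uminus)

text \<open>Series, coordinate vectors and elements of the monoid algebra are all complex-valued
  functions; this common scalar multiplication lets one stock of linear algebra serve for all of
  them.\<close>

definition fscale :: "complex \<Rightarrow> ('i \<Rightarrow> complex) \<Rightarrow> 'i \<Rightarrow> complex" where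
  "fscale c f = (\<lambda>i. c * f i)"

interpretation fs: vector_space fscale
  by unfold_locales (auto simp: fscale_def algebra_simps)

lemma fscale_apply [simp]: "fscale c f i = c * f i" by (simp add: fscale_def)

lemma mmul_const_fscale: "mmul (mseries_const c) a = fscale c a"
  by (simp add: mmul_const fscale_def)

lemma convergent_fscale: "convergent_mseries a \<Longrightarrow> convergent_mseries (fscale c a)"
  using convergent_scale[of a c] by (simp add: fscale_def)

lemma convergent_sum: "(\<And>i. i \<in> A \<Longrightarrow> convergent_mseries (f i)) \<Longrightarrow> convergent_mseries (sum f A)"
  by (induction A rule: infinite_finite_induct) (auto intro: convergent_add)

lemma sum_fun_apply: "sum f A x = (\<Sum>i\<in>A. f i x)"
  by (induction A rule: infinite_finite_induct) auto

context
  fixes J :: "'n::finite mseries set"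
  assumes J: "ideal J conv_series"
begin

lemma conv_ideal_convergent: "x \<in> J \<Longrightarrow> convergent_mseries x"
  using ideal.Icarr[OF J] by (auto simp: conv_series_simps)

lemma conv_ideal_0: "0 \<in> J"
  using additive_subgroup.zero_closed[OF ideal.axioms(1)[OF J]] by (simp add: conv_series_simps)

lemma conv_ideal_add: "x \<in> J \<Longrightarrow> y \<in> J \<Longrightarrow> x + y \<in> J"
  using additive_subgroup.a_closed[OF ideal.axioms(1)[OF J]] by (simp add: conv_series_simps)

lemma conv_ideal_mult: "x \<in> J \<Longrightarrow> convergent_mseries a \<Longrightarrow> mmul a x \<in> J"
  using ideal.I_l_closed[OF J] by (simp add: conv_series_simps)

lemma conv_ideal_scale: "x \<in> J \<Longrightarrow> fscale c x \<in> J"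
  using conv_ideal_mult[of x "mseries_const c"] by (simp add: mmul_const_fscale)

lemma conv_ideal_subspace: "fs.subspace J"
  by (intro fs.subspaceI conv_ideal_0 conv_ideal_add conv_ideal_scale)

lemmas conv_ideal_diff = fs.subspace_diff[OF conv_ideal_subspace]
lemmas conv_ideal_sum = fs.subspace_sum[OF conv_ideal_subspace]

end

text \<open>On a small polydisc \<open>a\<close> is at distance less than \<open>1\<close> from its
  constant term: shrinking the radius by the factor \<open>t\<close> multiplies each nonconstant
  coefficient by at most \<open>t\<close>, while the constant one stays \<open>1\<close>.\<close>

lemma conv_unit:
  assumes "convergent_mseries a" "a 0 = 1"
  obtains b where "convergent_mseries b" "mmul a b = mseries_const 1"
proof -
  obtain r where r: "r > 0" "abs_summ (rescale r a)" using assms by (auto simp: convergent_iff)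
  define C where "C = (\<Sum>\<^sub>\<infinity>x. norm (rescale r a x))"
  have "C \<ge> 0" unfolding C_def by (intro infsum_nonneg) auto
  define t where "t = 1 / (C + 2)"
  have t: "0 < t" "t \<le> 1" "t * C < 1" using \<open>C \<ge> 0\<close> by (auto simp: t_def field_simps)
  have s: "abs_summ (rescale (t * r) a)"
    using t r by (intro rescale_smaller[OF r(2)]) (auto simp: mult_le_cancel_right1)
  define A where "A = Abs_l1 (rescale (t * r) a)"
  have A: "l1coeff A = rescale (t * r) a" unfolding A_def using s by (intro Abs_l1_inverse) simp
  have "norm (1 - A) \<le> t * C"
  proof (rule norm_l1_le)
    fix F :: "('a \<Rightarrow> nat) set" assume "finite F"
    have "(\<Sum>\<alpha>\<in>F. norm (l1coeff (1 - A) \<alpha>)) \<le> (\<Sum>\<alpha>\<in>F. t * norm (rescale r a \<alpha>))"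
    proof (rule sum_mono)
      fix \<alpha>
      show "norm (l1coeff (1 - A) \<alpha>) \<le> t * norm (rescale r a \<alpha>)"
      proof (cases "\<alpha> = 0")
        case True
        then have "mdeg \<alpha> = 0" by (simp add: mdeg_0_iff)
        then have "l1coeff (1 - A) \<alpha> = 0"
          using True assms(2) by (simp add: coeff_ops A mmonom_def rescale_def)
        then show ?thesis using t by simp
      next
        case False
        then obtain k where k: "mdeg \<alpha> = Suc k" using mdeg_0_iff[of \<alpha>] not0_implies_Suc by blast
        have "t ^ mdeg \<alpha> \<le> t" unfolding k using t by (simp add: mult_left_le power_le_one)
        then have "norm (a \<alpha>) * (t ^ mdeg \<alpha> * r ^ mdeg \<alpha>) \<le> norm (a \<alpha>) * (t * r ^ mdeg \<alpha>)"
          using r(1) by (intro mult_left_mono mult_right_mono) auto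
        then show ?thesis using False t r
          by (simp add: coeff_ops A mmonom_def norm_rescale power_mult_distrib mult_ac)
      qed
    qed
    also have "\<dots> \<le> t * C"
      unfolding sum_distrib_left[symmetric] C_def using \<open>finite F\<close> t r
      by (intro mult_left_mono abs_summable_finite_sum_le) auto
    finally show "(\<Sum>\<alpha>\<in>F. norm (l1coeff (1 - A) \<alpha>)) \<le> t * C" .
  qed
  then have "norm (1 - A) < 1" using t(3) by linarith
  from l1.one_minus_invertible[OF this] obtain y where y: "A * y = 1" by auto
  define b where "b = rescale (1 / (t * r)) (l1coeff y)"
  have tr: "t * r \<noteq> 0" "t * r > 0" using t r by auto
  have b: "rescale (t * r) b = l1coeff y" unfolding b_def rescale_rescale using tr by (simp add: rescale_1)
  then have conv: "convergent_mseries b"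
    unfolding convergent_iff using tr coeff_summable[of y] by (intro exI[of _ "t * r"]) simp
  have "rescale (t * r) (mmul a b) = l1coeff (A * y)" by (simp add: rescale_mmul b A coeff_ops)
  also have "\<dots> = mseries_const 1" unfolding y by (simp add: coeff_ops mseries_const_eq)
  finally have "rescale (1 / (t * r)) (rescale (t * r) (mmul a b)) = rescale (1 / (t * r)) (mseries_const 1)" by simp
  also have "rescale (1 / (t * r)) (mseries_const 1) = mseries_const 1"
    by (rule ext) (auto simp: rescale_def mseries_const_def mdeg_def)
  finally have "mmul a b = mseries_const 1" unfolding rescale_rescale using tr by (simp add: rescale_1)
  then show ?thesis using that conv by blast
qed

section \<open>The Jacobian ideal of an isolated singularity has finite codimension\<close>

lemma jacobian_ideal_ideal:
  assumes "convergent_mseries f" shows "ideal (jacobian_ideal f) conv_series"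
  unfolding jacobian_ideal_def
  by (rule conv.genideal_ideal) (use assms in \<open>auto simp: conv_series_simps convergent_partial\<close>)

lemma partial_mem_jacobian_ideal:
  assumes "convergent_mseries f" shows "mseries_partial i f \<in> jacobian_ideal f"
proof -
  have "range (\<lambda>i. mseries_partial i f) \<subseteq> carrier conv_series"
    using assms by (auto simp: conv_series_simps convergent_partial)
  from conv.genideal_self[OF this] show ?thesis unfolding jacobian_ideal_def by blast
qed

lemma jacobian_ideal_least:
  assumes "ideal J conv_series" "\<And>i. mseries_partial i f \<in> J"
  shows "jacobian_ideal f \<subseteq> J"
  unfolding jacobian_ideal_def using assms by (intro conv.genideal_minimal) auto

lemma ideal_set_generated:
  fixes g :: "'i \<Rightarrow> 'a::comm_ring_1"
  shows "ideal_set {\<Sum>i\<in>A. q i * g i |q. True}"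
  unfolding ideal_set_def
proof (intro conjI ballI allI)
  show "0 \<in> {\<Sum>i\<in>A. q i * g i |q. True}" by (auto intro!: exI[of _ "\<lambda>_. 0"])
next
  fix x y assume "x \<in> {\<Sum>i\<in>A. q i * g i |q. True}" "y \<in> {\<Sum>i\<in>A. q i * g i |q. True}"
  then obtain q q' where "x = (\<Sum>i\<in>A. q i * g i)" "y = (\<Sum>i\<in>A. q' i * g i)" by auto
  then have "x + y = (\<Sum>i\<in>A. (q i + q' i) * g i)" by (simp add: distrib_right sum.distrib)
  then show "x + y \<in> {\<Sum>i\<in>A. q i * g i |q. True}" by (auto intro!: exI[of _ "\<lambda>i. q i + q' i"])
next
  fix x a assume "x \<in> {\<Sum>i\<in>A. q i * g i |q. True}"
  then obtain q where "x = (\<Sum>i\<in>A. q i * g i)" by auto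
  then have "a * x = (\<Sum>i\<in>A. (a * q i) * g i)" by (simp add: sum_distrib_left mult.assoc)
  then show "a * x \<in> {\<Sum>i\<in>A. q i * g i |q. True}" by (auto intro!: exI[of _ "\<lambda>i. a * q i"])
qed

lemma mseries_eval_rescale:
  assumes "abs_summ (rescale r g)"
  shows "l1_eval z (Abs_l1 (rescale r g)) = mseries_eval g (\<chi> j. of_real r * z j)"
proof -
  have "l1coeff (Abs_l1 (rescale r g)) = rescale r g" using assms by (intro Abs_l1_inverse) simp
  moreover have "rescale r g \<alpha> * monom_eval z \<alpha> = g \<alpha> * (\<Prod>i\<in>UNIV. (of_real r * z i) ^ \<alpha> i)" for \<alpha>
    by (simp add: rescale_def monom_eval_def mdeg_def power_mult_distrib prod.distrib power_sum)
  ultimately show ?thesis by (simp add: l1_eval_def mseries_eval_def)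
qed

text \<open>Transfers division from the unit polydisc to germs. On the polydisc of radius
  \<open>r\<close> the origin is the only common zero of the partial derivatives. The multipliers
  found in \<open>l1\<close> scale back to series that converge there, so the difference
  \<open>h - p\<close> lies in the Jacobian ideal of the ring of germs.\<close>

lemma isolated_division:
  fixes f :: "'n::finite mseries"
  assumes iso: "isolated_hypersurface_singularity f"
  obtains M r where "r > 0"
    "\<And>h. abs_summ (rescale r h) \<Longrightarrow> \<exists>p. p = box_part M p \<and> h - p \<in> jacobian_ideal f"
proof -
  have f: "convergent_mseries f" using iso by (simp add: isolated_hypersurface_singularity_def conv_series_simps)
  note J = jacobian_ideal_ideal[OF f]
  obtain d where d: "d > 0"
    "\<And>z. z \<noteq> 0 \<Longrightarrow> norm z < d \<Longrightarrow> \<exists>i. mseries_eval (mseries_partial i f) z \<noteq> 0"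
    using iso by (auto simp: isolated_hypersurface_singularity_def eventually_at dist_norm)
  \<comment> \<open>A point of the polydisc of radius \<open>R\<close> has norm at most
    \<open>CARD('n) * R = d / 2\<close>.\<close>
  define R where "R = d / (2 * real CARD('n))"
  have "R > 0" using d by (simp add: R_def)
  have "convergent_mseries a" if "a \<in> range (\<lambda>i. mseries_partial i f)" for a
    using that convergent_partial[OF f] by auto
  then obtain r where r0: "r > 0" "r \<le> R" "\<And>a. a \<in> range (\<lambda>i. mseries_partial i f) \<Longrightarrow> abs_summ (rescale r a)"
    using convergent_common_radius[OF finite_imageI[OF finite] _ \<open>R > 0\<close>] by metis
  then have r: "r > 0" "r \<le> R" "\<And>i. abs_summ (rescale r (mseries_partial i f))" by blast+
  define g where "g i = Abs_l1 (rescale r (mseries_partial i f))" for i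
  have g: "l1coeff (g i) = rescale r (mseries_partial i f)" for i
    unfolding g_def using r(3) by (intro Abs_l1_inverse) simp
  define I where "I = {\<Sum>i\<in>UNIV. q i * g i |q. True}"
  have I: "ideal_set I" unfolding I_def by (rule ideal_set_generated)
  have gI: "g i \<in> I" for i
  proof -
    have "(\<Sum>j\<in>UNIV. (if j = i then 1 else 0) * g j) = g i" by (simp add: if_distrib[of "\<lambda>x. x * _"] cong: if_cong)
    then show ?thesis unfolding I_def mem_Collect_eq by (intro exI[of _ "\<lambda>j. if j = i then 1 else 0"]) simp
  qed
  have zeros: "z = (\<lambda>_. 0)" if z: "\<And>i. norm (z i) \<le> 1" and vanish: "\<And>a. a \<in> I \<Longrightarrow> l1_eval z a = 0" for z
  proof (rule ccontr)
    assume "z \<noteq> (\<lambda>_. 0)"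
    then obtain i where "z i \<noteq> 0" by auto
    define w where "w = (\<chi> j. of_real r * z j)"
    have "w $ i \<noteq> 0" using \<open>z i \<noteq> 0\<close> r by (simp add: w_def)
    then have "w \<noteq> 0" by auto
    have "norm w \<le> (\<Sum>j\<in>UNIV. norm (w $ j))" unfolding norm_vec_def by (rule L2_set_le_sum) auto
    also have "\<dots> \<le> (\<Sum>j\<in>(UNIV::'n set). R)"
    proof (rule sum_mono)
      fix j
      have "norm (w $ j) \<le> r * 1" unfolding w_def using r z[of j] by (simp add: norm_mult mult_left_le)
      then show "norm (w $ j) \<le> R" using r by simp
    qed
    also have "\<dots> < d" using d by (simp add: R_def)
    finally obtain k where "mseries_eval (mseries_partial k f) w \<noteq> 0" using d(2)[OF \<open>w \<noteq> 0\<close>] by blast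
    moreover have "mseries_eval (mseries_partial k f) w = l1_eval z (g k)"
      unfolding g_def w_def by (rule mseries_eval_rescale[symmetric, OF r(3)])
    ultimately show False using vanish[OF gI] by simp
  qed
  obtain M where M: "\<And>h. \<exists>p. l1coeff p = box_part M (l1coeff p) \<and> h - p \<in> I"
    using l1_division[OF I qn_var_power_tendsto_0[OF I zeros]] by metis
  have "\<exists>p. p = box_part M p \<and> h - p \<in> jacobian_ideal f" if h: "abs_summ (rescale r h)" for h
  proof -
    define H where "H = Abs_l1 (rescale r h)"
    have H: "l1coeff H = rescale r h" unfolding H_def using h by (intro Abs_l1_inverse) simp
    obtain P where P: "l1coeff P = box_part M (l1coeff P)" "H - P \<in> I" using M by blast
    then obtain q where q: "H - P = (\<Sum>i\<in>UNIV. q i * g i)" by (auto simp: I_def)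
    define p where "p = rescale (1/r) (l1coeff P)"
    have inv: "rescale (1/r) (rescale r a) = a" "rescale r (rescale (1/r) a) = a" for a :: "'n mseries"
      using r by (simp_all add: rescale_rescale rescale_1)
    have "p \<alpha> = box_part M p \<alpha>" for \<alpha>
      using fun_cong[OF P(1), of \<alpha>] by (auto simp: p_def rescale_def box_part_def)
    then have "p = box_part M p" by (rule ext)
    moreover have "h - p \<in> jacobian_ideal f"
    proof -
      let ?q = "\<lambda>i. rescale (1/r) (l1coeff (q i))"
      have conv: "convergent_mseries (?q i)" for i
        unfolding convergent_iff using r coeff_summable[of "q i"] by (intro exI[of _ r]) (simp add: inv)
      have "h - p = rescale (1/r) (l1coeff (H - P))"
        by (rule ext) (simp add: p_def H coeff_ops rescale_def right_diff_distrib power_divide less_imp_neq[OF r(1), symmetric])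
      also have "l1coeff (H - P) = (\<lambda>\<alpha>. \<Sum>i\<in>UNIV. l1coeff (q i * g i) \<alpha>)"
        unfolding q by (rule ext) (simp add: coeff_sum)
      also have "rescale (1/r) \<dots> = (\<Sum>i\<in>UNIV. mmul (?q i) (mseries_partial i f))"
        by (rule ext) (simp add: rescale_sum coeff_ops rescale_mmul g inv sum_fun_apply)
      finally have eq: "h - p = (\<Sum>i\<in>UNIV. mmul (?q i) (mseries_partial i f))" .
      show ?thesis unfolding eq
        by (intro conv_ideal_sum[OF J] conv_ideal_mult[OF J] conv partial_mem_jacobian_ideal f)
    qed
    ultimately show ?thesis by blast
  qed
  with r(1) show ?thesis using that by blast
qed

lemma box_part_in_span: "box_part M p \<in> fs.span (mmonom ` ebox M)" for p :: "'n::finite mseries"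
proof -
  have "box_part M p = (\<Sum>\<alpha>\<in>ebox M. fscale (p \<alpha>) (mmonom \<alpha>))"
  proof
    fix \<beta> :: "'n \<Rightarrow> nat"
    have "(\<Sum>\<alpha>\<in>ebox M. fscale (p \<alpha>) (mmonom \<alpha>)) \<beta> = (\<Sum>\<alpha>\<in>ebox M. if \<alpha> = \<beta> then p \<beta> else 0)"
      unfolding sum_fun_apply by (intro sum.cong) (auto simp: mmonom_def)
    then show "box_part M p \<beta> = (\<Sum>\<alpha>\<in>ebox M. fscale (p \<alpha>) (mmonom \<alpha>)) \<beta>"
      by (simp add: finite_ebox box_part_def)
  qed
  moreover have "\<dots> \<in> fs.span (mmonom ` ebox M)"
    by (intro fs.span_sum fs.span_scale fs.span_base imageI)
  ultimately show ?thesis by simp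
qed

text \<open>The vectors form a family, not a set: a repetition is already a relation, and otherwise
  there are \<open>card T + 1\<close> distinct vectors in the span of \<open>T\<close>.\<close>

lemma linear_relation_of_long_family:
  assumes "finite T" "\<And>k. v k \<in> fs.span T"
  obtains c where "\<exists>k\<le>card T. c k \<noteq> 0" "(\<Sum>k\<le>card T. fscale (c k) (v k)) = 0"
proof (cases "inj_on v {..card T}")
  case False
  then obtain k l where kl: "k \<le> card T" "l \<le> card T" "k \<noteq> l" "v k = v l" by (auto simp: inj_on_def)
  let ?c = "\<lambda>j. if j = k then 1 else if j = l then - 1 else (0::complex)"
  have "(\<Sum>j\<le>card T. fscale (?c j) (v j)) = (\<Sum>j\<in>{k, l}. fscale (?c j) (v j))"
    using kl by (intro sum.mono_neutral_right) auto
  also have "\<dots> = 0" using kl by (simp add: fun_eq_iff)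
  finally show ?thesis using kl by (intro that[of ?c]) auto
next
  case True
  have "fs.dependent (v ` {..card T})"
  proof (rule ccontr)
    assume "fs.independent (v ` {..card T})"
    then have "card (v ` {..card T}) \<le> card T"
      using fs.independent_span_bound[OF assms(1)] assms(2) by blast
    then show False using card_image[OF True] by simp
  qed
  then obtain u where u: "\<exists>x\<in>v ` {..card T}. u x \<noteq> 0" "(\<Sum>x\<in>v ` {..card T}. fscale (u x) x) = 0"
    unfolding fs.dependent_finite[OF finite_imageI[OF finite_atMost]] by blast
  show ?thesis
  proof (rule that[of "\<lambda>k. u (v k)"])
    show "(\<Sum>k\<le>card T. fscale (u (v k)) (v k)) = 0" using u(2) by (simp add: sum.reindex[OF True])
  qed (use u(1) in auto)
qed

text \<open>The remainders of the powers of \<open>z_i\<close> lie in one finite-dimensional space,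
  so a nontrivial polynomial in \<open>z_i\<close> lies in the Jacobian ideal. It is the product of
  its lowest term and a unit, so a power of \<open>z_i\<close> lies there too.\<close>

lemma var_power_in_jacobian_ideal:
  fixes f :: "'n::finite mseries"
  assumes iso: "isolated_hypersurface_singularity f"
  obtains k where "mmonom (unitv i k) \<in> jacobian_ideal f"
proof -
  have f: "convergent_mseries f" using iso by (simp add: isolated_hypersurface_singularity_def conv_series_simps)
  note J = jacobian_ideal_ideal[OF f]
  obtain M r where r: "r > 0" and
    M: "\<And>h. abs_summ (rescale r h) \<Longrightarrow> \<exists>p. p = box_part M p \<and> h - p \<in> jacobian_ideal f"
    using isolated_division[OF iso] by metis
  have "abs_summ (rescale r (mmonom (unitv i k)))" for k
    by (rule finite_nonzero_values_imp_summable_on, rule finite_subset[of _ "{unitv i k}"])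
       (auto simp: rescale_def mmonom_def)
  then have "\<exists>p. p = box_part M p \<and> mmonom (unitv i k) - p \<in> jacobian_ideal f" for k by (rule M)
  then obtain p where p: "\<And>k. p k = box_part M (p k)" "\<And>k. mmonom (unitv i k) - p k \<in> jacobian_ideal f"
    by metis
  define T where "T = (mmonom ` ebox M :: 'n mseries set)"
  have "finite T" unfolding T_def by (simp add: finite_ebox)
  moreover have "p k \<in> fs.span T" for k unfolding T_def by (subst p(1)) (rule box_part_in_span)
  ultimately obtain c where c: "\<exists>k\<le>card T. c k \<noteq> 0" "(\<Sum>k\<le>card T. fscale (c k) (p k)) = 0"
    using linear_relation_of_long_family by blast
  have "(\<Sum>k\<le>card T. fscale (c k) (mmonom (unitv i k) - p k)) \<in> jacobian_ideal f"
    by (intro conv_ideal_sum[OF J] conv_ideal_scale[OF J] p(2))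
  then have rel: "(\<Sum>k\<le>card T. fscale (c k) (mmonom (unitv i k))) \<in> jacobian_ideal f"
    using c(2) by (simp add: fs.scale_right_diff_distrib sum_subtractf)
  define m where "m = (LEAST k. c k \<noteq> 0)"
  obtain k0 where k0: "k0 \<le> card T" "c k0 \<noteq> 0" using c(1) by blast
  have "c m \<noteq> 0" unfolding m_def by (rule LeastI[of "\<lambda>k. c k \<noteq> 0", OF k0(2)])
  moreover have "c k = 0" if "k < m" for k using that not_less_Least unfolding m_def by blast
  moreover have "m \<le> card T" unfolding m_def using Least_le[of "\<lambda>k. c k \<noteq> 0", OF k0(2)] k0(1) by simp
  ultimately have m: "c m \<noteq> 0" "\<And>k. k < m \<Longrightarrow> c k = 0" "m \<le> card T" by blast+
  \<comment> \<open>The relation divided by its lowest term, hence with constant term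
    \<open>1\<close>.\<close>
  define w where "w = (\<Sum>k=m..card T. fscale (c k / c m) (mmonom (unitv i (k - m))))"
  have w: "convergent_mseries w"
    unfolding w_def by (intro convergent_sum convergent_fscale convergent_monom)
  have w0: "w 0 = 1"
  proof -
    have "unitv i l = 0 \<longleftrightarrow> l = 0" for l by (auto simp: unitv_def fun_eq_iff)
    then have "w 0 = (\<Sum>k=m..card T. if k = m then 1 else 0)"
      unfolding w_def sum_fun_apply using m by (intro sum.cong) (auto simp: mmonom_def)
    then show ?thesis using m(3) by simp
  qed
  obtain b where b: "convergent_mseries b" "mmul w b = mseries_const 1" by (rule conv_unit[OF w w0])
  have "mmul (mmonom (unitv i m)) w = fscale (1 / c m) (\<Sum>k\<le>card T. fscale (c k) (mmonom (unitv i k)))"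
  proof -
    have "(\<Sum>k\<le>card T. fscale (c k) (mmonom (unitv i k))) = (\<Sum>k=m..card T. fscale (c k) (mmonom (unitv i k)))"
      using m by (intro sum.mono_neutral_right) (auto simp: not_le fun_eq_iff)
    moreover have "mmul a (sum h A) = (\<Sum>k\<in>A. mmul a (h k))" for a :: "'n mseries" and h and A :: "nat set"
      by (rule ext) (simp add: mmul_def sum_fun_apply sum_distrib_left sum.swap[of _ A])
    moreover have "mmul a (fscale x d) = fscale x (mmul a d)" for a d :: "'n mseries" and x
      by (rule ext) (simp add: mmul_def sum_distrib_left mult_ac)
    ultimately show ?thesis
      unfolding w_def
      by (simp add: mmul_monom_monom unitv_add fs.scale_sum_right)
  qed
  then have "mmul (mmonom (unitv i m)) w \<in> jacobian_ideal f" using conv_ideal_scale[OF J rel] by simp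
  then have "mmul b (mmul (mmonom (unitv i m)) w) \<in> jacobian_ideal f" using conv_ideal_mult[OF J _ b(1)] by simp
  also have "mmul b (mmul (mmonom (unitv i m)) w) = mmonom (unitv i m)"
    by (metis mmul_assoc mmul_commute b(2) mmul_const_fscale fs.scale_one)
  finally show ?thesis by (rule that)
qed

text \<open>Once true powers of the variables lie in the ideal, the remainder is just the truncation
  of \<open>h\<close>. It depends linearly on \<open>h\<close> and is available for every radius of
  convergence, whereas the division above worked at one fixed radius.\<close>

lemma box_part_mod_ideal:
  assumes J: "ideal J conv_series" and mem: "\<And>i. mmonom (unitv i N) \<in> J" and h: "convergent_mseries h"
  shows "h - box_part N h \<in> J"
proof -
  have "h - box_part N h = (\<Sum>i\<in>UNIV. mmul (quot_part N i h) (mmonom (unitv i N)))"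
  proof
    fix \<alpha>
    show "(h - box_part N h) \<alpha> = (\<Sum>i\<in>UNIV. mmul (quot_part N i h) (mmonom (unitv i N))) \<alpha>"
      using fun_cong[OF box_decomposition[of h N], of \<alpha>]
      by (simp add: sum_fun_apply mmul_commute[of "mmonom _"])
  qed
  also have "\<dots> \<in> J"
    by (intro conv_ideal_sum[OF J] conv_ideal_mult[OF J] convergent_quot_part h mem)
  finally show ?thesis .
qed

theorem jacobian_ideal_contains_high_order:
  fixes f :: "'n::finite mseries"
  assumes iso: "isolated_hypersurface_singularity f"
  obtains N where "\<And>i k. N \<le> k \<Longrightarrow> mmonom (unitv i k) \<in> jacobian_ideal f"
proof -
  have f: "convergent_mseries f" using iso by (simp add: isolated_hypersurface_singularity_def conv_series_simps)
  note J = jacobian_ideal_ideal[OF f]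
  have "\<exists>k. mmonom (unitv i k) \<in> jacobian_ideal f" for i
    using var_power_in_jacobian_ideal[OF iso, of i] by blast
  then obtain k where k: "\<And>i. mmonom (unitv i (k i)) \<in> jacobian_ideal f" by metis
  define N where "N = Max (range k)"
  have "mmonom (unitv i n) \<in> jacobian_ideal f" if "N \<le> n" for i n
  proof -
    have "k i \<le> N" unfolding N_def by (rule Max_ge) auto
    then have "mmonom (unitv i n) = mmul (mmonom (unitv i (n - k i))) (mmonom (unitv i (k i)))"
      using that by (simp add: mmul_monom_monom unitv_add)
    then show ?thesis using conv_ideal_mult[OF J k] by simp
  qed
  then show ?thesis by (rule that)
qed

section \<open>Linear algebra in coordinate spaces\<close>

interpretation fsp: vector_space_pair "fscale :: complex \<Rightarrow> ('i \<Rightarrow> complex) \<Rightarrow> _" "fscale :: complex \<Rightarrow> ('j \<Rightarrow> complex) \<Rightarrow> _"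
  by unfold_locales

abbreviation flinear :: "(('i \<Rightarrow> complex) \<Rightarrow> ('j \<Rightarrow> complex)) \<Rightarrow> bool" where
  "flinear \<equiv> Vector_Spaces.linear fscale fscale"

lemma flinearI:
  assumes "\<And>x y. f (x + y) = f x + f y" "\<And>c x. f (fscale c x) = fscale c (f x)"
  shows "flinear f"
  unfolding Vector_Spaces.linear_iff by (simp add: assms fs.vector_space_axioms)

lemma flinear_add: "flinear f \<Longrightarrow> f (x + y) = f x + f y"
  and flinear_scale: "flinear f \<Longrightarrow> f (fscale c x) = fscale c (f x)"
  unfolding Vector_Spaces.linear_iff by auto

lemma flinear_0: "flinear f \<Longrightarrow> f 0 = 0"
  using flinear_scale[of f 0 0] by simp

lemma flinear_diff: "flinear f \<Longrightarrow> f (x - y) = f x - f y"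
  using flinear_add[of f "x - y" y] by (simp only: diff_add_cancel) (simp add: eq_diff_eq)

lemma flinear_sum:
  assumes "flinear f" shows "f (sum g A) = (\<Sum>a\<in>A. f (g a))"
  by (induction A rule: infinite_finite_induct)
     (simp_all only: sum.infinite sum.empty sum.insert flinear_0[OF assms] flinear_add[OF assms] not_False_eq_True)

lemma flinear_compose:
  assumes "flinear f" "flinear g" shows "flinear (\<lambda>x. f (g x))"
  by (rule flinearI)
     (simp_all only: flinear_add[OF assms(1)] flinear_add[OF assms(2)] flinear_scale[OF assms(1)] flinear_scale[OF assms(2)])

lemma subspace_image: "flinear f \<Longrightarrow> fs.subspace V \<Longrightarrow> fs.subspace (f ` V)"
proof (rule fs.subspaceI)
  assume f: "flinear f" and V: "fs.subspace V"
  show "0 \<in> f ` V" using flinear_0[OF f] fs.subspace_0[OF V] by (metis imageI)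
  show "x + y \<in> f ` V" if "x \<in> f ` V" "y \<in> f ` V" for x y
    using that flinear_add[OF f] fs.subspace_add[OF V] by (auto simp: image_iff) metis
  show "fscale c x \<in> f ` V" if "x \<in> f ` V" for c x
    using that flinear_scale[OF f] fs.subspace_scale[OF V] by (auto simp: image_iff) metis
qed

lemma span_image: "flinear f \<Longrightarrow> fs.span (f ` S) = f ` fs.span S"
  using module_hom.span_image[of fscale fscale f S] by (simp add: linear_iff_module_hom)

lemma span_Int_of_independent_Un:
  assumes "fs.independent (S \<union> T)" "S \<inter> T = {}" "x \<in> fs.span S" "x \<in> fs.span T"
  shows "x = 0"
proof -
  have "fs.representation (S \<union> T) x = fs.representation S x" "fs.representation (S \<union> T) x = fs.representation T x"
    by (intro fs.representation_extend assms; simp)+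
  then have "fs.representation (S \<union> T) x v = 0" for v
    using fs.representation_ne_zero[of S x v] fs.representation_ne_zero[of T x v] assms(2) by auto
  then have "{v. fs.representation (S \<union> T) x v \<noteq> 0} = {}" by simp
  moreover have "x \<in> fs.span (S \<union> T)" using assms(3) fs.span_mono[of S "S \<union> T"] by blast
  note fs.sum_nonzero_representation_eq[OF assms(1) this]
  ultimately show ?thesis by (simp only: sum.empty)
qed

lemma independent_Un:
  assumes S: "fs.independent S" "finite S" and T: "fs.independent T" "finite T"
    and disj: "\<And>x. x \<in> fs.span S \<Longrightarrow> x \<in> fs.span T \<Longrightarrow> x = 0"
  shows "fs.independent (S \<union> T)" "S \<inter> T = {}"
proof -
  show ST: "S \<inter> T = {}"
  proof (rule ccontr)
    assume "S \<inter> T \<noteq> {}"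
    then obtain x where x: "x \<in> S" "x \<in> T" by blast
    then have "x = 0" by (intro disj fs.span_base)
    then show False using x(1) S(1) fs.dependent_zero by blast
  qed
  show "fs.independent (S \<union> T)"
    unfolding fs.dependent_finite[OF finite_UnI[OF S(2) T(2)]]
  proof
    assume "\<exists>u. (\<exists>v\<in>S \<union> T. u v \<noteq> 0) \<and> (\<Sum>v\<in>S \<union> T. fscale (u v) v) = 0"
    then obtain u where u: "\<exists>v\<in>S \<union> T. u v \<noteq> 0" "(\<Sum>v\<in>S \<union> T. fscale (u v) v) = 0" by blast
    let ?a = "\<Sum>v\<in>S. fscale (u v) v" and ?b = "\<Sum>v\<in>T. fscale (u v) v"
    have ab: "?a + ?b = 0" using u(2) S(2) T(2) ST by (simp add: sum.union_disjoint)
    have "?a \<in> fs.span S" "?b \<in> fs.span T" by (intro fs.span_sum fs.span_scale fs.span_base; assumption)+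
    moreover have "?a = - ?b" using ab by (rule eq_neg_iff_add_eq_0[THEN iffD2])
    ultimately have a0: "?a = 0" by (intro disj) (auto intro: fs.span_neg)
    then have b0: "?b = 0" using ab by simp
    have "u v = 0" if "v \<in> S" for v
      using S(1) a0 that unfolding fs.dependent_finite[OF S(2)] by blast
    moreover have "u v = 0" if "v \<in> T" for v
      using T(1) b0 that unfolding fs.dependent_finite[OF T(2)] by blast
    ultimately show False using u(1) by blast
  qed
qed

lemma finite_basis_extend:
  assumes "fs.subspace W" "W \<subseteq> V" "fs.subspace V" "V \<subseteq> fs.span T" "finite T" "fs.independent B" "W = fs.span B"
  obtains B' where "B \<subseteq> B'" "finite B'" "fs.independent B'" "V = fs.span B'"
proof -
  have "B \<subseteq> V" using assms(2,7) fs.span_superset by blast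
  then obtain B' where B': "B \<subseteq> B'" "B' \<subseteq> V" "fs.independent B'" "V \<subseteq> fs.span B'"
    using fs.maximal_independent_subset_extend assms(6) by metis
  have "fs.span B' = V" using B' fs.span_minimal[OF B'(2) assms(3)] by blast
  moreover have "finite B'" using fs.independent_span_bound[OF assms(5) B'(3)] B'(2) assms(4) by blast
  ultimately show ?thesis using that B' by blast
qed

lemma finite_basis:
  assumes "fs.subspace V" "V \<subseteq> fs.span T" "finite T"
  obtains B where "finite B" "fs.independent B" "V = fs.span B"
  using finite_basis_extend[of "{0}" V T "{}"] assms fs.subspace_0[OF assms(1)] by (metis empty_subsetI fs.independent_empty fs.span_empty fs.subspace_single_0 insert_subset)

text \<open>The ambient function spaces may be infinite dimensional; only \<open>V\<close> is
  confined to the span of a finite set.\<close>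

theorem rank_nullity:
  fixes f :: "('i \<Rightarrow> complex) \<Rightarrow> ('j \<Rightarrow> complex)"
  assumes f: "flinear f" and V: "fs.subspace V" "V \<subseteq> fs.span T" "finite T"
  shows "fs.dim V = fs.dim (f ` V) + fs.dim {x \<in> V. f x = 0}"
proof -
  let ?N = "{x \<in> V. f x = 0}"
  have N: "fs.subspace ?N"
    by (rule fs.subspaceI) (auto simp: flinear_0[OF f] flinear_add[OF f] flinear_scale[OF f]
        fs.subspace_0[OF V(1)] fs.subspace_add[OF V(1)] fs.subspace_scale[OF V(1)])
  have "?N \<subseteq> fs.span T" using V(2) by blast
  then obtain B where B: "finite B" "fs.independent B" "?N = fs.span B" using finite_basis[OF N _ V(3)] by blast
  obtain B' where B': "B \<subseteq> B'" "finite B'" "fs.independent B'" "V = fs.span B'"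
    using finite_basis_extend[OF N _ V B(2,3)] by blast
  define C where "C = B' - B"
  have C: "finite C" "B \<union> C = B'" "B \<inter> C = {}" using B' by (auto simp: C_def)
  have CB: "C \<subseteq> B'" by (auto simp: C_def)
  have inj: "inj_on f (fs.span C)"
  proof (rule inj_onI)
    fix x y assume xy: "x \<in> fs.span C" "y \<in> fs.span C" "f x = f y"
    then have d: "x - y \<in> fs.span C" by (intro fs.span_diff)
    have "x - y \<in> V" using subsetD[OF fs.span_mono[OF CB] d] unfolding B'(4) .
    moreover have "f (x - y) = 0" by (simp only: flinear_diff[OF f] xy(3) diff_self)
    ultimately have "x - y \<in> fs.span B" unfolding B(3)[symmetric] mem_Collect_eq by (rule conjI)
    then have "x - y = 0" using d B'(3) C(3) unfolding C(2)[symmetric]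
      by (intro span_Int_of_independent_Un[of B C "x - y"])
    then show "x = y" by simp
  qed
  have "fs.independent C" by (rule fs.independent_mono[OF B'(3) CB])
  then have ind: "fs.independent (f ` C)"
    by (rule fsp.linear_independent_injective_image[OF f _ inj])
  have "f b = 0" if "b \<in> B" for b
  proof -
    have "b \<in> fs.span B" by (rule fs.span_base[OF that])
    then show ?thesis unfolding B(3)[symmetric] by blast
  qed
  then have "f ` B' \<subseteq> fs.span (f ` C)"
    unfolding C(2)[symmetric] by (auto simp: fs.span_zero intro: fs.span_base)
  then have "fs.span (f ` B') = fs.span (f ` C)"
    by (intro antisym fs.span_minimal fs.subspace_span fs.span_mono image_mono CB)
  then have "f ` V = fs.span (f ` C)" unfolding B'(4) by (simp only: span_image[OF f])
  then have "fs.dim (f ` V) = card (f ` C)" using fs.dim_span_eq_card_independent[OF ind] by simp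
  also have "\<dots> = card C" by (rule card_image[OF inj_on_subset[OF inj fs.span_superset]])
  finally have 1: "fs.dim (f ` V) = card C" .
  have 2: "fs.dim ?N = card B" unfolding B(3) by (rule fs.dim_span_eq_card_independent[OF B(2)])
  have 3: "fs.dim V = card B'" unfolding B'(4) by (rule fs.dim_span_eq_card_independent[OF B'(3)])
  have "card B' = card B + card C" unfolding C(2)[symmetric] by (rule card_Un_disjoint[OF B(1) C(1,3)])
  then show ?thesis using 1 2 3 by simp
qed

text \<open>A stand-in for the projection from \<open>X\<close> to \<open>X / W\<close> with values
  in the same function space: in a basis of \<open>X\<close> extending one of \<open>W\<close>, the
  vectors from \<open>W\<close> go to \<open>0\<close> and the others stay fixed.\<close>

lemma exists_linear_with_kernel:
  fixes W X :: "('i \<Rightarrow> complex) set"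
  assumes W: "fs.subspace W" "W \<subseteq> X" and X: "fs.subspace X" "X \<subseteq> fs.span T" "finite T"
  obtains f :: "('i \<Rightarrow> complex) \<Rightarrow> ('i \<Rightarrow> complex)"
  where "flinear f" "\<And>x. x \<in> X \<Longrightarrow> f x = 0 \<longleftrightarrow> x \<in> W"
proof -
  obtain B where B: "finite B" "fs.independent B" "W = fs.span B"
    using finite_basis[OF W(1) _ X(3)] W(2) X(2) by blast
  obtain B' where B': "B \<subseteq> B'" "finite B'" "fs.independent B'" "X = fs.span B'"
    using finite_basis_extend[OF W X B(2,3)] by blast
  obtain f :: "('i \<Rightarrow> complex) \<Rightarrow> ('i \<Rightarrow> complex)"
    where f: "flinear f" "\<And>x. x \<in> B' \<Longrightarrow> f x = (if x \<in> B then 0 else x)"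
    using fsp.linear_independent_extend[OF B'(3), of "\<lambda>x. if x \<in> B then 0 else x"] by blast
  have ker: "f x = 0 \<longleftrightarrow> x \<in> W" if x: "x \<in> X" for x
  proof -
    define r where "r = fs.representation B' x"
    have x_eq: "x = (\<Sum>b\<in>B'. fscale (r b) b)"
      unfolding r_def using fs.sum_representation_eq[OF B'(3) _ B'(2) subset_refl, of x] x B'(4) by simp
    have "f x = f (\<Sum>b\<in>B'. fscale (r b) b)" by (rule arg_cong[OF x_eq])
    also have "\<dots> = (\<Sum>b\<in>B'. fscale (r b) (f b))"
      by (simp only: flinear_sum[OF f(1)] flinear_scale[OF f(1)])
    also have "\<dots> = (\<Sum>b\<in>B' - B. fscale (r b) b)"
    proof (rule sum.mono_neutral_cong_right)
      show "\<forall>b\<in>B' - (B' - B). fscale (r b) (f b) = 0" using f(2) by auto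
      show "fscale (r b) (f b) = fscale (r b) b" if "b \<in> B' - B" for b using f(2) that by auto
    qed (use B'(2) in auto)
    finally have fx: "f x = (\<Sum>b\<in>B' - B. fscale (r b) b)" .
    have x_fx: "x = f x + (\<Sum>b\<in>B. fscale (r b) b)"
      unfolding fx by (rule trans[OF x_eq sum.subset_diff[OF B'(1,2)]])
    have inB: "(\<Sum>b\<in>B. fscale (r b) b) \<in> fs.span B" by (intro fs.span_sum fs.span_scale fs.span_base)
    show ?thesis
    proof
      assume "f x = 0"
      then have "x = (\<Sum>b\<in>B. fscale (r b) b)" using x_fx by (simp only: add_0_left)
      then show "x \<in> W" unfolding B(3) using inB by (simp only:)
    next
      assume "x \<in> W"
      then have "x - (\<Sum>b\<in>B. fscale (r b) b) \<in> fs.span B"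
        unfolding B(3) using inB by (rule fs.span_diff)
      moreover have "x - (\<Sum>b\<in>B. fscale (r b) b) = f x" using x_fx by (simp only: diff_eq_eq)
      ultimately have inB: "f x \<in> fs.span B" by (simp only:)
      have inC: "f x \<in> fs.span (B' - B)" unfolding fx by (intro fs.span_sum fs.span_scale fs.span_base)
      have "B \<union> (B' - B) = B'" using B'(1) by blast
      then have "fs.independent (B \<union> (B' - B))" using B'(3) by simp
      then show "f x = 0" by (rule span_Int_of_independent_Un[OF _ Diff_disjoint inB inC])
    qed
  qed
  show ?thesis by (rule that[OF f(1) ker])
qed

section \<open>Coordinate subspaces and adapted bases\<close>

definition fsupp :: "'i set \<Rightarrow> ('i \<Rightarrow> complex) set" where
  "fsupp D = {x. \<forall>i. i \<notin> D \<longrightarrow> x i = 0}"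

lemma fsuppD: "x \<in> fsupp D \<Longrightarrow> i \<notin> D \<Longrightarrow> x i = 0" by (simp add: fsupp_def)

lemma fsupp_mono: "D \<subseteq> E \<Longrightarrow> fsupp D \<subseteq> fsupp E" by (auto simp: fsupp_def)

lemma subspace_fsupp: "fs.subspace (fsupp D)"
  by (rule fs.subspaceI) (auto simp: fsupp_def)

definition dirac :: "'i \<Rightarrow> 'i \<Rightarrow> complex" where "dirac i = (\<lambda>j. if j = i then 1 else 0)"

lemma dirac_in_fsupp: "i \<in> D \<Longrightarrow> dirac i \<in> fsupp D" by (auto simp: dirac_def fsupp_def)

lemma fsupp_expansion:
  assumes "finite D" "x \<in> fsupp D" shows "x = (\<Sum>i\<in>D. fscale (x i) (dirac i))"
proof
  fix j
  have "(\<Sum>i\<in>D. fscale (x i) (dirac i)) j = (\<Sum>i\<in>D. if i = j then x j else 0)"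
    unfolding sum_fun_apply by (intro sum.cong) (auto simp: dirac_def)
  then show "x j = (\<Sum>i\<in>D. fscale (x i) (dirac i)) j" using assms by (auto simp: fsupp_def)
qed

lemma fsupp_eq_span: assumes "finite D" shows "fsupp D = fs.span (dirac ` D)"
proof
  show "fsupp D \<subseteq> fs.span (dirac ` D)"
  proof
    fix x assume "x \<in> fsupp D"
    then have "x = (\<Sum>i\<in>D. fscale (x i) (dirac i))" by (rule fsupp_expansion[OF assms])
    moreover have "\<dots> \<in> fs.span (dirac ` D)" by (intro fs.span_sum fs.span_scale fs.span_base imageI)
    ultimately show "x \<in> fs.span (dirac ` D)" by simp
  qed
  show "fs.span (dirac ` D) \<subseteq> fsupp D"
    by (intro fs.span_minimal subspace_fsupp) (auto intro: dirac_in_fsupp)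
qed

lemma dim_fsupp: assumes "finite D" shows "fs.dim (fsupp D) = card D"
proof -
  have inj: "inj_on dirac D" by (auto simp: inj_on_def dirac_def fun_eq_iff split: if_splits)
  have "fs.independent (dirac ` D)"
    unfolding fs.dependent_finite[OF finite_imageI[OF assms]]
  proof
    assume "\<exists>u. (\<exists>v\<in>dirac ` D. u v \<noteq> 0) \<and> (\<Sum>v\<in>dirac ` D. fscale (u v) v) = 0"
    then obtain u i where u: "i \<in> D" "u (dirac i) \<noteq> 0" "(\<Sum>v\<in>dirac ` D. fscale (u v) v) = 0" by blast
    have "(\<Sum>v\<in>dirac ` D. fscale (u v) v) i = (\<Sum>j\<in>D. if j = i then u (dirac i) else 0)"
      unfolding sum_fun_apply sum.reindex[OF inj] by (intro sum.cong) (auto simp: dirac_def)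
    then show False using u assms by simp
  qed
  from fs.dim_span_eq_card_independent[OF this] show ?thesis
    unfolding fsupp_eq_span[OF assms] card_image[OF inj] .
qed

text \<open>The basis vectors themselves will serve as coordinate indices.\<close>

lemma adapted_basis:
  fixes X P Q R :: "('i \<Rightarrow> complex) set"
  assumes X: "fs.subspace X" "X \<subseteq> fs.span T" "finite T"
    and sub: "fs.subspace P" "fs.subspace Q" "fs.subspace R" "P \<subseteq> X" "Q \<subseteq> X" "R \<subseteq> Q"
    and disj: "\<And>x. x \<in> R \<Longrightarrow> x \<in> P \<Longrightarrow> x = 0"
    and sum: "\<And>x. x \<in> Q \<Longrightarrow> \<exists>y\<in>R. \<exists>z\<in>P \<inter> Q. x = y + z"
  obtains D DP DQ where "finite D" "DP \<subseteq> D" "DQ \<subseteq> D" "fs.independent D" "X = fs.span D"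
    "P = fs.span DP" "Q = fs.span DQ" "R = fs.span (DQ - DP)"
proof -
  have "fs.subspace (P \<inter> Q)" by (rule fs.subspace_inter[OF sub(1,2)])
  then obtain W where W: "finite W" "fs.independent W" "P \<inter> Q = fs.span W"
    using finite_basis[OF _ _ X(3)] sub(4) X(2) by blast
  have PT: "P \<subseteq> fs.span T" "R \<subseteq> fs.span T" using sub X(2) by blast+
  obtain DP where DP: "W \<subseteq> DP" "finite DP" "fs.independent DP" "P = fs.span DP"
    by (rule finite_basis_extend[OF \<open>fs.subspace (P \<inter> Q)\<close> Int_lower1 sub(1) PT(1) X(3) W(2,3)])
  obtain DR where DR: "finite DR" "fs.independent DR" "R = fs.span DR"
    by (rule finite_basis[OF sub(3) PT(2) X(3)])
  \<comment> \<open>\<open>P\<close> and \<open>R\<close> meet only in \<open>0\<close>, so their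
    bases are jointly independent. As \<open>DP\<close> extends a basis \<open>W\<close> of
    \<open>P \<inter> Q\<close>, the vectors of \<open>W\<close> and \<open>DR\<close> together will
    span \<open>Q\<close>.\<close>
  have "fs.independent (DP \<union> DR)" "DP \<inter> DR = {}"
    by (rule independent_Un[OF DP(3,2) DR(2,1)]; use disj DP(4) DR(3) in blast)+
  note un = this
  have "DP \<union> DR \<subseteq> X" using fs.span_superset[of DP] fs.span_superset[of DR] DP DR sub by blast
  then obtain D where D: "DP \<union> DR \<subseteq> D" "finite D" "fs.independent D" "X = fs.span D"
    using finite_basis_extend[OF fs.subspace_span _ X un(1) refl] fs.span_minimal[OF _ X(1)] by blast
  have Q: "Q = fs.span (W \<union> DR)"
  proof
    show "Q \<subseteq> fs.span (W \<union> DR)"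
    proof
      fix x assume "x \<in> Q"
      then obtain y z where "y \<in> R" "z \<in> P \<inter> Q" "x = y + z" using sum by blast
      then show "x \<in> fs.span (W \<union> DR)"
        using DR(3) W(3) fs.span_mono[of W "W \<union> DR"] fs.span_mono[of DR "W \<union> DR"]
        by (auto intro!: fs.span_add)
    qed
    show "fs.span (W \<union> DR) \<subseteq> Q"
      using W(3) DR(3) sub(6) fs.span_superset[of W] fs.span_superset[of DR] by (intro fs.span_minimal sub(2)) blast
  qed
  have "(W \<union> DR) - DP = DR" using DP(1) un(2) by blast
  then show ?thesis
    using that[of D DP "W \<union> DR"] D DP DR Q by auto
qed

lemma representation_span_iff:
  assumes "fs.independent D" "finite D" "S \<subseteq> D" "x \<in> fs.span D"
  shows "x \<in> fs.span S \<longleftrightarrow> fs.representation D x \<in> fsupp S"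
proof
  assume "x \<in> fs.span S"
  then have "fs.representation D x = fs.representation S x"
    by (rule fs.representation_extend[OF assms(1) _ assms(3)])
  then show "fs.representation D x \<in> fsupp S"
    using fs.representation_ne_zero[of S x] by (auto simp: fsupp_def)
next
  assume s: "fs.representation D x \<in> fsupp S"
  have "x = (\<Sum>b\<in>D. fscale (fs.representation D x b) b)"
    using fs.sum_representation_eq[OF assms(1,4,2) subset_refl] by simp
  also have "\<dots> = (\<Sum>b\<in>S. fscale (fs.representation D x b) b)"
    using assms(2,3) s by (intro sum.mono_neutral_right) (auto simp: fsupp_def)
  also have "\<dots> \<in> fs.span S" by (intro fs.span_sum fs.span_scale fs.span_base)
  finally show "x \<in> fs.span S" .
qed

subsection \<open>The rank of a sum of two commuting operators\<close>

definition mat_op :: "'i set \<Rightarrow> ('i \<Rightarrow> 'i \<Rightarrow> complex) \<Rightarrow> ('i \<Rightarrow> complex) \<Rightarrow> 'i \<Rightarrow> complex" where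
  "mat_op D A v = (\<lambda>i. \<Sum>k\<in>D. A i k * v k)"

text \<open>The operator \<open>A \<otimes> 1 + 1 \<otimes> B\<close>, with tensors written as
  functions of two indices: \<open>A\<close> acts on columns and \<open>B\<close> on rows.\<close>

definition sum_op ::
  "'i set \<Rightarrow> ('i \<Rightarrow> 'i \<Rightarrow> complex) \<Rightarrow> 'j set \<Rightarrow> ('j \<Rightarrow> 'j \<Rightarrow> complex) \<Rightarrow>
   ('i \<times> 'j \<Rightarrow> complex) \<Rightarrow> 'i \<times> 'j \<Rightarrow> complex" where
  "sum_op D A E B x = (\<lambda>p. mat_op D A (\<lambda>i. x (i, snd p)) (fst p) + mat_op E B (\<lambda>j. x (fst p, j)) (snd p))"

lemma flinear_mat_op: "flinear (mat_op D A)"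
  by (rule flinearI) (auto simp: mat_op_def fun_eq_iff algebra_simps sum.distrib sum_distrib_left)

lemma mat_op_zero: "mat_op D A (\<lambda>_. 0) = (\<lambda>_. 0)"
  by (simp add: mat_op_def)

lemma flinear_sum_op: "flinear (sum_op D A E B)"
  by (rule flinearI) (auto simp: sum_op_def mat_op_def fun_eq_iff algebra_simps sum.distrib sum_distrib_left)

definition frestrict :: "'i set \<Rightarrow> ('i \<Rightarrow> complex) \<Rightarrow> 'i \<Rightarrow> complex" where
  "frestrict S x = (\<lambda>i. if i \<in> S then x i else 0)"

lemma flinear_frestrict: "flinear (frestrict S)"
  by (rule flinearI) (auto simp: frestrict_def fun_eq_iff)

lemma frestrict_in_fsupp: "frestrict S x \<in> fsupp S"
  by (simp add: frestrict_def fsupp_def)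

text \<open>The shape that multiplication by \<open>f_i\<close> takes in an adapted basis: its
  kernel and its image are coordinate subspaces, indexed by \<open>K\<close> and
  \<open>L\<close>.\<close>

locale kernel_image_coordinates =
  fixes D K L :: "'i set" and A :: "'i \<Rightarrow> 'i \<Rightarrow> complex"
  assumes fin: "finite D" and K: "K \<subseteq> D" and L: "L \<subseteq> D"
    and image: "mat_op D A ` fsupp D = fsupp L"
    and kernel: "\<And>v. v \<in> fsupp D \<Longrightarrow> mat_op D A v = (\<lambda>_. 0) \<longleftrightarrow> v \<in> fsupp K"
begin

lemma finite_KL: "finite K" "finite L" using fin K L finite_subset by auto

lemma card_rank: "card K + card L = card D"
proof -
  have "fs.dim (fsupp D) = fs.dim (mat_op D A ` fsupp D) + fs.dim {x \<in> fsupp D. mat_op D A x = 0}"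
    by (rule rank_nullity[OF flinear_mat_op subspace_fsupp equalityD1[OF fsupp_eq_span[OF fin]] finite_imageI[OF fin]])
  moreover have "{x \<in> fsupp D. mat_op D A x = 0} = fsupp K"
    using kernel fsupp_mono[OF K] by (auto simp: zero_fun_def)
  ultimately show ?thesis
    using dim_fsupp[OF fin] dim_fsupp[OF finite_KL(1)] dim_fsupp[OF finite_KL(2)] image by simp
qed

lemma mat_op_in: "v \<in> fsupp D \<Longrightarrow> i \<notin> L \<Longrightarrow> mat_op D A v i = 0"
proof -
  assume "v \<in> fsupp D" and i: "i \<notin> L"
  then have "mat_op D A v \<in> fsupp L" unfolding image[symmetric] by (intro imageI)
  then show "mat_op D A v i = 0" using i by (rule fsuppD)
qed

lemma mat_op_kernel: "v \<in> fsupp K \<Longrightarrow> mat_op D A v i = 0"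
proof -
  assume v: "v \<in> fsupp K"
  then have "mat_op D A v = (\<lambda>_. 0)" using kernel[OF subsetD[OF fsupp_mono[OF K] v]] by simp
  then show "mat_op D A v i = 0" by simp
qed

lemma kernel_complement: "v \<in> fsupp (D - K) \<Longrightarrow> (\<And>i. mat_op D A v i = 0) \<Longrightarrow> v i = 0"
proof -
  assume v: "v \<in> fsupp (D - K)" and "\<And>i. mat_op D A v i = 0"
  then have "mat_op D A v = (\<lambda>_. 0)" by (intro ext)
  then have "v \<in> fsupp K" using kernel[OF subsetD[OF fsupp_mono[OF Diff_subset] v]] by simp
  then show "v i = 0" using v by (cases "i \<in> K") (auto simp: fsupp_def)
qed

lemma card_complement: "card (D - K) = card L"
  using card_rank card_Diff_subset[OF finite_KL(1) K] by simp

end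

locale two_kernel_image_coordinates =
  c1: kernel_image_coordinates D1 K1 L1 A1 + c2: kernel_image_coordinates D2 K2 L2 A2
  for D1 K1 L1 :: "'i set" and A1 and D2 K2 L2 :: "'j set" and A2
begin

definition F where "F = sum_op D1 A1 D2 A2"

text \<open>\<open>u\<close> indexes a basis of \<open>U\<close>, and
  \<open>(L1 - K1) \<times> (L2 - K2)\<close> one of \<open>B_1 \<otimes> B_2\<close>; so
  \<open>G\<close> below is \<open>F (B_1 \<otimes> B_2)\<close>.\<close>

definition u where "u = K1 \<times> L2 \<union> L1 \<times> K2"

definition G where "G = F ` fsupp ((L1 - K1) \<times> (L2 - K2))"

lemma F_apply: "F x (i, j) = mat_op D1 A1 (\<lambda>k. x (k, j)) i + mat_op D2 A2 (\<lambda>l. x (i, l)) j"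
  by (simp add: F_def sum_op_def)

lemma F: "flinear F" unfolding F_def by (rule flinear_sum_op)

lemma col: "x \<in> fsupp (S \<times> T) \<Longrightarrow> (\<lambda>k. x (k, j)) \<in> fsupp S"
  and row: "x \<in> fsupp (S \<times> T) \<Longrightarrow> (\<lambda>l. x (i, l)) \<in> fsupp T"
  by (auto simp: fsupp_def)

lemma col0: "x \<in> fsupp (S \<times> T) \<Longrightarrow> j \<notin> T \<Longrightarrow> mat_op D1 A1 (\<lambda>k. x (k, j)) i = 0"
  and row0: "x \<in> fsupp (S \<times> T) \<Longrightarrow> i \<notin> S \<Longrightarrow> mat_op D2 A2 (\<lambda>l. x (i, l)) j = 0"
  by (simp_all add: fsupp_def mat_op_def)

lemma finite_u: "finite u" unfolding u_def using c1.finite_KL c2.finite_KL by simp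

text \<open>On \<open>Ker \<otimes> M\<close> the first summand of \<open>F\<close> vanishes, and
  the second maps into \<open>Ker \<otimes> Im\<close>.\<close>

lemma F_K1: "x \<in> fsupp (K1 \<times> D2) \<Longrightarrow> F x \<in> fsupp (K1 \<times> L2)"
proof -
  assume x: "x \<in> fsupp (K1 \<times> D2)"
  have "F x (i, j) = 0" if "(i, j) \<notin> K1 \<times> L2" for i j
    using that c1.mat_op_kernel[OF col[OF x]] c2.mat_op_in[OF row[OF x]] row0[OF x] by (auto simp: F_apply)
  then show ?thesis by (auto simp: fsupp_def)
qed

lemma F_K2: "x \<in> fsupp (D1 \<times> K2) \<Longrightarrow> F x \<in> fsupp (L1 \<times> K2)"
proof -
  assume x: "x \<in> fsupp (D1 \<times> K2)"
  have "F x (i, j) = 0" if "(i, j) \<notin> L1 \<times> K2" for i j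
    using that c2.mat_op_kernel[OF row[OF x]] c1.mat_op_in[OF col[OF x]] col0[OF x] by (auto simp: F_apply)
  then show ?thesis by (auto simp: fsupp_def)
qed

text \<open>On \<open>Ker \<otimes> M\<close> the map \<open>F\<close> is
  \<open>1 \<otimes> A2\<close>, which is onto \<open>Ker \<otimes> Im\<close>; the other summand of
  \<open>U\<close> is reached from \<open>M \<otimes> Ker\<close> in the same way.\<close>

lemma U_subset_image: "fsupp u \<subseteq> F ` fsupp (D1 \<times> D2)"
proof
  fix y assume y: "y \<in> fsupp u"
  have "\<exists>w\<in>fsupp D2. mat_op D2 A2 w = (\<lambda>j. if i \<in> K1 \<and> j \<in> L2 then y (i, j) else 0)" for i
  proof -
    have "(\<lambda>j. if i \<in> K1 \<and> j \<in> L2 then y (i, j) else 0) \<in> mat_op D2 A2 ` fsupp D2"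
      unfolding c2.image by (simp add: fsupp_def)
    then show ?thesis by auto
  qed
  then obtain w where w: "\<And>i. w i \<in> fsupp D2" "\<And>i. mat_op D2 A2 (w i) = (\<lambda>j. if i \<in> K1 \<and> j \<in> L2 then y (i, j) else 0)"
    by metis
  \<comment> \<open>Entries whose index pair belongs to both summands of \<open>U\<close> are left
    to the first preimage.\<close>
  have "\<exists>w\<in>fsupp D1. mat_op D1 A1 w = (\<lambda>i. if i \<in> L1 \<and> j \<in> K2 \<and> (i, j) \<notin> K1 \<times> L2 then y (i, j) else 0)" for j
  proof -
    have "(\<lambda>i. if i \<in> L1 \<and> j \<in> K2 \<and> (i, j) \<notin> K1 \<times> L2 then y (i, j) else 0) \<in> mat_op D1 A1 ` fsupp D1"
      unfolding c1.image by (simp add: fsupp_def)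
    then show ?thesis by auto
  qed
  then obtain v where v: "\<And>j. v j \<in> fsupp D1"
    "\<And>j. mat_op D1 A1 (v j) = (\<lambda>i. if i \<in> L1 \<and> j \<in> K2 \<and> (i, j) \<notin> K1 \<times> L2 then y (i, j) else 0)"
    by metis
  define x1 where "x1 = (\<lambda>(i, l). if i \<in> K1 then w i l else 0)"
  define x2 where "x2 = (\<lambda>(k, j). if j \<in> K2 then v j k else 0)"
  have x1: "x1 \<in> fsupp (K1 \<times> D2)" using w(1) by (auto simp: x1_def fsupp_def)
  have x2: "x2 \<in> fsupp (D1 \<times> K2)" using v(1) by (auto simp: x2_def fsupp_def)
  have 1: "F x1 (i, j) = (if i \<in> K1 \<and> j \<in> L2 then y (i, j) else 0)" for i j
  proof -
    have "F x1 (i, j) = mat_op D2 A2 (\<lambda>l. x1 (i, l)) j"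
      using c1.mat_op_kernel[OF col[OF x1]] by (simp add: F_apply)
    then show ?thesis using w(2)[of i] by (cases "i \<in> K1") (simp_all add: x1_def mat_op_zero)
  qed
  have 2: "F x2 (i, j) = (if i \<in> L1 \<and> j \<in> K2 \<and> (i, j) \<notin> K1 \<times> L2 then y (i, j) else 0)" for i j
  proof -
    have "F x2 (i, j) = mat_op D1 A1 (\<lambda>k. x2 (k, j)) i"
      using c2.mat_op_kernel[OF row[OF x2]] by (simp add: F_apply)
    then show ?thesis using v(2)[of j] by (cases "j \<in> K2") (simp_all add: x2_def mat_op_zero)
  qed
  have "y = F (x1 + x2)"
  proof
    fix p :: "'i \<times> 'j"
    obtain i j where p: "p = (i, j)" by fastforce
    have "F (x1 + x2) p = F x1 p + F x2 p" by (simp only: flinear_add[OF F] plus_fun_apply)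
    then show "y p = F (x1 + x2) p" using fsuppD[OF y, of p] unfolding p 1 2 by (auto simp: u_def)
  qed
  moreover have "x1 + x2 \<in> fsupp (D1 \<times> D2)"
    using x1 x2 fsupp_mono[of "K1 \<times> D2" "D1 \<times> D2"] fsupp_mono[of "D1 \<times> K2" "D1 \<times> D2"] c1.K c2.K
    by (intro fs.subspace_add[OF subspace_fsupp]) auto
  ultimately show "y \<in> F ` fsupp (D1 \<times> D2)" by blast
qed

text \<open>Restriction to the indices outside \<open>u\<close>, which is the projection modulo
  \<open>U\<close>.\<close>

definition P where "P = frestrict (- u)"

lemma P: "flinear P" unfolding P_def by (rule flinear_frestrict)

lemma P_0_iff: "P x = 0 \<longleftrightarrow> x \<in> fsupp u"
  by (auto simp: P_def frestrict_def fsupp_def fun_eq_iff)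

text \<open>In a column \<open>j\<close> outside \<open>K2\<close> and \<open>L2\<close> no index
  pair belongs to \<open>u\<close>, and the second summand of \<open>F\<close> vanishes because its
  values are supported in \<open>L2\<close>. So the first operator kills that column, and it is
  injective on vectors supported off \<open>K1\<close>. Hence \<open>x\<close> lives on columns in
  \<open>L2\<close>, and by symmetry on rows in \<open>L1\<close>.\<close>

lemma PF_0_on_complement:
  assumes x: "x \<in> fsupp ((D1 - K1) \<times> (D2 - K2))" and "P (F x) = 0"
  shows "x \<in> fsupp ((L1 - K1) \<times> (L2 - K2))"
proof -
  have Fx: "F x (i, j) = 0" if "(i, j) \<notin> u" for i j
    using assms(2) that unfolding P_0_iff by (rule fsuppD)
  have xD: "x \<in> fsupp (D1 \<times> D2)" using x fsupp_mono[of "(D1 - K1) \<times> (D2 - K2)" "D1 \<times> D2"] by blast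
  have "x (i, j) = 0" if "j \<notin> L2" for i j
  proof (cases "j \<in> D2 - K2")
    case False then show ?thesis using fsuppD[OF x] by blast
  next
    case True
    have "mat_op D1 A1 (\<lambda>k. x (k, j)) k = 0" for k
      using Fx[of k j] True that c2.mat_op_in[OF row[OF xD] that] by (auto simp: F_apply u_def)
    then show ?thesis using c1.kernel_complement[OF col[OF x]] by blast
  qed
  moreover have "x (i, j) = 0" if "i \<notin> L1" for i j
  proof (cases "i \<in> D1 - K1")
    case False then show ?thesis using fsuppD[OF x] by blast
  next
    case True
    have "mat_op D2 A2 (\<lambda>l. x (i, l)) l = 0" for l
      using Fx[of i l] True that c1.mat_op_in[OF col[OF xD] that] by (auto simp: F_apply u_def)
    then show ?thesis using c2.kernel_complement[OF row[OF x]] by blast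
  qed
  ultimately show ?thesis using fsuppD[OF x] by (auto simp: fsupp_def)
qed

lemma fsupp_finite_span: "finite S \<Longrightarrow> fsupp S \<subseteq> fs.span (dirac ` S) \<and> finite (dirac ` S)"
  using fsupp_eq_span by blast

lemma image_modulo_U: "(\<lambda>x. P (F x)) ` fsupp (D1 \<times> D2) = (\<lambda>x. P (F x)) ` fsupp ((D1 - K1) \<times> (D2 - K2))"
proof
  show "(\<lambda>x. P (F x)) ` fsupp (D1 \<times> D2) \<subseteq> (\<lambda>x. P (F x)) ` fsupp ((D1 - K1) \<times> (D2 - K2))"
  proof
    fix y assume "y \<in> (\<lambda>x. P (F x)) ` fsupp (D1 \<times> D2)"
    then obtain x where x: "x \<in> fsupp (D1 \<times> D2)" "y = P (F x)" by blast
    define x1 where "x1 = frestrict (K1 \<times> D2) x"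
    define x2 where "x2 = frestrict ((D1 - K1) \<times> K2) x"
    define x3 where "x3 = frestrict ((D1 - K1) \<times> (D2 - K2)) x"
    have "x = x1 + x2 + x3"
    proof
      fix p show "x p = (x1 + x2 + x3) p"
        using fsuppD[OF x(1), of p] by (cases p) (auto simp: x1_def x2_def x3_def frestrict_def)
    qed
    moreover have "P (F x1) = 0"
      using F_K1[of x1] frestrict_in_fsupp[of "K1 \<times> D2" x] fsupp_mono[of "K1 \<times> L2" u]
      unfolding P_0_iff by (auto simp: u_def x1_def)
    moreover have "x2 \<in> fsupp (D1 \<times> K2)"
      using frestrict_in_fsupp[of "(D1 - K1) \<times> K2" x] fsupp_mono[of "(D1 - K1) \<times> K2" "D1 \<times> K2"]
      by (auto simp: x2_def)
    then have "P (F x2) = 0"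
      using F_K2[of x2] fsupp_mono[of "L1 \<times> K2" u] unfolding P_0_iff by (auto simp: u_def)
    ultimately have "y = P (F x3)"
      unfolding x(2) by (simp only: flinear_add[OF F] flinear_add[OF P] add_0_left add_0_right)
    moreover have "x3 \<in> fsupp ((D1 - K1) \<times> (D2 - K2))" unfolding x3_def by (rule frestrict_in_fsupp)
    ultimately show "y \<in> (\<lambda>x. P (F x)) ` fsupp ((D1 - K1) \<times> (D2 - K2))" by blast
  qed
  show "(\<lambda>x. P (F x)) ` fsupp ((D1 - K1) \<times> (D2 - K2)) \<subseteq> (\<lambda>x. P (F x)) ` fsupp (D1 \<times> D2)"
    by (intro image_mono fsupp_mono) auto
qed

text \<open>Write \<open>?C\<close> and \<open>?B\<close> for the two index sets with the kernels
  removed. By the preceding lemma \<open>P \<circ> F\<close> has the same kernel on both, so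
  \<open>card ?C - card ?B\<close> is the difference of its ranks on them. The rank on
  \<open>?C\<close> is the rank of \<open>F\<close> minus \<open>card u\<close>, because the image
  contains \<open>U\<close>; the rank on \<open>?B\<close> is
  \<open>dim G - dim (U \<inter> G)\<close>. The equation is additive because subtraction of natural
  numbers truncates.\<close>

theorem rank_F:
  "fs.dim (F ` fsupp (D1 \<times> D2)) + card ((L1 - K1) \<times> (L2 - K2)) + fs.dim (fsupp u \<inter> G)
   = card u + card ((D1 - K1) \<times> (D2 - K2)) + fs.dim G"
  "fs.dim (fsupp u \<inter> G) \<le> fs.dim G" "fs.dim G \<le> card ((L1 - K1) \<times> (L2 - K2))"
proof -
  let ?C = "(D1 - K1) \<times> (D2 - K2)" and ?B = "(L1 - K1) \<times> (L2 - K2)"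
  have fin: "finite (D1 \<times> D2)" "finite ?C" "finite ?B"
    using c1.fin c2.fin c1.finite_KL c2.finite_KL by auto
  have PF: "flinear (\<lambda>x. P (F x))" by (rule flinear_compose[OF P F])
  have span_im: "F ` fsupp S \<subseteq> fs.span (F ` dirac ` S) \<and> finite (F ` dirac ` S)" if "finite S" for S
    unfolding fsupp_eq_span[OF that] span_image[OF F] using that by simp
  have sub_im: "fs.subspace (F ` fsupp S)" for S by (rule subspace_image[OF F subspace_fsupp])
  have rnP: "fs.dim (F ` fsupp S) = fs.dim ((\<lambda>x. P (F x)) ` fsupp S) + fs.dim (fsupp u \<inter> F ` fsupp S)" if "finite S" for S
  proof -
    have "fs.dim (F ` fsupp S) = fs.dim (P ` F ` fsupp S) + fs.dim {x \<in> F ` fsupp S. P x = 0}"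
      using span_im[OF that] by (intro rank_nullity[OF P sub_im]) auto
    also have "{x \<in> F ` fsupp S. P x = 0} = fsupp u \<inter> F ` fsupp S" unfolding P_0_iff by blast
    finally show ?thesis unfolding image_image .
  qed
  have rnF: "card S = fs.dim ((\<lambda>x. P (F x)) ` fsupp S) + fs.dim {x \<in> fsupp S. P (F x) = 0}" if "finite S" for S
  proof -
    have "fs.dim (fsupp S) = fs.dim ((\<lambda>x. P (F x)) ` fsupp S) + fs.dim {x \<in> fsupp S. P (F x) = 0}"
      using fsupp_finite_span[OF that] by (intro rank_nullity[OF PF subspace_fsupp]) auto
    then show ?thesis unfolding dim_fsupp[OF that] .
  qed
  have "fsupp ?B \<subseteq> fsupp ?C" using c1.L c2.L by (intro fsupp_mono) auto
  then have ker: "{x \<in> fsupp ?C. P (F x) = 0} = {x \<in> fsupp ?B. P (F x) = 0}"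
    using PF_0_on_complement by blast
  have 1: "fs.dim (F ` fsupp (D1 \<times> D2)) = fs.dim ((\<lambda>x. P (F x)) ` fsupp ?C) + card u"
    using rnP[OF fin(1)] unfolding image_modulo_U Int_absorb2[OF U_subset_image] dim_fsupp[OF finite_u] .
  have 2: "fs.dim G = fs.dim ((\<lambda>x. P (F x)) ` fsupp ?B) + fs.dim (fsupp u \<inter> G)"
    unfolding G_def by (rule rnP[OF fin(3)])
  show "fs.dim (F ` fsupp (D1 \<times> D2)) + card ?B + fs.dim (fsupp u \<inter> G) = card u + card ?C + fs.dim G"
    using 1 2 rnF[OF fin(2)] rnF[OF fin(3)] unfolding ker by linarith
  show "fs.dim (fsupp u \<inter> G) \<le> fs.dim G" using 2 by simp
  have "fs.dim (fsupp ?B) = fs.dim G + fs.dim {x \<in> fsupp ?B. F x = 0}"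
    unfolding G_def using fsupp_finite_span[OF fin(3)] by (intro rank_nullity[OF F subspace_fsupp]) auto
  then show "fs.dim G \<le> card ?B" unfolding dim_fsupp[OF fin(3)] by simp
qed

text \<open>Inserts \<open>card K = d - r\<close> and counts \<open>u\<close> by inclusion and
  exclusion; the overlap of its two rectangles is
  \<open>(K1 \<inter> L1) \<times> (K2 \<inter> L2)\<close>, whence the product
  \<open>n1 * n2\<close>.\<close>

theorem corank_F:
  defines "d1 \<equiv> int (card D1)" and "d2 \<equiv> int (card D2)" and "r1 \<equiv> int (card L1)" and "r2 \<equiv> int (card L2)"
    and "n1 \<equiv> int (card (K1 \<inter> L1))" and "n2 \<equiv> int (card (K2 \<inter> L2))"
    and "c \<equiv> int (card (D1 \<times> D2)) - int (fs.dim (F ` fsupp (D1 \<times> D2)))"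
  shows "c = (d1 - r1) * (d2 - r2) + r1 * r2 - n2 * (r1 - n1) - n1 * (r2 - n2)
      - int (fs.dim G) + int (fs.dim (fsupp u \<inter> G))"
    and "(d1 - r1) * (d2 - r2) \<le> c" and "c \<le> (d1 - r1) * (d2 - r2) + r1 * r2"
proof -
  have fin: "finite K1" "finite L1" "finite K2" "finite L2"
    using c1.finite_KL c2.finite_KL by auto
  have k: "int (card K1) = d1 - r1" "int (card K2) = d2 - r2"
    unfolding d1_def d2_def r1_def r2_def using c1.card_rank c2.card_rank by linarith+
  have "card (K1 \<times> L2) + card (L1 \<times> K2) = card u + card ((K1 \<times> L2) \<inter> (L1 \<times> K2))"
    unfolding u_def by (rule card_Un_Int) (use fin in auto)
  moreover have "(K1 \<times> L2) \<inter> (L1 \<times> K2) = (K1 \<inter> L1) \<times> (K2 \<inter> L2)" by blast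
  ultimately have "card K1 * card L2 + card L1 * card K2 = card u + card (K1 \<inter> L1) * card (K2 \<inter> L2)"
    by (simp add: card_cartesian_product)
  from arg_cong[OF this, of int] have cu: "(d1 - r1) * r2 + r1 * (d2 - r2) = int (card u) + n1 * n2"
    unfolding k[symmetric] unfolding n1_def n2_def r1_def r2_def by simp
  have diff: "int (card (L - K)) = int (card L) - int (card (K \<inter> L))" if "finite L" for K L :: "'z set"
  proof -
    have "card (L - K) = card L - card (L \<inter> K)" by (rule card_Diff_subset_Int) (use that in auto)
    moreover have "card (L \<inter> K) \<le> card L" by (rule card_mono) (use that in auto)
    ultimately show ?thesis by (simp add: Int_commute)
  qed
  have B: "int (card ((L1 - K1) \<times> (L2 - K2))) = (r1 - n1) * (r2 - n2)"
    unfolding card_cartesian_product of_nat_mult diff[OF fin(2)] diff[OF fin(4)] r1_def r2_def n1_def n2_def ..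
  have C: "int (card ((D1 - K1) \<times> (D2 - K2))) = r1 * r2"
    unfolding card_cartesian_product of_nat_mult c1.card_complement c2.card_complement r1_def r2_def ..
  have D: "int (card (D1 \<times> D2)) = d1 * d2"
    by (simp add: card_cartesian_product d1_def d2_def)
  have rank: "int (fs.dim (F ` fsupp (D1 \<times> D2))) + (r1 - n1) * (r2 - n2) + int (fs.dim (fsupp u \<inter> G))
      = int (card u) + r1 * r2 + int (fs.dim G)"
    using arg_cong[OF rank_F(1), of int] by (simp only: of_nat_add B C)
  show eq: "c = (d1 - r1) * (d2 - r2) + r1 * r2 - n2 * (r1 - n1) - n1 * (r2 - n2)
      - int (fs.dim G) + int (fs.dim (fsupp u \<inter> G))"
    unfolding c_def D using rank cu by (simp add: algebra_simps)
  have n: "0 \<le> n1" "n1 \<le> r1" "0 \<le> n2" "n2 \<le> r2"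
    unfolding n1_def n2_def r1_def r2_def using fin by (auto intro: card_mono)
  have bu: "int (fs.dim (fsupp u \<inter> G)) \<le> int (fs.dim G)" using rank_F(2) by simp
  have b: "int (fs.dim G) \<le> (r1 - n1) * (r2 - n2)" using rank_F(3) unfolding B[symmetric] by simp
  have "0 \<le> n2 * (r1 - n1)" "0 \<le> n1 * (r2 - n2)" "0 \<le> n1 * n2" using n by auto
  then show "c \<le> (d1 - r1) * (d2 - r2) + r1 * r2" unfolding eq using bu by linarith
  \<comment> \<open>The last summand is the dimension of \<open>B_1 \<otimes> B_2\<close>, which
    bounds that of \<open>G\<close>; after cancelling the two negative products, the excess over
    \<open>(d1 - r1) * (d2 - r2)\<close> is nonnegative.\<close>
  have "r1 * r2 = n1 * n2 + n2 * (r1 - n1) + n1 * (r2 - n2) + (r1 - n1) * (r2 - n2)" by (simp add: algebra_simps)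
  then show "(d1 - r1) * (d2 - r2) \<le> c" unfolding eq using b \<open>0 \<le> n1 * n2\<close> by linarith
qed

end

declare fscale_apply [simp del]

section \<open>Dimensions over the image of the complex numbers\<close>

text \<open>Dimensions in the statement are taken over the subfield \<open>range s\<close> of a
  ring. Here they are reduced to dimensions of subspaces of a function space.\<close>

locale complex_algebra = cring A for A (structure) +
  fixes s :: "complex \<Rightarrow> 'a"
  assumes s_closed [simp, intro]: "s c \<in> carrier A"
    and s_add: "s (c + d) = s c \<oplus> s d"
    and s_mult: "s (c * d) = s c \<otimes> s d"
    and s_one: "s 1 = \<one>"
    and one_not_zero: "\<one> \<noteq> \<zero>"
begin

lemma s_zero: "s 0 = \<zero>"
  using s_add[of 0 0] by (metis add.r_cancel_one' add_0_left s_closed)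

lemma s_uminus: "\<ominus> s c = s (- c)"
proof -
  have "s (- c) \<oplus> s c = \<zero>" using s_add[of "- c" c] s_zero by simp
  then show ?thesis by (metis minus_equality s_closed)
qed

lemma subfield_range: "subfield (range s) A"
proof (rule subfieldI)
  have "subring (range s) A"
    by (rule subringI) (auto simp: s_uminus s_mult[symmetric] s_add[symmetric] s_one[symmetric])
  then show "subcring (range s) A" by (rule subcringI')
  show "Units (A\<lparr>carrier := range s\<rparr>) = range s - {\<zero>}"
  proof
    show "Units (A\<lparr>carrier := range s\<rparr>) \<subseteq> range s - {\<zero>}"
    proof
      fix x assume "x \<in> Units (A\<lparr>carrier := range s\<rparr>)"
      then obtain y where "x \<in> range s" "y \<in> range s" "x \<otimes> y = \<one>" by (auto simp: Units_def)
      then show "x \<in> range s - {\<zero>}" using one_not_zero by auto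
    qed
    show "range s - {\<zero>} \<subseteq> Units (A\<lparr>carrier := range s\<rparr>)"
    proof
      fix x assume "x \<in> range s - {\<zero>}"
      then obtain c where c: "x = s c" "c \<noteq> 0" using s_zero by auto
      then have "s (inverse c) \<otimes> x = \<one>" "x \<otimes> s (inverse c) = \<one>"
        by (simp_all add: s_mult[symmetric] s_one)
      then show "x \<in> Units (A\<lparr>carrier := range s\<rparr>)" using c(1) unfolding Units_def by auto
    qed
  qed
qed

lemma subspace_closed:
  assumes "subalgebra (range s) V A"
  shows "V \<subseteq> carrier A" "\<zero> \<in> V" "x \<in> V \<Longrightarrow> y \<in> V \<Longrightarrow> x \<oplus> y \<in> V" "x \<in> V \<Longrightarrow> s c \<otimes> x \<in> V"
  using subalgebra_in_carrier[OF assms] subgroup.one_closed[OF subalgebra.axioms(1)[OF assms]]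
    subgroup.m_closed[OF subalgebra.axioms(1)[OF assms]] subalgebra.smult_closed[OF assms]
  by auto

lemma subalgebraI:
  assumes "V \<subseteq> carrier A" "\<zero> \<in> V" "\<And>x y. x \<in> V \<Longrightarrow> y \<in> V \<Longrightarrow> x \<oplus> y \<in> V" "\<And>c x. x \<in> V \<Longrightarrow> s c \<otimes> x \<in> V"
  shows "subalgebra (range s) V A"
proof (rule subalgebra.intro)
  have neg: "\<ominus> x \<in> V" if "x \<in> V" for x
  proof -
    have "x \<in> carrier A" using assms(1) that by blast
    then have "\<ominus> x = s (- 1) \<otimes> x" by (metis l_minus l_one one_closed s_one s_uminus)
    then show ?thesis using assms(4)[OF that] by simp
  qed
  show "subgroup V (add_monoid A)"
    using assms neg by (intro add.subgroupI) (auto simp: a_inv_def)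
  show "subalgebra_axioms (range s) V A"
    using assms(4) by unfold_locales auto
qed

context
  fixes V :: "'a set" and \<phi> :: "'a \<Rightarrow> ('i \<Rightarrow> complex)"
  assumes V: "subalgebra (range s) V A"
    and \<phi>_add: "\<And>x y. x \<in> V \<Longrightarrow> y \<in> V \<Longrightarrow> \<phi> (x \<oplus> y) = \<phi> x + \<phi> y"
    and \<phi>_scale: "\<And>c x. x \<in> V \<Longrightarrow> \<phi> (s c \<otimes> x) = fscale c (\<phi> x)"
begin

lemma linear_zero: "\<phi> \<zero> = 0"
proof -
  have "\<phi> (s 0 \<otimes> \<zero>) = fscale 0 (\<phi> \<zero>)" by (rule \<phi>_scale[OF subspace_closed(2)[OF V]])
  then show ?thesis by (simp add: fun_eq_iff fscale_apply)
qed

lemma subspace_linear_image: "fs.subspace (\<phi> ` V)"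
proof (rule fs.subspaceI)
  show "0 \<in> \<phi> ` V" unfolding linear_zero[symmetric] by (rule imageI[OF subspace_closed(2)[OF V]])
  show "x + y \<in> \<phi> ` V" if xy: "x \<in> \<phi> ` V" "y \<in> \<phi> ` V" for x y
  proof -
    obtain a b where ab: "a \<in> V" "b \<in> V" "x = \<phi> a" "y = \<phi> b" using xy by blast
    show ?thesis unfolding ab(3,4) \<phi>_add[OF ab(1,2), symmetric]
      by (rule imageI[OF subspace_closed(3)[OF V ab(1,2)]])
  qed
  show "fscale c x \<in> \<phi> ` V" if x: "x \<in> \<phi> ` V" for c x
  proof -
    obtain a where a: "a \<in> V" "x = \<phi> a" using x by blast
    show ?thesis unfolding a(2) \<phi>_scale[OF a(1), symmetric]
      by (rule imageI[OF subspace_closed(4)[OF V a(1)]])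
  qed
qed

text \<open>The ring-theoretic dimension is an inductive notion that adjoins one vector at a time,
  so a basis of the image is pulled back one element at a time.\<close>

lemma dimension_preimage_span:
  assumes inj: "inj_on \<phi> V"
  shows "finite B \<Longrightarrow> fs.independent B \<Longrightarrow> B \<subseteq> \<phi> ` V \<Longrightarrow> dimension (card B) (range s) {x \<in> V. \<phi> x \<in> fs.span B}"
proof (induction B rule: finite_induct)
  case empty
  have "{x \<in> V. \<phi> x \<in> fs.span {}} = {\<zero>}"
  proof (intro equalityI subsetI)
    fix x assume "x \<in> {x \<in> V. \<phi> x \<in> fs.span {}}"
    then have "x \<in> V" "\<phi> x = \<phi> \<zero>" by (simp_all add: linear_zero del: zero_fun_apply)
    then show "x \<in> {\<zero>}" using inj_onD[OF inj _ _ subspace_closed(2)[OF V]] by simp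
  next
    fix x assume "x \<in> {\<zero>}"
    then show "x \<in> {x \<in> V. \<phi> x \<in> fs.span {}}"
      using subspace_closed(2)[OF V] fs.span_zero by (simp add: linear_zero)
  qed
  then show ?case by (simp only: card.empty zero_dim)
next
  case (insert b B)
  then have "b \<notin> fs.span B" "fs.independent B" by (simp_all add: fs.independent_insert)
  obtain v where v: "v \<in> V" "\<phi> v = b" using insert.prems by auto
  let ?E = "{x \<in> V. \<phi> x \<in> fs.span B}"
  have carr: "x \<in> carrier A" if "x \<in> V" for x using that subspace_closed(1)[OF V] by blast
  have "line_extension (range s) v ?E = {x \<in> V. \<phi> x \<in> fs.span (insert b B)}"
  proof (intro equalityI subsetI)
    fix u assume "u \<in> line_extension (range s) v ?E"
    then obtain c e where u: "u = s c \<otimes> v \<oplus> e" "e \<in> V" "\<phi> e \<in> fs.span B"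
      unfolding line_extension_mem_iff by auto
    have cv: "s c \<otimes> v \<in> V" by (rule subspace_closed(4)[OF V v(1)])
    have "u \<in> V" unfolding u(1) by (rule subspace_closed(3)[OF V cv u(2)])
    moreover have "\<phi> u - fscale c b = \<phi> e"
      unfolding u(1) \<phi>_add[OF cv u(2)] \<phi>_scale[OF v(1)] v(2) by (simp only: add_diff_cancel_left')
    ultimately show "u \<in> {x \<in> V. \<phi> x \<in> fs.span (insert b B)}"
      unfolding fs.span_breakdown_eq mem_Collect_eq using u(3) by (intro conjI exI[of _ c]) simp_all
  next
    fix u assume "u \<in> {x \<in> V. \<phi> x \<in> fs.span (insert b B)}"
    then obtain c where u: "u \<in> V" "\<phi> u - fscale c b \<in> fs.span B" unfolding fs.span_breakdown_eq by blast
    let ?e = "u \<oplus> s (- c) \<otimes> v"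
    have cv: "s (- c) \<otimes> v \<in> V" by (rule subspace_closed(4)[OF V v(1)])
    have "?e \<in> V" by (rule subspace_closed(3)[OF V u(1) cv])
    moreover have "\<phi> ?e = \<phi> u - fscale c b"
      unfolding \<phi>_add[OF u(1) cv] \<phi>_scale[OF v(1)] v(2) by (simp add: fun_eq_iff fscale_apply)
    ultimately have e: "?e \<in> ?E" using u(2) by simp
    have "s c \<otimes> v \<oplus> ?e = u"
    proof -
      have "s c \<otimes> v \<oplus> s (- c) \<otimes> v = \<zero>"
        using carr[OF v(1)] by (simp add: l_distr[symmetric] s_add[symmetric] s_zero)
      moreover have "s c \<otimes> v \<oplus> ?e = u \<oplus> (s c \<otimes> v \<oplus> s (- c) \<otimes> v)"
        using carr[OF v(1)] carr[OF u(1)] by (intro a_lcomm) auto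
      ultimately show ?thesis using carr[OF u(1)] by simp
    qed
    then show "u \<in> line_extension (range s) v ?E"
      unfolding line_extension_mem_iff
      by (intro bexI[of _ "s c"] bexI[OF _ e] rangeI) (rule sym)
  qed
  moreover have "dimension (Suc (card B)) (range s) (line_extension (range s) v ?E)"
  proof (rule Suc_dim)
    show "v \<in> carrier A" by (rule carr[OF v(1)])
    show "v \<notin> ?E" using v \<open>b \<notin> fs.span B\<close> by simp
    show "dimension (card B) (range s) ?E"
      using insert.IH \<open>fs.independent B\<close> insert.prems by blast
  qed
  ultimately show ?case unfolding card_insert_disjoint[OF insert.hyps] by simp
qed

theorem dim_transport:
  assumes "inj_on \<phi> V" "\<phi> ` V \<subseteq> fs.span T" "finite T"
  shows "dim (range s) V = fs.dim (\<phi> ` V)"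
proof -
  obtain B where B: "finite B" "fs.independent B" "\<phi> ` V = fs.span B"
    by (rule finite_basis[OF subspace_linear_image assms(2,3)])
  have "dimension (card B) (range s) {x \<in> V. \<phi> x \<in> fs.span B}"
    by (rule dimension_preimage_span[OF assms(1) B(1,2)]) (use B(3) fs.span_superset in blast)
  moreover have "{x \<in> V. \<phi> x \<in> fs.span B} = V" unfolding B(3)[symmetric] by blast
  ultimately have "dimension (card B) (range s) V" by (simp only:)
  from dimI[OF subfield_range this] have "dim (range s) V = card B" by (simp add: over_def)
  also have "card B = fs.dim (\<phi> ` V)" unfolding B(3) by (rule fs.dim_span_eq_card_independent[OF B(2), symmetric])
  finally show ?thesis .
qed

end

end

text \<open>The common pattern for Milnor algebras, Tjurina algebras and the tensor product: a
  linear map \<open>\<Psi>\<close> with kernel exactly \<open>I\<close> induces an injective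
  coordinate map \<open>\<phi>\<close> on the quotient ring, and dimensions are those of images
  under \<open>\<phi>\<close>.\<close>

locale coordinate_quotient = ideal I R + cring R
  for I and R (structure) +
  fixes \<sigma> :: "complex \<Rightarrow> 'a" and \<Psi> :: "'a \<Rightarrow> ('i \<Rightarrow> complex)"
  assumes \<sigma>_closed [simp, intro]: "\<sigma> c \<in> carrier R"
    and \<sigma>_add: "\<sigma> (c + d) = \<sigma> c \<oplus> \<sigma> d"
    and \<sigma>_mult: "\<sigma> (c * d) = \<sigma> c \<otimes> \<sigma> d"
    and \<sigma>_one: "\<sigma> 1 = \<one>"
    and proper: "\<one> \<notin> I"
    and \<Psi>_add: "\<And>x y. x \<in> carrier R \<Longrightarrow> y \<in> carrier R \<Longrightarrow> \<Psi> (x \<oplus> y) = \<Psi> x + \<Psi> y"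
    and \<Psi>_scale: "\<And>c x. x \<in> carrier R \<Longrightarrow> \<Psi> (\<sigma> c \<otimes> x) = fscale c (\<Psi> x)"
    and \<Psi>_kernel: "\<And>x. x \<in> carrier R \<Longrightarrow> \<Psi> x = 0 \<longleftrightarrow> x \<in> I"
begin

abbreviation "s \<equiv> \<lambda>c. I +> \<sigma> c"

lemma Quot_simps:
  "carrier (R Quot I) = (\<lambda>x. I +> x) ` carrier R"
  "x \<in> carrier R \<Longrightarrow> y \<in> carrier R \<Longrightarrow> (I +> x) \<otimes>\<^bsub>R Quot I\<^esub> (I +> y) = I +> (x \<otimes> y)"
  "x \<in> carrier R \<Longrightarrow> y \<in> carrier R \<Longrightarrow> (I +> x) \<oplus>\<^bsub>R Quot I\<^esub> (I +> y) = I +> (x \<oplus> y)"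
  "\<one>\<^bsub>R Quot I\<^esub> = I +> \<one>" "\<zero>\<^bsub>R Quot I\<^esub> = I +> \<zero>"
proof -
  show "carrier (R Quot I) = (\<lambda>x. I +> x) ` carrier R"
    by (auto simp: FactRing_def A_RCOSETS_def')
  show "x \<in> carrier R \<Longrightarrow> y \<in> carrier R \<Longrightarrow> (I +> x) \<otimes>\<^bsub>R Quot I\<^esub> (I +> y) = I +> (x \<otimes> y)"
    by (simp add: FactRing_def rcoset_mult_add)
  show "x \<in> carrier R \<Longrightarrow> y \<in> carrier R \<Longrightarrow> (I +> x) \<oplus>\<^bsub>R Quot I\<^esub> (I +> y) = I +> (x \<oplus> y)"
    by (simp add: FactRing_def a_rcos_sum)
  show "\<one>\<^bsub>R Quot I\<^esub> = I +> \<one>" by (simp add: FactRing_def)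
  show "\<zero>\<^bsub>R Quot I\<^esub> = I +> \<zero>"
    using a_rcos_zero[OF ideal_axioms additive_subgroup.zero_closed[OF is_additive_subgroup]] by (simp add: FactRing_def)
qed

lemma coset_eq_iff: "x \<in> carrier R \<Longrightarrow> y \<in> carrier R \<Longrightarrow> I +> x = I +> y \<longleftrightarrow> \<Psi> x = \<Psi> y"
proof -
  assume xy: "x \<in> carrier R" "y \<in> carrier R"
  have "\<Psi> (\<sigma> (- 1) \<otimes> y) = fscale (- 1) (\<Psi> y)" by (rule \<Psi>_scale[OF xy(2)])
  moreover have "\<sigma> (- 1) \<otimes> y = \<ominus> y"
  proof -
    have "\<sigma> 0 = \<zero>" using \<sigma>_add[of 0 0] by (metis add.r_cancel_one' add_0_left \<sigma>_closed)
    then have "\<sigma> (- 1) \<oplus> \<one> = \<zero>" using \<sigma>_add[of "- 1" 1] \<sigma>_one by simp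
    then show ?thesis using xy by (metis \<sigma>_closed l_minus l_one minus_equality one_closed)
  qed
  ultimately have "\<Psi> (\<ominus> y) = - \<Psi> y" by (simp add: fun_eq_iff fscale_apply)
  then have "\<Psi> (x \<ominus> y) = \<Psi> x - \<Psi> y"
    using \<Psi>_add[of x "\<ominus> y"] xy unfolding a_minus_def by simp
  moreover have "I +> x = I +> y \<longleftrightarrow> x \<ominus> y \<in> I"
    using quotient_eq_iff_same_a_r_cos[OF ideal_axioms xy] by blast
  ultimately show ?thesis using \<Psi>_kernel[of "x \<ominus> y"] xy by (metis eq_iff_diff_eq_0 minus_closed)
qed

lemma proper_quotient: "\<one>\<^bsub>R Quot I\<^esub> \<noteq> \<zero>\<^bsub>R Quot I\<^esub>"
proof -
  have "\<Psi> \<one> \<noteq> 0" using \<Psi>_kernel[of \<one>] proper by simp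
  moreover have "\<Psi> \<zero> = 0" using \<Psi>_kernel[of \<zero>] additive_subgroup.zero_closed[OF is_additive_subgroup] by simp
  ultimately show ?thesis unfolding Quot_simps(4,5) using coset_eq_iff[of \<one> \<zero>] by simp
qed

sublocale Q: complex_algebra "R Quot I" s
proof (rule complex_algebra.intro)
  show "cring (R Quot I)" by (rule quotient_is_cring[OF cring_axioms])
  show "complex_algebra_axioms (R Quot I) s"
    using proper_quotient by unfold_locales (simp_all add: Quot_simps \<sigma>_add \<sigma>_mult \<sigma>_one)
qed

definition \<phi> :: "'a set \<Rightarrow> 'i \<Rightarrow> complex" where "\<phi> X = \<Psi> (SOME x. x \<in> carrier R \<and> X = I +> x)"

lemma \<phi>_coset: "x \<in> carrier R \<Longrightarrow> \<phi> (I +> x) = \<Psi> x"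
proof -
  assume x: "x \<in> carrier R"
  then have "\<exists>y. y \<in> carrier R \<and> I +> x = I +> y" by blast
  from someI_ex[OF this] show ?thesis
    unfolding \<phi>_def using coset_eq_iff[OF x] by auto
qed

lemma \<phi>_add: "X \<in> carrier (R Quot I) \<Longrightarrow> Y \<in> carrier (R Quot I) \<Longrightarrow> \<phi> (X \<oplus>\<^bsub>R Quot I\<^esub> Y) = \<phi> X + \<phi> Y"
  by (auto simp: Quot_simps \<phi>_coset \<Psi>_add simp del: plus_fun_apply)

lemma \<phi>_scale: "X \<in> carrier (R Quot I) \<Longrightarrow> \<phi> (s c \<otimes>\<^bsub>R Quot I\<^esub> X) = fscale c (\<phi> X)"
  by (auto simp: Quot_simps \<phi>_coset \<Psi>_scale)

lemma inj_\<phi>: "inj_on \<phi> (carrier (R Quot I))"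
  by (auto simp: inj_on_def Quot_simps \<phi>_coset coset_eq_iff)

theorem dim_eq:
  assumes "subalgebra (range s) V (R Quot I)" "\<phi> ` V \<subseteq> fs.span T" "finite T"
  shows "ring.dim (R Quot I) (range s) V = fs.dim (\<phi> ` V)"
proof -
  have V: "V \<subseteq> carrier (R Quot I)" by (rule Q.subspace_closed(1)[OF assms(1)])
  show ?thesis
    by (rule Q.dim_transport[OF assms(1) _ _ _ assms(2,3)])
       (use V in \<open>auto intro!: \<phi>_add \<phi>_scale inj_on_subset[OF inj_\<phi>]\<close>)
qed

lemma subalgebra_if_subspace:
  assumes V: "V \<subseteq> carrier (R Quot I)" and sub: "fs.subspace (\<phi> ` V)"
  shows "subalgebra (range s) V (R Quot I)"
proof (rule Q.subalgebraI[OF V])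
  have mem: "X \<in> V" if "X \<in> carrier (R Quot I)" "\<phi> X \<in> \<phi> ` V" for X
    using that V inj_\<phi> by (auto simp: inj_on_def)
  have z: "\<phi> \<zero>\<^bsub>R Quot I\<^esub> = 0"
  proof -
    have "\<Psi> \<zero> = 0" using \<Psi>_kernel[OF zero_closed] additive_subgroup.zero_closed[OF is_additive_subgroup] by blast
    then show ?thesis unfolding Quot_simps(5) \<phi>_coset[OF zero_closed] .
  qed
  show "\<zero>\<^bsub>R Quot I\<^esub> \<in> V" by (rule mem) (use z fs.subspace_0[OF sub] in simp_all)
  show "X \<oplus>\<^bsub>R Quot I\<^esub> Y \<in> V" if XY: "X \<in> V" "Y \<in> V" for X Y
  proof (rule mem)
    have c: "X \<in> carrier (R Quot I)" "Y \<in> carrier (R Quot I)" using XY V by auto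
    show "X \<oplus>\<^bsub>R Quot I\<^esub> Y \<in> carrier (R Quot I)" using c by simp
    show "\<phi> (X \<oplus>\<^bsub>R Quot I\<^esub> Y) \<in> \<phi> ` V"
      unfolding \<phi>_add[OF c] using XY by (intro fs.subspace_add[OF sub] imageI)
  qed
  show "s c \<otimes>\<^bsub>R Quot I\<^esub> X \<in> V" if X: "X \<in> V" for c X
  proof (rule mem)
    have c: "X \<in> carrier (R Quot I)" using X V by auto
    show "s c \<otimes>\<^bsub>R Quot I\<^esub> X \<in> carrier (R Quot I)" using c by simp
    show "\<phi> (s c \<otimes>\<^bsub>R Quot I\<^esub> X) \<in> \<phi> ` V"
      unfolding \<phi>_scale[OF c] using X by (intro fs.subspace_scale[OF sub] imageI)
  qed
qed

lemma \<phi>_image_carrier: "\<phi> ` carrier (R Quot I) = \<Psi> ` carrier R"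
  unfolding Quot_simps(1) image_image by (rule image_cong) (auto simp: \<phi>_coset)

end

section \<open>Coordinates on the Milnor algebra of an isolated singularity\<close>

lemma mseries_eval_0: "mseries_eval g 0 = g 0"
proof -
  have "mseries_eval g 0 = (\<Sum>\<^sub>\<infinity>\<alpha>\<in>{0}. g \<alpha>)"
    unfolding mseries_eval_def
  proof (rule infsum_cong_neutral)
    fix \<alpha> :: "'a \<Rightarrow> nat" assume "\<alpha> \<in> UNIV - {0}"
    then obtain i where "\<alpha> i \<noteq> 0" by (auto simp: fun_eq_iff)
    then show "g \<alpha> * (\<Prod>i\<in>UNIV. (0 :: complex ^ 'a) $ i ^ \<alpha> i) = 0" by (auto simp: prod_zero_iff)
  qed auto
  then show ?thesis by simp
qed

lemma mmul_0: "mmul a b 0 = a 0 * b 0"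
proof -
  have "splittings (0 :: 'a \<Rightarrow> nat) = {(0, 0)}"
    by (auto simp: splittings_def fun_eq_iff)
  then show ?thesis by (simp add: mmul_def)
qed

lemma maximal_ideal: "ideal {a. convergent_mseries a \<and> a 0 = 0} (conv_series :: 'n::finite mseries ring)"
proof (rule idealI[OF conv.ring_axioms])
  show "subgroup {a. convergent_mseries a \<and> a 0 = 0} (add_monoid (conv_series :: 'n mseries ring))"
    by (rule conv.add.subgroupI)
       (auto simp: conv_series_simps convergent_add a_inv_def[symmetric] conv_a_inv convergent_uminus intro!: exI[of _ 0])
qed (auto simp: conv_series_simps convergent_mmul mmul_0)

text \<open>Vanishing of the partial derivatives at the origin keeps the constant \<open>1\<close>
  out of the Jacobian ideal, so the Milnor algebra is not the zero ring and has the complex numbers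
  as a subfield.\<close>

lemma jacobian_ideal_maximal:
  assumes "convergent_mseries f" "\<And>i. mseries_partial i f 0 = 0"
  shows "jacobian_ideal f \<subseteq> {a. convergent_mseries a \<and> a 0 = 0}"
  by (rule jacobian_ideal_least[OF maximal_ideal]) (use assms in \<open>auto simp: convergent_partial\<close>)

lemma one_notin_maximal: "mseries_const 1 \<notin> {a. convergent_mseries a \<and> a 0 = 0}"
  by (simp add: mseries_const_def zero_fun_def)

lemma tjurina_ideal_eq:
  assumes "convergent_mseries f"
  shows "ideal (tjurina_ideal f) conv_series"
    "tjurina_ideal f = {mmul f h + j |h j. convergent_mseries h \<and> j \<in> jacobian_ideal f}"
proof -
  have f: "f \<in> carrier conv_series" using assms by (simp add: conv_series_simps)
  show "ideal (tjurina_ideal f) conv_series"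
    unfolding tjurina_ideal_def
    by (rule conv.add_ideals[OF conv.cgenideal_ideal[OF f] jacobian_ideal_ideal[OF assms]])
  show "tjurina_ideal f = {mmul f h + j |h j. convergent_mseries h \<and> j \<in> jacobian_ideal f}"
    unfolding tjurina_ideal_def set_add_def' cgenideal_def
    by (auto simp: conv_series_simps mmul_commute[of f])
qed

lemma tjurina_ideal_maximal:
  assumes "convergent_mseries f" "\<And>i. mseries_partial i f 0 = 0" "f 0 = 0"
  shows "tjurina_ideal f \<subseteq> {a. convergent_mseries a \<and> a 0 = 0}"
  unfolding tjurina_ideal_eq(2)[OF assms(1)]
  using jacobian_ideal_maximal[OF assms(1,2)] assms
  by (auto simp: convergent_add convergent_mmul mmul_0)

lemma mmul_add_right: "mmul a (x + y) = mmul a x + mmul a y"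
  using mmul_add_left[of x y a] by (simp only: mmul_commute[of a])

lemma mmul_fscale_right: "mmul a (fscale c x) = fscale c (mmul a x)"
  by (rule ext) (simp add: mmul_def fscale_apply sum_distrib_left mult_ac)

lemma flinear_mmul: "flinear (mmul a)"
  by (rule flinearI) (simp_all only: mmul_add_right mmul_fscale_right)

lemma subspace_convergent: "fs.subspace {a. convergent_mseries a}"
  by (rule fs.subspaceI) (auto simp: convergent_add convergent_fscale)

text \<open>\<open>\<psi>\<close> is linear on all formal series, while its kernel is prescribed
  only on the convergent ones, which are the elements of the ring.\<close>

locale jacobian_coordinates =
  fixes f :: "'n::finite mseries" and \<psi> :: "'n mseries \<Rightarrow> ('i \<Rightarrow> complex)"
  assumes conv_f: "convergent_mseries f"
    and proper_jacobian: "mseries_const 1 \<notin> jacobian_ideal f"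
    and linear: "flinear \<psi>"
    and kernel: "\<And>h. convergent_mseries h \<Longrightarrow> \<psi> h = 0 \<longleftrightarrow> h \<in> jacobian_ideal f"
begin

abbreviation "J \<equiv> jacobian_ideal f"

lemmas J = jacobian_ideal_ideal[OF conv_f]

sublocale ideal J conv_series by (rule J)

sublocale coordinate_quotient J conv_series mseries_const \<psi>
proof (rule coordinate_quotient.intro[OF J cring_conv_series])
  show "coordinate_quotient_axioms J conv_series mseries_const \<psi>"
  proof
    show "mseries_const (c + d) = mseries_const c \<oplus>\<^bsub>conv_series\<^esub> mseries_const d" for c d
      unfolding conv_series_simps by (rule ext) (simp add: mseries_const_def)
    show "mseries_const (c * d) = mseries_const c \<otimes>\<^bsub>conv_series\<^esub> mseries_const d" for c d
      unfolding conv_series_simps mmul_const by (rule ext) (simp add: mseries_const_def)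
    show "\<psi> (x \<oplus>\<^bsub>conv_series\<^esub> y) = \<psi> x + \<psi> y" for x y
      unfolding conv_series_simps by (rule flinear_add[OF linear])
    show "\<psi> (mseries_const c \<otimes>\<^bsub>conv_series\<^esub> x) = fscale c (\<psi> x)" for c x
      unfolding conv_series_simps mmul_const_fscale by (rule flinear_scale[OF linear])
  qed (use proper_jacobian kernel in \<open>auto simp: conv_series_simps\<close>)
qed

lemma milnor_algebra_eq: "milnor_algebra f = conv_series Quot J"
  by (simp add: milnor_algebra_def)

lemma milnor_scalar_eq: "milnor_scalar f = s"
  unfolding milnor_scalar_def quot_scalar_def ..

lemma coset_0: "h \<in> carrier conv_series \<Longrightarrow> J +>\<^bsub>conv_series\<^esub> h = \<zero>\<^bsub>milnor_algebra f\<^esub> \<longleftrightarrow> \<psi> h = 0"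
  using coset_eq_iff[of h "\<zero>\<^bsub>conv_series\<^esub>"] flinear_0[OF linear]
  unfolding milnor_algebra_eq Quot_simps(5) by (simp add: conv_series_simps)

lemma class_mult: "convergent_mseries h \<Longrightarrow>
    milnor_class f \<otimes>\<^bsub>milnor_algebra f\<^esub> (J +>\<^bsub>conv_series\<^esub> h) = J +>\<^bsub>conv_series\<^esub> mmul f h"
  unfolding milnor_class_def milnor_algebra_eq
  using Quot_simps(2)[of f h] conv_f by (simp add: conv_series_simps)

lemma milnor_carrier: "carrier (milnor_algebra f) = (\<lambda>h. J +>\<^bsub>conv_series\<^esub> h) ` {h. convergent_mseries h}"
  unfolding milnor_algebra_eq Quot_simps(1) by (simp add: conv_series_simps)

lemma milnor_Ker_eq:
  "milnor_Ker f = (\<lambda>h. J +>\<^bsub>conv_series\<^esub> h) ` {h. convergent_mseries h \<and> \<psi> (mmul f h) = 0}"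
proof -
  have "milnor_class f \<otimes>\<^bsub>milnor_algebra f\<^esub> (J +>\<^bsub>conv_series\<^esub> h) = \<zero>\<^bsub>milnor_algebra f\<^esub> \<longleftrightarrow> \<psi> (mmul f h) = 0"
    if "convergent_mseries h" for h
    using class_mult[OF that] coset_0[of "mmul f h"] conv_f that by (simp add: conv_series_simps convergent_mmul)
  then show ?thesis unfolding milnor_Ker_def a_kernel_def' milnor_carrier by blast
qed

lemma milnor_Im_eq:
  "milnor_Im f = (\<lambda>h. J +>\<^bsub>conv_series\<^esub> h) ` (mmul f ` {h. convergent_mseries h})"
  unfolding milnor_Im_def milnor_carrier image_image by (rule image_cong) (auto simp: class_mult)

lemma \<phi>_conv: "convergent_mseries h \<Longrightarrow> \<phi> (J +>\<^bsub>conv_series\<^esub> h) = \<psi> h"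
  by (rule \<phi>_coset) (simp add: conv_series_simps)

lemma \<phi>_Ker: "\<phi> ` milnor_Ker f = \<psi> ` {h. convergent_mseries h \<and> \<psi> (mmul f h) = 0}"
  unfolding milnor_Ker_eq image_image by (rule image_cong) (auto simp: \<phi>_conv)

lemma \<phi>_Im: "\<phi> ` milnor_Im f = \<psi> ` (mmul f ` {h. convergent_mseries h})"
  unfolding milnor_Im_eq image_image by (rule image_cong) (auto simp: \<phi>_conv convergent_mmul conv_f)

lemma \<phi>_carrier: "\<phi> ` carrier (milnor_algebra f) = \<psi> ` {h. convergent_mseries h}"
  unfolding milnor_algebra_eq \<phi>_image_carrier conv_series_simps ..

lemma subspace_\<phi>_Ker: "fs.subspace (\<phi> ` milnor_Ker f)"
  unfolding \<phi>_Ker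
proof (rule subspace_image[OF linear])
  show "fs.subspace {h. convergent_mseries h \<and> \<psi> (mmul f h) = 0}"
    using flinear_compose[OF linear flinear_mmul, of f]
    by (intro fs.subspaceI)
       (auto simp: convergent_add convergent_fscale flinear_0[of "\<lambda>h. \<psi> (mmul f h)"]
         flinear_add[of "\<lambda>h. \<psi> (mmul f h)"] flinear_scale[of "\<lambda>h. \<psi> (mmul f h)"] fs.scale_zero_right)
qed

lemma subspace_\<phi>_Im: "fs.subspace (\<phi> ` milnor_Im f)"
  unfolding \<phi>_Im
  by (rule subspace_image[OF linear subspace_image[OF flinear_mmul subspace_convergent]])

lemma subspace_\<phi>_carrier: "fs.subspace (\<phi> ` carrier (milnor_algebra f))"
  unfolding \<phi>_carrier by (rule subspace_image[OF linear subspace_convergent])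

lemma Ker_subset: "milnor_Ker f \<subseteq> carrier (milnor_algebra f)"
  unfolding milnor_Ker_eq milnor_carrier by auto

lemma Im_subset: "milnor_Im f \<subseteq> carrier (milnor_algebra f)"
  unfolding milnor_Im_eq milnor_carrier by (auto simp: convergent_mmul conv_f)

lemma inj: "X \<in> carrier (milnor_algebra f) \<Longrightarrow> Y \<in> carrier (milnor_algebra f) \<Longrightarrow> \<phi> X = \<phi> Y \<longleftrightarrow> X = Y"
  using inj_\<phi> unfolding milnor_algebra_eq by (auto simp: inj_on_def)

lemma subalgebra_of_subspace:
  assumes "V \<subseteq> carrier (milnor_algebra f)" "fs.subspace (\<phi> ` V)"
  shows "subalgebra (range (milnor_scalar f)) V (milnor_algebra f)"
  unfolding milnor_scalar_eq milnor_algebra_eq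
  by (rule subalgebra_if_subspace) (use assms in \<open>simp_all add: milnor_algebra_eq\<close>)

end

text \<open>The kernel, the image and the complement \<open>B\<close> become the coordinate
  subspaces of \<open>K\<close>, \<open>L\<close> and \<open>L - K\<close>. The exponent
  \<open>N\<close> is recorded because coordinates for the join are built from truncated
  series.\<close>

locale milnor_coordinates = jacobian_coordinates f \<psi>
  for f :: "'n::finite mseries" and \<psi> :: "'n mseries \<Rightarrow> ('i \<Rightarrow> complex)" +
  fixes D K L :: "'i set" and N :: nat and B :: "'n mseries set set"
  assumes finite_D: "finite D" and K_subset: "K \<subseteq> D" and L_subset: "L \<subseteq> D"
    and coord_carrier: "\<phi> ` carrier (milnor_algebra f) = fsupp D"
    and coord_Ker: "\<phi> ` milnor_Ker f = fsupp K"
    and coord_Im: "\<phi> ` milnor_Im f = fsupp L"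
    and B_complement: "Im_complement f B"
    and coord_B: "\<phi> ` B = fsupp (L - K)"
    and f_0: "f 0 = 0" and partial_0: "\<And>i. mseries_partial i f 0 = 0"
    and monom_vanish: "\<And>i k. N \<le> k \<Longrightarrow> mmonom (unitv i k) \<in> jacobian_ideal f"

section \<open>Existence of coordinates and of complements\<close>

lemma representation_image:
  assumes "fs.independent D" "finite D" "S \<subseteq> D"
  shows "fs.representation D ` fs.span S = fsupp S"
proof (intro equalityI subsetI)
  fix y assume "y \<in> fs.representation D ` fs.span S"
  then obtain x where x: "x \<in> fs.span S" "y = fs.representation D x" by blast
  have "x \<in> fs.span D" using fs.span_mono[OF assms(3)] x(1) by blast
  then show "y \<in> fsupp S" unfolding x(2) using representation_span_iff[OF assms] x(1) by blast
next
  fix y assume y: "y \<in> fsupp S"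
  have fin: "finite S" by (rule finite_subset[OF assms(3,2)])
  let ?x = "\<Sum>b\<in>S. fscale (y b) b"
  have x: "?x \<in> fs.span S" by (intro fs.span_sum fs.span_scale fs.span_base)
  have "fs.representation D ?x = y"
  proof (rule fs.representation_eqI[OF assms(1)])
    show "?x \<in> fs.span D" using fs.span_mono[OF assms(3)] x by blast
    show "\<And>b. y b \<noteq> 0 \<Longrightarrow> b \<in> D" using fsuppD[OF y] assms(3) by blast
    have sub: "{b. y b \<noteq> 0} \<subseteq> S" using fsuppD[OF y] by blast
    then show "finite {b. y b \<noteq> 0}" using fin by (rule finite_subset)
    show "(\<Sum>b | y b \<noteq> 0. fscale (y b) b) = ?x"
      using sub fin by (intro sum.mono_neutral_left) auto
  qed
  then show "y \<in> fs.representation D ` fs.span S" by (rule image_eqI[OF sym x])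
qed

lemma flinear_box_part: "flinear (box_part N)"
  by (rule flinearI) (auto simp: box_part_def fun_eq_iff fscale_apply)

lemma convergent_box_part: "convergent_mseries (box_part N h)"
  by (rule convergent_finite_support, rule finite_subset[OF _ finite_ebox[of N]]) (auto simp: box_part_def)

lemma isolatedD:
  assumes "isolated_hypersurface_singularity f"
  shows "convergent_mseries f" "f 0 = 0" "mseries_partial i f 0 = 0"
  using assms by (auto simp: isolated_hypersurface_singularity_def conv_series_simps mseries_eval_0)

text \<open>A convergent series is congruent to its truncation to the box. So \<open>\<psi>\<close>
  can be truncation followed by the projection of the finite-dimensional space of truncations modulo
  its part in the Jacobian ideal.\<close>

lemma exists_jacobian_coordinates:
  fixes f :: "'n::finite mseries"
  assumes iso: "isolated_hypersurface_singularity f"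
  obtains \<psi> :: "'n mseries \<Rightarrow> 'n mseries" and T N
  where "jacobian_coordinates f \<psi>" "range \<psi> \<subseteq> fs.span T" "finite T"
    "range \<psi> = \<psi> ` {h. convergent_mseries h}"
    "\<And>i k. N \<le> k \<Longrightarrow> mmonom (unitv i k) \<in> jacobian_ideal f"
proof -
  note f = isolatedD[OF iso]
  note J = jacobian_ideal_ideal[OF f(1)]
  obtain N where N: "\<And>i k. N \<le> k \<Longrightarrow> mmonom (unitv i k) \<in> jacobian_ideal f"
    "\<And>h. convergent_mseries h \<Longrightarrow> h - box_part N h \<in> jacobian_ideal f"
    using jacobian_ideal_contains_high_order[OF iso] box_part_mod_ideal[OF J] by (metis order_refl)
  let ?X = "fsupp (ebox N) :: 'n mseries set"
  have fin: "finite (dirac ` (ebox N :: ('n \<Rightarrow> nat) set))" by (simp add: finite_ebox)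
  have X: "?X = fs.span (dirac ` ebox N)" by (rule fsupp_eq_span[OF finite_ebox])
  obtain \<pi> :: "'n mseries \<Rightarrow> 'n mseries" where \<pi>: "flinear \<pi>" "\<And>x. x \<in> ?X \<Longrightarrow> \<pi> x = 0 \<longleftrightarrow> x \<in> jacobian_ideal f \<inter> ?X"
    using exists_linear_with_kernel[OF fs.subspace_inter[OF conv_ideal_subspace[OF J] subspace_fsupp]
          Int_lower2 subspace_fsupp equalityD1[OF X] fin] by blast
  define \<psi> where "\<psi> = (\<lambda>h. \<pi> (box_part N h))"
  have lin: "flinear \<psi>" unfolding \<psi>_def by (rule flinear_compose[OF \<pi>(1) flinear_box_part])
  have box: "box_part N h \<in> ?X" for h by (simp add: box_part_def fsupp_def)
  have "\<psi> h = 0 \<longleftrightarrow> h \<in> jacobian_ideal f" if h: "convergent_mseries h" for h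
  proof -
    have "\<psi> h = 0 \<longleftrightarrow> box_part N h \<in> jacobian_ideal f" unfolding \<psi>_def using \<pi>(2)[OF box] box by blast
    also have "\<dots> \<longleftrightarrow> h \<in> jacobian_ideal f"
      using conv_ideal_add[OF J N(2)[OF h], of "box_part N h"] conv_ideal_diff[OF J _ N(2)[OF h], of h]
      by auto
    finally show ?thesis .
  qed
  moreover have "mseries_const 1 \<notin> jacobian_ideal f"
    using jacobian_ideal_maximal[OF f(1,3)] one_notin_maximal by blast
  ultimately have "jacobian_coordinates f \<psi>" using f(1) lin by (intro jacobian_coordinates.intro)
  moreover have "range \<psi> \<subseteq> fs.span (\<pi> ` dirac ` ebox N)"
  proof -
    have "\<psi> h \<in> \<pi> ` ?X" for h unfolding \<psi>_def by (rule imageI[OF box])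
    then show ?thesis unfolding X span_image[OF \<pi>(1)] by blast
  qed
  moreover have "finite (\<pi> ` dirac ` (ebox N :: ('n \<Rightarrow> nat) set))" using fin by (rule finite_imageI)
  \<comment> \<open>Formal series contribute no further values, since \<open>\<psi>\<close> sees
    only their truncations, which are polynomials.\<close>
  moreover have "range \<psi> = \<psi> ` {h. convergent_mseries h}"
  proof -
    have "box_part N (box_part N h) = box_part N h" for h :: "'n mseries" by (auto simp: box_part_def)
    then have bx: "\<psi> h = \<psi> (box_part N h)" for h unfolding \<psi>_def by (simp only:)
    have "\<psi> h \<in> \<psi> ` {h. convergent_mseries h}" for h
      by (subst bx) (rule imageI, simp add: convergent_box_part)
    then show ?thesis by (intro equalityI image_subsetI image_mono subset_UNIV)
  qed
  ultimately show ?thesis by (rule that) (rule N(1))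
qed

context jacobian_coordinates
begin

text \<open>Carries the complement condition over to the function space. The forward direction
  serves a given complement, the backward one the construction of a complement.\<close>

lemma Im_complement_iff:
  "Im_complement f B \<longleftrightarrow> B \<subseteq> milnor_Im f \<and> fs.subspace (\<phi> ` B) \<and>
     (\<forall>x\<in>\<phi> ` B. x \<in> \<phi> ` milnor_Ker f \<longrightarrow> x = 0) \<and>
     (\<forall>x\<in>\<phi> ` milnor_Im f. \<exists>y\<in>\<phi> ` B. \<exists>z\<in>\<phi> ` milnor_Ker f \<inter> \<phi> ` milnor_Im f. x = y + z)"
  (is "?L \<longleftrightarrow> ?R")
proof -
  let ?M = "milnor_algebra f" and ?W = "milnor_Im f \<inter> milnor_Ker f"
  have zero: "\<phi> \<zero>\<^bsub>?M\<^esub> = 0"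
    unfolding milnor_algebra_eq Quot_simps(5) conv_series_simps \<phi>_conv[OF convergent_0] by (rule flinear_0[OF linear])
  have zeroM: "\<zero>\<^bsub>?M\<^esub> \<in> carrier ?M" unfolding milnor_algebra_eq by (rule Q.zero_closed)
  have add: "\<phi> (X \<oplus>\<^bsub>?M\<^esub> Y) = \<phi> X + \<phi> Y" "X \<oplus>\<^bsub>?M\<^esub> Y \<in> carrier ?M"
    if "X \<in> carrier ?M" "Y \<in> carrier ?M" for X Y
    using that \<phi>_add Q.add.m_closed unfolding milnor_algebra_eq by blast+
  show ?thesis
  proof
    assume ?L
    then have sub: "subalgebra (range (milnor_scalar f)) B ?M" and BI: "B \<subseteq> milnor_Im f"
      and disj: "B \<inter> ?W = {\<zero>\<^bsub>?M\<^esub>}" and sum: "B <+>\<^bsub>?M\<^esub> ?W = milnor_Im f"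
      unfolding Im_complement_def vs_complement_def by blast+
    have Bc: "B \<subseteq> carrier ?M" using BI Im_subset by blast
    have 1: "fs.subspace (\<phi> ` B)"
    proof (rule Q.subspace_linear_image)
      show "subalgebra (range s) B (conv_series Quot J)" using sub unfolding milnor_scalar_eq milnor_algebra_eq .
      have c: "X \<in> carrier (conv_series Quot J)" if "X \<in> B" for X using that Bc by (auto simp: milnor_algebra_eq)
      show "\<phi> (X \<oplus>\<^bsub>conv_series Quot J\<^esub> Y) = \<phi> X + \<phi> Y" if "X \<in> B" "Y \<in> B" for X Y
        by (rule \<phi>_add[OF c[OF that(1)] c[OF that(2)]])
      show "\<phi> (s c \<otimes>\<^bsub>conv_series Quot J\<^esub> X) = fscale c (\<phi> X)" if "X \<in> B" for c X
        by (rule \<phi>_scale[OF c[OF that]])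
    qed
    have 2: "x = 0" if x: "x \<in> \<phi> ` B" "x \<in> \<phi> ` milnor_Ker f" for x
    proof -
      obtain X Y where XY: "X \<in> B" "Y \<in> milnor_Ker f" "x = \<phi> X" "\<phi> X = \<phi> Y" using x by auto
      then have "X = Y" using inj[of X Y] Bc Ker_subset by blast
      then have "X \<in> B \<inter> ?W" using XY BI by blast
      then show ?thesis using disj XY(3) zero by simp
    qed
    have 3: "\<exists>y\<in>\<phi> ` B. \<exists>z\<in>\<phi> ` milnor_Ker f \<inter> \<phi> ` milnor_Im f. x = y + z" if x: "x \<in> \<phi> ` milnor_Im f" for x
    proof -
      obtain X where X: "X \<in> milnor_Im f" "x = \<phi> X" using x by blast
      have "X \<in> B <+>\<^bsub>?M\<^esub> ?W" by (rule subst[OF sum[symmetric], of "\<lambda>S. X \<in> S", OF X(1)])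
      then obtain Y Z where YZ: "Y \<in> B" "Z \<in> ?W" "X = Y \<oplus>\<^bsub>?M\<^esub> Z" unfolding set_add_def' by blast
      have "x = \<phi> Y + \<phi> Z" unfolding X(2) YZ(3)
        by (rule add(1)) (use YZ(1,2) Bc Im_subset in auto)
      then show ?thesis using YZ(1,2) by blast
    qed
    show ?R using BI 1 2 3 by blast
  next
    assume R: ?R
    then have BI: "B \<subseteq> milnor_Im f" and Bs: "fs.subspace (\<phi> ` B)" by blast+
    have Bc: "B \<subseteq> carrier ?M" using BI Im_subset by blast
    have sub: "subalgebra (range (milnor_scalar f)) B ?M" by (rule subalgebra_of_subspace[OF Bc Bs])
    have mem: "X \<in> V" if "X \<in> carrier ?M" "\<phi> X \<in> \<phi> ` V" "V \<subseteq> carrier ?M" for X V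
      using that inj by auto
    have zB: "\<zero>\<^bsub>?M\<^esub> \<in> B" by (rule mem[OF zeroM _ Bc]) (use zero fs.subspace_0[OF Bs] in simp)
    have zK: "\<zero>\<^bsub>?M\<^esub> \<in> milnor_Ker f"
      by (rule mem[OF zeroM _ Ker_subset]) (use zero fs.subspace_0[OF subspace_\<phi>_Ker] in simp)
    have disj: "B \<inter> ?W = {\<zero>\<^bsub>?M\<^esub>}"
    proof
      show "B \<inter> ?W \<subseteq> {\<zero>\<^bsub>?M\<^esub>}"
      proof
        fix X assume X: "X \<in> B \<inter> ?W"
        then have "\<phi> X = 0" using R by blast
        then show "X \<in> {\<zero>\<^bsub>?M\<^esub>}" using X Bc zeroM zero inj[of X "\<zero>\<^bsub>?M\<^esub>"] by auto
      qed
    qed (use zB zK BI in blast)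
    have "B <+>\<^bsub>?M\<^esub> ?W = milnor_Im f"
    proof (intro equalityI subsetI)
      fix X assume "X \<in> B <+>\<^bsub>?M\<^esub> ?W"
      then obtain Y Z where YZ: "Y \<in> B" "Z \<in> ?W" "X = Y \<oplus>\<^bsub>?M\<^esub> Z" unfolding set_add_def' by blast
      then have c: "Y \<in> carrier ?M" "Z \<in> carrier ?M" using Bc Ker_subset by blast+
      have "\<phi> X \<in> \<phi> ` milnor_Im f"
        unfolding YZ(3) add(1)[OF c] using YZ BI by (intro fs.subspace_add[OF subspace_\<phi>_Im] imageI) auto
      moreover have "X \<in> carrier ?M" unfolding YZ(3) by (rule add(2)[OF c])
      ultimately show "X \<in> milnor_Im f" by (intro mem[OF _ _ Im_subset])
    next
      fix X assume X: "X \<in> milnor_Im f"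
      then obtain Y Z Z' where YZ: "Y \<in> B" "Z \<in> milnor_Ker f" "Z' \<in> milnor_Im f" "\<phi> Z = \<phi> Z'" "\<phi> X = \<phi> Y + \<phi> Z"
        using R by blast
      then have "Z = Z'" using inj[of Z Z'] Ker_subset Im_subset by blast
      then have Z: "Z \<in> ?W" using YZ by blast
      have c: "Y \<in> carrier ?M" "Z \<in> carrier ?M" "X \<in> carrier ?M" using YZ(1,2) X Bc Ker_subset Im_subset by blast+
      have "X = Y \<oplus>\<^bsub>?M\<^esub> Z" using inj[OF c(3) add(2)[OF c(1,2)]] add(1)[OF c(1,2)] YZ(5) by simp
      then show "X \<in> B <+>\<^bsub>?M\<^esub> ?W" unfolding set_add_def' using YZ(1) Z by blast
    qed
    then show ?L unfolding Im_complement_def vs_complement_def using sub BI disj by blast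
  qed
qed

end

lemma fsupp_Int: "fsupp S \<inter> fsupp T = fsupp (S \<inter> T)"
  by (auto simp: fsupp_def)

lemma fsupp_span: "finite D \<Longrightarrow> fsupp D \<subseteq> fs.span (dirac ` D)"
  by (simp only: fsupp_eq_span order_refl)

text \<open>Supplies the complements needed for the two inequalities, which are proved in
  coordinates adapted to some complement.\<close>

lemma exists_Im_complement:
  fixes f :: "'n::finite mseries"
  assumes iso: "isolated_hypersurface_singularity f"
  obtains B where "Im_complement f B"
proof -
  obtain \<psi>0 :: "'n mseries \<Rightarrow> 'n mseries" and T N where c0: "jacobian_coordinates f \<psi>0" and T: "range \<psi>0 \<subseteq> fs.span T" "finite T"
    "range \<psi>0 = \<psi>0 ` {h. convergent_mseries h}"
    and N: "\<And>i k. N \<le> k \<Longrightarrow> mmonom (unitv i k) \<in> jacobian_ideal f"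
    by (rule exists_jacobian_coordinates[OF iso]) (rule that)
  interpret c0: jacobian_coordinates f \<psi>0 by (rule c0)
  let ?P = "c0.\<phi> ` milnor_Ker f" and ?Q = "c0.\<phi> ` milnor_Im f"
  have "?Q \<subseteq> c0.\<phi> ` carrier (milnor_algebra f)" by (rule image_mono[OF c0.Im_subset])
  then have QT: "?Q \<subseteq> fs.span T" using T(1,3) unfolding c0.\<phi>_carrier by blast
  have W: "fs.subspace (?P \<inter> ?Q)" by (rule fs.subspace_inter[OF c0.subspace_\<phi>_Ker c0.subspace_\<phi>_Im])
  have WT: "?P \<inter> ?Q \<subseteq> fs.span T" using QT by blast
  obtain b where b: "finite b" "fs.independent b" "?P \<inter> ?Q = fs.span b"
    using finite_basis[OF W WT T(2)] by blast
  obtain b' where b': "b \<subseteq> b'" "finite b'" "fs.independent b'" "?Q = fs.span b'"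
    using finite_basis_extend[OF W Int_lower2 c0.subspace_\<phi>_Im QT T(2) b(2,3)] by blast
  \<comment> \<open>The new vectors of a basis of the image that extends a basis of the intersection
    span the complement.\<close>
  define R where "R = fs.span (b' - b)"
  have un: "b \<union> (b' - b) = b'" using b'(1) by blast
  have RQ: "R \<subseteq> ?Q" unfolding R_def b'(4) by (rule fs.span_mono) blast
  define B where "B = {X \<in> milnor_Im f. c0.\<phi> X \<in> R}"
  have BR: "c0.\<phi> ` B = R" using RQ unfolding B_def by blast
  have "Im_complement f B"
    unfolding c0.Im_complement_iff BR
  proof (intro conjI ballI impI)
    show "B \<subseteq> milnor_Im f" by (auto simp: B_def)
    show "fs.subspace R" unfolding R_def by (rule fs.subspace_span)
    show "x = 0" if "x \<in> R" "x \<in> ?P" for x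
    proof -
      have "x \<in> fs.span b" unfolding b(3)[symmetric] using that RQ by blast
      moreover have "fs.independent (b \<union> (b' - b))" using b'(3) un by simp
      ultimately show ?thesis
        using span_Int_of_independent_Un[of b "b' - b" x] that(1) unfolding R_def by blast
    qed
    show "\<exists>y\<in>R. \<exists>z\<in>?P \<inter> ?Q. x = y + z" if "x \<in> ?Q" for x
    proof -
      have "x \<in> fs.span (b \<union> (b' - b))" using that unfolding b'(4) un .
      then obtain z y where "x = z + y" "z \<in> fs.span b" "y \<in> R" unfolding fs.span_Un R_def by blast
      then show ?thesis unfolding b(3) by (metis add.commute)
    qed
  qed
  then show ?thesis by (rule that)
qed

text \<open>The values of \<open>\<psi>0\<close> are re-expressed in a basis \<open>D\<close>
  adapted to the three subspaces. The basis vectors serve as indices; being functions of exponents,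
  they are themselves of the type of series.\<close>

theorem exists_milnor_coordinates:
  fixes f :: "'n::finite mseries"
  assumes iso: "isolated_hypersurface_singularity f" and compl: "Im_complement f B"
  obtains \<psi> :: "'n mseries \<Rightarrow> ('n mseries \<Rightarrow> complex)" and D K L N
  where "milnor_coordinates f \<psi> D K L N B"
proof -
  obtain \<psi>0 :: "'n mseries \<Rightarrow> 'n mseries" and T N where c0: "jacobian_coordinates f \<psi>0" and T: "range \<psi>0 \<subseteq> fs.span T" "finite T"
    "range \<psi>0 = \<psi>0 ` {h. convergent_mseries h}"
    and N: "\<And>i k. N \<le> k \<Longrightarrow> mmonom (unitv i k) \<in> jacobian_ideal f"
    by (rule exists_jacobian_coordinates[OF iso]) (rule that)
  interpret c0: jacobian_coordinates f \<psi>0 by (rule c0)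
  let ?M = "milnor_algebra f"
  have B: "B \<subseteq> milnor_Im f" "fs.subspace (c0.\<phi> ` B)"
    "\<And>x. x \<in> c0.\<phi> ` B \<Longrightarrow> x \<in> c0.\<phi> ` milnor_Ker f \<Longrightarrow> x = 0"
    "\<And>x. x \<in> c0.\<phi> ` milnor_Im f \<Longrightarrow> \<exists>y\<in>c0.\<phi> ` B. \<exists>z\<in>c0.\<phi> ` milnor_Ker f \<inter> c0.\<phi> ` milnor_Im f. x = y + z"
    using compl unfolding c0.Im_complement_iff by blast+
  have carr: "c0.\<phi> ` carrier ?M = range \<psi>0" unfolding c0.\<phi>_carrier T(3) ..
  have XT: "c0.\<phi> ` carrier ?M \<subseteq> fs.span T" unfolding carr by (rule T(1))
  obtain D K L where D: "finite D" "K \<subseteq> D" "L \<subseteq> D" "fs.independent D" "c0.\<phi> ` carrier ?M = fs.span D"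
    "c0.\<phi> ` milnor_Ker f = fs.span K" "c0.\<phi> ` milnor_Im f = fs.span L" "c0.\<phi> ` B = fs.span (L - K)"
    using adapted_basis[OF c0.subspace_\<phi>_carrier XT T(2) c0.subspace_\<phi>_Ker c0.subspace_\<phi>_Im B(2)
        image_mono[OF c0.Ker_subset] image_mono[OF c0.Im_subset] image_mono[OF B(1)] B(3,4)] by blast
  define \<psi> where "\<psi> h = fs.representation D (\<psi>0 h)" for h
  have in_span: "\<psi>0 h \<in> fs.span D" for h using D(5) carr by blast
  have lin: "flinear \<psi>"
  proof (rule flinearI)
    show "\<psi> (x + y) = \<psi> x + \<psi> y" for x y
      unfolding \<psi>_def flinear_add[OF c0.linear] fs.representation_add[OF D(4) in_span in_span]
      by (rule ext) simp
    show "\<psi> (fscale c x) = fscale c (\<psi> x)" for c x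
      unfolding \<psi>_def flinear_scale[OF c0.linear] fs.representation_scale[OF D(4) in_span]
      by (rule ext) (simp add: fscale_apply)
  qed
  have ker: "\<psi> h = 0 \<longleftrightarrow> h \<in> jacobian_ideal f" if "convergent_mseries h" for h
  proof -
    have "\<psi> h = 0 \<longleftrightarrow> \<psi> h \<in> fsupp {}" by (auto simp: fsupp_def fun_eq_iff)
    also have "\<dots> \<longleftrightarrow> \<psi>0 h \<in> fs.span {}"
      unfolding \<psi>_def by (rule representation_span_iff[OF D(4,1) empty_subsetI in_span, symmetric])
    also have "\<dots> \<longleftrightarrow> h \<in> jacobian_ideal f" using c0.kernel[OF that] by (simp add: fs.span_empty)
    finally show ?thesis .
  qed
  have c: "jacobian_coordinates f \<psi>"
    by (intro jacobian_coordinates.intro c0.conv_f c0.proper_jacobian lin ker)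
  interpret c: jacobian_coordinates f \<psi> by (rule c)
  have \<phi>: "c.\<phi> ` V = fs.representation D ` (c0.\<phi> ` V)" if "V \<subseteq> carrier ?M" for V
  proof -
    have "c.\<phi> X = fs.representation D (c0.\<phi> X)" if X: "X \<in> carrier ?M" for X
    proof -
      obtain h where h: "convergent_mseries h" "X = jacobian_ideal f +>\<^bsub>conv_series\<^esub> h"
        using X unfolding c.milnor_carrier by blast
      show ?thesis unfolding h(2) c.\<phi>_conv[OF h(1)] c0.\<phi>_conv[OF h(1)] \<psi>_def ..
    qed
    then show ?thesis unfolding image_image using that by (intro image_cong) auto
  qed
  have BM: "B \<subseteq> carrier ?M" using B(1) c0.Im_subset by blast
  have "milnor_coordinates f \<psi> D K L N B"
  proof (intro milnor_coordinates.intro c milnor_coordinates_axioms.intro D(1-3) compl)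
    show "c.\<phi> ` carrier ?M = fsupp D"
      unfolding \<phi>[OF order_refl] D(5) by (rule representation_image[OF D(4,1) order_refl])
    show "c.\<phi> ` milnor_Ker f = fsupp K"
      unfolding \<phi>[OF c0.Ker_subset] D(6) by (rule representation_image[OF D(4,1,2)])
    show "c.\<phi> ` milnor_Im f = fsupp L"
      unfolding \<phi>[OF c0.Im_subset] D(7) by (rule representation_image[OF D(4,1,3)])
    have "L - K \<subseteq> D" using D(3) by blast
    then show "c.\<phi> ` B = fsupp (L - K)"
      unfolding \<phi>[OF BM] D(8) by (rule representation_image[OF D(4,1)])
    show "f 0 = 0" "mseries_partial i f 0 = 0" for i using isolatedD[OF iso] by auto
    show "mmonom (unitv i k) \<in> jacobian_ideal f" if "N \<le> k" for i k by (rule N[OF that])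
  qed
  then show ?thesis by (rule that)
qed

section \<open>Milnor number, Tjurina number and multiplication matrices\<close>

context jacobian_coordinates
begin

lemma quot_dim_eq:
  assumes "V \<subseteq> carrier (milnor_algebra f)" "fs.subspace (\<phi> ` V)" "\<phi> ` V \<subseteq> fs.span T" "finite T"
  shows "quot_dim J V = fs.dim (\<phi> ` V)"
proof -
  have "subalgebra (range s) V (conv_series Quot J)"
    using subalgebra_of_subspace[OF assms(1,2)] unfolding milnor_scalar_eq milnor_algebra_eq .
  from dim_eq[OF this assms(3,4)] show ?thesis unfolding quot_dim_def quot_scalar_def .
qed

text \<open>The Tjurina algebra is the cokernel of multiplication by \<open>f\<close> on the Milnor
  algebra, so its dimension is the Milnor number minus the rank. Its coordinates are
  \<open>\<psi>\<close> followed by a map \<open>\<pi>\<close> that kills exactly the image.\<close>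

theorem tjurina_number_eq:
  assumes D: "finite D" "\<phi> ` carrier (milnor_algebra f) = fsupp D"
    and f0: "f 0 = 0" "\<And>i. mseries_partial i f 0 = 0"
  shows "int (tjurina_number f) = int (card D) - int (fs.dim (\<phi> ` milnor_Im f))"
proof -
  let ?W = "\<phi> ` milnor_Im f"
  let ?T = "tjurina_ideal f"
  note span = fsupp_span[OF D(1)] and fin = finite_imageI[OF D(1), of dirac]
  have WD: "?W \<subseteq> fsupp D" unfolding D(2)[symmetric] by (rule image_mono[OF Im_subset])
  obtain \<pi> :: "('i \<Rightarrow> complex) \<Rightarrow> ('i \<Rightarrow> complex)" where \<pi>: "flinear \<pi>" "\<And>x. x \<in> fsupp D \<Longrightarrow> \<pi> x = 0 \<longleftrightarrow> x \<in> ?W"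
    using exists_linear_with_kernel[OF subspace_\<phi>_Im WD subspace_fsupp span fin] by blast
  have \<psi>D: "\<psi> ` {h. convergent_mseries h} = fsupp D" using D(2) unfolding \<phi>_carrier .
  have TI: "ideal ?T conv_series" by (rule tjurina_ideal_eq(1)[OF conv_f])
  have ker: "\<pi> (\<psi> h) = 0 \<longleftrightarrow> h \<in> ?T" if h: "convergent_mseries h" for h
  proof -
    have hD: "\<psi> h \<in> fsupp D" using \<psi>D h by blast
    have "\<pi> (\<psi> h) = 0 \<longleftrightarrow> (\<exists>h'. convergent_mseries h' \<and> \<psi> h = \<psi> (mmul f h'))"
      unfolding \<pi>(2)[OF hD] \<phi>_Im by blast
    also have "\<dots> \<longleftrightarrow> h \<in> ?T"
    proof
      assume "\<exists>h'. convergent_mseries h' \<and> \<psi> h = \<psi> (mmul f h')"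
      then obtain h' where h': "convergent_mseries h'" "\<psi> h = \<psi> (mmul f h')" by blast
      have "convergent_mseries (h - mmul f h')"
        using fs.subspace_diff[OF subspace_convergent, of h "mmul f h'"] h convergent_mmul[OF conv_f h'(1)] by blast
      moreover have "\<psi> (h - mmul f h') = 0" by (simp only: flinear_diff[OF linear] h'(2) diff_self)
      ultimately have "h - mmul f h' \<in> J" using kernel by blast
      moreover have "h = mmul f h' + (h - mmul f h')" by (rule ext) simp
      ultimately show "h \<in> ?T" unfolding tjurina_ideal_eq(2)[OF conv_f] using h'(1) by blast
    next
      assume "h \<in> ?T"
      then obtain h' j where hj: "h = mmul f h' + j" "convergent_mseries h'" "j \<in> J"
        unfolding tjurina_ideal_eq(2)[OF conv_f] by blast
      have "\<psi> j = 0" using kernel[OF conv_ideal_convergent[OF J hj(3)]] hj(3) by simp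
      then have "\<psi> h = \<psi> (mmul f h')" unfolding hj(1) flinear_add[OF linear] by (simp only: add_0_right)
      then show "\<exists>h'. convergent_mseries h' \<and> \<psi> h = \<psi> (mmul f h')" using hj(2) by blast
    qed
    finally show ?thesis .
  qed
  have \<pi>\<psi>: "flinear (\<lambda>h. \<pi> (\<psi> h))" by (rule flinear_compose[OF \<pi>(1) linear])
  have proper: "mseries_const 1 \<notin> ?T"
    using tjurina_ideal_maximal[OF conv_f f0(2,1)] one_notin_maximal by blast
  interpret t: coordinate_quotient ?T conv_series mseries_const "\<lambda>h. \<pi> (\<psi> h)"
  proof (rule coordinate_quotient.intro[OF TI cring_conv_series], unfold_locales)
    show "\<pi> (\<psi> (x \<oplus>\<^bsub>conv_series\<^esub> y)) = \<pi> (\<psi> x) + \<pi> (\<psi> y)" for x y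
      unfolding conv_series_simps by (rule flinear_add[OF \<pi>\<psi>])
    show "\<pi> (\<psi> (mseries_const c \<otimes>\<^bsub>conv_series\<^esub> x)) = fscale c (\<pi> (\<psi> x))" for c x
      unfolding conv_series_simps mmul_const_fscale by (rule flinear_scale[OF \<pi>\<psi>])
    show "(\<pi> (\<psi> x) = 0) = (x \<in> ?T)" if "x \<in> carrier conv_series" for x
      using ker that by (simp add: conv_series_simps)
  qed (use proper \<sigma>_add \<sigma>_mult in \<open>auto simp: conv_series_simps(1,3)\<close>)
  have im: "t.\<phi> ` carrier (conv_series Quot ?T) = \<pi> ` fsupp D"
    unfolding t.\<phi>_image_carrier conv_series_simps(1) \<psi>D[symmetric] image_image ..
  have "tjurina_number f = fs.dim (\<pi> ` fsupp D)"
    unfolding tjurina_number_def quot_dim_def quot_scalar_def im[symmetric]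
  proof (rule t.dim_eq)
    show "subalgebra (range t.s) (carrier (conv_series Quot ?T)) (conv_series Quot ?T)"
      by (rule t.Q.carrier_is_subalgebra) auto
    show "t.\<phi> ` carrier (conv_series Quot ?T) \<subseteq> fs.span (\<pi> ` dirac ` D)"
      unfolding im span_image[OF \<pi>(1)] by (rule image_mono[OF span])
    show "finite (\<pi> ` dirac ` D)" by (rule finite_imageI[OF fin])
  qed
  moreover have "fs.dim (fsupp D) = fs.dim (\<pi> ` fsupp D) + fs.dim {x \<in> fsupp D. \<pi> x = 0}"
    by (rule rank_nullity[OF \<pi>(1) subspace_fsupp span fin])
  moreover have "{x \<in> fsupp D. \<pi> x = 0} = ?W" using \<pi>(2) WD by blast
  ultimately show ?thesis using dim_fsupp[OF D(1)] by simp
qed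

end

context milnor_coordinates
begin

lemma finite_KL: "finite K" "finite L"
  using finite_subset[OF K_subset finite_D] finite_subset[OF L_subset finite_D] .

lemma \<psi>_image: "\<psi> ` {h. convergent_mseries h} = fsupp D"
  using coord_carrier unfolding \<phi>_carrier .

lemma milnor_number_eq: "milnor_number f = card D"
proof -
  have "quot_dim J (carrier (milnor_algebra f)) = fs.dim (\<phi> ` carrier (milnor_algebra f))"
    by (rule quot_dim_eq[OF order_refl subspace_\<phi>_carrier, of "dirac ` D"])
       (unfold coord_carrier, rule fsupp_span[OF finite_D], rule finite_imageI[OF finite_D])
  then show ?thesis unfolding milnor_number_def coord_carrier dim_fsupp[OF finite_D] .
qed

lemma nu1_eq: "nu1 f = card (K \<inter> L)"
proof -
  let ?V = "milnor_Ker f \<inter> milnor_Im f"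
  have im: "\<phi> ` ?V = fsupp (K \<inter> L)"
    unfolding fsupp_Int[symmetric] coord_Ker[symmetric] coord_Im[symmetric]
    using inj Ker_subset Im_subset by (intro inj_on_image_Int[of \<phi> "carrier (milnor_algebra f)"]) (auto simp: inj_on_def)
  have fin: "finite (K \<inter> L)" using finite_KL by blast
  have "quot_dim J ?V = fs.dim (\<phi> ` ?V)"
    by (rule quot_dim_eq[of _ "dirac ` (K \<inter> L)"])
       (use Ker_subset fin in \<open>auto simp: im subspace_fsupp fsupp_span[OF fin, THEN subsetD]\<close>)
  then show ?thesis unfolding nu1_def im dim_fsupp[OF fin] .
qed

lemma tjurina_eq: "int (tjurina_number f) = int (card D) - int (card L)"
  using tjurina_number_eq[OF finite_D coord_carrier f_0 partial_0]
  unfolding coord_Im dim_fsupp[OF finite_KL(2)] .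

text \<open>Convergent representatives of the basis vectors; \<open>\<Lambda> g\<close> below is the
  matrix of multiplication by \<open>g\<close> in this basis.\<close>

definition e :: "'i \<Rightarrow> 'n mseries" where "e k = (SOME h. convergent_mseries h \<and> \<psi> h = dirac k)"

lemma e: "k \<in> D \<Longrightarrow> convergent_mseries (e k)" "k \<in> D \<Longrightarrow> \<psi> (e k) = dirac k"
proof -
  have "\<exists>h. convergent_mseries h \<and> \<psi> h = dirac k" if "k \<in> D"
    using dirac_in_fsupp[OF that] unfolding \<psi>_image[symmetric] by auto
  from someI_ex[OF this] show "k \<in> D \<Longrightarrow> convergent_mseries (e k)" "k \<in> D \<Longrightarrow> \<psi> (e k) = dirac k"
    unfolding e_def by blast+
qed

definition \<Lambda> :: "'n mseries \<Rightarrow> 'i \<Rightarrow> 'i \<Rightarrow> complex" where "\<Lambda> g i k = \<psi> (mmul g (e k)) i"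

lemma expansion_mod_J:
  assumes "convergent_mseries h"
  shows "convergent_mseries (\<Sum>k\<in>D. fscale (\<psi> h k) (e k))" "h - (\<Sum>k\<in>D. fscale (\<psi> h k) (e k)) \<in> J"
proof -
  let ?h = "\<Sum>k\<in>D. fscale (\<psi> h k) (e k)"
  show conv: "convergent_mseries ?h" by (intro convergent_sum convergent_fscale e(1))
  have hD: "\<psi> h \<in> fsupp D" using \<psi>_image assms by blast
  have "\<psi> ?h = (\<Sum>k\<in>D. fscale (\<psi> h k) (\<psi> (e k)))"
    by (simp only: flinear_sum[OF linear] flinear_scale[OF linear])
  also have "\<dots> = (\<Sum>k\<in>D. fscale (\<psi> h k) (dirac k))" by (rule sum.cong) (simp_all only: e(2))
  also have "\<dots> = \<psi> h" by (rule fsupp_expansion[OF finite_D hD, symmetric])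
  finally have "\<psi> (h - ?h) = 0" by (simp only: flinear_diff[OF linear] diff_self)
  moreover have "convergent_mseries (h - ?h)"
    using fs.subspace_diff[OF subspace_convergent] assms conv by blast
  ultimately show "h - ?h \<in> J" using kernel by blast
qed

lemma mult_matrix:
  assumes g: "convergent_mseries g" and h: "convergent_mseries h"
  shows "\<psi> (mmul g h) = mat_op D (\<Lambda> g) (\<psi> h)"
proof -
  let ?h = "\<Sum>k\<in>D. fscale (\<psi> h k) (e k)"
  have "mmul g (h - ?h) \<in> J" by (rule conv_ideal_mult[OF J expansion_mod_J(2)[OF h] g])
  then have "\<psi> (mmul g (h - ?h)) = 0" using kernel conv_ideal_convergent[OF J] by blast
  then have "\<psi> (mmul g h) = \<psi> (mmul g ?h)"
    by (simp only: flinear_diff[OF flinear_mmul] flinear_diff[OF linear] eq_iff_diff_eq_0[symmetric])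
  also have "\<dots> = (\<Sum>k\<in>D. fscale (\<psi> h k) (\<psi> (mmul g (e k))))"
    by (simp only: flinear_sum[OF flinear_mmul] flinear_scale[OF flinear_mmul] flinear_sum[OF linear] flinear_scale[OF linear])
  finally show ?thesis
    by (simp add: fun_eq_iff sum_fun_apply fscale_apply mat_op_def \<Lambda>_def mult.commute)
qed

sublocale A: kernel_image_coordinates D K L "\<Lambda> f"
proof
  show "finite D" "K \<subseteq> D" "L \<subseteq> D" by (fact finite_D K_subset L_subset)+
  have "mat_op D (\<Lambda> f) ` fsupp D = (\<lambda>h. \<psi> (mmul f h)) ` {h. convergent_mseries h}"
    unfolding \<psi>_image[symmetric] image_image by (rule image_cong) (auto simp: mult_matrix[OF conv_f])
  also have "\<dots> = fsupp L" using coord_Im unfolding \<phi>_Im image_image .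
  finally show "mat_op D (\<Lambda> f) ` fsupp D = fsupp L" .
  show "mat_op D (\<Lambda> f) v = (\<lambda>_. 0) \<longleftrightarrow> v \<in> fsupp K" if v: "v \<in> fsupp D" for v
  proof -
    obtain h where h: "convergent_mseries h" "v = \<psi> h" using v unfolding \<psi>_image[symmetric] by blast
    have "mat_op D (\<Lambda> f) v = (\<lambda>_. 0) \<longleftrightarrow> \<psi> (mmul f h) = 0"
      unfolding h(2) mult_matrix[OF conv_f h(1)] zero_fun_def ..
    also have "\<dots> \<longleftrightarrow> v \<in> \<phi> ` milnor_Ker f"
    proof
      assume "v \<in> \<phi> ` milnor_Ker f"
      then obtain h' where h': "convergent_mseries h'" "\<psi> (mmul f h') = 0" "v = \<psi> h'" unfolding \<phi>_Ker by blast
      \<comment> \<open>\<open>h\<close> and \<open>h'\<close> may differ, but they have the same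
        coordinates, and these determine the product.\<close>
      have "\<psi> (mmul f h) = \<psi> (mmul f h')"
        unfolding mult_matrix[OF conv_f h(1)] mult_matrix[OF conv_f h'(1)] h(2)[symmetric] h'(3)[symmetric] ..
      then show "\<psi> (mmul f h) = 0" using h'(2) by (simp only:)
    qed (use h in \<open>auto simp: \<phi>_Ker\<close>)
    finally show ?thesis unfolding coord_Ker .
  qed
qed

end

section \<open>Series in separate variables\<close>

definition left_part :: "('n + 'm \<Rightarrow> nat) \<Rightarrow> 'n \<Rightarrow> nat" where "left_part \<gamma> = (\<lambda>i. \<gamma> (Inl i))"
definition right_part :: "('n + 'm \<Rightarrow> nat) \<Rightarrow> 'm \<Rightarrow> nat" where "right_part \<gamma> = (\<lambda>j. \<gamma> (Inr j))"

lemma parts_case_sum [simp]: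
  "left_part (case_sum \<alpha> \<beta>) = \<alpha>" "right_part (case_sum \<alpha> \<beta>) = \<beta>"
  by (simp_all add: left_part_def right_part_def)

lemma case_sum_parts: "case_sum (left_part \<gamma>) (right_part \<gamma>) = \<gamma>"
  by (rule ext) (auto simp: left_part_def right_part_def split: sum.split)

lemma parts_add: "left_part (\<gamma> + \<delta>) = left_part \<gamma> + left_part \<delta>" "right_part (\<gamma> + \<delta>) = right_part \<gamma> + right_part \<delta>"
  by (auto simp: left_part_def right_part_def)

lemma case_sum_eq_iff: "case_sum \<alpha> \<beta> = \<gamma> \<longleftrightarrow> \<alpha> = left_part \<gamma> \<and> \<beta> = right_part \<gamma>"
  using case_sum_parts parts_case_sum by metis

lemma exponent_eq_iff: "\<gamma> = \<delta> \<longleftrightarrow> left_part \<gamma> = left_part \<delta> \<and> right_part \<gamma> = right_part \<delta>"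
  using case_sum_parts by metis

lemma mdeg_parts: "mdeg \<gamma> = mdeg (left_part \<gamma>) + mdeg (right_part \<gamma>)"
  for \<gamma> :: "'n::finite + 'm::finite \<Rightarrow> nat"
proof -
  have "mdeg \<gamma> = (\<Sum>i\<in>UNIV <+> UNIV. \<gamma> i)" by (simp add: mdeg_def UNIV_Plus_UNIV)
  also have "\<dots> = (\<Sum>i\<in>UNIV. \<gamma> (Inl i)) + (\<Sum>j\<in>UNIV. \<gamma> (Inr j))"
    by (subst sum.Plus) (simp_all add: comp_def)
  finally show ?thesis by (simp add: mdeg_def left_part_def right_part_def)
qed

lemma Inl_apply: "mseries_Inl g \<gamma> = (if right_part \<gamma> = 0 then g (left_part \<gamma>) else 0)"
  by (auto simp: mseries_Inl_def left_part_def right_part_def fun_eq_iff)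

lemma Inr_apply: "mseries_Inr g \<gamma> = (if left_part \<gamma> = 0 then g (right_part \<gamma>) else 0)"
  by (auto simp: mseries_Inr_def left_part_def right_part_def fun_eq_iff)

text \<open>The coefficient of \<open>y^\<beta>\<close>, as a series in \<open>x\<close>.
  Multiplication by a series in \<open>x\<close> alone acts on each of these coefficients
  separately.\<close>

definition lslice :: "('n + 'm) mseries \<Rightarrow> ('m \<Rightarrow> nat) \<Rightarrow> 'n mseries" where
  "lslice h \<beta> = (\<lambda>\<alpha>. h (case_sum \<alpha> \<beta>))"

definition rslice :: "('n + 'm) mseries \<Rightarrow> ('n \<Rightarrow> nat) \<Rightarrow> 'm mseries" where
  "rslice h \<alpha> = (\<lambda>\<beta>. h (case_sum \<alpha> \<beta>))"

text \<open>Serves the embeddings of the two sets of variables, with \<open>d = 0\<close>, and the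
  slices, with \<open>d\<close> the degree of the fixed exponent.\<close>

lemma convergent_reindex:
  fixes h :: "'a::finite mseries" and g :: "'b::finite mseries"
  assumes "convergent_mseries h"
    and inj: "inj_on \<tau> {\<gamma>. g \<gamma> \<noteq> 0}"
    and eq: "\<And>\<gamma>. g \<gamma> \<noteq> 0 \<Longrightarrow> g \<gamma> = h (\<tau> \<gamma>) \<and> mdeg (\<tau> \<gamma>) = mdeg \<gamma> + d"
  shows "convergent_mseries g"
proof -
  obtain r where r: "r > 0" "abs_summ (rescale r h)" using assms(1) by (auto simp: convergent_iff)
  have "abs_summ (rescale r g)"
  proof (rule abs_summableI(1)[where C = "(\<Sum>\<^sub>\<infinity>x. norm (rescale r h x)) / r ^ d"])
    fix F :: "('b \<Rightarrow> nat) set" assume F: "finite F"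
    let ?F = "{\<gamma> \<in> F. g \<gamma> \<noteq> 0}"
    have "(\<Sum>\<gamma>\<in>F. norm (rescale r g \<gamma>)) = (\<Sum>\<gamma>\<in>?F. norm (rescale r g \<gamma>))"
      using F by (intro sum.mono_neutral_right) (auto simp: rescale_def)
    also have "\<dots> = (\<Sum>\<gamma>\<in>?F. norm (rescale r h (\<tau> \<gamma>)) / r ^ d)"
    proof (rule sum.cong[OF refl])
      fix \<gamma> assume "\<gamma> \<in> ?F"
      then have "g \<gamma> = h (\<tau> \<gamma>)" "mdeg (\<tau> \<gamma>) = mdeg \<gamma> + d" using eq by auto
      then show "norm (rescale r g \<gamma>) = norm (rescale r h (\<tau> \<gamma>)) / r ^ d"
        using r(1) by (simp add: norm_rescale power_add)
    qed
    also have "\<dots> = (\<Sum>\<gamma>\<in>\<tau> ` ?F. norm (rescale r h \<gamma>)) / r ^ d"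
      unfolding sum_divide_distrib by (subst sum.reindex) (auto intro: inj_on_subset[OF inj])
    also have "\<dots> \<le> (\<Sum>\<^sub>\<infinity>x. norm (rescale r h x)) / r ^ d"
      using r F by (intro divide_right_mono abs_summable_finite_sum_le) auto
    finally show "(\<Sum>\<gamma>\<in>F. norm (rescale r g \<gamma>)) \<le> (\<Sum>\<^sub>\<infinity>x. norm (rescale r h x)) / r ^ d" .
  qed
  then show ?thesis using r(1) by (auto simp: convergent_iff)
qed

lemma mdeg_zero [simp]: "mdeg 0 = 0" by (simp add: mdeg_0_iff)

lemma convergent_Inl: "convergent_mseries g \<Longrightarrow> convergent_mseries (mseries_Inl g :: ('n::finite + 'm::finite) mseries)"
  by (erule convergent_reindex[where \<tau> = left_part and d = 0])
     (auto simp: Inl_apply inj_on_def exponent_eq_iff mdeg_parts split: if_splits)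

lemma convergent_Inr: "convergent_mseries g \<Longrightarrow> convergent_mseries (mseries_Inr g :: ('n::finite + 'm::finite) mseries)"
  by (erule convergent_reindex[where \<tau> = right_part and d = 0])
     (auto simp: Inr_apply inj_on_def exponent_eq_iff mdeg_parts split: if_splits)

lemma convergent_lslice: "convergent_mseries h \<Longrightarrow> convergent_mseries (lslice h \<beta>)"
  by (erule convergent_reindex[where \<tau> = "\<lambda>\<alpha>. case_sum \<alpha> \<beta>" and d = "mdeg \<beta>"])
     (auto simp: lslice_def inj_on_def case_sum_eq_iff mdeg_parts)

lemma convergent_rslice: "convergent_mseries h \<Longrightarrow> convergent_mseries (rslice h \<alpha>)"
  by (erule convergent_reindex[where \<tau> = "\<lambda>\<beta>. case_sum \<alpha> \<beta>" and d = "mdeg \<alpha>"])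
     (auto simp: rslice_def inj_on_def case_sum_eq_iff mdeg_parts)

text \<open>A splitting contributes only if its first part is free of \<open>y\<close>, and such
  splittings of \<open>case_sum \<alpha> \<beta>\<close> correspond to the splittings of
  \<open>\<alpha>\<close>.\<close>

lemma lslice_mmul_Inl:
  fixes g :: "'n::finite mseries" and h :: "('n + 'm::finite) mseries"
  shows "lslice (mmul (mseries_Inl g) h) \<beta> = mmul g (lslice h \<beta>)"
proof
  fix \<alpha> :: "'n \<Rightarrow> nat"
  let ?S = "(\<lambda>q. (case_sum (fst q) (0 :: 'm \<Rightarrow> nat), case_sum (snd q) \<beta>)) ` splittings \<alpha>"
  have "?S \<subseteq> splittings (case_sum \<alpha> \<beta>)"
    by (auto simp: splittings_def exponent_eq_iff parts_add)
  note sub = this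
  have zero: "mseries_Inl g (fst p) * h (snd p) = 0" if "p \<in> splittings (case_sum \<alpha> \<beta>) - ?S" for p
  proof (rule ccontr)
    assume "mseries_Inl g (fst p) * h (snd p) \<noteq> 0"
    then have r: "right_part (fst p) = 0" by (auto simp: Inl_apply split: if_splits)
    have "left_part (fst p) + left_part (snd p) = \<alpha>" "right_part (fst p) + right_part (snd p) = \<beta>"
      using that by (auto simp: splittings_def parts_add[symmetric])
    then have "p \<in> ?S" using r case_sum_parts[of "fst p"] case_sum_parts[of "snd p"]
      by (intro image_eqI[of _ _ "(left_part (fst p), left_part (snd p))"]) (auto simp: splittings_def)
    then show False using that by blast
  qed
  have "lslice (mmul (mseries_Inl g) h) \<beta> \<alpha> = (\<Sum>p\<in>?S. mseries_Inl g (fst p) * h (snd p))"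
    unfolding lslice_def mmul_def using zero by (intro sum.mono_neutral_right[OF finite_splittings sub] ballI)
  also have "\<dots> = (\<Sum>q\<in>splittings \<alpha>. g (fst q) * h (case_sum (snd q) \<beta>))"
    by (subst sum.reindex) (auto simp: inj_on_def case_sum_eq_iff Inl_apply prod_eq_iff)
  finally show "lslice (mmul (mseries_Inl g) h) \<beta> \<alpha> = mmul g (lslice h \<beta>) \<alpha>"
    by (simp add: mmul_def lslice_def)
qed

lemma rslice_mmul_Inr:
  fixes g :: "'m::finite mseries" and h :: "('n::finite + 'm) mseries"
  shows "rslice (mmul (mseries_Inr g) h) \<alpha> = mmul g (rslice h \<alpha>)"
proof
  fix \<beta> :: "'m \<Rightarrow> nat"
  let ?S = "(\<lambda>q. (case_sum (0 :: 'n \<Rightarrow> nat) (fst q), case_sum \<alpha> (snd q))) ` splittings \<beta>"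
  have "?S \<subseteq> splittings (case_sum \<alpha> \<beta>)"
    by (auto simp: splittings_def exponent_eq_iff parts_add)
  note sub = this
  have zero: "mseries_Inr g (fst p) * h (snd p) = 0" if "p \<in> splittings (case_sum \<alpha> \<beta>) - ?S" for p
  proof (rule ccontr)
    assume "mseries_Inr g (fst p) * h (snd p) \<noteq> 0"
    then have r: "left_part (fst p) = 0" by (auto simp: Inr_apply split: if_splits)
    have "left_part (fst p) + left_part (snd p) = \<alpha>" "right_part (fst p) + right_part (snd p) = \<beta>"
      using that by (auto simp: splittings_def parts_add[symmetric])
    then have "p \<in> ?S" using r case_sum_parts[of "fst p"] case_sum_parts[of "snd p"]
      by (intro image_eqI[of _ _ "(right_part (fst p), right_part (snd p))"]) (auto simp: splittings_def)
    then show False using that by blast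
  qed
  have "rslice (mmul (mseries_Inr g) h) \<alpha> \<beta> = (\<Sum>p\<in>?S. mseries_Inr g (fst p) * h (snd p))"
    unfolding rslice_def mmul_def using zero by (intro sum.mono_neutral_right[OF finite_splittings sub] ballI)
  also have "\<dots> = (\<Sum>q\<in>splittings \<beta>. g (fst q) * h (case_sum \<alpha> (snd q)))"
    by (subst sum.reindex) (auto simp: inj_on_def case_sum_eq_iff Inr_apply prod_eq_iff)
  finally show "rslice (mmul (mseries_Inr g) h) \<alpha> \<beta> = mmul g (rslice h \<alpha>) \<beta>"
    by (simp add: mmul_def rslice_def)
qed

lemma series_eq_lslice: "(\<And>\<beta>. lslice h \<beta> = lslice h' \<beta>) \<Longrightarrow> h = h'"
proof
  fix \<gamma> assume "\<And>\<beta>. lslice h \<beta> = lslice h' \<beta>"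
  then have "lslice h (right_part \<gamma>) (left_part \<gamma>) = lslice h' (right_part \<gamma>) (left_part \<gamma>)" by simp
  then show "h \<gamma> = h' \<gamma>" by (simp add: lslice_def case_sum_parts)
qed

lemma series_eq_rslice: "(\<And>\<alpha>. rslice h \<alpha> = rslice h' \<alpha>) \<Longrightarrow> h = h'"
proof
  fix \<gamma> assume "\<And>\<alpha>. rslice h \<alpha> = rslice h' \<alpha>"
  then have "rslice h (left_part \<gamma>) (right_part \<gamma>) = rslice h' (left_part \<gamma>) (right_part \<gamma>)" by simp
  then show "h \<gamma> = h' \<gamma>" by (simp add: rslice_def case_sum_parts)
qed

lemma lslice_Inl: "lslice (mseries_Inl g) \<beta> = (if \<beta> = 0 then g else 0)"
  by (rule ext) (simp add: lslice_def Inl_apply)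

lemma rslice_Inr: "rslice (mseries_Inr g) \<alpha> = (if \<alpha> = 0 then g else 0)"
  by (rule ext) (simp add: rslice_def Inr_apply)

lemma lslice_Inr: "lslice (mseries_Inr g) \<beta> = mseries_const (g \<beta>)"
  by (rule ext) (simp add: lslice_def Inr_apply mseries_const_def zero_fun_def)

lemma mmul_zero_right: "mmul a 0 = 0"
  by (rule ext) (simp add: mmul_def)

lemma Inl_mmul: "mseries_Inl (mmul a b) = mmul (mseries_Inl a) (mseries_Inl b)"
  by (rule series_eq_lslice) (simp add: lslice_mmul_Inl lslice_Inl mmul_zero_right)

lemma Inr_mmul: "mseries_Inr (mmul a b) = mmul (mseries_Inr a) (mseries_Inr b)"
  by (rule series_eq_rslice) (simp add: rslice_mmul_Inr rslice_Inr mmul_zero_right)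

lemma flinear_Inl: "flinear mseries_Inl"
  by (rule flinearI) (auto simp: Inl_apply fun_eq_iff fscale_apply)

lemma flinear_Inr: "flinear mseries_Inr"
  by (rule flinearI) (auto simp: Inr_apply fun_eq_iff fscale_apply)

lemma partial_Inl:
  fixes f :: "'a mseries" and g :: "'b mseries"
  shows "mseries_partial (Inl i) (mseries_Inl f + mseries_Inr g) = mseries_Inl (mseries_partial i f)"
proof
  fix \<gamma> :: "'a + 'b \<Rightarrow> nat"
  let ?\<gamma> = "\<gamma>(Inl i := Suc (\<gamma> (Inl i)))"
  have "left_part ?\<gamma> = (left_part \<gamma>)(i := Suc (left_part \<gamma> i))" "right_part ?\<gamma> = right_part \<gamma>"
    by (auto simp: left_part_def right_part_def)
  moreover have "left_part ?\<gamma> i \<noteq> 0" by (simp add: left_part_def)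
  then have "left_part ?\<gamma> \<noteq> 0" by (metis zero_fun_apply)
  ultimately show "mseries_partial (Inl i) (mseries_Inl f + mseries_Inr g) \<gamma> = mseries_Inl (mseries_partial i f) \<gamma>"
    by (simp add: mseries_partial_def Inl_apply Inr_apply left_part_def)
qed

lemma partial_Inr:
  fixes f :: "'a mseries" and g :: "'b mseries"
  shows "mseries_partial (Inr j) (mseries_Inl f + mseries_Inr g) = mseries_Inr (mseries_partial j g)"
proof
  fix \<gamma> :: "'a + 'b \<Rightarrow> nat"
  let ?\<gamma> = "\<gamma>(Inr j := Suc (\<gamma> (Inr j)))"
  have "right_part ?\<gamma> = (right_part \<gamma>)(j := Suc (right_part \<gamma> j))" "left_part ?\<gamma> = left_part \<gamma>"
    by (auto simp: left_part_def right_part_def)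
  moreover have "right_part ?\<gamma> j \<noteq> 0" by (simp add: right_part_def)
  then have "right_part ?\<gamma> \<noteq> 0" by (metis zero_fun_apply)
  ultimately show "mseries_partial (Inr j) (mseries_Inl f + mseries_Inr g) \<gamma> = mseries_Inr (mseries_partial j g) \<gamma>"
    by (simp add: mseries_partial_def Inl_apply Inr_apply right_part_def)
qed

lemma monom_parts: "mmonom \<gamma> = mmul (mseries_Inl (mmonom (left_part \<gamma>))) (mseries_Inr (mmonom (right_part \<gamma>)))"
proof (rule series_eq_lslice)
  fix \<beta>
  have "lslice (mmonom \<gamma>) \<beta> = (if \<beta> = right_part \<gamma> then mmonom (left_part \<gamma>) else 0)"
    by (rule ext) (auto simp: lslice_def mmonom_def case_sum_eq_iff)
  also have "\<dots> = mmul (mmonom (left_part \<gamma>)) (mseries_const (mmonom (right_part \<gamma>) \<beta>))"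
    unfolding mmul_commute[of _ "mseries_const _"] mmul_const by (auto simp: mmonom_def)
  finally show "lslice (mmonom \<gamma>) \<beta> = lslice (mmul (mseries_Inl (mmonom (left_part \<gamma>))) (mseries_Inr (mmonom (right_part \<gamma>)))) \<beta>"
    by (simp add: lslice_mmul_Inl lslice_Inr)
qed

lemma Inl_monom_unitv: "mseries_Inl (mmonom (unitv i k)) = (mmonom (unitv (Inl i) k) :: ('a + 'b) mseries)"
proof
  fix \<gamma> :: "'a + 'b \<Rightarrow> nat"
  have "left_part (unitv (Inl i) k :: 'a + 'b \<Rightarrow> nat) = unitv i k" "right_part (unitv (Inl i) k :: 'a + 'b \<Rightarrow> nat) = 0"
    by (auto simp: left_part_def right_part_def unitv_def)
  then show "mseries_Inl (mmonom (unitv i k)) \<gamma> = mmonom (unitv (Inl i) k) \<gamma>"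
    by (simp add: Inl_apply mmonom_def exponent_eq_iff[of \<gamma>])
qed

lemma Inr_monom_unitv: "mseries_Inr (mmonom (unitv j k)) = (mmonom (unitv (Inr j) k) :: ('a + 'b) mseries)"
proof
  fix \<gamma> :: "'a + 'b \<Rightarrow> nat"
  have "right_part (unitv (Inr j) k :: 'a + 'b \<Rightarrow> nat) = unitv j k" "left_part (unitv (Inr j) k :: 'a + 'b \<Rightarrow> nat) = 0"
    by (auto simp: left_part_def right_part_def unitv_def)
  then show "mseries_Inr (mmonom (unitv j k)) \<gamma> = mmonom (unitv (Inr j) k) \<gamma>"
    by (simp add: Inr_apply mmonom_def exponent_eq_iff[of \<gamma>])
qed

section \<open>The Milnor algebra of the join\<close>

lemma box_part_expansion: "box_part N p = (\<Sum>\<alpha>\<in>ebox N. fscale (p \<alpha>) (mmonom \<alpha>))"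
  for p :: "'n::finite mseries"
proof
  fix \<beta> :: "'n \<Rightarrow> nat"
  have "(\<Sum>\<alpha>\<in>ebox N. fscale (p \<alpha>) (mmonom \<alpha>)) \<beta> = (\<Sum>\<alpha>\<in>ebox N. if \<alpha> = \<beta> then p \<beta> else 0)"
    unfolding sum_fun_apply by (intro sum.cong) (auto simp: mmonom_def fscale_apply)
  then show "box_part N p \<beta> = (\<Sum>\<alpha>\<in>ebox N. fscale (p \<alpha>) (mmonom \<alpha>)) \<beta>"
    by (simp add: finite_ebox box_part_def)
qed

lemma conv_idealI:
  fixes S :: "'n::finite mseries set"
  assumes S: "fs.subspace S" "\<And>a. a \<in> S \<Longrightarrow> convergent_mseries a"
    and mult: "\<And>a x. a \<in> S \<Longrightarrow> convergent_mseries x \<Longrightarrow> mmul x a \<in> S"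
  shows "ideal S conv_series"
proof (rule idealI[OF conv.ring_axioms])
  have neg: "\<ominus>\<^bsub>conv_series\<^esub> a \<in> S" if "a \<in> S" for a
    unfolding conv_a_inv[OF S(2)[OF that]] by (rule fs.subspace_neg[OF S(1) that])
  have add: "a \<oplus>\<^bsub>conv_series\<^esub> b \<in> S" if "a \<in> S" "b \<in> S" for a b
    unfolding conv_series_simps by (rule fs.subspace_add[OF S(1) that])
  have "S \<subseteq> carrier conv_series" "S \<noteq> {}"
    using S(2) fs.subspace_0[OF S(1)] by (auto simp: conv_series_simps)
  then show "subgroup S (add_monoid (conv_series :: 'n mseries ring))"
    by (rule conv.add.subgroupI) (simp_all add: add neg)
  show "x \<otimes>\<^bsub>conv_series\<^esub> a \<in> S" "a \<otimes>\<^bsub>conv_series\<^esub> x \<in> S"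
    if "a \<in> S" "x \<in> carrier conv_series" for a x
    using that mult[of a x] unfolding conv_series_simps mmul_commute[of a x] by auto
qed

lemma subspace_vimage: "flinear g \<Longrightarrow> fs.subspace V \<Longrightarrow> fs.subspace {a. g a \<in> V}"
  by (rule fs.subspaceI)
     (simp_all only: mem_Collect_eq flinear_0 flinear_add flinear_scale fs.subspace_0 fs.subspace_add fs.subspace_scale)

context milnor_coordinates
begin

text \<open>The coordinates depend on the finitely many coefficients in the box only. This is what
  allows \<open>\<psi>1\<close> and \<open>\<psi>2\<close> to be applied to the two sets of
  variables one after the other.\<close>

lemma \<psi>_box:
  assumes h: "convergent_mseries h" shows "\<psi> h i = (\<Sum>\<alpha>\<in>ebox N. h \<alpha> * \<psi> (mmonom \<alpha>) i)"
proof -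
  have "h - box_part N h \<in> J" by (rule box_part_mod_ideal[OF J monom_vanish[OF order_refl] h])
  then have "\<psi> (h - box_part N h) = 0" using kernel conv_ideal_convergent[OF J] by blast
  then have "\<psi> h = \<psi> (box_part N h)" by (simp only: flinear_diff[OF linear] eq_iff_diff_eq_0[symmetric])
  also have "\<dots> = (\<Sum>\<alpha>\<in>ebox N. fscale (h \<alpha>) (\<psi> (mmonom \<alpha>)))"
    unfolding box_part_expansion by (simp only: flinear_sum[OF linear] flinear_scale[OF linear])
  finally show ?thesis by (simp only: sum_fun_apply fscale_apply)
qed

lemma \<psi>_outside: "convergent_mseries h \<Longrightarrow> i \<notin> D \<Longrightarrow> \<psi> h i = 0"
proof -
  assume "convergent_mseries h" and i: "i \<notin> D"
  then have "\<psi> h \<in> fsupp D" unfolding \<psi>_image[symmetric] by (intro imageI) simp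
  then show "\<psi> h i = 0" using i by (rule fsuppD)
qed

lemma \<Lambda>_ideal: "g \<in> J \<Longrightarrow> k \<in> D \<Longrightarrow> \<Lambda> g i k = 0"
proof -
  assume g: "g \<in> J" and k: "k \<in> D"
  have "mmul g (e k) \<in> J" unfolding mmul_commute[of g] by (rule conv_ideal_mult[OF J g e(1)[OF k]])
  then have "\<psi> (mmul g (e k)) = 0" using kernel conv_ideal_convergent[OF J] by blast
  then show "\<Lambda> g i k = 0" by (simp add: \<Lambda>_def)
qed

end

locale two_milnor_coordinates =
  m1: milnor_coordinates f1 \<psi>1 D1 K1 L1 N1 B1 + m2: milnor_coordinates f2 \<psi>2 D2 K2 L2 N2 B2
  for f1 :: "'n::finite mseries" and \<psi>1 :: "'n mseries \<Rightarrow> ('i \<Rightarrow> complex)" and D1 K1 L1 N1 B1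
    and f2 :: "'m::finite mseries" and \<psi>2 :: "'m mseries \<Rightarrow> ('j \<Rightarrow> complex)" and D2 K2 L2 N2 B2
begin

sublocale A: two_kernel_image_coordinates D1 K1 L1 "m1.\<Lambda> f1" D2 K2 L2 "m2.\<Lambda> f2"
  by unfold_locales

text \<open>This is \<open>\<psi>1 \<otimes> \<psi>2\<close>, computed from the coefficients in the
  two boxes. The isomorphism of the Milnor algebra of the join with the tensor product remains
  implicit: both algebras receive coordinates in \<open>fsupp (D1 \<times> D2)\<close>, and in both
  the relevant multiplication becomes \<open>A.F\<close>.\<close>

definition \<psi> :: "('n + 'm) mseries \<Rightarrow> ('i \<times> 'j \<Rightarrow> complex)" where
  "\<psi> h = (\<lambda>(i, j). \<Sum>\<alpha>\<in>ebox N1. \<Sum>\<beta>\<in>ebox N2. h (case_sum \<alpha> \<beta>) * \<psi>1 (mmonom \<alpha>) i * \<psi>2 (mmonom \<beta>) j)"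

abbreviation "f \<equiv> mseries_Inl f1 + mseries_Inr f2"

abbreviation "pure a b \<equiv> mmul (mseries_Inl a) (mseries_Inr b)"

lemma join_eq: "join_series f1 f2 = f"
  by (simp only: join_series_def conv_series_simps)

lemma conv_join: "convergent_mseries f"
  by (intro convergent_add convergent_Inl convergent_Inr m1.conv_f m2.conv_f)

lemma linear: "flinear \<psi>"
  by (rule flinearI) (auto simp: \<psi>_def fun_eq_iff fscale_apply algebra_simps sum.distrib sum_distrib_left)

lemma \<psi>_lslice:
  assumes "convergent_mseries h"
  shows "\<psi> h (i, j) = (\<Sum>\<beta>\<in>ebox N2. \<psi>1 (lslice h \<beta>) i * \<psi>2 (mmonom \<beta>) j)"
proof -
  have "\<psi> h (i, j) = (\<Sum>\<beta>\<in>ebox N2. \<Sum>\<alpha>\<in>ebox N1. h (case_sum \<alpha> \<beta>) * \<psi>1 (mmonom \<alpha>) i * \<psi>2 (mmonom \<beta>) j)"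
    unfolding \<psi>_def prod.case by (rule sum.swap)
  also have "\<dots> = (\<Sum>\<beta>\<in>ebox N2. \<psi>1 (lslice h \<beta>) i * \<psi>2 (mmonom \<beta>) j)"
    unfolding m1.\<psi>_box[OF convergent_lslice[OF assms]] sum_distrib_right unfolding lslice_def ..
  finally show ?thesis .
qed

lemma \<psi>_rslice:
  assumes "convergent_mseries h"
  shows "\<psi> h (i, j) = (\<Sum>\<alpha>\<in>ebox N1. \<psi>1 (mmonom \<alpha>) i * \<psi>2 (rslice h \<alpha>) j)"
  unfolding \<psi>_def prod.case m2.\<psi>_box[OF convergent_rslice[OF assms]] sum_distrib_left
  unfolding rslice_def by (simp add: mult_ac)

text \<open>Multiplication by a series in \<open>x\<close> acts as
  \<open>\<Lambda> g \<otimes> 1\<close>, because it acts on each coefficient of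
  \<open>y^\<beta>\<close> by itself.\<close>

lemma \<psi>_mmul_Inl:
  assumes g: "convergent_mseries g" and h: "convergent_mseries h"
  shows "\<psi> (mmul (mseries_Inl g) h) (i, j) = mat_op D1 (m1.\<Lambda> g) (\<lambda>k. \<psi> h (k, j)) i"
proof -
  have "\<psi> (mmul (mseries_Inl g) h) (i, j)
      = (\<Sum>\<beta>\<in>ebox N2. mat_op D1 (m1.\<Lambda> g) (\<psi>1 (lslice h \<beta>)) i * \<psi>2 (mmonom \<beta>) j)"
    unfolding \<psi>_lslice[OF convergent_mmul[OF convergent_Inl[OF g] h]] lslice_mmul_Inl
      m1.mult_matrix[OF g convergent_lslice[OF h]] ..
  also have "\<dots> = (\<Sum>\<beta>\<in>ebox N2. \<Sum>k\<in>D1. m1.\<Lambda> g i k * (\<psi>1 (lslice h \<beta>) k * \<psi>2 (mmonom \<beta>) j))"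
    by (simp add: mat_op_def sum_distrib_right mult.assoc)
  also have "\<dots> = (\<Sum>k\<in>D1. \<Sum>\<beta>\<in>ebox N2. m1.\<Lambda> g i k * (\<psi>1 (lslice h \<beta>) k * \<psi>2 (mmonom \<beta>) j))"
    by (rule sum.swap)
  finally show ?thesis by (simp add: mat_op_def \<psi>_lslice[OF h] sum_distrib_left)
qed

lemma \<psi>_mmul_Inr:
  assumes g: "convergent_mseries g" and h: "convergent_mseries h"
  shows "\<psi> (mmul (mseries_Inr g) h) (i, j) = mat_op D2 (m2.\<Lambda> g) (\<lambda>l. \<psi> h (i, l)) j"
proof -
  have "\<psi> (mmul (mseries_Inr g) h) (i, j)
      = (\<Sum>\<alpha>\<in>ebox N1. \<psi>1 (mmonom \<alpha>) i * mat_op D2 (m2.\<Lambda> g) (\<psi>2 (rslice h \<alpha>)) j)"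
    unfolding \<psi>_rslice[OF convergent_mmul[OF convergent_Inr[OF g] h]] rslice_mmul_Inr
      m2.mult_matrix[OF g convergent_rslice[OF h]] ..
  also have "\<dots> = (\<Sum>\<alpha>\<in>ebox N1. \<Sum>l\<in>D2. m2.\<Lambda> g j l * (\<psi>1 (mmonom \<alpha>) i * \<psi>2 (rslice h \<alpha>) l))"
    by (simp add: mat_op_def sum_distrib_left mult_ac)
  also have "\<dots> = (\<Sum>l\<in>D2. \<Sum>\<alpha>\<in>ebox N1. m2.\<Lambda> g j l * (\<psi>1 (mmonom \<alpha>) i * \<psi>2 (rslice h \<alpha>) l))"
    by (rule sum.swap)
  finally show ?thesis by (simp add: mat_op_def \<psi>_rslice[OF h] sum_distrib_left)
qed

lemma convergent_pure: "convergent_mseries a \<Longrightarrow> convergent_mseries b \<Longrightarrow> convergent_mseries (pure a b)"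
  by (intro convergent_mmul convergent_Inl convergent_Inr)

lemma \<psi>_pure:
  assumes a: "convergent_mseries a" and b: "convergent_mseries b"
  shows "\<psi> (pure a b) (i, j) = \<psi>1 a i * \<psi>2 b j"
proof -
  have "lslice (pure a b) \<beta> = fscale (b \<beta>) a" for \<beta>
    unfolding lslice_mmul_Inl lslice_Inr mmul_commute[of a] mmul_const_fscale ..
  then have "\<psi> (pure a b) (i, j) = (\<Sum>\<beta>\<in>ebox N2. b \<beta> * \<psi>1 a i * \<psi>2 (mmonom \<beta>) j)"
    unfolding \<psi>_lslice[OF convergent_pure[OF a b]] by (simp only: flinear_scale[OF m1.linear] fscale_apply)
  then show ?thesis by (simp add: m2.\<psi>_box[OF b] sum_distrib_left mult_ac)
qed

lemma \<psi>_in_fsupp: "convergent_mseries h \<Longrightarrow> \<psi> h \<in> fsupp (D1 \<times> D2)"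
proof -
  assume h: "convergent_mseries h"
  have "\<psi> h (i, j) = 0" if "i \<notin> D1 \<or> j \<notin> D2" for i j
    using that \<psi>_lslice[OF h] m1.\<psi>_outside[OF convergent_lslice[OF h]] m2.\<psi>_outside[OF convergent_monom] by auto
  then show ?thesis by (auto simp: fsupp_def)
qed

definition E :: "'i \<times> 'j \<Rightarrow> ('n + 'm) mseries" where "E p = pure (m1.e (fst p)) (m2.e (snd p))"

lemma E: "p \<in> D1 \<times> D2 \<Longrightarrow> convergent_mseries (E p)" "p \<in> D1 \<times> D2 \<Longrightarrow> \<psi> (E p) = dirac p"
proof -
  assume p: "p \<in> D1 \<times> D2"
  then have c: "convergent_mseries (m1.e (fst p))" "convergent_mseries (m2.e (snd p))" using m1.e m2.e by auto
  show "convergent_mseries (E p)" unfolding E_def by (rule convergent_pure[OF c])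
  show "\<psi> (E p) = dirac p"
  proof
    fix q :: "'i \<times> 'j"
    obtain i j where q: "q = (i, j)" by fastforce
    show "\<psi> (E p) q = dirac p q"
      unfolding E_def q \<psi>_pure[OF c] using p m1.e(2)[of "fst p"] m2.e(2)[of "snd p"]
      by (cases p) (auto simp: dirac_def)
  qed
qed

text \<open>A linear section of \<open>\<psi>\<close>: the normal form with prescribed
  coordinates.\<close>

definition red :: "('i \<times> 'j \<Rightarrow> complex) \<Rightarrow> ('n + 'm) mseries" where
  "red v = (\<Sum>p\<in>D1 \<times> D2. fscale (v p) (E p))"

lemma finite_D: "finite (D1 \<times> D2)" using m1.finite_D m2.finite_D by simp

lemma convergent_red: "convergent_mseries (red v)"
  unfolding red_def by (intro convergent_sum convergent_fscale E(1))

lemma \<psi>_red: "v \<in> fsupp (D1 \<times> D2) \<Longrightarrow> \<psi> (red v) = v"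
proof -
  assume v: "v \<in> fsupp (D1 \<times> D2)"
  have "\<psi> (red v) = (\<Sum>p\<in>D1 \<times> D2. fscale (v p) (\<psi> (E p)))"
    unfolding red_def by (simp only: flinear_sum[OF linear] flinear_scale[OF linear])
  also have "\<dots> = (\<Sum>p\<in>D1 \<times> D2. fscale (v p) (dirac p))" by (rule sum.cong) (simp_all only: E(2))
  finally show "\<psi> (red v) = v" using fsupp_expansion[OF finite_D v] by simp
qed

lemma \<psi>_image: "\<psi> ` {h. convergent_mseries h} = fsupp (D1 \<times> D2)"
proof (intro equalityI subsetI)
  fix v assume "v \<in> fsupp (D1 \<times> D2)"
  then have "v = \<psi> (red v)" by (rule \<psi>_red[symmetric])
  moreover have "red v \<in> {h. convergent_mseries h}" using convergent_red[of v] by simp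
  ultimately show "v \<in> \<psi> ` {h. convergent_mseries h}" by (rule image_eqI[of v \<psi> "red v"])
qed (auto simp: \<psi>_in_fsupp)

lemma flinear_red: "flinear red"
  unfolding red_def by (rule flinearI)
    (auto simp: fun_eq_iff sum_fun_apply fscale_apply algebra_simps sum.distrib sum_distrib_left)

section \<open>The Jacobian ideal of the join\<close>

abbreviation "JJ \<equiv> jacobian_ideal f"

lemmas JJ = jacobian_ideal_ideal[OF conv_join]

lemma partial_f: "mseries_partial (Inl i) f = mseries_Inl (mseries_partial i f1)"
  "mseries_partial (Inr j) f = mseries_Inr (mseries_partial j f2)"
  by (rule partial_Inl, rule partial_Inr)

text \<open>The series in \<open>x\<close> whose embedding lies in \<open>JJ\<close> form an ideal,
  and it contains the partial derivatives of \<open>f1\<close>.\<close>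

lemma Inl_JJ: "a \<in> m1.J \<Longrightarrow> mseries_Inl a \<in> JJ"
proof -
  let ?S = "{a. convergent_mseries a} \<inter> {a. mseries_Inl a \<in> JJ}"
  have "ideal ?S conv_series"
  proof (rule conv_idealI)
    show "fs.subspace ?S"
      by (intro fs.subspace_inter subspace_convergent subspace_vimage flinear_Inl conv_ideal_subspace[OF JJ])
    fix a x :: "'n mseries" assume "a \<in> ?S" "convergent_mseries x"
    then show "mmul x a \<in> ?S"
      using conv_ideal_mult[OF JJ _ convergent_Inl[of x]] by (auto simp: convergent_mmul Inl_mmul)
  qed auto
  moreover have "mseries_partial i f1 \<in> ?S" for i
    using partial_mem_jacobian_ideal[OF conv_join, of "Inl i"] unfolding partial_f
    by (simp add: convergent_partial m1.conv_f)
  ultimately show "a \<in> m1.J \<Longrightarrow> mseries_Inl a \<in> JJ" using jacobian_ideal_least[of ?S f1] by blast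
qed

lemma Inr_JJ: "a \<in> m2.J \<Longrightarrow> mseries_Inr a \<in> JJ"
proof -
  let ?S = "{a. convergent_mseries a} \<inter> {a. mseries_Inr a \<in> JJ}"
  have "ideal ?S conv_series"
  proof (rule conv_idealI)
    show "fs.subspace ?S"
      by (intro fs.subspace_inter subspace_convergent subspace_vimage flinear_Inr conv_ideal_subspace[OF JJ])
    fix a x :: "'m mseries" assume "a \<in> ?S" "convergent_mseries x"
    then show "mmul x a \<in> ?S"
      using conv_ideal_mult[OF JJ _ convergent_Inr[of x]] by (auto simp: convergent_mmul Inr_mmul)
  qed auto
  moreover have "mseries_partial i f2 \<in> ?S" for i
    using partial_mem_jacobian_ideal[OF conv_join, of "Inr i"] unfolding partial_f
    by (simp add: convergent_partial m2.conv_f)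
  ultimately show "a \<in> m2.J \<Longrightarrow> mseries_Inr a \<in> JJ" using jacobian_ideal_least[of ?S f2] by blast
qed

text \<open>That the kernel of \<open>\<psi>\<close> is an ideal is not yet known, but
  \<open>?S\<close>, the series all of whose multiples it contains, visibly is one. The partial
  derivatives belong to \<open>?S\<close>, because each acts on one tensor factor by a zero
  matrix.\<close>

lemma kernel_of_JJ: "x \<in> JJ \<Longrightarrow> \<psi> x = 0"
proof -
  let ?S = "{x. convergent_mseries x \<and> (\<forall>a. convergent_mseries a \<longrightarrow> \<psi> (mmul a x) = 0)}"
  have "ideal ?S conv_series"
  proof (rule conv_idealI)
    show "fs.subspace ?S"
    proof (rule fs.subspaceI)
      show "0 \<in> ?S" by (simp only: mem_Collect_eq convergent_0 mmul_zero_right flinear_0[OF linear]) simp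
      show "a + b \<in> ?S" if "a \<in> ?S" "b \<in> ?S" for a b
        using that convergent_add[of a b]
        by (simp only: mem_Collect_eq mmul_add_right flinear_add[OF linear] add_0_left) simp
      show "fscale c a \<in> ?S" if "a \<in> ?S" for c a
        using that convergent_fscale[of a c]
        by (simp only: mem_Collect_eq mmul_fscale_right flinear_scale[OF linear] fs.scale_zero_right) simp
    qed
    fix a x :: "('n + 'm) mseries" assume ax: "a \<in> ?S" "convergent_mseries x"
    then show "mmul x a \<in> ?S"
      using convergent_mmul by (auto simp: mmul_assoc[symmetric])
  qed auto
  moreover have "mseries_partial p f \<in> ?S" for p
  proof -
    have "\<psi> (mmul a (mseries_partial p f)) q = 0" if a: "convergent_mseries a" for a q
    proof -
      obtain i j where q: "q = (i, j)" by fastforce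
      show ?thesis
      proof (cases p)
        case (Inl k)
        show ?thesis unfolding Inl partial_f q mmul_commute[of a] \<psi>_mmul_Inl[OF convergent_partial[OF m1.conv_f] a]
          using m1.\<Lambda>_ideal[OF partial_mem_jacobian_ideal[OF m1.conv_f]] by (simp add: mat_op_def)
      next
        case (Inr k)
        show ?thesis unfolding Inr partial_f q mmul_commute[of a] \<psi>_mmul_Inr[OF convergent_partial[OF m2.conv_f] a]
          using m2.\<Lambda>_ideal[OF partial_mem_jacobian_ideal[OF m2.conv_f]] by (simp add: mat_op_def)
      qed
    qed
    then show ?thesis using convergent_partial[OF conv_join] by (simp add: fun_eq_iff)
  qed
  ultimately have "JJ \<subseteq> ?S" by (rule jacobian_ideal_least)
  moreover assume "x \<in> JJ"
  ultimately have "\<psi> (mmul (mseries_const 1) x) = 0" by auto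
  then show "\<psi> x = 0" by (simp only: mmul_const_fscale fs.scale_one)
qed

text \<open>The factors \<open>a\<close> and \<open>b\<close> are replaced by their basis expansions
  in turn; each replacement changes the product by a multiple of an embedded element of
  \<open>m1.J\<close> or \<open>m2.J\<close>.\<close>

lemma pure_mod_JJ:
  assumes a: "convergent_mseries a" and b: "convergent_mseries b"
  shows "pure a b - red (\<psi> (pure a b)) \<in> JJ"
proof -
  let ?a = "\<Sum>k\<in>D1. fscale (\<psi>1 a k) (m1.e k)" and ?b = "\<Sum>l\<in>D2. fscale (\<psi>2 b l) (m2.e l)"
  note ea = m1.expansion_mod_J[OF a] and eb = m2.expansion_mod_J[OF b]
  have "pure (a - ?a) b \<in> JJ"
    unfolding mmul_commute[of "mseries_Inl _"] by (rule conv_ideal_mult[OF JJ Inl_JJ[OF ea(2)] convergent_Inr[OF b]])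
  moreover have "pure ?a (b - ?b) \<in> JJ"
    by (rule conv_ideal_mult[OF JJ Inr_JJ[OF eb(2)] convergent_Inl[OF ea(1)]])
  ultimately have "pure (a - ?a) b + pure ?a (b - ?b) \<in> JJ" by (rule conv_ideal_add[OF JJ])
  also have "pure (a - ?a) b + pure ?a (b - ?b) = pure a b - pure ?a ?b"
    unfolding flinear_diff[OF flinear_Inl] flinear_diff[OF flinear_Inr] flinear_diff[OF flinear_mmul]
      mmul_commute[of _ "mseries_Inr b"] by (rule ext) simp
  also have "pure ?a ?b = red (\<psi> (pure a b))"
  proof -
    have "pure ?a ?b = (\<Sum>l\<in>D2. fscale (\<psi>2 b l) (pure ?a (m2.e l)))"
      by (simp only: flinear_sum[OF flinear_Inr] flinear_scale[OF flinear_Inr] flinear_sum[OF flinear_mmul] flinear_scale[OF flinear_mmul])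
    also have "\<dots> = (\<Sum>l\<in>D2. fscale (\<psi>2 b l) (\<Sum>k\<in>D1. fscale (\<psi>1 a k) (pure (m1.e k) (m2.e l))))"
      by (simp only: mmul_commute[of _ "mseries_Inr _"] flinear_sum[OF flinear_Inl] flinear_scale[OF flinear_Inl]
          flinear_sum[OF flinear_mmul] flinear_scale[OF flinear_mmul])
    also have "\<dots> = (\<Sum>k\<in>D1. \<Sum>l\<in>D2. fscale (\<psi>1 a k * \<psi>2 b l) (pure (m1.e k) (m2.e l)))"
      by (subst sum.swap) (simp only: fs.scale_sum_right fs.scale_scale mult.commute)
    also have "\<dots> = red (\<psi> (pure a b))"
      unfolding red_def E_def sum.cartesian_product
      by (rule sum.cong) (auto simp: \<psi>_pure[OF a b])
    finally show ?thesis .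
  qed
  finally show ?thesis .
qed

text \<open>A convergent series is congruent to a polynomial, monomials are products of one in
  \<open>x\<close> and one in \<open>y\<close>, and such products are congruent to their normal
  forms. So a polynomial with zero coordinates is congruent to the normal form of
  \<open>0\<close>.\<close>

lemma kernel: "convergent_mseries h \<Longrightarrow> \<psi> h = 0 \<longleftrightarrow> h \<in> JJ"
proof
  assume h: "convergent_mseries h" and "\<psi> h = 0"
  \<comment> \<open>Large enough for this power of a variable of either kind to lie in
    \<open>JJ\<close>.\<close>
  let ?N = "max N1 N2"
  have "mmonom (unitv p ?N) \<in> JJ" for p :: "'n + 'm"
  proof (cases p)
    case (Inl i) show ?thesis unfolding Inl Inl_monom_unitv[symmetric] by (rule Inl_JJ[OF m1.monom_vanish]) simp
  next
    case (Inr j) show ?thesis unfolding Inr Inr_monom_unitv[symmetric] by (rule Inr_JJ[OF m2.monom_vanish]) simp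
  qed
  then have box: "h - box_part ?N h \<in> JJ" by (rule box_part_mod_ideal[OF JJ _ h])
  then have "\<psi> (h - box_part ?N h) = 0" by (rule kernel_of_JJ)
  then have \<psi>0: "\<psi> (box_part ?N h) = 0"
    using \<open>\<psi> h = 0\<close> by (simp only: flinear_diff[OF linear] diff_0 neg_equal_0_iff_equal)
  have lin: "flinear (\<lambda>h. h - red (\<psi> h))"
    by (rule flinearI)
       (simp_all only: flinear_add[OF linear] flinear_scale[OF linear] flinear_add[OF flinear_red]
         flinear_scale[OF flinear_red] fs.scale_right_diff_distrib add_diff_add)
  have "box_part ?N h - red (\<psi> (box_part ?N h)) = (\<Sum>\<gamma>\<in>ebox ?N. fscale (h \<gamma>) (mmonom \<gamma> - red (\<psi> (mmonom \<gamma>))))"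
    unfolding box_part_expansion by (simp only: flinear_sum[OF lin] flinear_scale[OF lin])
  also have "\<dots> \<in> JJ"
  proof (intro conv_ideal_sum[OF JJ] conv_ideal_scale[OF JJ])
    fix \<gamma> :: "'n + 'm \<Rightarrow> nat"
    show "mmonom \<gamma> - red (\<psi> (mmonom \<gamma>)) \<in> JJ"
      unfolding monom_parts[of \<gamma>] by (rule pure_mod_JJ) simp_all
  qed
  finally have "box_part ?N h \<in> JJ"
    unfolding \<psi>0 flinear_0[OF flinear_red] by (simp only: diff_0_right)
  from conv_ideal_add[OF JJ box this] show "h \<in> JJ" by (simp only: diff_add_cancel)
qed (rule kernel_of_JJ)

lemma join_at_0: "f 0 = 0" "mseries_partial p f 0 = 0"
proof -
  have [simp]: "left_part (0 :: 'n + 'm \<Rightarrow> nat) = 0" "right_part (0 :: 'n + 'm \<Rightarrow> nat) = 0"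
    by (auto simp: left_part_def right_part_def fun_eq_iff)
  show "f 0 = 0" by (simp add: Inl_apply Inr_apply m1.f_0 m2.f_0)
  show "mseries_partial p f 0 = 0"
    by (cases p) (simp_all only: partial_f, simp_all add: Inl_apply Inr_apply m1.partial_0 m2.partial_0)
qed

sublocale jc: jacobian_coordinates f \<psi>
proof (intro jacobian_coordinates.intro conv_join linear kernel)
  show "mseries_const 1 \<notin> JJ"
    using jacobian_ideal_maximal[OF conv_join join_at_0(2)] one_notin_maximal by blast
qed

lemma \<psi>_mult_join: "convergent_mseries h \<Longrightarrow> \<psi> (mmul f h) = A.F (\<psi> h)"
proof
  fix p :: "'i \<times> 'j"
  assume h: "convergent_mseries h"
  obtain i j where p: "p = (i, j)" by fastforce
  have "\<psi> (mmul f h) p = \<psi> (mmul (mseries_Inl f1) h) p + \<psi> (mmul (mseries_Inr f2) h) p"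
    by (simp only: mmul_add_left flinear_add[OF linear] plus_fun_apply)
  then show "\<psi> (mmul f h) p = A.F (\<psi> h) p"
    unfolding p A.F_apply \<psi>_mmul_Inl[OF m1.conv_f h] \<psi>_mmul_Inr[OF m2.conv_f h] .
qed

theorem tjurina_join:
  "int (tjurina_number (join_series f1 f2)) = int (card (D1 \<times> D2)) - int (fs.dim (A.F ` fsupp (D1 \<times> D2)))"
proof -
  have "jc.\<phi> ` carrier (milnor_algebra f) = fsupp (D1 \<times> D2)" unfolding jc.\<phi>_carrier by (rule \<psi>_image)
  moreover have "jc.\<phi> ` milnor_Im f = A.F ` fsupp (D1 \<times> D2)"
    unfolding jc.\<phi>_Im \<psi>_image[symmetric] image_image by (rule image_cong) (auto simp: \<psi>_mult_join)
  ultimately show ?thesis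
    unfolding join_eq using jc.tjurina_number_eq[OF finite_D _ join_at_0] by simp
qed

end

section \<open>The monoid algebra\<close>

text \<open>The value at \<open>p\<close> of the linear functional that extends \<open>h\<close>.
  Elements of the monoid algebra are determined by these values, and pairing with a product is an
  iterated pairing, so the ring laws reduce to those of the monoid.\<close>

definition pairing :: "('g \<Rightarrow> complex) \<Rightarrow> ('g \<Rightarrow> complex) \<Rightarrow> complex" where
  "pairing p h = (\<Sum>x | p x \<noteq> 0. p x * h x)"

lemma pairing_superset: "finite S \<Longrightarrow> {x. p x \<noteq> 0} \<subseteq> S \<Longrightarrow> pairing p h = (\<Sum>x\<in>S. p x * h x)"
  unfolding pairing_def by (rule sum.mono_neutral_left) auto

lemma pairing_sum_right: "pairing p (\<lambda>x. \<Sum>k\<in>A. h k x) = (\<Sum>k\<in>A. pairing p (h k))"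
  unfolding pairing_def sum_distrib_left by (rule sum.swap)

lemma pairing_scale_right: "pairing p (\<lambda>x. c * h x) = c * pairing p h"
  unfolding pairing_def sum_distrib_left by (simp add: mult_ac)

lemma pairing_point_mass: "pairing (point_mass c x) h = c * h x"
proof -
  have "pairing (point_mass c x) h = (\<Sum>y\<in>{x}. point_mass c x y * h y)"
    by (rule pairing_superset) (auto simp: point_mass_def)
  then show ?thesis by (simp add: point_mass_def)
qed

locale commutative_monoid_algebra = comm_monoid M for M :: "('g, 'r) monoid_scheme" (structure)
begin

abbreviation "P \<equiv> monoid_algebra M"

lemma P_simps:
  "carrier P = {p. finite {g. p g \<noteq> 0} \<and> {g. p g \<noteq> 0} \<subseteq> carrier M}"
  "p \<oplus>\<^bsub>P\<^esub> q = p + q" "\<zero>\<^bsub>P\<^esub> = 0" "\<one>\<^bsub>P\<^esub> = point_mass 1 \<one>"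
  by (auto simp: monoid_algebra_def plus_fun_def zero_fun_def point_mass_def)

lemma carrier_add: "p \<in> carrier P \<Longrightarrow> q \<in> carrier P \<Longrightarrow> p + q \<in> carrier P"
proof -
  assume "p \<in> carrier P" "q \<in> carrier P"
  moreover have "{g. (p + q) g \<noteq> 0} \<subseteq> {g. p g \<noteq> 0} \<union> {g. q g \<noteq> 0}" by auto
  ultimately show ?thesis unfolding P_simps by (auto intro: finite_subset)
qed

lemma carrier_point_mass: "x \<in> carrier M \<Longrightarrow> point_mass c x \<in> carrier P"
proof -
  assume "x \<in> carrier M"
  moreover have "{g. point_mass c x g \<noteq> 0} \<subseteq> {x}" by (auto simp: point_mass_def)
  ultimately show ?thesis unfolding P_simps by (auto intro: finite_subset)
qed

lemma support_mult: "{g. (p \<otimes>\<^bsub>P\<^esub> q) g \<noteq> 0} \<subseteq> (\<lambda>(x, y). x \<otimes> y) ` ({x. p x \<noteq> 0} \<times> {y. q y \<noteq> 0})"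
proof
  fix g assume g: "g \<in> {g. (p \<otimes>\<^bsub>P\<^esub> q) g \<noteq> 0}"
  show "g \<in> (\<lambda>(x, y). x \<otimes> y) ` ({x. p x \<noteq> 0} \<times> {y. q y \<noteq> 0})"
  proof (rule ccontr)
    assume no: "\<not> ?thesis"
    then have "(if x \<otimes> y = g then p x * q y else 0) = 0" if "p x \<noteq> 0" "q y \<noteq> 0" for x y using that by auto
    then have "(p \<otimes>\<^bsub>P\<^esub> q) g = 0" unfolding monoid_algebra_def by simp
    then show False using g by simp
  qed
qed

lemma carrier_mult: "p \<in> carrier P \<Longrightarrow> q \<in> carrier P \<Longrightarrow> p \<otimes>\<^bsub>P\<^esub> q \<in> carrier P"
proof -
  assume pq: "p \<in> carrier P" "q \<in> carrier P"
  let ?S = "(\<lambda>(x, y). x \<otimes> y) ` ({x. p x \<noteq> 0} \<times> {y. q y \<noteq> 0})"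
  have "finite ?S" "?S \<subseteq> carrier M" using pq unfolding P_simps by auto
  then show ?thesis using support_mult[of p q] unfolding P_simps(1) by (auto intro: finite_subset)
qed

lemma pairing_add: "p \<in> carrier P \<Longrightarrow> q \<in> carrier P \<Longrightarrow> pairing (p + q) h = pairing p h + pairing q h"
proof -
  assume "p \<in> carrier P" "q \<in> carrier P"
  then have S: "finite ({g. p g \<noteq> 0} \<union> {g. q g \<noteq> 0})" (is "finite ?S") by (simp add: P_simps)
  have "pairing (p + q) h = (\<Sum>x\<in>?S. (p + q) x * h x)" by (rule pairing_superset[OF S]) auto
  moreover have "pairing p h = (\<Sum>x\<in>?S. p x * h x)" by (rule pairing_superset[OF S]) auto
  moreover have "pairing q h = (\<Sum>x\<in>?S. q x * h x)" by (rule pairing_superset[OF S]) auto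
  ultimately show ?thesis by (simp add: sum.distrib distrib_right)
qed

lemma pairing_cong: "p \<in> carrier P \<Longrightarrow> (\<And>x. x \<in> carrier M \<Longrightarrow> h x = h' x) \<Longrightarrow> pairing p h = pairing p h'"
  unfolding pairing_def P_simps by (rule sum.cong) auto

lemma pairing_swap: "pairing p (\<lambda>x. pairing q (\<lambda>y. h x y)) = pairing q (\<lambda>y. pairing p (\<lambda>x. h x y))"
  unfolding pairing_def sum_distrib_left by (subst sum.swap) (simp add: mult_ac)

lemma pairing_mult:
  assumes pq: "p \<in> carrier P" "q \<in> carrier P"
  shows "pairing (p \<otimes>\<^bsub>P\<^esub> q) h = pairing p (\<lambda>x. pairing q (\<lambda>y. h (x \<otimes> y)))"
proof -
  let ?S = "(\<lambda>(x, y). x \<otimes> y) ` ({x. p x \<noteq> 0} \<times> {y. q y \<noteq> 0})"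
  have S: "finite ?S" using pq unfolding P_simps by auto
  have "pairing (p \<otimes>\<^bsub>P\<^esub> q) h = (\<Sum>g\<in>?S. (p \<otimes>\<^bsub>P\<^esub> q) g * h g)"
    by (rule pairing_superset[OF S support_mult])
  also have "\<dots> = (\<Sum>g\<in>?S. \<Sum>x | p x \<noteq> 0. \<Sum>y | q y \<noteq> 0. if x \<otimes> y = g then p x * q y * h g else 0)"
    unfolding monoid_algebra_def by (simp add: sum_distrib_right) (intro sum.cong refl, auto)
  also have "\<dots> = (\<Sum>x | p x \<noteq> 0. \<Sum>g\<in>?S. \<Sum>y | q y \<noteq> 0. if x \<otimes> y = g then p x * q y * h g else 0)"
    by (rule sum.swap)
  also have "\<dots> = (\<Sum>x | p x \<noteq> 0. \<Sum>y | q y \<noteq> 0. \<Sum>g\<in>?S. if x \<otimes> y = g then p x * q y * h g else 0)"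
    by (intro sum.cong refl sum.swap)
  also have "\<dots> = (\<Sum>x | p x \<noteq> 0. \<Sum>y | q y \<noteq> 0. p x * q y * h (x \<otimes> y))"
  proof (intro sum.cong refl)
    fix x y assume "x \<in> {x. p x \<noteq> 0}" "y \<in> {y. q y \<noteq> 0}"
    then have "x \<otimes> y \<in> ?S" by auto
    then show "(\<Sum>g\<in>?S. if x \<otimes> y = g then p x * q y * h g else 0) = p x * q y * h (x \<otimes> y)"
      using S by (simp add: sum.delta')
  qed
  finally show ?thesis by (simp add: pairing_def sum_distrib_left mult.assoc)
qed

lemma pairing_delta: "p \<in> carrier P \<Longrightarrow> pairing p (\<lambda>x. if x = g then 1 else 0) = p g"
proof -
  assume p: "p \<in> carrier P"
  then have fin: "finite (insert g {x. p x \<noteq> 0})" (is "finite ?S") by (simp add: P_simps)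
  have "pairing p (\<lambda>x. if x = g then 1 else 0) = (\<Sum>x\<in>?S. p x * (if x = g then 1 else 0))"
    by (rule pairing_superset[OF fin]) blast
  also have "\<dots> = (\<Sum>x\<in>?S. if x = g then p g else 0)" by (rule sum.cong) auto
  also have "\<dots> = (if g \<in> ?S then p g else 0)" using fin by (rule sum.delta)
  finally show ?thesis by simp
qed

lemma eq_via_pairing: "p \<in> carrier P \<Longrightarrow> q \<in> carrier P \<Longrightarrow> (\<And>h. pairing p h = pairing q h) \<Longrightarrow> p = q"
  by (rule ext) (metis pairing_delta)

lemma carrier_uminus: "p \<in> carrier P \<Longrightarrow> - p \<in> carrier P"
  by (simp add: P_simps)

lemma carrier_zero: "0 \<in> carrier P"
  by (simp add: P_simps)

lemma cring_P: "cring P"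
proof (rule cringI)
  show "abelian_group P"
  proof (rule abelian_groupI)
    show "\<exists>y\<in>carrier P. y \<oplus>\<^bsub>P\<^esub> x = \<zero>\<^bsub>P\<^esub>" if "x \<in> carrier P" for x
      unfolding P_simps(2,3) by (rule bexI[of _ "- x"]) (simp_all add: carrier_uminus that del: plus_fun_apply)
  qed (simp_all only: P_simps(2,3) carrier_add carrier_zero add_ac add_0_left add_0_right)
  have mult_comm: "x \<otimes>\<^bsub>P\<^esub> y = y \<otimes>\<^bsub>P\<^esub> x" if xy: "x \<in> carrier P" "y \<in> carrier P" for x y
  proof (rule eq_via_pairing[OF carrier_mult[OF xy] carrier_mult[OF xy(2,1)]])
    fix h
    have "pairing (x \<otimes>\<^bsub>P\<^esub> y) h = pairing y (\<lambda>b. pairing x (\<lambda>a. h (a \<otimes> b)))"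
      unfolding pairing_mult[OF xy] by (rule pairing_swap)
    also have "\<dots> = pairing y (\<lambda>b. pairing x (\<lambda>a. h (b \<otimes> a)))"
      by (intro pairing_cong xy) (simp add: m_comm)
    finally show "pairing (x \<otimes>\<^bsub>P\<^esub> y) h = pairing (y \<otimes>\<^bsub>P\<^esub> x) h" unfolding pairing_mult[OF xy(2,1)] .
  qed
  show "comm_monoid P"
  proof (rule comm_monoidI)
    show "\<one>\<^bsub>P\<^esub> \<in> carrier P" unfolding P_simps(4) by (rule carrier_point_mass) simp
    show "x \<otimes>\<^bsub>P\<^esub> y \<otimes>\<^bsub>P\<^esub> z = x \<otimes>\<^bsub>P\<^esub> (y \<otimes>\<^bsub>P\<^esub> z)" if c: "x \<in> carrier P" "y \<in> carrier P" "z \<in> carrier P" for x y z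
    proof (rule eq_via_pairing[OF carrier_mult[OF carrier_mult[OF c(1,2)] c(3)] carrier_mult[OF c(1) carrier_mult[OF c(2,3)]]])
      fix h
      have "pairing (x \<otimes>\<^bsub>P\<^esub> y \<otimes>\<^bsub>P\<^esub> z) h = pairing x (\<lambda>a. pairing y (\<lambda>b. pairing z (\<lambda>d. h (a \<otimes> b \<otimes> d))))"
        unfolding pairing_mult[OF carrier_mult[OF c(1,2)] c(3)] pairing_mult[OF c(1,2)] ..
      also have "\<dots> = pairing x (\<lambda>a. pairing y (\<lambda>b. pairing z (\<lambda>d. h (a \<otimes> (b \<otimes> d)))))"
        by (intro pairing_cong c) (simp add: m_assoc)
      finally show "pairing (x \<otimes>\<^bsub>P\<^esub> y \<otimes>\<^bsub>P\<^esub> z) h = pairing (x \<otimes>\<^bsub>P\<^esub> (y \<otimes>\<^bsub>P\<^esub> z)) h"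
        unfolding pairing_mult[OF c(1) carrier_mult[OF c(2,3)]] pairing_mult[OF c(2,3)] .
    qed
    show "\<one>\<^bsub>P\<^esub> \<otimes>\<^bsub>P\<^esub> x = x" if x: "x \<in> carrier P" for x
    proof -
      have one: "point_mass 1 \<one> \<in> carrier P" by (rule carrier_point_mass) simp
      show ?thesis unfolding P_simps(4)
      proof (rule eq_via_pairing[OF carrier_mult[OF one x] x])
        fix h show "pairing (point_mass 1 \<one> \<otimes>\<^bsub>P\<^esub> x) h = pairing x h"
          unfolding pairing_mult[OF one x] pairing_point_mass mult_1 by (rule pairing_cong[OF x]) simp
      qed
    qed
  qed (simp_all only: carrier_mult mult_comm)
  show "(x \<oplus>\<^bsub>P\<^esub> y) \<otimes>\<^bsub>P\<^esub> z = x \<otimes>\<^bsub>P\<^esub> z \<oplus>\<^bsub>P\<^esub> y \<otimes>\<^bsub>P\<^esub> z" if c: "x \<in> carrier P" "y \<in> carrier P" "z \<in> carrier P" for x y z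
    unfolding P_simps(2)
  proof (rule eq_via_pairing)
    show "pairing ((x + y) \<otimes>\<^bsub>P\<^esub> z) h = pairing (x \<otimes>\<^bsub>P\<^esub> z + y \<otimes>\<^bsub>P\<^esub> z) h" for h
      unfolding pairing_mult[OF carrier_add[OF c(1,2)] c(3)] pairing_add[OF carrier_mult[OF c(1,3)] carrier_mult[OF c(2,3)]]
        pairing_mult[OF c(1,3)] pairing_mult[OF c(2,3)] by (rule pairing_add[OF c(1,2)])
  qed (intro carrier_mult carrier_add c)+
qed

sublocale P: cring P by (rule cring_P)

lemma P_a_inv: "p \<in> carrier P \<Longrightarrow> \<ominus>\<^bsub>P\<^esub> p = - p"
  by (rule sym, rule P.sum_zero_eq_neg) (simp_all add: P_simps(2,3) carrier_uminus del: plus_fun_apply)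

lemma P_minus: "q \<in> carrier P \<Longrightarrow> p \<ominus>\<^bsub>P\<^esub> q = p - q"
  unfolding a_minus_def P_a_inv P_simps(2) by (rule ext) simp

lemma scalar_mult: "p \<in> carrier P \<Longrightarrow> point_mass c \<one> \<otimes>\<^bsub>P\<^esub> p = fscale c p"
proof -
  assume p: "p \<in> carrier P"
  have one: "point_mass c \<one> \<in> carrier P" by (rule carrier_point_mass) simp
  have "{g. fscale c p g \<noteq> 0} \<subseteq> {g. p g \<noteq> 0}" by (auto simp: fscale_apply)
  then have cp: "fscale c p \<in> carrier P" using p unfolding P_simps(1) by (auto intro: finite_subset)
  show ?thesis
  proof (rule eq_via_pairing[OF carrier_mult[OF one p] cp])
    fix h
    have "pairing (point_mass c \<one> \<otimes>\<^bsub>P\<^esub> p) h = c * pairing p h"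
      unfolding pairing_mult[OF one p] pairing_point_mass by (rule arg_cong[of _ _ "(*) c"], rule pairing_cong[OF p]) simp
    also have "\<dots> = (\<Sum>x | p x \<noteq> 0. fscale c p x * h x)"
      by (simp add: pairing_def sum_distrib_left fscale_apply mult.assoc)
    also have "\<dots> = pairing (fscale c p) h"
      using p by (intro pairing_superset[symmetric]) (auto simp: P_simps fscale_apply)
    finally show "pairing (point_mass c \<one> \<otimes>\<^bsub>P\<^esub> p) h = pairing (fscale c p) h" .
  qed
qed

lemma point_mass_scale: "point_mass c x = fscale c (point_mass 1 x)"
  by (rule ext) (simp add: point_mass_def fscale_apply)

lemma P_idealD:
  assumes T: "ideal T P"
  shows "fs.subspace T" "T \<subseteq> carrier P"
proof -
  show sub: "T \<subseteq> carrier P" using ideal.Icarr[OF T] by blast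
  show "fs.subspace T"
  proof (rule fs.subspaceI)
    show "0 \<in> T" using additive_subgroup.zero_closed[OF ideal.axioms(1)[OF T]] unfolding P_simps .
    show "x + y \<in> T" if "x \<in> T" "y \<in> T" for x y
      using additive_subgroup.a_closed[OF ideal.axioms(1)[OF T] that] unfolding P_simps .
    show "fscale c x \<in> T" if "x \<in> T" for c x
    proof -
      have "point_mass c \<one> \<otimes>\<^bsub>P\<^esub> x \<in> T"
        by (rule ideal.I_l_closed[OF T that carrier_point_mass]) simp
      then show ?thesis using scalar_mult[of x c] sub that by (metis subsetD)
    qed
  qed
qed

lemma P_idealI:
  assumes S: "fs.subspace S" "S \<subseteq> carrier P" and mult: "\<And>p q. p \<in> S \<Longrightarrow> q \<in> carrier P \<Longrightarrow> q \<otimes>\<^bsub>P\<^esub> p \<in> S"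
  shows "ideal S P"
proof (rule idealI[OF P.ring_axioms])
  have neg: "\<ominus>\<^bsub>P\<^esub> a \<in> S" if "a \<in> S" for a
    unfolding P_a_inv[OF subsetD[OF S(2) that]] by (rule fs.subspace_neg[OF S(1) that])
  have add: "a \<oplus>\<^bsub>P\<^esub> b \<in> S" if "a \<in> S" "b \<in> S" for a b
    unfolding P_simps by (rule fs.subspace_add[OF S(1) that])
  have "S \<noteq> {}" using fs.subspace_0[OF S(1)] by blast
  with S(2) show "subgroup S (add_monoid P)"
    by (rule P.add.subgroupI) (simp_all add: add neg)
  show "x \<otimes>\<^bsub>P\<^esub> a \<in> S" "a \<otimes>\<^bsub>P\<^esub> x \<in> S" if "a \<in> S" "x \<in> carrier P" for a x
    using mult[OF that] P.m_comm[of a x] S(2) that by (auto simp del: P.m_comm)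
qed

lemma expansion: "p \<in> carrier P \<Longrightarrow> p = (\<Sum>x | p x \<noteq> 0. fscale (p x) (point_mass 1 x))"
proof
  fix g assume "p \<in> carrier P"
  then have fin: "finite {x. p x \<noteq> 0}" by (simp add: P_simps)
  have "(\<Sum>x | p x \<noteq> 0. fscale (p x) (point_mass 1 x)) g = (\<Sum>x | p x \<noteq> 0. if x = g then p g else 0)"
    unfolding sum_fun_apply by (rule sum.cong) (auto simp: fscale_apply point_mass_def)
  also have "\<dots> = p g" unfolding sum.delta[OF fin] by simp
  finally show "p g = (\<Sum>x | p x \<noteq> 0. fscale (p x) (point_mass 1 x)) g" ..
qed

end

section \<open>Coordinates on the tensor product\<close>

context jacobian_coordinates
begin

sublocale M: complex_algebra "milnor_algebra f" "milnor_scalar f"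
  unfolding milnor_algebra_eq milnor_scalar_eq by (rule Q.complex_algebra_axioms)

lemma \<phi>_add': "X \<in> carrier (milnor_algebra f) \<Longrightarrow> Y \<in> carrier (milnor_algebra f) \<Longrightarrow>
    \<phi> (X \<oplus>\<^bsub>milnor_algebra f\<^esub> Y) = \<phi> X + \<phi> Y"
  unfolding milnor_algebra_eq by (rule \<phi>_add)

lemma \<phi>_scale': "X \<in> carrier (milnor_algebra f) \<Longrightarrow> \<phi> (milnor_scalar f c \<otimes>\<^bsub>milnor_algebra f\<^esub> X) = fscale c (\<phi> X)"
  unfolding milnor_algebra_eq milnor_scalar_eq by (rule \<phi>_scale)

end

context milnor_coordinates
begin

lemma \<phi>_mult: "convergent_mseries g \<Longrightarrow> X \<in> carrier (milnor_algebra f) \<Longrightarrow>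
    \<phi> ((J +>\<^bsub>conv_series\<^esub> g) \<otimes>\<^bsub>milnor_algebra f\<^esub> X) = mat_op D (\<Lambda> g) (\<phi> X)"
proof -
  assume g: "convergent_mseries g" and "X \<in> carrier (milnor_algebra f)"
  then obtain h where h: "convergent_mseries h" "X = J +>\<^bsub>conv_series\<^esub> h" unfolding milnor_carrier by blast
  have "(J +>\<^bsub>conv_series\<^esub> g) \<otimes>\<^bsub>milnor_algebra f\<^esub> X = J +>\<^bsub>conv_series\<^esub> mmul g h"
    unfolding milnor_algebra_eq h(2) using Quot_simps(2)[of g h] g h(1) by (simp add: conv_series_simps)
  then show ?thesis
    unfolding h(2) by (simp only: \<phi>_conv[OF convergent_mmul[OF g h(1)]] \<phi>_conv[OF h(1)] mult_matrix[OF g h(1)])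
qed

definition basis :: "'i \<Rightarrow> 'n mseries set" where "basis k = J +>\<^bsub>conv_series\<^esub> e k"

lemma basis: "k \<in> D \<Longrightarrow> basis k \<in> carrier (milnor_algebra f)" "k \<in> D \<Longrightarrow> \<phi> (basis k) = dirac k"
  unfolding basis_def milnor_carrier using e \<phi>_conv by auto

text \<open>Formulated for maps that are linear only modulo a subspace \<open>T\<close>. It is
  applied to \<open>\<beta> X = point_mass 1 (X, b)\<close>, which is linear modulo the tensor
  relations, and likewise to the second factor.\<close>

lemma linear_map_expansion:
  fixes \<beta> :: "'n mseries set \<Rightarrow> ('z \<Rightarrow> complex)"
  assumes T: "fs.subspace T"
    and add: "\<And>X Y. X \<in> carrier (milnor_algebra f) \<Longrightarrow> Y \<in> carrier (milnor_algebra f) \<Longrightarrow>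
      \<beta> (X \<oplus>\<^bsub>milnor_algebra f\<^esub> Y) - (\<beta> X + \<beta> Y) \<in> T"
    and scale: "\<And>c X. X \<in> carrier (milnor_algebra f) \<Longrightarrow>
      \<beta> (milnor_scalar f c \<otimes>\<^bsub>milnor_algebra f\<^esub> X) - fscale c (\<beta> X) \<in> T"
    and X: "X \<in> carrier (milnor_algebra f)"
  shows "\<beta> X - (\<Sum>k\<in>D. fscale (\<phi> X k) (\<beta> (basis k))) \<in> T"
proof -
  have conv: "convergent_mseries (\<Sum>k\<in>S. fscale (c k) (e k))" if "S \<subseteq> D" for S c
    using that by (intro convergent_sum convergent_fscale e(1)) auto
  have "\<beta> (J +>\<^bsub>conv_series\<^esub> (\<Sum>k\<in>S. fscale (c k) (e k))) - (\<Sum>k\<in>S. fscale (c k) (\<beta> (basis k))) \<in> T"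
    if "finite S" "S \<subseteq> D" for S c
    using that
  proof (induction S rule: finite_induct)
    case empty
    have zero: "J +>\<^bsub>conv_series\<^esub> 0 = \<zero>\<^bsub>milnor_algebra f\<^esub>"
      unfolding milnor_algebra_eq Quot_simps(5) conv_series_simps ..
    have "\<beta> (milnor_scalar f 0 \<otimes>\<^bsub>milnor_algebra f\<^esub> \<zero>\<^bsub>milnor_algebra f\<^esub>) - fscale 0 (\<beta> \<zero>\<^bsub>milnor_algebra f\<^esub>) \<in> T"
      by (rule scale) simp
    then have "\<beta> \<zero>\<^bsub>milnor_algebra f\<^esub> \<in> T" by (simp add: M.s_zero fs.scale_zero_left)
    then show ?case by (simp only: sum.empty zero diff_0_right)
  next
    case (insert k S)
    let ?r = "\<Sum>k\<in>S. fscale (c k) (e k)"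
    let ?R = "J +>\<^bsub>conv_series\<^esub> ?r" and ?Y = "milnor_scalar f (c k) \<otimes>\<^bsub>milnor_algebra f\<^esub> basis k"
    let ?s = "\<Sum>k\<in>S. fscale (c k) (\<beta> (basis k))"
    have k: "k \<in> D" and S: "S \<subseteq> D" using insert.prems by auto
    have R: "?R \<in> carrier (milnor_algebra f)" unfolding milnor_carrier using conv[OF S] by blast
    have Y: "?Y \<in> carrier (milnor_algebra f)" using basis(1)[OF k] by simp
    have eq: "J +>\<^bsub>conv_series\<^esub> (\<Sum>k\<in>insert k S. fscale (c k) (e k)) = ?Y \<oplus>\<^bsub>milnor_algebra f\<^esub> ?R"
    proof -
      have "?Y = J +>\<^bsub>conv_series\<^esub> fscale (c k) (e k)"
        unfolding milnor_scalar_eq basis_def milnor_algebra_eq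
        using Quot_simps(2)[of "mseries_const (c k)" "e k"] e(1)[OF k]
        by (simp add: conv_series_simps mmul_const_fscale)
      then have "?Y \<oplus>\<^bsub>milnor_algebra f\<^esub> ?R = J +>\<^bsub>conv_series\<^esub> (fscale (c k) (e k) + ?r)"
        using Quot_simps(3)[of "fscale (c k) (e k)" ?r] convergent_fscale[OF e(1)[OF k], of "c k"] conv[OF S]
        unfolding milnor_algebra_eq by (simp only: conv_series_simps mem_Collect_eq)
      then show ?thesis unfolding sum.insert[OF insert.hyps] by (simp only:)
    qed
    have 1: "\<beta> (?Y \<oplus>\<^bsub>milnor_algebra f\<^esub> ?R) - (\<beta> ?Y + \<beta> ?R) \<in> T" by (rule add[OF Y R])
    have 2: "\<beta> ?Y - fscale (c k) (\<beta> (basis k)) \<in> T" by (rule scale[OF basis(1)[OF k]])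
    have 3: "\<beta> ?R - ?s \<in> T" by (rule insert.IH[OF S])
    have "\<beta> (?Y \<oplus>\<^bsub>milnor_algebra f\<^esub> ?R) - (fscale (c k) (\<beta> (basis k)) + ?s)
      = (\<beta> (?Y \<oplus>\<^bsub>milnor_algebra f\<^esub> ?R) - (\<beta> ?Y + \<beta> ?R)) + (\<beta> ?Y - fscale (c k) (\<beta> (basis k))) + (\<beta> ?R - ?s)"
      by (rule ext) simp
    also have "\<dots> \<in> T" by (rule fs.subspace_add[OF T fs.subspace_add[OF T 1 2] 3])
    finally show ?case unfolding eq unfolding sum.insert[OF insert.hyps] .
  qed
  from this[OF finite_D order_refl]
  have *: "\<beta> (J +>\<^bsub>conv_series\<^esub> (\<Sum>k\<in>D. fscale (c k) (e k))) - (\<Sum>k\<in>D. fscale (c k) (\<beta> (basis k))) \<in> T" for c .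
  obtain h where h: "convergent_mseries h" "X = J +>\<^bsub>conv_series\<^esub> h" using X unfolding milnor_carrier by blast
  let ?h = "\<Sum>k\<in>D. fscale (\<psi> h k) (e k)"
  have "J +>\<^bsub>conv_series\<^esub> ?h = X"
  proof -
    have "\<phi> (J +>\<^bsub>conv_series\<^esub> ?h) = \<phi> X"
    proof -
      have "\<psi> (h - ?h) = 0"
        using expansion_mod_J(2)[OF h(1)] kernel conv_ideal_convergent[OF J] by blast
      then have "\<psi> h = \<psi> ?h" by (simp only: flinear_diff[OF linear] eq_iff_diff_eq_0[symmetric])
      then show ?thesis unfolding h(2) \<phi>_conv[OF h(1)] \<phi>_conv[OF conv[OF order_refl]] ..
    qed
    moreover have "J +>\<^bsub>conv_series\<^esub> ?h \<in> carrier (milnor_algebra f)" unfolding milnor_carrier using conv[OF order_refl] by blast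
    ultimately show ?thesis using inj X by blast
  qed
  moreover have "\<phi> X = \<psi> h" unfolding h(2) by (rule \<phi>_conv[OF h(1)])
  ultimately show ?thesis using *[of "\<psi> h"] by (simp only:)
qed

end

context two_milnor_coordinates
begin

abbreviation "M1 \<equiv> milnor_algebra f1"
abbreviation "M2 \<equiv> milnor_algebra f2"

sublocale MA: commutative_monoid_algebra "M1 \<times>\<times> M2"
proof (rule commutative_monoid_algebra.intro, rule comm_monoidI)
  show "x \<otimes>\<^bsub>M1 \<times>\<times> M2\<^esub> y \<otimes>\<^bsub>M1 \<times>\<times> M2\<^esub> z = x \<otimes>\<^bsub>M1 \<times>\<times> M2\<^esub> (y \<otimes>\<^bsub>M1 \<times>\<times> M2\<^esub> z)"
    if "x \<in> carrier (M1 \<times>\<times> M2)" "y \<in> carrier (M1 \<times>\<times> M2)" "z \<in> carrier (M1 \<times>\<times> M2)" for x y z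
    using that by (cases x; cases y; cases z) (simp add: m1.M.m_assoc m2.M.m_assoc)
  show "x \<otimes>\<^bsub>M1 \<times>\<times> M2\<^esub> y = y \<otimes>\<^bsub>M1 \<times>\<times> M2\<^esub> x"
    if "x \<in> carrier (M1 \<times>\<times> M2)" "y \<in> carrier (M1 \<times>\<times> M2)" for x y
    using that by (cases x; cases y) (simp add: m1.M.m_comm m2.M.m_comm)
qed auto

abbreviation "T \<equiv> tensor_ideal (milnor_scalar f1) M1 (milnor_scalar f2) M2"

text \<open>The coordinates of the pure tensor of a pair; \<open>\<Theta>\<close> extends them
  linearly to the free vector space on the pairs.\<close>

definition \<theta> :: "'n mseries set \<times> 'm mseries set \<Rightarrow> 'i \<times> 'j \<Rightarrow> complex" where
  "\<theta> x p = m1.\<phi> (fst x) (fst p) * m2.\<phi> (snd x) (snd p)"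

definition \<Theta> :: "('n mseries set \<times> 'm mseries set \<Rightarrow> complex) \<Rightarrow> 'i \<times> 'j \<Rightarrow> complex" where
  "\<Theta> x = (\<lambda>p. pairing x (\<lambda>y. \<theta> y p))"

lemma \<Theta>_add: "x \<in> carrier MA.P \<Longrightarrow> y \<in> carrier MA.P \<Longrightarrow> \<Theta> (x + y) = \<Theta> x + \<Theta> y"
  by (rule ext) (simp add: \<Theta>_def MA.pairing_add)

lemma \<Theta>_minus: "x \<in> carrier MA.P \<Longrightarrow> y \<in> carrier MA.P \<Longrightarrow> \<Theta> (x - y) = \<Theta> x - \<Theta> y"
proof -
  assume xy: "x \<in> carrier MA.P" "y \<in> carrier MA.P"
  have "x - y \<in> carrier MA.P" unfolding MA.P_minus[OF xy(2), symmetric] by (rule MA.P.minus_closed[OF xy])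
  from \<Theta>_add[OF this xy(2)] show ?thesis by (simp only: diff_add_cancel eq_diff_eq)
qed

lemma \<Theta>_point_mass: "\<Theta> (point_mass c x) = fscale c (\<theta> x)"
  by (rule ext) (simp add: \<Theta>_def pairing_point_mass fscale_apply)

lemma \<Theta>_scale: "x \<in> carrier MA.P \<Longrightarrow> \<Theta> (fscale c x) = fscale c (\<Theta> x)"
proof -
  assume x: "x \<in> carrier MA.P"
  have one: "point_mass c \<one>\<^bsub>M1 \<times>\<times> M2\<^esub> \<in> carrier MA.P" by (rule MA.carrier_point_mass) simp
  show ?thesis
  proof
    fix p
    have "\<Theta> (fscale c x) p = c * pairing x (\<lambda>y. \<theta> (\<one>\<^bsub>M1 \<times>\<times> M2\<^esub> \<otimes>\<^bsub>M1 \<times>\<times> M2\<^esub> y) p)"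
      unfolding \<Theta>_def MA.scalar_mult[OF x, symmetric] MA.pairing_mult[OF one x] pairing_point_mass ..
    also have "pairing x (\<lambda>y. \<theta> (\<one>\<^bsub>M1 \<times>\<times> M2\<^esub> \<otimes>\<^bsub>M1 \<times>\<times> M2\<^esub> y) p) = pairing x (\<lambda>y. \<theta> y p)"
      by (rule MA.pairing_cong[OF x]) (simp add: MA.l_one del: one_DirProd)
    finally have eq: "\<Theta> (fscale c x) p = c * pairing x (\<lambda>y. \<theta> y p)" .
    show "\<Theta> (fscale c x) p = fscale c (\<Theta> x) p" unfolding eq by (simp add: \<Theta>_def fscale_apply)
  qed
qed

text \<open>A pair acts on coordinates as \<open>\<Lambda> g \<otimes> \<Lambda> h\<close>. This
  shows that the kernel of \<open>\<Theta>\<close> is an ideal, and it later computes the join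
  map.\<close>

lemma pairing_pure_mult:
  assumes g: "convergent_mseries g" "convergent_mseries h" and x: "x \<in> carrier MA.P"
  shows "pairing x (\<lambda>y. \<theta> ((m1.J +>\<^bsub>conv_series\<^esub> g, m2.J +>\<^bsub>conv_series\<^esub> h) \<otimes>\<^bsub>M1 \<times>\<times> M2\<^esub> y) (i, j))
    = mat_op D1 (m1.\<Lambda> g) (\<lambda>k. mat_op D2 (m2.\<Lambda> h) (\<lambda>l. \<Theta> x (k, l)) j) i"
proof -
  have "pairing x (\<lambda>y. \<theta> ((m1.J +>\<^bsub>conv_series\<^esub> g, m2.J +>\<^bsub>conv_series\<^esub> h) \<otimes>\<^bsub>M1 \<times>\<times> M2\<^esub> y) (i, j))
    = pairing x (\<lambda>y. \<Sum>k\<in>D1. \<Sum>l\<in>D2. m1.\<Lambda> g i k * (m2.\<Lambda> h j l * \<theta> y (k, l)))"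
  proof (rule MA.pairing_cong[OF x])
    fix y assume "y \<in> carrier (M1 \<times>\<times> M2)"
    then obtain a b where y: "y = (a, b)" "a \<in> carrier M1" "b \<in> carrier M2" by auto
    show "\<theta> ((m1.J +>\<^bsub>conv_series\<^esub> g, m2.J +>\<^bsub>conv_series\<^esub> h) \<otimes>\<^bsub>M1 \<times>\<times> M2\<^esub> y) (i, j)
      = (\<Sum>k\<in>D1. \<Sum>l\<in>D2. m1.\<Lambda> g i k * (m2.\<Lambda> h j l * \<theta> y (k, l)))"
      unfolding y(1) mult_DirProd \<theta>_def fst_conv snd_conv m1.\<phi>_mult[OF g(1) y(2)] m2.\<phi>_mult[OF g(2) y(3)]
        mat_op_def sum_product by (intro sum.cong refl) (simp add: mult_ac)
  qed
  also have "\<dots> = (\<Sum>k\<in>D1. \<Sum>l\<in>D2. m1.\<Lambda> g i k * (m2.\<Lambda> h j l * \<Theta> x (k, l)))"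
    by (simp only: pairing_sum_right pairing_scale_right \<Theta>_def)
  finally show ?thesis by (simp add: mat_op_def sum_distrib_left)
qed

lemma M_cosetE:
  assumes "x \<in> carrier (M1 \<times>\<times> M2)"
  obtains g h where "convergent_mseries g" "convergent_mseries h" "x = (m1.J +>\<^bsub>conv_series\<^esub> g, m2.J +>\<^bsub>conv_series\<^esub> h)"
  using assms unfolding carrier_DirProd m1.milnor_carrier m2.milnor_carrier by blast

lemma pm_carrier: "a \<in> carrier M1 \<Longrightarrow> b \<in> carrier M2 \<Longrightarrow> point_mass c (a, b) \<in> carrier MA.P"
  by (rule MA.carrier_point_mass) simp

lemma kernel_ideal: "ideal {x \<in> carrier MA.P. \<Theta> x = 0} MA.P"
proof (rule MA.P_idealI)
  show "fs.subspace {x \<in> carrier MA.P. \<Theta> x = 0}"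
  proof (rule fs.subspaceI)
    have "\<Theta> 0 = 0" by (rule ext) (simp add: \<Theta>_def pairing_def)
    then show "0 \<in> {x \<in> carrier MA.P. \<Theta> x = 0}" using MA.carrier_zero by simp
    show "x + y \<in> {x \<in> carrier MA.P. \<Theta> x = 0}" if "x \<in> {x \<in> carrier MA.P. \<Theta> x = 0}" "y \<in> {x \<in> carrier MA.P. \<Theta> x = 0}" for x y
      using that \<Theta>_add[of x y] MA.carrier_add[of x y] by (simp only: mem_Collect_eq add_0_left)
    show "fscale c x \<in> {x \<in> carrier MA.P. \<Theta> x = 0}" if "x \<in> {x \<in> carrier MA.P. \<Theta> x = 0}" for c x
    proof -
      have x: "x \<in> carrier MA.P" "\<Theta> x = 0" using that by auto
      have "fscale c x \<in> carrier MA.P" unfolding MA.scalar_mult[OF x(1), symmetric]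
        by (rule MA.carrier_mult[OF MA.carrier_point_mass x(1)]) simp
      then show ?thesis using \<Theta>_scale[OF x(1), of c] x(2) by (simp add: fs.scale_zero_right)
    qed
  qed
  fix x q assume x: "x \<in> {x \<in> carrier MA.P. \<Theta> x = 0}" and q: "q \<in> carrier MA.P"
  then have xc: "x \<in> carrier MA.P" and x0: "\<Theta> x = 0" by auto
  have "\<Theta> (q \<otimes>\<^bsub>MA.P\<^esub> x) p = 0" for p
  proof -
    obtain i j where p: "p = (i, j)" by fastforce
    have "\<Theta> (q \<otimes>\<^bsub>MA.P\<^esub> x) p = pairing q (\<lambda>y. pairing x (\<lambda>z. \<theta> (y \<otimes>\<^bsub>M1 \<times>\<times> M2\<^esub> z) (i, j)))"
      unfolding \<Theta>_def p by (rule MA.pairing_mult[OF q xc])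
    also have "\<dots> = pairing q (\<lambda>y. 0)"
    proof (rule MA.pairing_cong[OF q])
      fix y assume "y \<in> carrier (M1 \<times>\<times> M2)"
      then obtain g h where gh: "convergent_mseries g" "convergent_mseries h" "y = (m1.J +>\<^bsub>conv_series\<^esub> g, m2.J +>\<^bsub>conv_series\<^esub> h)"
        by (rule M_cosetE)
      show "pairing x (\<lambda>z. \<theta> (y \<otimes>\<^bsub>M1 \<times>\<times> M2\<^esub> z) (i, j)) = 0"
        unfolding gh(3) pairing_pure_mult[OF gh(1,2) xc] x0 by (simp add: mat_op_def)
    qed
    finally show ?thesis by (simp add: pairing_def)
  qed
  then show "q \<otimes>\<^bsub>MA.P\<^esub> x \<in> {x \<in> carrier MA.P. \<Theta> x = 0}"
    using MA.carrier_mult[OF q xc] by (simp add: fun_eq_iff)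
qed blast

text \<open>Passes from differences and sums in the monoid algebra to those of functions.\<close>

lemma relations:
  "tensor_relations (milnor_scalar f1) M1 (milnor_scalar f2) M2 =
     {point_mass 1 (a \<oplus>\<^bsub>M1\<^esub> a', b) - (point_mass 1 (a, b) + point_mass 1 (a', b)) |a a' b.
        a \<in> carrier M1 \<and> a' \<in> carrier M1 \<and> b \<in> carrier M2} \<union>
     {point_mass 1 (a, b \<oplus>\<^bsub>M2\<^esub> b') - (point_mass 1 (a, b) + point_mass 1 (a, b')) |a b b'.
        a \<in> carrier M1 \<and> b \<in> carrier M2 \<and> b' \<in> carrier M2} \<union>
     {point_mass 1 (milnor_scalar f1 c \<otimes>\<^bsub>M1\<^esub> a, b) - point_mass c (a, b) |c a b. a \<in> carrier M1 \<and> b \<in> carrier M2} \<union>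
     {point_mass 1 (a, milnor_scalar f2 c \<otimes>\<^bsub>M2\<^esub> b) - point_mass c (a, b) |c a b. a \<in> carrier M1 \<and> b \<in> carrier M2}"
proof -
  have 1: "x \<ominus>\<^bsub>MA.P\<^esub> (point_mass 1 (a, b) \<oplus>\<^bsub>MA.P\<^esub> point_mass 1 (a', b')) = x - (point_mass 1 (a, b) + point_mass 1 (a', b'))"
    if "a \<in> carrier M1" "a' \<in> carrier M1" "b \<in> carrier M2" "b' \<in> carrier M2" for x a a' b b'
    unfolding MA.P_simps(2) by (rule MA.P_minus[OF MA.carrier_add[OF pm_carrier pm_carrier]]) (use that in auto)
  have 2: "x \<ominus>\<^bsub>MA.P\<^esub> point_mass c (a, b) = x - point_mass c (a, b)"
    if "a \<in> carrier M1" "b \<in> carrier M2" for x c a b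
    by (rule MA.P_minus[OF pm_carrier[OF that]])
  show ?thesis unfolding tensor_relations_def
    by (intro arg_cong2[of _ _ _ _ "(\<union>)"] Collect_cong) (metis 1, metis 1, metis 2, metis 2)
qed

lemma relations_kernel: "tensor_relations (milnor_scalar f1) M1 (milnor_scalar f2) M2 \<subseteq> {x \<in> carrier MA.P. \<Theta> x = 0}"
proof -
  have diff: "x - y \<in> {x \<in> carrier MA.P. \<Theta> x = 0}" if "x \<in> carrier MA.P" "y \<in> carrier MA.P" "\<Theta> x = \<Theta> y" for x y
  proof -
    have "x - y \<in> carrier MA.P" unfolding MA.P_minus[OF that(2), symmetric] by (rule MA.P.minus_closed[OF that(1,2)])
    moreover have "\<Theta> (x - y) = 0" by (simp only: \<Theta>_minus[OF that(1,2)] that(3) diff_self)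
    ultimately show ?thesis by blast
  qed
  have th1: "\<theta> (a \<oplus>\<^bsub>M1\<^esub> a', b) = \<theta> (a, b) + \<theta> (a', b)" if "a \<in> carrier M1" "a' \<in> carrier M1" for a a' b
    by (rule ext) (simp add: \<theta>_def m1.\<phi>_add'[OF that] algebra_simps)
  have th2: "\<theta> (a, b \<oplus>\<^bsub>M2\<^esub> b') = \<theta> (a, b) + \<theta> (a, b')" if "b \<in> carrier M2" "b' \<in> carrier M2" for a b b'
    by (rule ext) (simp add: \<theta>_def m2.\<phi>_add'[OF that] algebra_simps)
  have th3: "\<theta> (milnor_scalar f1 c \<otimes>\<^bsub>M1\<^esub> a, b) = fscale c (\<theta> (a, b))" if "a \<in> carrier M1" for c a b
    by (rule ext) (simp add: \<theta>_def m1.\<phi>_scale'[OF that] fscale_apply)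
  have th4: "\<theta> (a, milnor_scalar f2 c \<otimes>\<^bsub>M2\<^esub> b) = fscale c (\<theta> (a, b))" if "b \<in> carrier M2" for c a b
    by (rule ext) (simp add: \<theta>_def m2.\<phi>_scale'[OF that] fscale_apply)
  note simps = \<Theta>_add pm_carrier \<Theta>_point_mass fs.scale_one th1 th2 th3 th4
  show ?thesis
    unfolding relations
    by (rule subsetI, elim UnE CollectE exE conjE; hypsubst; rule diff)
       (simp_all add: simps MA.carrier_add del: plus_fun_apply)
qed

lemma relations_carrier: "tensor_relations (milnor_scalar f1) M1 (milnor_scalar f2) M2 \<subseteq> carrier MA.P"
  using relations_kernel by blast

lemma T_ideal: "ideal T MA.P"
  unfolding tensor_ideal_def by (rule MA.P.genideal_ideal[OF relations_carrier])

lemma T_relations: "tensor_relations (milnor_scalar f1) M1 (milnor_scalar f2) M2 \<subseteq> T"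
  unfolding tensor_ideal_def by (rule MA.P.genideal_self[OF relations_carrier])

lemmas T_subspace = MA.P_idealD(1)[OF T_ideal]

definition redT :: "('i \<times> 'j \<Rightarrow> complex) \<Rightarrow> ('n mseries set \<times> 'm mseries set \<Rightarrow> complex)" where
  "redT v = (\<Sum>k\<in>D1. \<Sum>l\<in>D2. fscale (v (k, l)) (point_mass 1 (m1.basis k, m2.basis l)))"

lemma flinear_redT: "flinear redT"
  by (rule flinearI)
     (auto simp: redT_def fun_eq_iff sum_fun_apply fscale_apply algebra_simps sum.distrib sum_distrib_left)

lemma pm_mod_T:
  assumes a: "a \<in> carrier M1" and b: "b \<in> carrier M2"
  shows "point_mass 1 (a, b) - redT (\<theta> (a, b)) \<in> T"
proof -
  have 1: "point_mass 1 (a, b) - (\<Sum>k\<in>D1. fscale (m1.\<phi> a k) (point_mass 1 (m1.basis k, b))) \<in> T"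
  proof (rule m1.linear_map_expansion[OF T_subspace _ _ a, of "\<lambda>a. point_mass 1 (a, b)"])
    show "point_mass 1 (X \<oplus>\<^bsub>M1\<^esub> Y, b) - (point_mass 1 (X, b) + point_mass 1 (Y, b)) \<in> T" if "X \<in> carrier M1" "Y \<in> carrier M1" for X Y
      by (rule subsetD[OF T_relations], unfold relations) (use that b in blast)
    show "point_mass 1 (milnor_scalar f1 c \<otimes>\<^bsub>M1\<^esub> X, b) - fscale c (point_mass 1 (X, b)) \<in> T" if "X \<in> carrier M1" for c X
      unfolding MA.point_mass_scale[symmetric]
      by (rule subsetD[OF T_relations], unfold relations) (use that b in blast)
  qed
  have 2: "point_mass 1 (a', b) - (\<Sum>l\<in>D2. fscale (m2.\<phi> b l) (point_mass 1 (a', m2.basis l))) \<in> T" if a': "a' \<in> carrier M1" for a'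
  proof (rule m2.linear_map_expansion[OF T_subspace _ _ b, of "\<lambda>b. point_mass 1 (a', b)"])
    show "point_mass 1 (a', X \<oplus>\<^bsub>M2\<^esub> Y) - (point_mass 1 (a', X) + point_mass 1 (a', Y)) \<in> T" if "X \<in> carrier M2" "Y \<in> carrier M2" for X Y
      by (rule subsetD[OF T_relations], unfold relations) (use that a' in blast)
    show "point_mass 1 (a', milnor_scalar f2 c \<otimes>\<^bsub>M2\<^esub> X) - fscale c (point_mass 1 (a', X)) \<in> T" if "X \<in> carrier M2" for c X
      unfolding MA.point_mass_scale[symmetric]
      by (rule subsetD[OF T_relations], unfold relations) (use that a' in blast)
  qed
  have 3: "(\<Sum>k\<in>D1. fscale (m1.\<phi> a k) (point_mass 1 (m1.basis k, b) -
      (\<Sum>l\<in>D2. fscale (m2.\<phi> b l) (point_mass 1 (m1.basis k, m2.basis l))))) \<in> T"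
    by (intro fs.subspace_sum[OF T_subspace] fs.subspace_scale[OF T_subspace] 2 m1.basis(1))
  have "point_mass 1 (a, b) - redT (\<theta> (a, b)) =
      (point_mass 1 (a, b) - (\<Sum>k\<in>D1. fscale (m1.\<phi> a k) (point_mass 1 (m1.basis k, b)))) +
      (\<Sum>k\<in>D1. fscale (m1.\<phi> a k) (point_mass 1 (m1.basis k, b) -
      (\<Sum>l\<in>D2. fscale (m2.\<phi> b l) (point_mass 1 (m1.basis k, m2.basis l)))))"
    by (rule ext)
       (simp add: redT_def \<theta>_def sum_fun_apply fscale_apply right_diff_distrib sum_subtractf sum_distrib_left mult.assoc)
  also have "\<dots> \<in> T" by (rule fs.subspace_add[OF T_subspace 1 3])
  finally show ?thesis .
qed

text \<open>Expanding both factors, each point mass is congruent modulo \<open>T\<close> to a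
  combination of pairs of basis elements with coefficients \<open>\<theta>\<close>, so an element
  with zero coordinates lies in \<open>T\<close>. Conversely, the kernel of \<open>\<Theta>\<close>
  is an ideal that contains the relations.\<close>

lemma kernel_T: "x \<in> carrier MA.P \<Longrightarrow> \<Theta> x = 0 \<longleftrightarrow> x \<in> T"
proof
  assume x: "x \<in> carrier MA.P" and 0: "\<Theta> x = 0"
  let ?S = "{y. x y \<noteq> 0}"
  have "(\<Sum>y\<in>?S. fscale (x y) (point_mass 1 y - redT (\<theta> y))) \<in> T"
  proof (intro fs.subspace_sum[OF T_subspace] fs.subspace_scale[OF T_subspace])
    fix y assume "y \<in> ?S"
    then have "y \<in> carrier (M1 \<times>\<times> M2)" using x unfolding MA.P_simps by blast
    then show "point_mass 1 y - redT (\<theta> y) \<in> T" using pm_mod_T by (cases y) simp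
  qed
  also have "(\<Sum>y\<in>?S. fscale (x y) (point_mass 1 y - redT (\<theta> y)))
      = (\<Sum>y\<in>?S. fscale (x y) (point_mass 1 y)) - redT (\<Sum>y\<in>?S. fscale (x y) (\<theta> y))"
    by (simp only: fs.scale_right_diff_distrib sum_subtractf flinear_sum[OF flinear_redT] flinear_scale[OF flinear_redT])
  also have "(\<Sum>y\<in>?S. fscale (x y) (\<theta> y)) = \<Theta> x"
    by (rule ext) (simp add: \<Theta>_def pairing_def sum_fun_apply fscale_apply)
  also have "(\<Sum>y\<in>?S. fscale (x y) (point_mass 1 y)) - redT (\<Theta> x) = x"
    unfolding 0 flinear_0[OF flinear_redT] diff_0_right by (rule MA.expansion[OF x, symmetric])
  finally show "x \<in> T" .
next
  assume "x \<in> T"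
  moreover have "T \<subseteq> {x \<in> carrier MA.P. \<Theta> x = 0}"
    unfolding tensor_ideal_def by (rule MA.P.genideal_minimal[OF kernel_ideal relations_kernel])
  ultimately show "\<Theta> x = 0" by blast
qed

end

section \<open>The tensor product as a coordinate quotient\<close>

context milnor_coordinates
begin

lemma one_eq: "\<one>\<^bsub>milnor_algebra f\<^esub> = J +>\<^bsub>conv_series\<^esub> mseries_const 1"
  unfolding milnor_algebra_eq Quot_simps(4) conv_series_simps ..

lemma \<phi>_one: "\<phi> \<one>\<^bsub>milnor_algebra f\<^esub> \<noteq> 0"
  unfolding one_eq \<phi>_conv[OF convergent_const] using kernel[OF convergent_const] proper_jacobian by blast

lemma mat_op_one: "v \<in> fsupp D \<Longrightarrow> mat_op D (\<Lambda> (mseries_const 1)) v = v"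
proof -
  assume "v \<in> fsupp D"
  then obtain h where h: "convergent_mseries h" "v = \<psi> h" unfolding \<psi>_image[symmetric] by blast
  show ?thesis
    unfolding h(2) mult_matrix[OF convergent_const h(1), symmetric] mmul_const_fscale fs.scale_one ..
qed

lemma \<phi>_in: "X \<in> carrier (milnor_algebra f) \<Longrightarrow> \<phi> X \<in> fsupp D"
  unfolding coord_carrier[symmetric] by (rule imageI)

lemma B_subset: "B \<subseteq> carrier (milnor_algebra f)"
  using B_complement Im_subset unfolding Im_complement_iff by blast

end

context two_milnor_coordinates
begin

sublocale t: coordinate_quotient T MA.P "\<lambda>c. point_mass c \<one>\<^bsub>M1 \<times>\<times> M2\<^esub>" \<Theta>
proof (rule coordinate_quotient.intro[OF T_ideal MA.cring_P])
  have closed: "point_mass c \<one>\<^bsub>M1 \<times>\<times> M2\<^esub> \<in> carrier MA.P" for c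
    by (rule MA.carrier_point_mass[OF MA.one_closed])
  show "coordinate_quotient_axioms T MA.P (\<lambda>c. point_mass c \<one>\<^bsub>M1 \<times>\<times> M2\<^esub>) \<Theta>"
  proof (rule coordinate_quotient_axioms.intro)
    show "point_mass c \<one>\<^bsub>M1 \<times>\<times> M2\<^esub> \<in> carrier MA.P" for c by (rule closed)
    show "point_mass (c + d) \<one>\<^bsub>M1 \<times>\<times> M2\<^esub> = point_mass c \<one>\<^bsub>M1 \<times>\<times> M2\<^esub> \<oplus>\<^bsub>MA.P\<^esub> point_mass d \<one>\<^bsub>M1 \<times>\<times> M2\<^esub>" for c d
      unfolding MA.P_simps(2) by (rule ext) (simp add: point_mass_def)
    show "point_mass (c * d) \<one>\<^bsub>M1 \<times>\<times> M2\<^esub> = point_mass c \<one>\<^bsub>M1 \<times>\<times> M2\<^esub> \<otimes>\<^bsub>MA.P\<^esub> point_mass d \<one>\<^bsub>M1 \<times>\<times> M2\<^esub>" for c d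
      unfolding MA.scalar_mult[OF closed] by (rule ext) (simp add: point_mass_def fscale_apply)
    show "point_mass 1 \<one>\<^bsub>M1 \<times>\<times> M2\<^esub> = \<one>\<^bsub>MA.P\<^esub>" unfolding MA.P_simps(4) ..
    show "\<one>\<^bsub>MA.P\<^esub> \<notin> T"
    proof
      assume "\<one>\<^bsub>MA.P\<^esub> \<in> T"
      then have "\<Theta> (point_mass 1 \<one>\<^bsub>M1 \<times>\<times> M2\<^esub>) = 0" using kernel_T[OF closed] unfolding MA.P_simps(4) by blast
      then have 0: "\<theta> (\<one>\<^bsub>M1\<^esub>, \<one>\<^bsub>M2\<^esub>) = 0" unfolding \<Theta>_point_mass fs.scale_one one_DirProd .
      \<comment> \<open>Both unit classes have a nonzero coordinate, hence so does their pure
        tensor, and the tensor product is not the zero ring.\<close>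
      obtain k l where "m1.\<phi> \<one>\<^bsub>M1\<^esub> k \<noteq> 0" "m2.\<phi> \<one>\<^bsub>M2\<^esub> l \<noteq> 0"
        using m1.\<phi>_one m2.\<phi>_one by (auto simp: fun_eq_iff)
      then have "\<theta> (\<one>\<^bsub>M1\<^esub>, \<one>\<^bsub>M2\<^esub>) (k, l) \<noteq> 0" by (simp add: \<theta>_def)
      then show False unfolding 0 by simp
    qed
    show "\<Theta> (x \<oplus>\<^bsub>MA.P\<^esub> y) = \<Theta> x + \<Theta> y" if "x \<in> carrier MA.P" "y \<in> carrier MA.P" for x y
      unfolding MA.P_simps(2) by (rule \<Theta>_add[OF that])
    show "\<Theta> (point_mass c \<one>\<^bsub>M1 \<times>\<times> M2\<^esub> \<otimes>\<^bsub>MA.P\<^esub> x) = fscale c (\<Theta> x)" if "x \<in> carrier MA.P" for c x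
      unfolding MA.scalar_mult[OF that] by (rule \<Theta>_scale[OF that])
    show "\<Theta> x = 0 \<longleftrightarrow> x \<in> T" if "x \<in> carrier MA.P" for x by (rule kernel_T[OF that])
  qed
qed

abbreviation "MT \<equiv> MA.P Quot T"

lemma milnor_tensor_eq: "milnor_tensor f1 f2 = MT"
  unfolding milnor_tensor_def algebra_tensor_def ..

lemma tensor_scalar_eq: "tensor_scalar (milnor_scalar f1) M1 (milnor_scalar f2) M2 = t.s"
  by (rule ext) (simp add: tensor_scalar_def)

lemma milnor_pure_eq: "milnor_pure f1 f2 a b = T +>\<^bsub>MA.P\<^esub> point_mass 1 (a, b)"
  unfolding milnor_pure_def pure_tensor_def ..

lemma milnor_pure:
  assumes "a \<in> carrier M1" "b \<in> carrier M2"
  shows "milnor_pure f1 f2 a b \<in> carrier MT" "t.\<phi> (milnor_pure f1 f2 a b) = \<theta> (a, b)"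
  unfolding milnor_pure_eq t.\<phi>_coset[OF pm_carrier[OF assms]] \<Theta>_point_mass fs.scale_one t.Quot_simps(1)
  by (rule imageI[OF pm_carrier[OF assms]]) (rule refl)

lemma \<Theta>_in: "x \<in> carrier MA.P \<Longrightarrow> \<Theta> x \<in> fsupp (D1 \<times> D2)"
proof -
  assume x: "x \<in> carrier MA.P"
  have "\<Theta> x (k, l) = 0" if "(k, l) \<notin> D1 \<times> D2" for k l
  proof -
    have "\<theta> y (k, l) = 0" if y: "y \<in> carrier (M1 \<times>\<times> M2)" for y
      using y \<open>(k, l) \<notin> D1 \<times> D2\<close> fsuppD[OF m1.\<phi>_in, of "fst y" k] fsuppD[OF m2.\<phi>_in, of "snd y" l]
      by (auto simp: \<theta>_def)
    then have "\<Theta> x (k, l) = pairing x (\<lambda>_. 0)" unfolding \<Theta>_def by (rule MA.pairing_cong[OF x])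
    then show ?thesis by (simp add: pairing_def)
  qed
  then show ?thesis unfolding fsupp_def by auto
qed

lemma t_\<phi>_in: "X \<in> carrier MT \<Longrightarrow> t.\<phi> X \<in> fsupp (D1 \<times> D2)"
  unfolding t.Quot_simps(1) using \<Theta>_in by (auto simp: t.\<phi>_coset)

context
  fixes V W S1 S2
  assumes V: "V \<subseteq> carrier M1" "m1.\<phi> ` V = fsupp S1" "finite S1"
    and W: "W \<subseteq> carrier M2" "m2.\<phi> ` W = fsupp S2" "finite S2"
begin

text \<open>Elements of \<open>V\<close> and \<open>W\<close> with coordinates
  \<open>dirac k\<close> and \<open>dirac l\<close> have a pure tensor with coordinates
  \<open>dirac (k, l)\<close>, and these vectors span.\<close>

lemma fsupp_subset_of_pure:
  assumes X: "subalgebra (range t.s) X MT" and pure: "\<And>v w. v \<in> V \<Longrightarrow> w \<in> W \<Longrightarrow> milnor_pure f1 f2 v w \<in> X"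
  shows "fsupp (S1 \<times> S2) \<subseteq> t.\<phi> ` X"
proof -
  have carr: "x \<in> carrier MT" if "x \<in> X" for x using t.Q.subspace_closed(1)[OF X] that by blast
  have sub: "fs.subspace (t.\<phi> ` X)"
    by (rule t.Q.subspace_linear_image[OF X t.\<phi>_add[OF carr carr] t.\<phi>_scale[OF carr]])
  have "dirac p \<in> t.\<phi> ` X" if pS: "p \<in> S1 \<times> S2" for p
  proof -
    obtain k l where p: "p = (k, l)" "k \<in> S1" "l \<in> S2" using pS by blast
    obtain v where v: "v \<in> V" "m1.\<phi> v = dirac k" using dirac_in_fsupp[OF p(2)] unfolding V(2)[symmetric] by auto
    obtain w where w: "w \<in> W" "m2.\<phi> w = dirac l" using dirac_in_fsupp[OF p(3)] unfolding W(2)[symmetric] by auto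
    have "\<theta> (v, w) = dirac p" by (rule ext) (auto simp: \<theta>_def v w p(1) dirac_def)
    moreover have "t.\<phi> (milnor_pure f1 f2 v w) = \<theta> (v, w)" by (rule milnor_pure(2)) (use v w V W in auto)
    ultimately show ?thesis using pure[OF v(1) w(1)] by (metis imageI)
  qed
  then have "fs.span (dirac ` (S1 \<times> S2)) \<subseteq> t.\<phi> ` X" by (intro fs.span_minimal[OF _ sub]) blast
  then show ?thesis using fsupp_eq_span[of "S1 \<times> S2"] V(3) W(3) by simp
qed

text \<open>The span is an intersection of subspaces. The set \<open>?E\<close> is one of those
  intersected, and by the preceding lemma and injectivity of the coordinates it lies in all the
  others.\<close>

lemma milnor_subspace_tensor_eq: "milnor_subspace_tensor f1 f2 V W = {x \<in> carrier MT. t.\<phi> x \<in> fsupp (S1 \<times> S2)}"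
  and \<phi>_milnor_subspace_tensor: "t.\<phi> ` milnor_subspace_tensor f1 f2 V W = fsupp (S1 \<times> S2)"
proof -
  let ?E = "{x \<in> carrier MT. t.\<phi> x \<in> fsupp (S1 \<times> S2)}"
  have pure: "milnor_pure f1 f2 v w \<in> carrier MT" "t.\<phi> (milnor_pure f1 f2 v w) \<in> fsupp (S1 \<times> S2)" if "v \<in> V" "w \<in> W" for v w
  proof -
    have vw: "v \<in> carrier M1" "w \<in> carrier M2" using that V W by auto
    show "milnor_pure f1 f2 v w \<in> carrier MT" by (rule milnor_pure(1)[OF vw])
    have "m1.\<phi> v \<in> fsupp S1" "m2.\<phi> w \<in> fsupp S2" using that V(2) W(2) by blast+
    then show "t.\<phi> (milnor_pure f1 f2 v w) \<in> fsupp (S1 \<times> S2)"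
      unfolding milnor_pure(2)[OF vw] by (auto simp: \<theta>_def fsupp_def)
  qed
  have "subalgebra (range t.s) (carrier MT) MT" by (rule t.Q.carrier_is_subalgebra, rule image_subsetI, rule t.Q.s_closed)
  from fsupp_subset_of_pure[OF this pure(1)] have im: "t.\<phi> ` ?E = fsupp (S1 \<times> S2)" by blast
  have E: "subalgebra (range t.s) ?E MT"
    by (rule t.subalgebra_if_subspace) (use im subspace_fsupp in auto)
  show eq: "milnor_subspace_tensor f1 f2 V W = ?E"
    unfolding milnor_subspace_tensor_def subspace_tensor_def milnor_pure_def[symmetric]
      algebra_tensor_def tensor_scalar_eq
  proof (intro equalityI Inter_lower Inter_greatest)
    show "?E \<in> {X. subalgebra (range t.s) X MT \<and> (\<forall>v\<in>V. \<forall>w\<in>W. milnor_pure f1 f2 v w \<in> X)}"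
      using E pure by blast
    fix X assume "X \<in> {X. subalgebra (range t.s) X MT \<and> (\<forall>v\<in>V. \<forall>w\<in>W. milnor_pure f1 f2 v w \<in> X)}"
    then have X: "subalgebra (range t.s) X MT" "\<And>v w. v \<in> V \<Longrightarrow> w \<in> W \<Longrightarrow> milnor_pure f1 f2 v w \<in> X" by blast+
    show "?E \<subseteq> X"
    proof
      fix x assume x: "x \<in> ?E"
      then obtain y where y: "y \<in> X" "t.\<phi> x = t.\<phi> y" using fsupp_subset_of_pure[OF X] by blast
      then have "y \<in> carrier MT" using t.Q.subspace_closed(1)[OF X(1)] by blast
      then have "x = y" using x y(2) t.inj_\<phi> by (auto simp: inj_on_def)
      then show "x \<in> X" using y(1) by simp
    qed
  qed
  show "t.\<phi> ` milnor_subspace_tensor f1 f2 V W = fsupp (S1 \<times> S2)" unfolding eq by (rule im)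
qed

lemma milnor_subspace_tensor_carrier: "milnor_subspace_tensor f1 f2 V W \<subseteq> carrier MT"
  unfolding milnor_subspace_tensor_eq by blast

end

section \<open>The map \<open>F\<close>, the subspace \<open>U\<close> and the numbers
  \<open>b\<close> and \<open>u\<close> in coordinates\<close>

lemma join_map:
  assumes X: "X \<in> carrier MT"
  shows "join_map f1 f2 X \<in> carrier MT" "t.\<phi> (join_map f1 f2 X) = A.F (t.\<phi> X)"
proof -
  obtain x where x: "x \<in> carrier MA.P" "X = T +>\<^bsub>MA.P\<^esub> x" using X unfolding t.Quot_simps(1) by blast
  let ?c1 = "(milnor_class f1, \<one>\<^bsub>M2\<^esub>)" and ?c2 = "(\<one>\<^bsub>M1\<^esub>, milnor_class f2)"
  let ?p = "point_mass 1 ?c1" and ?q = "point_mass 1 ?c2"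
  have c1: "?c1 = (m1.J +>\<^bsub>conv_series\<^esub> f1, m2.J +>\<^bsub>conv_series\<^esub> mseries_const 1)"
    unfolding milnor_class_def m2.one_eq ..
  have c2: "?c2 = (m1.J +>\<^bsub>conv_series\<^esub> mseries_const 1, m2.J +>\<^bsub>conv_series\<^esub> f2)"
    unfolding milnor_class_def m1.one_eq ..
  have cl: "milnor_class f1 \<in> carrier M1" "milnor_class f2 \<in> carrier M2"
    unfolding milnor_class_def m1.milnor_carrier m2.milnor_carrier using m1.conv_f m2.conv_f by auto
  have p: "?p \<in> carrier MA.P" and q: "?q \<in> carrier MA.P" by (intro pm_carrier cl m1.M.one_closed m2.M.one_closed)+
  have pq: "?p \<oplus>\<^bsub>MA.P\<^esub> ?q \<in> carrier MA.P" by (rule MA.P.a_closed[OF p q])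
  have eq: "join_map f1 f2 X = T +>\<^bsub>MA.P\<^esub> ((?p \<oplus>\<^bsub>MA.P\<^esub> ?q) \<otimes>\<^bsub>MA.P\<^esub> x)"
    unfolding join_map_def milnor_tensor_eq milnor_pure_eq x(2) t.Quot_simps(3)[OF p q] t.Quot_simps(2)[OF pq x(1)] ..
  have c: "(?p \<oplus>\<^bsub>MA.P\<^esub> ?q) \<otimes>\<^bsub>MA.P\<^esub> x \<in> carrier MA.P" by (rule MA.carrier_mult[OF pq x(1)])
  show "join_map f1 f2 X \<in> carrier MT" unfolding eq t.Quot_simps(1) by (rule imageI[OF c])
  have row: "(\<lambda>l. \<Theta> x (k, l)) \<in> fsupp D2" "k \<notin> D1 \<Longrightarrow> \<Theta> x (k, l) = 0" for k l
    using \<Theta>_in[OF x(1)] by (auto simp: fsupp_def)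
  have "\<Theta> ((?p \<oplus>\<^bsub>MA.P\<^esub> ?q) \<otimes>\<^bsub>MA.P\<^esub> x) (i, j) = A.F (\<Theta> x) (i, j)" for i j
  proof -
    have "\<Theta> ((?p \<oplus>\<^bsub>MA.P\<^esub> ?q) \<otimes>\<^bsub>MA.P\<^esub> x) = \<Theta> (?p \<otimes>\<^bsub>MA.P\<^esub> x) + \<Theta> (?q \<otimes>\<^bsub>MA.P\<^esub> x)"
      unfolding MA.P.l_distr[OF p q x(1)] unfolding MA.P_simps(2)
      by (rule \<Theta>_add[OF MA.carrier_mult[OF p x(1)] MA.carrier_mult[OF q x(1)]])
    moreover have "\<Theta> (?p \<otimes>\<^bsub>MA.P\<^esub> x) (i, j) = mat_op D1 (m1.\<Lambda> f1) (\<lambda>k. \<Theta> x (k, j)) i"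
    proof -
      have "\<Theta> (?p \<otimes>\<^bsub>MA.P\<^esub> x) (i, j) = pairing x (\<lambda>y. \<theta> (?c1 \<otimes>\<^bsub>M1 \<times>\<times> M2\<^esub> y) (i, j))"
        unfolding \<Theta>_def MA.pairing_mult[OF p x(1)] pairing_point_mass by (rule mult_1)
      also have "\<dots> = mat_op D1 (m1.\<Lambda> f1) (\<lambda>k. mat_op D2 (m2.\<Lambda> (mseries_const 1)) (\<lambda>l. \<Theta> x (k, l)) j) i"
        unfolding c1 by (rule pairing_pure_mult[OF m1.conv_f convergent_const x(1)])
      finally show ?thesis unfolding m2.mat_op_one[OF row(1)] .
    qed
    moreover have "\<Theta> (?q \<otimes>\<^bsub>MA.P\<^esub> x) (i, j) = mat_op D2 (m2.\<Lambda> f2) (\<lambda>l. \<Theta> x (i, l)) j"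
    proof -
      have "\<Theta> (?q \<otimes>\<^bsub>MA.P\<^esub> x) (i, j) = pairing x (\<lambda>y. \<theta> (?c2 \<otimes>\<^bsub>M1 \<times>\<times> M2\<^esub> y) (i, j))"
        unfolding \<Theta>_def MA.pairing_mult[OF q x(1)] pairing_point_mass by (rule mult_1)
      also have "\<dots> = mat_op D1 (m1.\<Lambda> (mseries_const 1)) (\<lambda>k. mat_op D2 (m2.\<Lambda> f2) (\<lambda>l. \<Theta> x (k, l)) j) i"
        unfolding c2 by (rule pairing_pure_mult[OF convergent_const m2.conv_f x(1)])
      also have "\<dots> = mat_op D2 (m2.\<Lambda> f2) (\<lambda>l. \<Theta> x (i, l)) j"
      proof -
        \<comment> \<open>The matrix of the unit acts as the identity only on vectors supported in
          \<open>D1\<close>.\<close>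
        have "(\<lambda>k. mat_op D2 (m2.\<Lambda> f2) (\<lambda>l. \<Theta> x (k, l)) j) \<in> fsupp D1"
          using row(2) by (simp add: fsupp_def mat_op_def)
        then show ?thesis by (simp only: m1.mat_op_one)
      qed
      finally show ?thesis .
    qed
    ultimately show ?thesis unfolding A.F_apply by (simp only: plus_fun_apply)
  qed
  then have "\<Theta> ((?p \<oplus>\<^bsub>MA.P\<^esub> ?q) \<otimes>\<^bsub>MA.P\<^esub> x) = A.F (\<Theta> x)" by (intro ext) (metis surj_pair)
  then show "t.\<phi> (join_map f1 f2 X) = A.F (t.\<phi> X)"
    unfolding eq unfolding x(2) t.\<phi>_coset[OF c] t.\<phi>_coset[OF x(1)] .
qed

lemma milnor_tensor_dim_eq:
  assumes V: "V \<subseteq> carrier MT" "fs.subspace (t.\<phi> ` V)"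
  shows "milnor_tensor_dim f1 f2 V = fs.dim (t.\<phi> ` V)"
  unfolding milnor_tensor_dim_def milnor_tensor_eq tensor_scalar_eq
proof (rule t.dim_eq[OF t.subalgebra_if_subspace[OF V]])
  have fin: "finite (D1 \<times> D2)" using m1.finite_D m2.finite_D by blast
  show "t.\<phi> ` V \<subseteq> fs.span (dirac ` (D1 \<times> D2))"
    unfolding fsupp_eq_span[OF fin, symmetric] using V(1) t_\<phi>_in by blast
  show "finite (dirac ` (D1 \<times> D2))" using fin by (rule finite_imageI)
qed

lemma \<phi>_set_add:
  assumes V: "V \<subseteq> carrier MT" "t.\<phi> ` V = fsupp S" and W: "W \<subseteq> carrier MT" "t.\<phi> ` W = fsupp S'"
  shows "V <+>\<^bsub>MT\<^esub> W \<subseteq> carrier MT" "t.\<phi> ` (V <+>\<^bsub>MT\<^esub> W) = fsupp (S \<union> S')"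
proof -
  show "V <+>\<^bsub>MT\<^esub> W \<subseteq> carrier MT" using V(1) W(1) by (auto simp: set_add_defs)
  have add: "t.\<phi> (v \<oplus>\<^bsub>MT\<^esub> w) = t.\<phi> v + t.\<phi> w" if "v \<in> V" "w \<in> W" for v w
    by (rule t.\<phi>_add) (use that V W in auto)
  show "t.\<phi> ` (V <+>\<^bsub>MT\<^esub> W) = fsupp (S \<union> S')"
  proof (intro equalityI subsetI)
    fix y assume "y \<in> t.\<phi> ` (V <+>\<^bsub>MT\<^esub> W)"
    then obtain v w where vw: "v \<in> V" "w \<in> W" "y = t.\<phi> (v \<oplus>\<^bsub>MT\<^esub> w)" by (auto simp: set_add_defs)
    have "t.\<phi> v \<in> fsupp S" "t.\<phi> w \<in> fsupp S'" using vw V(2) W(2) by blast+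
    then show "y \<in> fsupp (S \<union> S')" unfolding vw(3) add[OF vw(1,2)] by (simp add: fsupp_def)
  next
    fix y assume y: "y \<in> fsupp (S \<union> S')"
    \<comment> \<open>Indices common to \<open>S\<close> and \<open>S'\<close> go to the first
      summand.\<close>
    have "frestrict S y \<in> fsupp S" "frestrict (- S) y \<in> fsupp S'"
      using y by (auto simp: fsupp_def frestrict_def)
    then obtain v w where vw: "v \<in> V" "t.\<phi> v = frestrict S y" "w \<in> W" "t.\<phi> w = frestrict (- S) y"
      unfolding V(2)[symmetric] W(2)[symmetric] by auto
    have "y = t.\<phi> (v \<oplus>\<^bsub>MT\<^esub> w)" unfolding add[OF vw(1,3)] vw(2,4) by (rule ext) (simp add: frestrict_def)
    moreover have "v \<oplus>\<^bsub>MT\<^esub> w \<in> V <+>\<^bsub>MT\<^esub> W" using vw by (auto simp: set_add_defs)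
    ultimately show "y \<in> t.\<phi> ` (V <+>\<^bsub>MT\<^esub> W)" by (rule image_eqI)
  qed
qed

lemma join_U: "join_U f1 f2 \<subseteq> carrier MT" "t.\<phi> ` join_U f1 f2 = fsupp A.u"
  unfolding join_U_def A.u_def milnor_tensor_eq
  by (rule \<phi>_set_add milnor_subspace_tensor_carrier \<phi>_milnor_subspace_tensor
        m1.Ker_subset m2.Ker_subset m1.Im_subset m2.Im_subset m1.coord_Ker m2.coord_Ker m1.coord_Im m2.coord_Im
        m1.finite_KL m2.finite_KL)+

lemma join_map_B:
  "join_map f1 f2 ` milnor_subspace_tensor f1 f2 B1 B2 \<subseteq> carrier MT"
  "t.\<phi> ` join_map f1 f2 ` milnor_subspace_tensor f1 f2 B1 B2 = A.G"
proof -
  have fin: "finite (L1 - K1)" "finite (L2 - K2)" using m1.finite_KL m2.finite_KL by auto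
  note B = m1.B_subset m1.coord_B fin(1) m2.B_subset m2.coord_B fin(2)
  note c = milnor_subspace_tensor_carrier[OF B]
  show "join_map f1 f2 ` milnor_subspace_tensor f1 f2 B1 B2 \<subseteq> carrier MT" using c join_map(1) by blast
  have "t.\<phi> ` join_map f1 f2 ` milnor_subspace_tensor f1 f2 B1 B2 = A.F ` t.\<phi> ` milnor_subspace_tensor f1 f2 B1 B2"
    unfolding image_image by (intro image_cong refl join_map(2)) (use c in blast)
  then show "t.\<phi> ` join_map f1 f2 ` milnor_subspace_tensor f1 f2 B1 B2 = A.G"
    unfolding \<phi>_milnor_subspace_tensor[OF B] A.G_def .
qed

lemma subspace_G: "fs.subspace A.G"
  unfolding A.G_def by (rule subspace_image[OF A.F subspace_fsupp])

lemma join_b_eq: "join_b f1 f2 B1 B2 = fs.dim A.G"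
  unfolding join_b_def join_map_B(2)[symmetric]
  by (rule milnor_tensor_dim_eq[OF join_map_B(1)]) (unfold join_map_B(2), rule subspace_G)

lemma join_u_eq: "join_u f1 f2 B1 B2 = fs.dim (fsupp A.u \<inter> A.G)"
proof -
  let ?V = "join_U f1 f2 \<inter> join_map f1 f2 ` milnor_subspace_tensor f1 f2 B1 B2"
  have im: "t.\<phi> ` ?V = fsupp A.u \<inter> A.G"
    unfolding join_U(2)[symmetric] join_map_B(2)[symmetric]
    by (rule inj_on_image_Int[OF t.inj_\<phi> join_U(1) join_map_B(1)])
  show ?thesis unfolding join_u_def im[symmetric]
    by (rule milnor_tensor_dim_eq) (use join_U(1) in blast, unfold im, rule fs.subspace_inter[OF subspace_fsupp subspace_G])
qed

section \<open>The formula and the inequalities in coordinates\<close>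

theorem tjurina_join_formula:
  "int (tjurina_number (join_series f1 f2)) =
     int (tjurina_number f1) * int (tjurina_number f2)
     + (int (milnor_number f1) - int (tjurina_number f1))
       * (int (milnor_number f2) - int (tjurina_number f2))
     - int (nu1 f2) * (int (milnor_number f1) - int (tjurina_number f1) - int (nu1 f1))
     - int (nu1 f1) * (int (milnor_number f2) - int (tjurina_number f2) - int (nu1 f2))
     - int (join_b f1 f2 B1 B2) + int (join_u f1 f2 B1 B2)" (is ?formula)
  and tjurina_join_bounds:
  "int (tjurina_number f1) * int (tjurina_number f2) \<le> int (tjurina_number (join_series f1 f2))" (is ?lower)
  "int (tjurina_number (join_series f1 f2))
     \<le> int (tjurina_number f1) * int (tjurina_number f2)
        + (int (milnor_number f1) - int (tjurina_number f1))
          * (int (milnor_number f2) - int (tjurina_number f2))" (is ?upper)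
proof -
  have r: "int (milnor_number f1) - int (tjurina_number f1) = int (card L1)"
    "int (milnor_number f2) - int (tjurina_number f2) = int (card L2)"
    unfolding m1.milnor_number_eq m1.tjurina_eq m2.milnor_number_eq m2.tjurina_eq by simp_all
  show ?formula ?lower ?upper
    unfolding r unfolding m1.tjurina_eq m2.tjurina_eq m1.nu1_eq m2.nu1_eq join_b_eq join_u_eq tjurina_join
    by (rule A.corank_F)+
qed

end

theorem theorem1:
  fixes f1 :: "'n::finite mseries" and f2 :: "'m::finite mseries"
  assumes "isolated_hypersurface_singularity f1"
    and "isolated_hypersurface_singularity f2"
  shows
    "(\<forall>B1 B2. Im_complement f1 B1 \<longrightarrow> Im_complement f2 B2 \<longrightarrow>
        int (tjurina_number (join_series f1 f2)) =
          int (tjurina_number f1) * int (tjurina_number f2)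
          + (int (milnor_number f1) - int (tjurina_number f1))
            * (int (milnor_number f2) - int (tjurina_number f2))
          - int (nu1 f2) * (int (milnor_number f1) - int (tjurina_number f1) - int (nu1 f1))
          - int (nu1 f1) * (int (milnor_number f2) - int (tjurina_number f2) - int (nu1 f2))
          - int (join_b f1 f2 B1 B2) + int (join_u f1 f2 B1 B2))
     \<and> int (tjurina_number f1) * int (tjurina_number f2)
         \<le> int (tjurina_number (join_series f1 f2))
     \<and> int (tjurina_number (join_series f1 f2))
         \<le> int (tjurina_number f1) * int (tjurina_number f2)
            + (int (milnor_number f1) - int (tjurina_number f1))
              * (int (milnor_number f2) - int (tjurina_number f2))"
proof -
  \<comment> \<open>An elimination rule with open conclusion, so that each of the three claims can
    be proved in its own instance of the coordinate locale.\<close>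
  have coordinates: thesis
    if B: "Im_complement f1 B1" "Im_complement f2 B2"
      and *: "\<And>\<psi>1 D1 K1 L1 N1 \<psi>2 D2 K2 L2 N2.
        two_milnor_coordinates f1 (\<psi>1 :: 'n mseries \<Rightarrow> 'n mseries \<Rightarrow> complex) D1 K1 L1 N1 B1
          f2 (\<psi>2 :: 'm mseries \<Rightarrow> 'm mseries \<Rightarrow> complex) D2 K2 L2 N2 B2 \<Longrightarrow> thesis" for B1 B2 thesis
  proof -
    obtain \<psi>1 :: "'n mseries \<Rightarrow> 'n mseries \<Rightarrow> complex" and D1 K1 L1 N1
      where 1: "milnor_coordinates f1 \<psi>1 D1 K1 L1 N1 B1"
      by (rule exists_milnor_coordinates[OF assms(1) B(1)])
    obtain \<psi>2 :: "'m mseries \<Rightarrow> 'm mseries \<Rightarrow> complex" and D2 K2 L2 N2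
      where 2: "milnor_coordinates f2 \<psi>2 D2 K2 L2 N2 B2"
      by (rule exists_milnor_coordinates[OF assms(2) B(2)])
    show thesis by (rule *[OF two_milnor_coordinates.intro[OF 1 2]])
  qed
  \<comment> \<open>For the inequalities any complements will do, as neither side depends on
    them.\<close>
  obtain B1 B2 where B: "Im_complement f1 B1" "Im_complement f2 B2"
    by (rule exists_Im_complement[OF assms(1)], rule exists_Im_complement[OF assms(2)]) (rule that)
  show ?thesis
    by (intro conjI allI impI)
       (erule (1) coordinates, erule two_milnor_coordinates.tjurina_join_formula,
        rule coordinates[OF B], erule two_milnor_coordinates.tjurina_join_bounds(1),
        rule coordinates[OF B], erule two_milnor_coordinates.tjurina_join_bounds(2))
qed

end
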